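(* For every $\alpha>0$ and every admissible $\Sigma_z$, $\mathcal{C}_{MCC}\subseteq\mathcal{R}_{out}^{\alpha,\Sigma_z}$. Consequently $\mathcal{C}_{MCC}\subseteq\mathcal{R}_{out}:=\bigcap_{\Sigma_z}\bigcap_{\alpha>0}\mathcal{R}_{out}^{\alpha,\Sigma_z}$.
   Context: Gaussian MIMO cognitive channel (MCC): a primary transmitter with $n_{p,t}$ antennas, a cognitive transmitter with $n_{c,t}$ antennas, a primary receiver with $n_{p,r}$ antennas and a cognitive receiver with $n_{c,r}$ antennas. Fixed complex matrices $H_{p,p}\in\mathbb{C}^{n_{p,r}\times n_{p,t}}$, $H_{c,p}\in\mathbb{C}^{n_{p,r}\times n_{c,t}}$, $H_{p,c}\in\mathbb{C}^{n_{c,r}\times n_{p,t}}$, $H_{c,c}\in\mathbb{C}^{n_{c,r}\times n_{c,t}}$. At time $i$: $Y_p(i)=H_{p,p}X_p(i)+H_{c,p}X_c(i)+Z_p(i)$, $Y_c(i)=H_{p,c}X_p(i)+H_{c,c}X_c(i)+Z_c(i)$, with $Z_p(i)\sim\mathcal{N}(0,I)$, $Z_c(i)\sim\mathcal{N}(0,I)$ Gaussian, i.i.d. over time, arbitrarily correlated with each other. A code of length $n$: messages $m_p\in\{1,\dots,2^{nR_p}\}$, $m_c\in\{1,\dots,2^{nR_c}\}$; encoders $X_p^n=E_p^n(m_p)$, $X_c^n=E_c^n(m_p,m_c)$ with $\sum_{i}\mathrm{Tr}(\Sigma_p(i))\le nP_p$, $\sum_i\mathrm{Tr}(\Sigma_c(i))\le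 nP_c$ ($\Sigma_p(i),\Sigma_c(i)$ covariances of $X_p(i),X_c(i)$); decoders $\hat m_p=D_p^n(Y_p^n)$, $\hat m_c=D_c^n(Y_c^n)$. $(R_p,R_c)$ is achievable if for all $\epsilon>0$ and large $n$ there is a code with both error probabilities $\le\epsilon$; $\mathcal{C}_{MCC}$ is the set of achievable pairs. For $\alpha>0$ let $G_\alpha=[H_{p,p}\ \ H_{c,p}/\sqrt\alpha]$ and $\overline K=\begin{pmatrix}H_{p,p}&H_{c,p}/\sqrt\alpha\\0&H_{c,c}/\sqrt\alpha\end{pmatrix}$. An admissible $\Sigma_z$ is a positive semidefinite matrix of the form $\Sigma_z=\begin{pmatrix}I_{n_{p,r}}&Q_z\\Q_z^\dagger&I_{n_{c,r}}\end{pmatrix}$ (with $|\Sigma_z|>0$ so the expressions below are finite). $\mathcal{R}_{out}^{\alpha,\Sigma_z}$ is the closure of the convex hull of the set of $(R_p,R_c)$, $R_p,R_c\ge0$, for which there exist $Q_p,Q_c\succeq0$ of size $(n_{p,t}+n_{c,t})$ with $\mathrm{Tr}(Q_p)+\mathrm{Tr}(Q_c)\le P_p+\alpha P_c$, $R_p\le\log|I+G_\alpha Q_pG_\alpha^\dagger+G_\alpha Q_cG_\alpha^\dagger|-\log|I+G_\alpha Q_cG_\alpha^\dagger|$, and $R_c\le\log|\Sigma_z+\overline KQ_c\overline K^\dagger|-\log|\Sigma_z|$. *)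

theory Defs
  imports "HOL-Probability.Probability" "Jordan_Normal_Form.Schur_Decomposition"
begin

definition mtrace :: "complex mat \<Rightarrow> complex" where
  "mtrace A = (\<Sum>i<dim_row A. A $$ (i,i))"

definition psd :: "nat \<Rightarrow> complex mat \<Rightarrow> bool" where
  "psd k A \<longleftrightarrow> A \<in> carrier_mat k k \<and>
     (\<forall>v \<in> carrier_vec k. Im ((A *\<^sub>v v) \<bullet>c v) = 0 \<and> 0 \<le> Re ((A *\<^sub>v v) \<bullet>c v))"

text \<open>log (base 2) of the determinant of a Hermitian positive (semi)definite matrix
  (whose determinant is real and nonnegative).\<close>
definition logdet :: "complex mat \<Rightarrow> real" where
  "logdet A = log 2 (Re (det A))"

definition cgauss :: "complex measure" where
  "cgauss = density lborel (\<lambda>z. ennreal (exp (- (cmod z * cmod z)) / pi))"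

text \<open>Noise on a block of length n at a receiver with k antennas: i.i.d. CN(0,1) entries
  indexed by (time i, antenna j).\<close>
definition noise :: "nat \<Rightarrow> nat \<Rightarrow> (nat \<times> nat \<Rightarrow> complex) measure" where
  "noise n k = PiM ({..<n} \<times> {..<k}) (\<lambda>_. cgauss)"

definition err_prob :: "nat \<Rightarrow> nat \<Rightarrow> ((nat \<times> nat \<Rightarrow> complex) \<Rightarrow> nat)
     \<Rightarrow> (nat \<Rightarrow> complex vec) \<Rightarrow> nat \<Rightarrow> real" where
  "err_prob n k D s m = measure (noise n k)
     {z \<in> space (noise n k).
        D (restrict (\<lambda>(i,j). (s i) $ j + z (i,j)) ({..<n} \<times> {..<k})) \<noteq> m}"

definition cov_mat :: "nat \<Rightarrow> 'w set \<Rightarrow> ('w \<Rightarrow> complex vec) \<Rightarrow> complex mat" where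
  "cov_mat k W X =
     (let mu = (\<lambda>a. (\<Sum>w\<in>W. X w $ a) / of_nat (card W))
      in mat k k (\<lambda>(a,b). (\<Sum>w\<in>W. (X w $ a - mu a) * cnj (X w $ b - mu b)) / of_nat (card W)))"

definition nmsg :: "nat \<Rightarrow> real \<Rightarrow> nat" where
  "nmsg n R = nat \<lceil>2 powr (real n * R)\<rceil>"

text \<open>Existence of a length-n code for the MIMO cognitive channel with rates (Rp,Rc),
  powers (Pp,Pc), and both average error probabilities at most eps.
  Ep mp i : input of the primary transmitter at time i;
  Ec mp mc i : input of the cognitive transmitter at time i.\<close>
definition mcc_code_exists ::
  "nat \<Rightarrow> nat \<Rightarrow> nat \<Rightarrow> nat \<Rightarrow> complex mat \<Rightarrow> complex mat \<Rightarrow> complex mat \<Rightarrow> complex mat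
   \<Rightarrow> real \<Rightarrow> real \<Rightarrow> nat \<Rightarrow> real \<Rightarrow> real \<Rightarrow> real \<Rightarrow> bool" where
  "mcc_code_exists npt nct npr ncr Hpp Hcp Hpc Hcc Pp Pc n Rp Rc eps \<longleftrightarrow>
    (let Mp = nmsg n Rp; Mc = nmsg n Rc; Msg = {1..Mp} \<times> {1..Mc} in
     \<exists>(Ep :: nat \<Rightarrow> nat \<Rightarrow> complex vec) (Ec :: nat \<Rightarrow> nat \<Rightarrow> nat \<Rightarrow> complex vec)
       (Dp :: (nat \<times> nat \<Rightarrow> complex) \<Rightarrow> nat) (Dc :: (nat \<times> nat \<Rightarrow> complex) \<Rightarrow> nat).
       (\<forall>mp\<in>{1..Mp}. \<forall>i<n. Ep mp i \<in> carrier_vec npt) \<and>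
       (\<forall>(mp,mc)\<in>Msg. \<forall>i<n. Ec mp mc i \<in> carrier_vec nct) \<and>
       (\<Sum>i<n. Re (mtrace (cov_mat npt {1..Mp} (\<lambda>mp. Ep mp i)))) \<le> real n * Pp \<and>
       (\<Sum>i<n. Re (mtrace (cov_mat nct Msg (\<lambda>(mp,mc). Ec mp mc i)))) \<le> real n * Pc \<and>
       Dp \<in> measurable (PiM ({..<n} \<times> {..<npr}) (\<lambda>_. borel)) (count_space UNIV) \<and>
       Dc \<in> measurable (PiM ({..<n} \<times> {..<ncr}) (\<lambda>_. borel)) (count_space UNIV) \<and>
       (\<Sum>(mp,mc)\<in>Msg. err_prob n npr Dp
            (\<lambda>i. Hpp *\<^sub>v Ep mp i + Hcp *\<^sub>v Ec mp mc i) mp) / real (card Msg) \<le> eps \<and>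
       (\<Sum>(mp,mc)\<in>Msg. err_prob n ncr Dc
            (\<lambda>i. Hpc *\<^sub>v Ep mp i + Hcc *\<^sub>v Ec mp mc i) mc) / real (card Msg) \<le> eps)"

definition C_MCC ::
  "nat \<Rightarrow> nat \<Rightarrow> nat \<Rightarrow> nat \<Rightarrow> complex mat \<Rightarrow> complex mat \<Rightarrow> complex mat \<Rightarrow> complex mat
   \<Rightarrow> real \<Rightarrow> real \<Rightarrow> (real \<times> real) set" where
  "C_MCC npt nct npr ncr Hpp Hcp Hpc Hcc Pp Pc =
    {(Rp, Rc). 0 \<le> Rp \<and> 0 \<le> Rc \<and>
       (\<forall>eps>0. \<exists>N. \<forall>n\<ge>N. mcc_code_exists npt nct npr ncr Hpp Hcp Hpc Hcc Pp Pc n Rp Rc eps)}"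

definition G_alpha :: "nat \<Rightarrow> nat \<Rightarrow> complex mat \<Rightarrow> complex mat \<Rightarrow> real \<Rightarrow> complex mat" where
  "G_alpha npt nct Hpp Hcp \<alpha> =
     four_block_mat Hpp (complex_of_real (1 / sqrt \<alpha>) \<cdot>\<^sub>m Hcp) (0\<^sub>m 0 npt) (0\<^sub>m 0 nct)"

definition K_bar :: "nat \<Rightarrow> nat \<Rightarrow> complex mat \<Rightarrow> complex mat \<Rightarrow> complex mat \<Rightarrow> real \<Rightarrow> complex mat" where
  "K_bar npt ncr Hpp Hcp Hcc \<alpha> =
     four_block_mat Hpp (complex_of_real (1 / sqrt \<alpha>) \<cdot>\<^sub>m Hcp)
                    (0\<^sub>m ncr npt) (complex_of_real (1 / sqrt \<alpha>) \<cdot>\<^sub>m Hcc)"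

definition admissible_Sigma :: "nat \<Rightarrow> nat \<Rightarrow> complex mat \<Rightarrow> bool" where
  "admissible_Sigma npr ncr S \<longleftrightarrow>
     (\<exists>Qz \<in> carrier_mat npr ncr. S = four_block_mat (1\<^sub>m npr) Qz (mat_adjoint Qz) (1\<^sub>m ncr)) \<and>
     psd (npr + ncr) S \<and> 0 < Re (det S)"

definition R_out ::
  "nat \<Rightarrow> nat \<Rightarrow> nat \<Rightarrow> nat \<Rightarrow> complex mat \<Rightarrow> complex mat \<Rightarrow> complex mat
   \<Rightarrow> real \<Rightarrow> real \<Rightarrow> real \<Rightarrow> complex mat \<Rightarrow> (real \<times> real) set" where
  "R_out npt nct npr ncr Hpp Hcp Hcc Pp Pc \<alpha> S =
    (let G = G_alpha npt nct Hpp Hcp \<alpha>; K = K_bar npt ncr Hpp Hcp Hcc \<alpha>; t = npt + nct in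
     closure (convex hull
       {(Rp, Rc). 0 \<le> Rp \<and> 0 \<le> Rc \<and>
         (\<exists>Qp Qc. psd t Qp \<and> psd t Qc \<and>
            Re (mtrace Qp) + Re (mtrace Qc) \<le> Pp + \<alpha> * Pc \<and>
            Rp \<le> logdet (1\<^sub>m npr + G * Qp * mat_adjoint G + G * Qc * mat_adjoint G)
                 - logdet (1\<^sub>m npr + G * Qc * mat_adjoint G) \<and>
            Rc \<le> logdet (S + K * Qc * mat_adjoint K) - logdet S)}))"

end

theory Submission
  imports Defs "Jordan_Normal_Form.Spectral_Radius"
begin

text \<open>Fano's inequality bounds a weighted sum of the rates by mutual informations of Gaussian channels
with arbitrary finitely supported inputs, in which the cognitive receiver is replaced by one that
also sees the primary receiver's output, with noise covariance \<open>S\<close>. This makes the primary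
receiver a degraded version of it; the interference of the primary message at the cognitive receiver
can be subtracted, and scaling the cognitive input by \<open>sqrt \<alpha>\<close> turns the two power constraints
into a sum power constraint. Let \<open>(Qp, Qc)\<close> maximise the weighted sum of log-determinants.
Along a path of channels that connects the code to the Gaussian optimum, the derivative of the weighted
sum of mutual informations is given by estimation errors (the I-MMSE relation), and its sign follows
from the Karush--Kuhn--Tucker conditions at \<open>(Qp, Qc)\<close> together with degradedness. Hence
Gaussian inputs are optimal for every pair of weights, and a separating hyperplane argument gives the
inclusion of the regions.\<close>

unbundle no vec_syntax

section \<open>Complex Gaussian measures\<close>

text \<open>The weighted sum contains a difference of mutual informations in which the degraded
  receiver carries a minus sign, so concavity and the maximum entropy property of Gaussians alone do
  not bound it. On the path the total input is cos \<theta> X + sin \<theta> X_G, where X_G is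
  Gaussian with the optimal covariance. X_G never occurs as a random variable: once noise and
  received covariance are diagonal together, it merely raises the noise level of each scalar
  coordinate, and its own information is an explicit sum of logarithms. Hence all measure theory
  concerns finitely many signals in standard Gaussian noise. The angle is used instead of the power
  fraction t = (sin \<theta>)^2 because cos \<theta> is smooth at the Gaussian end, whereas the
  square root of 1 - t is not. The multiplier of the power constraint is split: one part pays for
  the primary message through a tangent bound for the logarithm, the rest becomes the squared norm
  of a linear map \<open>R\<close>, which joins the derivative inequality like a third receiver that
  observes nothing. The optimal covariances depend on the weights only and are fixed before
  blocklength and error probability.\<close>

definition cip :: "'j set \<Rightarrow> ('j \<Rightarrow> complex) \<Rightarrow> ('j \<Rightarrow> complex) \<Rightarrow> real" where
  "cip J a y = (\<Sum>j\<in>J. Re (a j * cnj (y j)))"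

definition csq :: "'j set \<Rightarrow> ('j \<Rightarrow> complex) \<Rightarrow> real" where
  "csq J a = (\<Sum>j\<in>J. (cmod (a j))\<^sup>2)"

text \<open>Density at \<open>y\<close> of the standard complex Gaussian translated by
  \<open>a\<close>, relative to the untranslated one: exp (-|y - a|^2) / exp (-|y|^2). All output
  distributions get their densities with respect to \<open>gam J\<close> in this way.\<close>

definition lik :: "'j set \<Rightarrow> ('j \<Rightarrow> complex) \<Rightarrow> ('j \<Rightarrow> complex) \<Rightarrow> real" where
  "lik J a y = exp (2 * cip J a y - csq J a)"

abbreviation gam :: "'j set \<Rightarrow> ('j \<Rightarrow> complex) measure" where
  "gam J \<equiv> PiM J (\<lambda>_. cgauss)"

lemma sets_cgauss[simp, measurable_cong]: "sets cgauss = sets borel"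
  by (simp add: cgauss_def)

lemma space_cgauss[simp]: "space cgauss = UNIV"
  by (simp add: cgauss_def)

text \<open>The unit variance splits evenly: real and imaginary part are independent with variance
  1/2, hence the standard deviation 1 / sqrt 2. The product over \<open>Basis\<close> is the form in
  which integrals over \<open>lborel\<close> factorise.\<close>

lemma cgauss_density_split:
  "ennreal (exp (- (cmod z * cmod z)) / pi) =
     (\<Prod>b\<in>Basis. ennreal (normal_density 0 (1 / sqrt 2) (z \<bullet> b)))"
proof -
  have nd: "normal_density 0 (1 / sqrt 2) x = exp (- x\<^sup>2) / sqrt pi" for x
    by (simp add: normal_density_def power_divide real_sqrt_divide)
  have "(\<Prod>b\<in>Basis. ennreal (normal_density 0 (1 / sqrt 2) (z \<bullet> b)))
     = ennreal (exp (- (Re z)\<^sup>2) / sqrt pi * (exp (- (Im z)\<^sup>2) / sqrt pi))"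
    by (simp add: Basis_complex_def nd ennreal_mult'[symmetric] inner_complex_def complex_eq_iff)
  also have "exp (- (Re z)\<^sup>2) / sqrt pi * (exp (- (Im z)\<^sup>2) / sqrt pi) = exp (- (cmod z * cmod z)) / pi"
    by (simp add: exp_add[symmetric] cmod_power2 flip: power2_eq_square)
  finally show ?thesis by simp
qed

lemma prob_space_cgauss: "prob_space cgauss"
proof
  have "emeasure cgauss (space cgauss) = (\<integral>\<^sup>+z. (\<Prod>b\<in>Basis. ennreal (normal_density 0 (1 / sqrt 2) (z \<bullet> b))) \<partial>(lborel :: complex measure))"
    by (simp add: cgauss_def emeasure_density cgauss_density_split)
  also have "\<dots> = (\<Prod>b\<in>(Basis :: complex set). \<integral>\<^sup>+x. ennreal (normal_density 0 (1 / sqrt 2) x) \<partial>lborel)"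
    by (rule nn_integral_lborel_prod) auto
  also have "(\<integral>\<^sup>+x. ennreal (normal_density 0 (1 / sqrt 2) x) \<partial>lborel) = 1"
    using prob_space.emeasure_space_1[OF prob_space_normal_density[of "1 / sqrt 2" 0]]
    by (simp add: emeasure_density)
  finally show "emeasure cgauss (space cgauss) = 1" by simp
qed

lemma product_sigma_finite_cgauss: "product_sigma_finite (\<lambda>_. cgauss)"
  by (simp add: product_sigma_finite_def prob_space_imp_sigma_finite[OF prob_space_cgauss])

lemma prob_space_gam: "prob_space (gam J)"
  by (rule prob_space_PiM) (rule prob_space_cgauss)

lemma nn_integral_cmod2_cgauss: "(\<integral>\<^sup>+z. ennreal ((cmod z)\<^sup>2) \<partial>cgauss) = 1"
proof -
  let ?nd = "normal_density 0 (1 / sqrt 2)"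
  have m2: "(\<integral>\<^sup>+x. ennreal (?nd x * x\<^sup>2) \<partial>lborel) = ennreal (1/2)"
  proof -
    have "has_bochner_integral lborel (\<lambda>x. ?nd x * (x - 0) ^ (2 * 1)) (fact (2 * 1) / ((2 / (1 / sqrt 2)\<^sup>2) ^ 1 * fact 1))"
      by (rule normal_moment_even) simp
    then have "integrable lborel (\<lambda>x. ?nd x * x\<^sup>2)" "(\<integral>x. ?nd x * x\<^sup>2 \<partial>lborel) = 1/2"
      by (auto simp: has_bochner_integral_iff power_divide)
    then show ?thesis
      by (subst nn_integral_eq_integral) (auto simp del: ennreal_half simp: field_simps)
  qed
  have m0: "(\<integral>\<^sup>+x. ennreal (?nd x) \<partial>lborel) = 1"
    using prob_space.emeasure_space_1[OF prob_space_normal_density[of "1 / sqrt 2" 0]]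
    by (simp add: emeasure_density)
  have *: "(\<integral>\<^sup>+z. ennreal ((z \<bullet> c)\<^sup>2) \<partial>cgauss) = ennreal (1/2)" if c: "c \<in> Basis" for c :: complex
  proof -
    \<comment> \<open>The square is attached to the single basis direction \<open>c\<close>; every
      other factor then integrates to 1.\<close>
    let ?f = "\<lambda>b x. ennreal (?nd x * (if b = c then x\<^sup>2 else 1))"
    have "(\<integral>\<^sup>+z. ennreal ((z \<bullet> c)\<^sup>2) \<partial>cgauss) = (\<integral>\<^sup>+z. (\<Prod>b\<in>Basis. ?f b (z \<bullet> b)) \<partial>lborel)"
      unfolding cgauss_def
      apply (subst nn_integral_density)
        apply simp_all
      apply (subst cgauss_density_split)
      apply (intro nn_integral_cong)
      using c by (auto simp: Basis_complex_def ennreal_mult' mult_ac complex_eq_iff inner_complex_def)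
    also have "\<dots> = (\<Prod>b\<in>Basis. \<integral>\<^sup>+x. ?f b x \<partial>lborel)"
      by (rule nn_integral_lborel_prod) auto
    also have "\<dots> = (\<integral>\<^sup>+x. ?f c x \<partial>lborel) * (\<Prod>b\<in>Basis - {c}. \<integral>\<^sup>+x. ?f b x \<partial>lborel)"
      by (rule prod.remove) (use c in auto)
    also have "(\<Prod>b\<in>Basis - {c}. \<integral>\<^sup>+x. ?f b x \<partial>lborel) = 1"
      by (intro prod.neutral) (auto simp: m0)
    finally show ?thesis using m2 by simp
  qed
  have "(\<integral>\<^sup>+z. ennreal ((cmod z)\<^sup>2) \<partial>cgauss) = (\<integral>\<^sup>+z. ennreal ((z \<bullet> 1)\<^sup>2) + ennreal ((z \<bullet> \<i>)\<^sup>2) \<partial>cgauss)"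
    by (intro nn_integral_cong) (simp add: cmod_power2 ennreal_plus[symmetric] inner_complex_def del: ennreal_plus)
  also have "\<dots> = ennreal (1/2) + ennreal (1/2)"
    using *[of 1] *[of \<i>] by (subst nn_integral_add) (simp_all add: Basis_complex_def del: ennreal_half)
  also have "\<dots> = 1" by (simp add: ennreal_plus[symmetric] del: ennreal_plus ennreal_half)
  finally show ?thesis .
qed

text \<open>Completing the square: |z - a|^2 = |z|^2 - 2 Re (a cnj z) + |a|^2. This is the one place
  where translation invariance of Lebesgue measure enters; from here on only likelihood ratios are
  used.\<close>

lemma distr_cgauss_shift:
  "distr cgauss borel (\<lambda>z. z + a) = density cgauss (\<lambda>z. ennreal (exp (2 * Re (a * cnj z) - (cmod a)\<^sup>2)))"
proof (rule measure_eqI)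
  fix A :: "complex set"
  assume "A \<in> sets (distr cgauss borel (\<lambda>z. z + a))"
  then have A[measurable]: "A \<in> sets borel" by simp
  let ?p = "\<lambda>z::complex. ennreal (exp (- (cmod z * cmod z)) / pi)"
  have "emeasure (distr cgauss borel (\<lambda>z. z + a)) A = (\<integral>\<^sup>+z. indicator A z \<partial>distr cgauss borel (\<lambda>z. z + a))"
    by simp
  also have "\<dots> = (\<integral>\<^sup>+z. indicator A (z + a) \<partial>cgauss)"
    by (subst nn_integral_distr) auto
  also have "\<dots> = (\<integral>\<^sup>+z. ?p z * indicator A (z + a) \<partial>lborel)"
    unfolding cgauss_def by (subst nn_integral_density) auto
  also have "\<dots> = (\<integral>\<^sup>+z. ?p (a + z - a) * indicator A (a + z) \<partial>lborel)"
    by (simp add: add.commute)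
  also have "\<dots> = (\<integral>\<^sup>+z. ?p (z - a) * indicator A z \<partial>distr lborel borel ((+) a))"
    by (subst nn_integral_distr) auto
  also have "\<dots> = (\<integral>\<^sup>+z. ?p (z - a) * indicator A z \<partial>lborel)"
    by (simp add: lborel_distr_plus)
  also have "\<dots> = (\<integral>\<^sup>+z. ?p z * (ennreal (exp (2 * Re (a * cnj z) - (cmod a)\<^sup>2)) * indicator A z) \<partial>lborel)"
  proof (intro nn_integral_cong)
    fix z
    have "- (cmod (z - a))\<^sup>2 = - (cmod z)\<^sup>2 + (2 * Re (a * cnj z) - (cmod a)\<^sup>2)"
      unfolding cmod_power2 by (simp add: power2_eq_square algebra_simps)
    then have "exp (- (cmod (z - a) * cmod (z - a))) / pi
      = exp (- (cmod z * cmod z)) / pi * exp (2 * Re (a * cnj z) - (cmod a)\<^sup>2)"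
      by (simp only: power2_eq_square exp_add) simp
    then show "?p (z - a) * indicator A z = ?p z * (ennreal (exp (2 * Re (a * cnj z) - (cmod a)\<^sup>2)) * indicator A z)"
      by (simp add: ennreal_mult'[symmetric] mult.assoc[symmetric])
  qed
  also have "\<dots> = (\<integral>\<^sup>+z. (ennreal (exp (2 * Re (a * cnj z) - (cmod a)\<^sup>2)) * indicator A z) \<partial>cgauss)"
    unfolding cgauss_def by (subst nn_integral_density) auto
  also have "\<dots> = emeasure (density cgauss (\<lambda>z. ennreal (exp (2 * Re (a * cnj z) - (cmod a)\<^sup>2)))) A"
    by (subst emeasure_density) auto
  finally show "emeasure (distr cgauss borel (\<lambda>z. z + a)) A = \<dots>" .
qed simp

lemma sets_gam: "sets (gam J) = sets (PiM J (\<lambda>_. borel))"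
  by (intro sets_PiM_cong) auto

lemma space_gam: "space (gam J) = PiE J (\<lambda>_. UNIV)"
  by (simp add: space_PiM)

lemma measurable_coord_gam[measurable (raw)]: "j \<in> J \<Longrightarrow> (\<lambda>y. y j) \<in> borel_measurable (gam J)"
  using measurable_component_singleton[of j J "\<lambda>_. cgauss"] by (simp cong: measurable_cong_sets)

lemma measurable_into_gam:
  assumes "\<And>k. k \<in> K \<Longrightarrow> (\<lambda>y. f y k) \<in> borel_measurable M"
  shows "(\<lambda>y. \<lambda>k\<in>K. f y k) \<in> measurable M (gam K)"
  by (intro measurable_restrict) (use assms in \<open>simp cong: measurable_cong_sets\<close>)

lemma borel_measurable_cnj[measurable]: "cnj \<in> borel_measurable borel"
  by (intro borel_measurable_continuous_onI continuous_intros)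

lemma measurable_cip[measurable]: "cip J a \<in> borel_measurable (gam J)"
  unfolding cip_def by measurable

lemma measurable_csq[measurable]: "csq J \<in> borel_measurable (gam J)"
  unfolding csq_def by measurable

lemma measurable_lik[measurable]: "lik J a \<in> borel_measurable (gam J)"
  unfolding lik_def by measurable

lemma measurable_shift[measurable]: "(\<lambda>y. \<lambda>j\<in>J. y j + a j) \<in> measurable (gam J) (gam J)"
  by (intro measurable_into_gam) measurable

lemma lik_pos[simp]: "0 < lik J a y" and lik_nonneg[simp]: "0 \<le> lik J a y"
  by (simp_all add: lik_def)

text \<open>Both measures are the product of the shifted scalar Gaussians \<open>M j\<close>, since
  the likelihood ratio factorises over the coordinates, and a finite product measure is determined
  by its values on rectangles.\<close>

lemma distr_gam_shift:
  assumes fin: "finite J"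
  shows "distr (gam J) (gam J) (\<lambda>y. \<lambda>j\<in>J. y j + a j) = density (gam J) (\<lambda>y. ennreal (lik J a y))"
proof -
  define M where "M j = distr cgauss borel (\<lambda>z. z + a j)" for j
  have pM: "prob_space (M j)" for j
    unfolding M_def by (rule prob_space.prob_space_distr[OF prob_space_cgauss]) simp
  have psM: "product_sigma_finite M"
    by (simp add: product_sigma_finite_def prob_space_imp_sigma_finite[OF pM])
  have sM: "sets (gam J) = sets (PiM J M)"
    by (intro sets_PiM_cong) (auto simp: M_def)
  have 1: "distr (gam J) (gam J) (\<lambda>y. \<lambda>j\<in>J. y j + a j) = PiM J M"
  proof (rule product_sigma_finite.PiM_eqI[OF psM fin])
    fix A assume A: "\<And>i. i \<in> J \<Longrightarrow> A i \<in> sets (M i)"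
    then have [measurable]: "i \<in> J \<Longrightarrow> A i \<in> sets borel" for i by (auto simp: M_def)
    have "emeasure (distr (gam J) (gam J) (\<lambda>y. \<lambda>j\<in>J. y j + a j)) (PiE J A)
        = emeasure (gam J) ((\<lambda>y. \<lambda>j\<in>J. y j + a j) -` (PiE J A) \<inter> space (gam J))"
      by (intro emeasure_distr measurable_shift sets_PiM_I_finite fin) auto
    also have "(\<lambda>y. \<lambda>j\<in>J. y j + a j) -` (PiE J A) \<inter> space (gam J) = PiE J (\<lambda>j. (\<lambda>z. z + a j) -` A j)"
      by (auto simp: space_gam PiE_def Pi_def)
    also have "emeasure (gam J) \<dots> = (\<Prod>j\<in>J. emeasure cgauss ((\<lambda>z. z + a j) -` A j))"
      by (intro product_sigma_finite.emeasure_PiM[OF product_sigma_finite_cgauss] fin)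
        (use measurable_sets[of "\<lambda>z. z + a _" borel borel "A _"] in simp)
    also have "\<dots> = (\<Prod>j\<in>J. emeasure (M j) (A j))"
      by (intro prod.cong refl) (simp add: M_def emeasure_distr)
    finally show "emeasure (distr (gam J) (gam J) (\<lambda>y. \<lambda>j\<in>J. y j + a j)) (PiE J A) = \<dots>" .
  qed (simp add: sM)
  have 2: "density (gam J) (\<lambda>y. ennreal (lik J a y)) = PiM J M"
  proof (rule product_sigma_finite.PiM_eqI[OF psM fin])
    fix A assume A: "\<And>i. i \<in> J \<Longrightarrow> A i \<in> sets (M i)"
    then have Ab[measurable]: "i \<in> J \<Longrightarrow> A i \<in> sets borel" for i by (auto simp: M_def)
    let ?g = "\<lambda>j z. ennreal (exp (2 * Re (a j * cnj z) - (cmod (a j))\<^sup>2)) * indicator (A j) z"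
    have "emeasure (density (gam J) (\<lambda>y. ennreal (lik J a y))) (PiE J A)
        = (\<integral>\<^sup>+y. ennreal (lik J a y) * indicator (PiE J A) y \<partial>gam J)"
      by (intro emeasure_density) (auto intro!: sets_PiM_I_finite fin)
    also have "\<dots> = (\<integral>\<^sup>+y. (\<Prod>j\<in>J. ?g j (y j)) \<partial>gam J)"
    proof (intro nn_integral_cong)
      fix y assume "y \<in> space (gam J)"
      then have ind: "indicator (PiE J A) y = (\<Prod>j\<in>J. indicator (A j) (y j) :: ennreal)"
        using fin by (auto simp: space_gam indicator_def PiE_def Pi_def prod_zero_iff)
      have "lik J a y = (\<Prod>j\<in>J. exp (2 * Re (a j * cnj (y j)) - (cmod (a j))\<^sup>2))"
        unfolding lik_def cip_def csq_def sum_distrib_left sum_subtractf[symmetric]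
        by (rule exp_sum[OF fin])
      then show "ennreal (lik J a y) * indicator (PiE J A) y = (\<Prod>j\<in>J. ?g j (y j))"
        by (simp add: ind prod.distrib prod_ennreal)
    qed
    also have "\<dots> = (\<Prod>j\<in>J. \<integral>\<^sup>+z. ?g j z \<partial>cgauss)"
      by (intro product_sigma_finite.product_nn_integral_prod[OF product_sigma_finite_cgauss] fin) (use Ab in measurable)
    also have "\<dots> = (\<Prod>j\<in>J. emeasure (M j) (A j))"
      by (intro prod.cong refl) (simp add: M_def distr_cgauss_shift emeasure_density)
    finally show "emeasure (density (gam J) (\<lambda>y. ennreal (lik J a y))) (PiE J A) = \<dots>" .
  qed (simp add: sM)
  show ?thesis using 1 2 by simp
qed

lemma nn_integral_gam_shift:
  assumes "finite J" "g \<in> borel_measurable (gam J)"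
  shows "(\<integral>\<^sup>+y. g (\<lambda>j\<in>J. y j + a j) \<partial>gam J) = (\<integral>\<^sup>+y. ennreal (lik J a y) * g y \<partial>gam J)"
proof -
  have "(\<integral>\<^sup>+y. g (\<lambda>j\<in>J. y j + a j) \<partial>gam J) = (\<integral>\<^sup>+y. g y \<partial>distr (gam J) (gam J) (\<lambda>y. \<lambda>j\<in>J. y j + a j))"
    using assms by (subst nn_integral_distr) auto
  also have "\<dots> = (\<integral>\<^sup>+y. ennreal (lik J a y) * g y \<partial>gam J)"
    unfolding distr_gam_shift[OF assms(1)] using assms by (subst nn_integral_density) auto
  finally show ?thesis .
qed

lemma integral_gam_shift:
  fixes g :: "_ \<Rightarrow> 'b :: {banach, second_countable_topology}"
  assumes "finite J" "g \<in> borel_measurable (gam J)"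
  shows "(\<integral>y. g (\<lambda>j\<in>J. y j + a j) \<partial>gam J) = (\<integral>y. lik J a y *\<^sub>R g y \<partial>gam J)"
proof -
  have "(\<integral>y. g (\<lambda>j\<in>J. y j + a j) \<partial>gam J) = (\<integral>y. g y \<partial>distr (gam J) (gam J) (\<lambda>y. \<lambda>j\<in>J. y j + a j))"
    using assms by (subst integral_distr) auto
  also have "\<dots> = (\<integral>y. lik J a y *\<^sub>R g y \<partial>gam J)"
    unfolding distr_gam_shift[OF assms(1)] using assms by (subst integral_density) auto
  finally show ?thesis .
qed

lemma integrable_gam_shift:
  fixes g :: "_ \<Rightarrow> 'b :: {banach, second_countable_topology}"
  assumes "finite J" "g \<in> borel_measurable (gam J)"
  shows "integrable (gam J) (\<lambda>y. g (\<lambda>j\<in>J. y j + a j)) \<longleftrightarrow> integrable (gam J) (\<lambda>y. lik J a y *\<^sub>R g y)"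
proof -
  have "integrable (gam J) (\<lambda>y. g (\<lambda>j\<in>J. y j + a j)) \<longleftrightarrow> integrable (distr (gam J) (gam J) (\<lambda>y. \<lambda>j\<in>J. y j + a j)) g"
    using assms by (subst integrable_distr_eq) auto
  also have "\<dots> \<longleftrightarrow> integrable (gam J) (\<lambda>y. lik J a y *\<^sub>R g y)"
    unfolding distr_gam_shift[OF assms(1)] using assms by (subst integrable_density) auto
  finally show ?thesis .
qed

lemma cip_commute: "cip J x y = cip J y x"
  unfolding cip_def by (intro sum.cong refl) (simp add: algebra_simps)

lemma cip_add_left: "cip J (\<lambda>j\<in>J. x j + y j) z = cip J x z + cip J y z"
  and cip_add_right: "cip J z (\<lambda>j\<in>J. x j + y j) = cip J z x + cip J z y"
  unfolding cip_def sum.distrib[symmetric] by (intro sum.cong refl; simp add: algebra_simps)+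

lemma cip_self: "cip J x x = csq J x"
  unfolding cip_def csq_def cmod_power2 by (intro sum.cong refl) (simp add: power2_eq_square)

lemma csq_add: "csq J (\<lambda>j\<in>J. x j + y j) = csq J x + 2 * cip J x y + csq J y"
  unfolding cip_self[symmetric] cip_add_left cip_add_right by (simp add: cip_commute)

text \<open>The shift formula characterises the Gaussian measure: weighting both measures with
  \<open>exp (csq J y)\<close> makes them translation invariant, so Fubini identifies them.\<close>

lemma gam_unique:
  assumes fin: "finite J" and "prob_space \<mu>" and s[measurable_cong]: "sets \<mu> = sets (gam J)"
    and shift: "\<And>a g. g \<in> borel_measurable (gam J) \<Longrightarrow>
      (\<integral>\<^sup>+y. g (\<lambda>j\<in>J. y j + a j) \<partial>\<mu>) = (\<integral>\<^sup>+y. ennreal (lik J a y) * g y \<partial>\<mu>)"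
  shows "\<mu> = gam J"
proof (rule measure_eqI)
  show "sets \<mu> = sets (gam J)" by (rule s)
next
  fix E assume "E \<in> sets \<mu>"
  then have E[measurable]: "E \<in> sets (gam J)" by (simp add: s)
  interpret mu: prob_space \<mu> by fact
  interpret g: prob_space "gam J" by (rule prob_space_gam)
  interpret P: pair_sigma_finite "gam J" \<mu> by unfold_locales
  have plus[measurable]: "(\<lambda>p. \<lambda>j\<in>J. snd p j + fst p j) \<in> measurable (gam J \<Otimes>\<^sub>M \<mu>) (gam J)"
    by (intro measurable_into_gam) measurable
  have cipm[measurable]: "(\<lambda>p. cip J (fst p) (snd p)) \<in> borel_measurable (gam J \<Otimes>\<^sub>M \<mu>)"
    unfolding cip_def by measurable
  have csm[measurable]: "(\<lambda>p. csq J (fst p)) \<in> borel_measurable (gam J \<Otimes>\<^sub>M \<mu>)"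
    unfolding csq_def by measurable
  \<comment> \<open>A kernel that couples the unknown measure, in the variable \<open>x\<close>,
    with the known one, in \<open>y\<close>. Its integral over \<open>x\<close> is
    \<open>emeasure \<mu> E\<close> for every \<open>y\<close>; the substitution in \<open>y\<close>
    moves the indicator from the sum to \<open>y\<close> alone, after which the integral over
    \<open>x\<close> is a total mass.\<close>
  define F where "F = (\<lambda>(y, x). ennreal (exp (- 2 * cip J y x - csq J y)) * indicator E (\<lambda>j\<in>J. x j + y j))"
  have Fm: "F \<in> borel_measurable (gam J \<Otimes>\<^sub>M \<mu>)"
    unfolding F_def split_beta by measurable
  define H where "H = (\<lambda>(y, x). ennreal (exp (2 * cip J y x - csq J y)) * indicator E y)"
  have Hm: "H \<in> borel_measurable (gam J \<Otimes>\<^sub>M \<mu>)"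
    unfolding H_def split_beta by measurable
  have 1: "emeasure \<mu> E = (\<integral>\<^sup>+x. F (y, x) \<partial>\<mu>)" for y
  proof -
    let ?g = "\<lambda>x. ennreal (exp (- 2 * cip J y x + csq J y)) * indicator E x"
    have "(\<integral>\<^sup>+x. F (y, x) \<partial>\<mu>) = (\<integral>\<^sup>+x. ?g (\<lambda>j\<in>J. x j + y j) \<partial>\<mu>)"
      by (intro nn_integral_cong)
        (simp add: F_def cip_add_right cip_self algebra_simps minus_diff_commute)
    also have "\<dots> = (\<integral>\<^sup>+x. ennreal (lik J y x) * ?g x \<partial>\<mu>)"
      by (rule shift) measurable
    also have "\<dots> = (\<integral>\<^sup>+x. indicator E x \<partial>\<mu>)"
      by (intro nn_integral_cong)
        (simp add: lik_def mult.assoc[symmetric] ennreal_mult'[symmetric] exp_add[symmetric])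
    finally show ?thesis by simp
  qed
  have 2: "(\<integral>\<^sup>+y. F (y, x) \<partial>gam J) = (\<integral>\<^sup>+y. H (y, x) \<partial>gam J)" for x
  proof -
    let ?g = "\<lambda>y. ennreal (exp (csq J x - csq J y)) * indicator E y"
    have "(\<integral>\<^sup>+y. F (y, x) \<partial>gam J) = (\<integral>\<^sup>+y. ?g (\<lambda>j\<in>J. y j + x j) \<partial>gam J)"
    proof (intro nn_integral_cong)
      fix y
      have "(\<lambda>j\<in>J. x j + y j) = (\<lambda>j\<in>J. y j + x j)" by (simp add: add.commute)
      then show "F (y, x) = ?g (\<lambda>j\<in>J. y j + x j)"
        by (simp add: F_def csq_add cip_commute[of J y] algebra_simps minus_diff_commute)
    qed
    also have "\<dots> = (\<integral>\<^sup>+y. ennreal (lik J x y) * ?g y \<partial>gam J)"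
      by (rule nn_integral_gam_shift[OF fin]) measurable
    also have "\<dots> = (\<integral>\<^sup>+y. H (y, x) \<partial>gam J)"
      by (intro nn_integral_cong)
        (simp add: H_def lik_def mult.assoc[symmetric] ennreal_mult'[symmetric] exp_add[symmetric] cip_commute[of J x])
    finally show ?thesis .
  qed
  have 3: "(\<integral>\<^sup>+x. H (y, x) \<partial>\<mu>) = indicator E y" for y
  proof -
    have "(\<integral>\<^sup>+x. H (y, x) \<partial>\<mu>) = (\<integral>\<^sup>+x. ennreal (lik J y x) * 1 \<partial>\<mu>) * indicator E y"
      unfolding H_def lik_def by (simp add: nn_integral_multc)
    also have "(\<integral>\<^sup>+x. ennreal (lik J y x) * 1 \<partial>\<mu>) = 1"
      by (subst shift[symmetric]) (auto simp: mu.emeasure_space_1)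
    finally show ?thesis by simp
  qed
  have "emeasure \<mu> E = (\<integral>\<^sup>+y. (\<integral>\<^sup>+x. F (y, x) \<partial>\<mu>) \<partial>gam J)"
    by (simp add: 1[symmetric] g.emeasure_space_1)
  also have "\<dots> = (\<integral>\<^sup>+x. (\<integral>\<^sup>+y. F (y, x) \<partial>gam J) \<partial>\<mu>)"
    by (rule P.Fubini'[symmetric]) (use Fm in \<open>simp add: split_beta'\<close>)
  also have "\<dots> = (\<integral>\<^sup>+x. (\<integral>\<^sup>+y. H (y, x) \<partial>gam J) \<partial>\<mu>)" by (simp add: 2)
  also have "\<dots> = (\<integral>\<^sup>+y. (\<integral>\<^sup>+x. H (y, x) \<partial>\<mu>) \<partial>gam J)"
    by (rule P.Fubini') (use Hm in \<open>simp add: split_beta'\<close>)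
  also have "\<dots> = emeasure (gam J) E" by (simp add: 3)
  finally show "emeasure \<mu> E = emeasure (gam J) E" .
qed

section \<open>Images of the standard Gaussian under linear maps with orthonormal rows\<close>

definition lin :: "'j set \<Rightarrow> 'k set \<Rightarrow> ('k \<Rightarrow> 'j \<Rightarrow> complex) \<Rightarrow> ('j \<Rightarrow> complex) \<Rightarrow> 'k \<Rightarrow> complex" where
  "lin J K T y = (\<lambda>k\<in>K. \<Sum>j\<in>J. T k j * y j)"

definition coisom :: "'j set \<Rightarrow> 'k set \<Rightarrow> ('k \<Rightarrow> 'j \<Rightarrow> complex) \<Rightarrow> bool" where
  "coisom J K T \<longleftrightarrow> (\<forall>k\<in>K. \<forall>l\<in>K. (\<Sum>j\<in>J. T k j * cnj (T l j)) = (if k = l then 1 else 0))"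

lemma measurable_lin[measurable]: "lin J K T \<in> measurable (gam J) (gam K)"
  unfolding lin_def by (intro measurable_into_gam) measurable

lemma cip_adjoint:
  "cip J (\<lambda>j\<in>J. \<Sum>k\<in>K. cnj (T k j) * a k) y = cip K a (lin J K T y)"
proof -
  have "cip J (\<lambda>j\<in>J. \<Sum>k\<in>K. cnj (T k j) * a k) y = Re (\<Sum>j\<in>J. \<Sum>k\<in>K. cnj (T k j) * a k * cnj (y j))"
    by (simp add: cip_def sum_distrib_right)
  also have "\<dots> = Re (\<Sum>k\<in>K. \<Sum>j\<in>J. cnj (T k j) * a k * cnj (y j))"
    by (subst sum.swap) simp
  also have "\<dots> = cip K a (lin J K T y)"
    unfolding cip_def lin_def Re_sum[symmetric]
    by (intro arg_cong[where f=Re] sum.cong refl) (simp add: sum_distrib_left mult_ac)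
  finally show ?thesis .
qed

lemma coisom_lin_adjoint:
  assumes "finite K" "coisom J K T" "k \<in> K"
  shows "(\<Sum>j\<in>J. T k j * (\<Sum>l\<in>K. cnj (T l j) * a l)) = a k"
proof -
  have "(\<Sum>j\<in>J. T k j * (\<Sum>l\<in>K. cnj (T l j) * a l)) = (\<Sum>l\<in>K. (\<Sum>j\<in>J. T k j * cnj (T l j)) * a l)"
    by (simp add: sum_distrib_left sum_distrib_right mult.assoc) (rule sum.swap)
  also have "\<dots> = (\<Sum>l\<in>K. if k = l then a l else 0)"
    using assms by (intro sum.cong refl) (auto simp: coisom_def)
  also have "\<dots> = a k" using assms by simp
  finally show ?thesis .
qed

text \<open>The image measure satisfies the shift formula that characterises \<open>gam K\<close>: a
  shift by \<open>a\<close> after the map is a shift by the adjoint image \<open>b\<close> before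
  it, and the two likelihood ratios agree because the adjoint of a coisometry preserves
  norms.\<close>

lemma distr_gam_lin:
  assumes fJ: "finite J" and fK: "finite K" and T: "coisom J K T"
  shows "distr (gam J) (gam K) (lin J K T) = gam K"
proof (rule gam_unique[OF fK])
  interpret g: prob_space "gam J" by (rule prob_space_gam)
  show "prob_space (distr (gam J) (gam K) (lin J K T))"
    by (rule g.prob_space_distr) measurable
  fix a and g :: "('b \<Rightarrow> complex) \<Rightarrow> ennreal" assume g[measurable]: "g \<in> borel_measurable (gam K)"
  define b where "b = (\<lambda>j\<in>J. \<Sum>k\<in>K. cnj (T k j) * a k)"
  have lin_add: "lin J K T (\<lambda>j\<in>J. y j + b j) = (\<lambda>k\<in>K. lin J K T y k + a k)" for y
  proof
    fix k show "lin J K T (\<lambda>j\<in>J. y j + b j) k = (\<lambda>k\<in>K. lin J K T y k + a k) k"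
      using coisom_lin_adjoint[OF fK T, of k a]
      by (cases "k \<in> K") (simp_all add: lin_def b_def ring_distribs sum.distrib)
  qed
  have lb: "lin J K T b = restrict a K"
    using coisom_lin_adjoint[OF fK T, of _ a] by (auto simp: lin_def b_def)
  have csq: "csq J b = csq K a"
  proof -
    have "csq J b = cip K a (lin J K T b)"
      unfolding cip_self[symmetric] by (subst (1) b_def) (rule cip_adjoint)
    also have "\<dots> = csq K a" unfolding lb cip_self[symmetric] by (simp add: cip_def)
    finally show ?thesis .
  qed
  have lik: "lik J b y = lik K a (lin J K T y)" for y
    unfolding lik_def csq unfolding b_def cip_adjoint ..
  have "(\<integral>\<^sup>+y. g (\<lambda>j\<in>K. y j + a j) \<partial>distr (gam J) (gam K) (lin J K T)) = (\<integral>\<^sup>+y. g (lin J K T (\<lambda>j\<in>J. y j + b j)) \<partial>gam J)"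
    unfolding lin_add by (subst nn_integral_distr) auto
  also have "\<dots> = (\<integral>\<^sup>+y. ennreal (lik J b y) * g (lin J K T y) \<partial>gam J)"
    by (rule nn_integral_gam_shift[OF fJ]) measurable
  also have "\<dots> = (\<integral>\<^sup>+y. ennreal (lik K a y) * g y \<partial>distr (gam J) (gam K) (lin J K T))"
    unfolding lik by (subst nn_integral_distr) auto
  finally show "(\<integral>\<^sup>+y. g (\<lambda>j\<in>K. y j + a j) \<partial>distr (gam J) (gam K) (lin J K T)) = \<dots>" .
qed simp

section \<open>Differentiation under the integral and Gaussian integration by parts\<close>

lemma has_real_derivative_integral:
  fixes f :: "real \<Rightarrow> 'a \<Rightarrow> real"
  assumes d: "0 < d"
    and der: "\<And>t x. \<bar>t - t0\<bar> < d \<Longrightarrow> x \<in> space M \<Longrightarrow> ((\<lambda>t. f t x) has_real_derivative f' t x) (at t)"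
    and int: "\<And>t. \<bar>t - t0\<bar> < d \<Longrightarrow> integrable M (f t)"
    and meas: "f' t0 \<in> borel_measurable M"
    and B: "integrable M B" "\<And>t x. \<bar>t - t0\<bar> < d \<Longrightarrow> x \<in> space M \<Longrightarrow> \<bar>f' t x\<bar> \<le> B x"
  shows "((\<lambda>t. \<integral>x. f t x \<partial>M) has_real_derivative (\<integral>x. f' t0 x \<partial>M)) (at t0)"
  unfolding DERIV_def tendsto_at_iff_sequentially comp_def
proof (intro allI impI)
  fix X :: "nat \<Rightarrow> real" assume X0: "\<forall>i. X i \<in> UNIV - {0}" and X: "X \<longlonglongrightarrow> 0"
  have "\<forall>\<^sub>F n in sequentially. \<bar>X n\<bar> < d"
    using tendstoD[OF X d] by (simp add: dist_real_def)
  then obtain N where N: "\<And>n. n \<ge> N \<Longrightarrow> \<bar>X n\<bar> < d"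
    by (auto simp: eventually_sequentially)
  \<comment> \<open>The sequence is shifted by \<open>N\<close> so that every difference quotient
    lies within the radius \<open>d\<close> where the domination holds.\<close>
  let ?q = "\<lambda>n x. (f (t0 + X (n + N)) x - f t0 x) / X (n + N)"
  have it0: "integrable M (f t0)" using int[of t0] d by simp
  have itn: "integrable M (f (t0 + X (n + N)))" for n
    using int[of "t0 + X (n + N)"] N[of "n + N"] by simp
  have "(\<lambda>n. \<integral>x. ?q n x \<partial>M) \<longlonglongrightarrow> (\<integral>x. f' t0 x \<partial>M)"
  proof (rule integral_dominated_convergence[where w=B])
    show "AE x in M. (\<lambda>n. ?q n x) \<longlonglongrightarrow> f' t0 x"
    proof (rule AE_I2)
      fix x assume x: "x \<in> space M"
      have "((\<lambda>t. f t x) has_real_derivative f' t0 x) (at t0)"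
        using der[of t0 x] d x by simp
      then have "(\<lambda>n. (f (t0 + X n) x - f t0 x) / X n) \<longlonglongrightarrow> f' t0 x"
        unfolding DERIV_def tendsto_at_iff_sequentially comp_def using X0 X by blast
      then show "(\<lambda>n. ?q n x) \<longlonglongrightarrow> f' t0 x" by (rule LIMSEQ_ignore_initial_segment)
    qed
    show "AE x in M. norm (?q n x) \<le> B x" for n
    proof (rule AE_I2)
      fix x assume x: "x \<in> space M"
      let ?h = "X (n + N)"
      have hd: "\<bar>?h\<bar> < d" using N by simp
      have h0: "?h \<noteq> 0" using X0 by auto
      \<comment> \<open>The mean value theorem turns the bound on the derivative into one on the
        difference quotient. It wants ordered endpoints, hence the two signs of
        \<open>?h\<close>.\<close>
      have "\<bar>f (t0 + ?h) x - f t0 x\<bar> \<le> B x * \<bar>?h\<bar>"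
      proof (cases "?h > 0")
        case True
        obtain z where "t0 < z" "z < t0 + ?h" "f (t0 + ?h) x - f t0 x = (t0 + ?h - t0) * f' z x"
          using MVT2[of t0 "t0 + ?h" "\<lambda>t. f t x" "\<lambda>t. f' t x"] True der[OF _ x] hd by (auto simp: abs_less_iff)
        then show ?thesis using B(2)[of z x] x hd True
          by (simp add: abs_mult mult.commute mult_right_mono)
      next
        case False
        then have neg: "?h < 0" using h0 by simp
        obtain z where "t0 + ?h < z" "z < t0" "f t0 x - f (t0 + ?h) x = (t0 - (t0 + ?h)) * f' z x"
          using MVT2[of "t0 + ?h" t0 "\<lambda>t. f t x" "\<lambda>t. f' t x"] neg der[OF _ x] hd by (auto simp: abs_less_iff)
        moreover have "\<bar>f (t0 + ?h) x - f t0 x\<bar> = \<bar>f t0 x - f (t0 + ?h) x\<bar>" by simp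
        ultimately show ?thesis using B(2)[of z x] x hd neg
          by (simp add: abs_mult mult.commute mult_right_mono)
      qed
      then show "norm (?q n x) \<le> B x" using h0 by (simp add: abs_divide divide_le_eq)
    qed
  qed (use B meas it0 itn in auto)
  moreover have "(\<integral>x. ?q n x \<partial>M) = ((\<integral>x. f (t0 + X (n + N)) x \<partial>M) - (\<integral>x. f t0 x \<partial>M)) / X (n + N)" for n
    using it0 itn by simp
  ultimately have "(\<lambda>n. ((\<integral>x. f (t0 + X (n + N)) x \<partial>M) - (\<integral>x. f t0 x \<partial>M)) / X (n + N)) \<longlonglongrightarrow> (\<integral>x. f' t0 x \<partial>M)"
    by (simp only:)
  then show "(\<lambda>n. ((\<integral>x. f (t0 + X n) x \<partial>M) - (\<integral>x. f t0 x \<partial>M)) / X n) \<longlonglongrightarrow> (\<integral>x. f' t0 x \<partial>M)"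
    by (rule LIMSEQ_offset)
qed

lemma cip_scale_left: "cip J (\<lambda>j. of_real s * u j) y = s * cip J u y"
  by (simp add: cip_def sum_distrib_left right_diff_distrib distrib_left mult.assoc)

lemma csq_scale: "csq J (\<lambda>j. of_real s * u j) = s\<^sup>2 * csq J u"
  by (simp add: csq_def sum_distrib_left norm_mult power_mult_distrib)

lemma csq_nonneg[simp]: "0 \<le> csq J u"
  by (simp add: csq_def sum_nonneg)

lemma integrable_lik:
  assumes "finite J" shows "integrable (gam J) (lik J a)" "(\<integral>y. lik J a y \<partial>gam J) = 1"
proof -
  interpret g: prob_space "gam J" by (rule prob_space_gam)
  show "integrable (gam J) (lik J a)"
    using integrable_gam_shift[OF assms, of "\<lambda>_. 1::real" a] by simp
  show "(\<integral>y. lik J a y \<partial>gam J) = 1"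
    using integral_gam_shift[OF assms, of "\<lambda>_. 1::real" a] by (simp add: g.prob_space)
qed

text \<open>Up to a constant, the exponential of a linear functional is the likelihood ratio of a
  shift; \<open>k / 2\<close> compensates the factor 2 in \<open>lik\<close>.\<close>

lemma integrable_exp_cip:
  assumes "finite J" shows "integrable (gam J) (\<lambda>y. exp (k * cip J u y))"
proof -
  have "exp (k * cip J u y) = exp (csq J (\<lambda>j. of_real (k/2) * u j)) * lik J (\<lambda>j. of_real (k/2) * u j) y" for y
    by (simp only: lik_def cip_scale_left exp_add[symmetric]) simp
  then show ?thesis using integrable_lik[OF assms] by simp
qed

lemma integrable_exp_abs_cip:
  assumes "finite J" shows "integrable (gam J) (\<lambda>y. exp (k * \<bar>cip J u y\<bar>))"
proof (rule Bochner_Integration.integrable_bound)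
  show "integrable (gam J) (\<lambda>y. exp (k * cip J u y) + exp ((- k) * cip J u y))"
    by (intro Bochner_Integration.integrable_add integrable_exp_cip assms)
  show "AE y in gam J. norm (exp (k * \<bar>cip J u y\<bar>)) \<le> norm (exp (k * cip J u y) + exp (- k * cip J u y))"
    unfolding real_norm_def abs_of_pos[OF add_pos_pos[OF exp_gt_zero exp_gt_zero]]
    by (intro AE_I2) (simp add: abs_if)
qed measurable

lemma integrable_abs_cip:
  assumes "finite J" shows "integrable (gam J) (\<lambda>y. \<bar>cip J u y\<bar>)"
proof (rule Bochner_Integration.integrable_bound[OF integrable_exp_abs_cip[OF assms, of 1 u]])
  show "AE y in gam J. norm \<bar>cip J u y\<bar> \<le> norm (exp (1 * \<bar>cip J u y\<bar>))"
    using exp_ge_add_one_self by (intro AE_I2) (smt (verit) exp_gt_zero mult_1 real_norm_def)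
qed measurable

lemma integrable_bounded_gam:
  assumes "g \<in> borel_measurable (gam J)" "\<And>y. y \<in> space (gam J) \<Longrightarrow> norm (g y) \<le> B"
  shows "integrable (gam J) (g :: _ \<Rightarrow> 'b :: {banach, second_countable_topology})"
proof -
  interpret g: prob_space "gam J" by (rule prob_space_gam)
  show ?thesis using assms by (intro g.integrable_const_bound[where B=B]) (auto intro: AE_I2)
qed

lemma shift_zero: "y \<in> space (gam J) \<Longrightarrow> (\<lambda>j\<in>J. y j + 0) = y"
  by (auto simp: space_gam PiE_def extensional_def)

text \<open>The mean of \<open>g\<close> over the noise shifted by \<open>s * u\<close> is
  differentiated at \<open>s = 0\<close> in two ways: inside \<open>g\<close>, which gives
  \<open>g'\<close>, and after the shift has been moved into the likelihood ratio, which gives the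
  factor \<open>2 * cip J u y\<close>. The parameter is real, so \<open>u\<close> and \<i> u yield
  separate identities; the factor 2 reflects the variance 1/2 of each real coordinate.\<close>

lemma gaussian_stein:
  fixes g g' :: "('j \<Rightarrow> complex) \<Rightarrow> real"
  assumes fin: "finite J" and m[measurable]: "g \<in> borel_measurable (gam J)" "g' \<in> borel_measurable (gam J)"
    and b: "\<And>y. y \<in> space (gam J) \<Longrightarrow> \<bar>g y\<bar> \<le> B" "\<And>y. y \<in> space (gam J) \<Longrightarrow> \<bar>g' y\<bar> \<le> B'"
    and der: "\<And>y s. y \<in> space (gam J) \<Longrightarrow>
      ((\<lambda>s. g (\<lambda>j\<in>J. y j + of_real s * u j)) has_real_derivative g' (\<lambda>j\<in>J. y j + of_real s * u j)) (at s)"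
  shows "2 * (\<integral>y. g y * cip J u y \<partial>gam J) = (\<integral>y. g' y \<partial>gam J)"
proof -
  interpret g: prob_space "gam J" by (rule prob_space_gam)
  have sp: "(\<lambda>j\<in>J. y j + a j) \<in> space (gam J)" for y a by (simp add: space_gam)
  have sm[measurable]: "(\<lambda>y. g (\<lambda>j\<in>J. y j + a j)) \<in> borel_measurable (gam J)"
     "(\<lambda>y. g' (\<lambda>j\<in>J. y j + a j)) \<in> borel_measurable (gam J)" for a
    by (rule measurable_compose[OF measurable_shift]; measurable)+
  let ?q = "csq J u"
  have B0: "0 \<le> B" using b(1)[OF sp[of undefined undefined]] by linarith
  have 1: "((\<lambda>s. \<integral>y. g (\<lambda>j\<in>J. y j + of_real s * u j) \<partial>gam J) has_real_derivative
     (\<integral>y. g' (\<lambda>j\<in>J. y j + of_real 0 * u j) \<partial>gam J)) (at 0)"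
    by (rule has_real_derivative_integral[where d=1 and B="\<lambda>_. B'"
          and f' = "\<lambda>s y. g' (\<lambda>j\<in>J. y j + of_real s * u j)"])
      (auto intro!: der b sp integrable_bounded_gam[where B=B])
  let ?L = "\<lambda>s y. exp (2 * s * cip J u y - s\<^sup>2 * ?q) * g y"
  let ?L' = "\<lambda>s y. exp (2 * s * cip J u y - s\<^sup>2 * ?q) * (2 * cip J u y - 2 * s * ?q) * g y"
  have bnd: "exp (2 * s * cip J u y - s\<^sup>2 * ?q) \<le> exp (2 * \<bar>cip J u y\<bar>)" if "\<bar>s\<bar> < 1" for s y
  proof -
    have "s * cip J u y \<le> \<bar>s\<bar> * \<bar>cip J u y\<bar>" by (metis abs_ge_self abs_mult)
    also have "\<dots> \<le> 1 * \<bar>cip J u y\<bar>" using that by (intro mult_right_mono) auto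
    finally have "2 * s * cip J u y \<le> 2 * \<bar>cip J u y\<bar>" by simp
    moreover have "0 \<le> s\<^sup>2 * ?q" by simp
    ultimately show ?thesis by (simp add: add_increasing2 algebra_simps)
  qed
  have 2: "((\<lambda>s. \<integral>y. ?L s y \<partial>gam J) has_real_derivative (\<integral>y. ?L' 0 y \<partial>gam J)) (at 0)"
  \<comment> \<open>One function has to dominate for all |s| < 1. The exponential contributes exp
    (2|c|) with c the inner product, and the linear factor 2|c| + 2q is absorbed into (1 + 2q) exp
    (2|c|).\<close>
  proof (rule has_real_derivative_integral[where d=1 and B="\<lambda>y. (1 + 2 * ?q) * exp (4 * \<bar>cip J u y\<bar>) * B"])
    show "((\<lambda>s. ?L s y) has_real_derivative ?L' s y) (at s)" for s y
      by (auto intro!: derivative_eq_intros)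
    show "integrable (gam J) (?L s)" if "\<bar>s - 0\<bar> < 1" for s
    proof (rule Bochner_Integration.integrable_bound)
      show "integrable (gam J) (\<lambda>y. exp (2 * \<bar>cip J u y\<bar>) * B)"
        by (intro integrable_mult_left integrable_exp_abs_cip fin)
      show "AE y in gam J. norm (?L s y) \<le> norm (exp (2 * \<bar>cip J u y\<bar>) * B)"
        using bnd[of s] that b(1) B0 by (intro AE_I2) (auto simp: abs_mult intro!: mult_mono)
    qed measurable
    show "integrable (gam J) (\<lambda>y. (1 + 2 * ?q) * exp (4 * \<bar>cip J u y\<bar>) * B)"
      by (intro integrable_mult_left integrable_mult_right integrable_exp_abs_cip fin)
    show "\<bar>?L' s y\<bar> \<le> (1 + 2 * ?q) * exp (4 * \<bar>cip J u y\<bar>) * B" if s: "\<bar>s - 0\<bar> < 1" and y: "y \<in> space (gam J)" for s y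
    proof -
      let ?c = "\<bar>cip J u y\<bar>"
      have "\<bar>2 * cip J u y - 2 * s * ?q\<bar> \<le> 2 * ?c + 2 * ?q"
      proof -
        have "\<bar>s * ?q\<bar> \<le> 1 * ?q" unfolding abs_mult using s by (intro mult_mono) auto
        then show ?thesis by (simp add: mult.assoc)
      qed
      also have "\<dots> \<le> exp (2 * ?c) + 2 * ?q * exp (2 * ?c)"
        using exp_ge_add_one_self[of "2 * ?c"] mult_left_mono[of 1 "exp (2 * ?c)" "2 * ?q"]
        by (smt (verit) csq_nonneg abs_ge_zero mult.right_neutral one_le_exp_iff)
      finally have "\<bar>2 * cip J u y - 2 * s * ?q\<bar> \<le> (1 + 2 * ?q) * exp (2 * ?c)" by (simp add: algebra_simps)
      then have "exp (2 * s * cip J u y - s\<^sup>2 * ?q) * \<bar>2 * cip J u y - 2 * s * ?q\<bar> * \<bar>g y\<bar>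
         \<le> exp (2 * ?c) * ((1 + 2 * ?q) * exp (2 * ?c)) * B"
        using bnd[of s y] s b(1)[OF y] by (intro mult_mono) auto
      also have "\<dots> = (1 + 2 * ?q) * (exp (2 * ?c) * exp (2 * ?c)) * B" by simp
      also have "exp (2 * ?c) * exp (2 * ?c) = exp (4 * ?c)" by (simp add: exp_add[symmetric])
      finally show ?thesis by (simp add: abs_mult)
    qed
  qed (auto simp: zero_less_one)
  have eq: "(\<integral>y. g (\<lambda>j\<in>J. y j + of_real s * u j) \<partial>gam J) = (\<integral>y. ?L s y \<partial>gam J)" for s
    using integral_gam_shift[OF fin m(1), of "\<lambda>j. of_real s * u j"]
    by (simp add: lik_def cip_scale_left csq_scale mult.assoc)
  have "(\<integral>y. g' (\<lambda>j\<in>J. y j + of_real 0 * u j) \<partial>gam J) = (\<integral>y. ?L' 0 y \<partial>gam J)"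
    using DERIV_unique[OF 1] 2 unfolding eq by blast
  moreover have "(\<integral>y. g' (\<lambda>j\<in>J. y j + of_real 0 * u j) \<partial>gam J) = (\<integral>y. g' y \<partial>gam J)"
    using shift_zero[of _ J] by (intro Bochner_Integration.integral_cong) auto
  moreover have "(\<integral>y. ?L' 0 y \<partial>gam J) = 2 * (\<integral>y. g y * cip J u y \<partial>gam J)"
    by (subst integral_mult_right_zero[symmetric]) (simp add: mult_ac)
  ultimately show ?thesis by simp
qed

text \<open>Divided by its norm, the row \<open>r\<close> is a coisometry onto one coordinate, so
  the form is distributed like a multiple of a single standard complex Gaussian. The zero row cannot
  be normalised and is treated apart.\<close>

lemma cmod2_lin_form:
  assumes fin: "finite J"
  shows "integrable (gam J) (\<lambda>y. (cmod (\<Sum>j\<in>J. r j * y j))\<^sup>2)"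
    and "(\<integral>y. (cmod (\<Sum>j\<in>J. r j * y j))\<^sup>2 \<partial>gam J) = csq J r"
proof -
  have m: "(\<lambda>y. (cmod (\<Sum>j\<in>J. r j * y j))\<^sup>2) \<in> borel_measurable (gam J)" by measurable
  have "(\<integral>\<^sup>+y. ennreal ((cmod (\<Sum>j\<in>J. r j * y j))\<^sup>2) \<partial>gam J) = ennreal (csq J r)"
  proof (cases "csq J r = 0")
    case True
    then have "\<forall>j\<in>J. r j = 0" using fin by (auto simp: csq_def sum_nonneg_eq_0_iff)
    then show ?thesis using True by simp
  next
    case False
    define c where "c = sqrt (csq J r)"
    have c: "c > 0" "c\<^sup>2 = csq J r" using False csq_nonneg[of J r] by (auto simp: c_def less_le)
    define T where "T = (\<lambda>(_::unit) j. r j / of_real c)"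
    have "(\<Sum>j\<in>J. r j / complex_of_real c * cnj (r j / complex_of_real c)) = (\<Sum>j\<in>J. of_real ((cmod (r j))\<^sup>2)) / (of_real c)\<^sup>2"
      unfolding sum_divide_distrib by (intro sum.cong refl) (simp add: complex_norm_square power2_eq_square[of "of_real c"] del: of_real_power)
    also have "\<dots> = 1" using False c by (simp add: csq_def flip: of_real_power of_real_sum)
    finally have co: "coisom J {()} T" by (simp add: coisom_def T_def)
    have lin: "(\<Sum>j\<in>J. r j * y j) = of_real c * lin J {()} T y ()" for y
      using c by (simp add: lin_def T_def sum_distrib_left)
    have "(\<integral>\<^sup>+y. ennreal ((cmod (\<Sum>j\<in>J. r j * y j))\<^sup>2) \<partial>gam J)
        = (\<integral>\<^sup>+y. ennreal (c\<^sup>2) * ennreal ((cmod (lin J {()} T y ()))\<^sup>2) \<partial>gam J)"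
      unfolding lin using c by (simp add: norm_mult power_mult_distrib ennreal_mult')
    also have "\<dots> = (\<integral>\<^sup>+z. ennreal (c\<^sup>2) * ennreal ((cmod (z ()))\<^sup>2) \<partial>distr (gam J) (gam {()}) (lin J {()} T))"
      by (subst nn_integral_distr) auto
    also have "\<dots> = ennreal (c\<^sup>2) * (\<integral>\<^sup>+z. ennreal ((cmod (z ()))\<^sup>2) \<partial>gam {()})"
      unfolding distr_gam_lin[OF fin _ co, simplified] by (rule nn_integral_cmult) measurable
    also have "(\<integral>\<^sup>+z. ennreal ((cmod (z ()))\<^sup>2) \<partial>gam {()}) = 1"
      by (subst product_sigma_finite.product_nn_integral_singleton[OF product_sigma_finite_cgauss])
        (auto simp: nn_integral_cmod2_cgauss)
    finally show ?thesis using c by simp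
  qed
  then show "integrable (gam J) (\<lambda>y. (cmod (\<Sum>j\<in>J. r j * y j))\<^sup>2)"
    and "(\<integral>y. (cmod (\<Sum>j\<in>J. r j * y j))\<^sup>2 \<partial>gam J) = csq J r"
    using m by (auto intro!: integrableI_nn_integral_finite integral_eq_nn_integral[THEN trans])
qed

section \<open>Information and estimation error\<close>

text \<open>Let \<open>X\<close> be uniform on \<open>W\<close> and \<open>Y = a X + y\<close> with standard Gaussian noise \<open>y\<close>.
  Given \<open>X = w\<close>, \<open>llr J a w v y\<close> is the log-likelihood ratio of \<open>v\<close> against \<open>w\<close> and
  \<open>pwt W J a w v y\<close> the posterior probability of \<open>v\<close>; \<open>iota W J a\<close> is the mutual information of
  \<open>X\<close> and \<open>Y\<close> (in nats), and \<open>mse W J a \<xi>\<close> the minimum mean square error of estimating \<open>\<xi> X\<close>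
  from \<open>Y\<close>. All are written as functions of the noise, so that \<open>a\<close> can be varied under the integral.\<close>

definition llr :: "'j set \<Rightarrow> ('w \<Rightarrow> 'j \<Rightarrow> complex) \<Rightarrow> 'w \<Rightarrow> 'w \<Rightarrow> ('j \<Rightarrow> complex) \<Rightarrow> real" where
  "llr J a w v y = - csq J (\<lambda>j. a w j - a v j) - 2 * cip J (\<lambda>j. a w j - a v j) y"

definition iota :: "'w set \<Rightarrow> 'j set \<Rightarrow> ('w \<Rightarrow> 'j \<Rightarrow> complex) \<Rightarrow> real" where
  "iota W J a = - (\<Sum>w\<in>W. \<integral>y. ln ((\<Sum>v\<in>W. exp (llr J a w v y)) / card W) \<partial>gam J) / card W"

definition pwt :: "'w set \<Rightarrow> 'j set \<Rightarrow> ('w \<Rightarrow> 'j \<Rightarrow> complex) \<Rightarrow> 'w \<Rightarrow> 'w \<Rightarrow> ('j \<Rightarrow> complex) \<Rightarrow> real" where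
  "pwt W J a w v y = exp (llr J a w v y) / (\<Sum>x\<in>W. exp (llr J a w x y))"

definition mse :: "'w set \<Rightarrow> 'j set \<Rightarrow> ('w \<Rightarrow> 'j \<Rightarrow> complex) \<Rightarrow> ('w \<Rightarrow> complex) \<Rightarrow> real" where
  "mse W J a \<xi> = (\<Sum>w\<in>W. \<integral>y. (cmod (\<Sum>v\<in>W. complex_of_real (pwt W J a w v y) * (\<xi> w - \<xi> v)))\<^sup>2 \<partial>gam J) / card W"

lemma measurable_llr[measurable]: "llr J a w v \<in> borel_measurable (gam J)"
  unfolding llr_def by measurable

lemma measurable_pwt[measurable]: "pwt W J a w v \<in> borel_measurable (gam J)"
  unfolding pwt_def by measurable

lemma sum_exp_pos: "finite W \<Longrightarrow> W \<noteq> {} \<Longrightarrow> 0 < (\<Sum>v\<in>W. exp (f v :: real))"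
  by (rule sum_pos) auto

lemma pwt_nonneg: "finite W \<Longrightarrow> W \<noteq> {} \<Longrightarrow> 0 \<le> pwt W J a w v y"
  unfolding pwt_def by (intro divide_nonneg_nonneg sum_nonneg) auto

lemma pwt_sum: "finite W \<Longrightarrow> W \<noteq> {} \<Longrightarrow> (\<Sum>v\<in>W. pwt W J a w v y) = 1"
  unfolding pwt_def sum_divide_distrib[symmetric] using sum_exp_pos[of W] by (simp add: less_imp_neq[symmetric])

lemma pwt_le1: "finite W \<Longrightarrow> v \<in> W \<Longrightarrow> pwt W J a w v y \<le> 1"
  using member_le_sum[of v W "\<lambda>v. pwt W J a w v y"] pwt_sum[of W J a w y] pwt_nonneg[of W J a w _ y]
  by (metis DiffD1 empty_iff)

lemma weighted_abs_le:
  fixes p f :: "'w \<Rightarrow> real"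
  assumes "finite W" "\<And>v. v \<in> W \<Longrightarrow> 0 \<le> p v" "(\<Sum>v\<in>W. p v) = 1" "\<And>v. v \<in> W \<Longrightarrow> \<bar>f v\<bar> \<le> B"
  shows "\<bar>\<Sum>v\<in>W. p v * f v\<bar> \<le> B"
proof -
  have "\<bar>\<Sum>v\<in>W. p v * f v\<bar> \<le> (\<Sum>v\<in>W. \<bar>p v * f v\<bar>)" by (rule sum_abs)
  also have "\<dots> \<le> (\<Sum>v\<in>W. p v * B)"
    using assms by (intro sum_mono) (auto simp: abs_mult intro: mult_left_mono)
  also have "\<dots> = B" using assms by (simp add: sum_distrib_right[symmetric])
  finally show ?thesis .
qed

text \<open>A log-mean-exp lies between the extremes of its exponents. Thus the integrand of
  \<open>iota\<close> grows at most linearly in the noise, and \<open>iota\<close> is a convergent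
  integral.\<close>

lemma abs_ln_mean_exp_le:
  fixes f :: "'w \<Rightarrow> real"
  assumes "finite W" "W \<noteq> {}" "\<And>v. v \<in> W \<Longrightarrow> \<bar>f v\<bar> \<le> B"
  shows "\<bar>ln ((\<Sum>v\<in>W. exp (f v)) / card W)\<bar> \<le> B"
proof -
  have c: "real (card W) > 0" using assms by (simp add: card_gt_0_iff)
  have "(\<Sum>v\<in>W. exp (f v)) \<le> (\<Sum>v\<in>W. exp B)" using assms(3) by (intro sum_mono) (auto simp: abs_le_iff)
  then have u: "(\<Sum>v\<in>W. exp (f v)) / card W \<le> exp B" using c by (simp add: divide_le_eq mult.commute)
  have "(\<Sum>v\<in>W. exp (- B)) \<le> (\<Sum>v\<in>W. exp (f v))"
  proof (intro sum_mono)
    fix v assume "v \<in> W" then show "exp (- B) \<le> exp (f v)" using assms(3)[of v] by simp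
  qed
  then have l: "exp (- B) \<le> (\<Sum>v\<in>W. exp (f v)) / card W" using c by (simp add: le_divide_eq mult.commute)
  have p: "0 < (\<Sum>v\<in>W. exp (f v)) / card W" using sum_exp_pos[OF assms(1,2)] c by simp
  have "ln ((\<Sum>v\<in>W. exp (f v)) / card W) \<le> B" using u p by (metis ln_le_cancel_iff exp_gt_zero ln_exp)
  moreover have "- B \<le> ln ((\<Sum>v\<in>W. exp (f v)) / card W)" using l p by (metis ln_le_cancel_iff exp_gt_zero ln_exp)
  ultimately show ?thesis by (simp add: abs_le_iff)
qed

text \<open>A sum over all alternatives rather than a maximum, so that integrability follows by
  linearity.\<close>

definition llr_bound :: "'w set \<Rightarrow> 'j set \<Rightarrow> ('w \<Rightarrow> 'j \<Rightarrow> complex) \<Rightarrow> 'w \<Rightarrow> ('j \<Rightarrow> complex) \<Rightarrow> real" where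
  "llr_bound W J a w y = (\<Sum>v\<in>W. csq J (\<lambda>j. a w j - a v j) + 2 * \<bar>cip J (\<lambda>j. a w j - a v j) y\<bar>)"

lemma llr_bound:
  assumes "finite W" "v \<in> W" shows "\<bar>llr J a w v y\<bar> \<le> llr_bound W J a w y"
proof -
  have "\<bar>llr J a w v y\<bar> \<le> csq J (\<lambda>j. a w j - a v j) + 2 * \<bar>cip J (\<lambda>j. a w j - a v j) y\<bar>"
    using csq_nonneg[of J "\<lambda>j. a w j - a v j"] unfolding llr_def by linarith
  also have "\<dots> \<le> llr_bound W J a w y"
    unfolding llr_bound_def using assms by (intro member_le_sum) auto
  finally show ?thesis .
qed

lemma integrable_llr_bound:
  assumes "finite J" shows "integrable (gam J) (llr_bound W J a w)"
proof -
  interpret g: prob_space "gam J" by (rule prob_space_gam)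
  show ?thesis unfolding llr_bound_def using integrable_abs_cip[OF assms]
    by (intro Bochner_Integration.integrable_sum Bochner_Integration.integrable_add integrable_mult_right) auto
qed

lemma integrable_lse:
  assumes "finite J" "finite W" "W \<noteq> {}"
  shows "integrable (gam J) (\<lambda>y. ln ((\<Sum>v\<in>W. exp (llr J a w v y)) / card W))"
proof (rule Bochner_Integration.integrable_bound[OF integrable_llr_bound[OF assms(1), of W a w]])
  show "AE y in gam J. norm (ln ((\<Sum>v\<in>W. exp (llr J a w v y)) / card W)) \<le> norm (llr_bound W J a w y)"
    using abs_ln_mean_exp_le[OF assms(2,3) llr_bound[OF assms(2)], of "\<lambda>v. v" J a w]
    by (intro AE_I2) (auto intro: order_trans[OF _ abs_ge_self])
qed measurable

section \<open>The derivative of the information with respect to the signal\<close>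

lemma DERIV_softmax:
  assumes fin: "finite W" "W \<noteq> {}" and v: "v \<in> W"
    and d: "\<And>x. x \<in> W \<Longrightarrow> ((\<lambda>s. h x s) has_real_derivative h' x) (at s)"
  shows "((\<lambda>s. exp (h v s) / (\<Sum>x\<in>W. exp (h x s))) has_real_derivative
     (exp (h v s) / (\<Sum>x\<in>W. exp (h x s))) * (h' v - (\<Sum>x\<in>W. (exp (h x s) / (\<Sum>x\<in>W. exp (h x s))) * h' x))) (at s)"
proof -
  let ?Z = "\<Sum>x\<in>W. exp (h x s)"
  have Z: "?Z \<noteq> 0" using sum_exp_pos[OF fin, of "\<lambda>x. h x s"] by linarith
  have dZ: "((\<lambda>s. \<Sum>x\<in>W. exp (h x s)) has_real_derivative (\<Sum>x\<in>W. exp (h x s) * h' x)) (at s)"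
    by (intro DERIV_sum derivative_intros d)
  have "((\<lambda>s. exp (h v s) / (\<Sum>x\<in>W. exp (h x s))) has_real_derivative
     ((exp (h v s) * h' v) * ?Z - exp (h v s) * (\<Sum>x\<in>W. exp (h x s) * h' x)) / (?Z * ?Z)) (at s)"
    by (intro DERIV_divide dZ Z derivative_intros d v)
  moreover have "((exp (h v s) * h' v) * ?Z - exp (h v s) * (\<Sum>x\<in>W. exp (h x s) * h' x)) / (?Z * ?Z)
    = (exp (h v s) / ?Z) * (h' v - (\<Sum>x\<in>W. (exp (h x s) / ?Z) * h' x))"
  proof -
    have "(\<Sum>x\<in>W. (exp (h x s) / ?Z) * h' x) = (\<Sum>x\<in>W. exp (h x s) * h' x) / ?Z"
      by (simp add: sum_divide_distrib)
    then show ?thesis using Z by (simp add: field_simps)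
  qed
  ultimately show ?thesis by simp
qed

lemma cip_shift_right: "cip J b (\<lambda>j\<in>J. y j + of_real s * u j) = cip J b y + s * cip J b u"
  by (simp add: cip_def sum.distrib sum_distrib_left algebra_simps)

text \<open>Integration by parts for a posterior weight as a function of the noise. A softmax weight
  has as derivative itself times the deviation of its slope from the posterior mean of the slopes,
  so a product of a weight with the noise becomes a combination of products of weights.\<close>

lemma stein_pwt:
  assumes fin: "finite J" "finite W" "W \<noteq> {}" and v: "v \<in> W"
  shows "2 * (\<integral>y. pwt W J a w v y * cip J u y \<partial>gam J) =
    (\<integral>y. pwt W J a w v y * (2 * (\<Sum>x\<in>W. pwt W J a w x y * cip J (\<lambda>j. a w j - a x j) u)
        - 2 * cip J (\<lambda>j. a w j - a v j) u) \<partial>gam J)"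
proof (rule gaussian_stein[where B=1 and B'="4 * (\<Sum>x\<in>W. \<bar>cip J (\<lambda>j. a w j - a x j) u\<bar>)"])
  let ?D = "\<lambda>x. cip J (\<lambda>j. a w j - a x j) u"
  have D: "\<bar>?D x\<bar> \<le> (\<Sum>x\<in>W. \<bar>?D x\<bar>)" if "x \<in> W" for x
    using fin that by (intro member_le_sum) auto
  show "\<bar>pwt W J a w v y\<bar> \<le> 1" for y
    using pwt_nonneg[OF fin(2,3), of J a w v y] pwt_le1[OF fin(2) v, of J a w y] by simp
  show "\<bar>pwt W J a w v y * (2 * (\<Sum>x\<in>W. pwt W J a w x y * ?D x) - 2 * ?D v)\<bar> \<le> 4 * (\<Sum>x\<in>W. \<bar>?D x\<bar>)" for y
  proof -
    have "\<bar>\<Sum>x\<in>W. pwt W J a w x y * ?D x\<bar> \<le> (\<Sum>x\<in>W. \<bar>?D x\<bar>)"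
      using pwt_nonneg[OF fin(2,3)] pwt_sum[OF fin(2,3)] D by (intro weighted_abs_le fin) auto
    then have "\<bar>2 * (\<Sum>x\<in>W. pwt W J a w x y * ?D x) - 2 * ?D v\<bar> \<le> 4 * (\<Sum>x\<in>W. \<bar>?D x\<bar>)"
      using D[OF v] by linarith
    then show ?thesis
      using pwt_nonneg[OF fin(2,3), of J a w v y] pwt_le1[OF fin(2) v, of J a w y] mult_mono[of "\<bar>pwt W J a w v y\<bar>" 1]
      unfolding abs_mult by fastforce
  qed
  show "((\<lambda>s. pwt W J a w v (\<lambda>j\<in>J. y j + complex_of_real s * u j)) has_real_derivative
         pwt W J a w v (\<lambda>j\<in>J. y j + complex_of_real s * u j) *
         (2 * (\<Sum>x\<in>W. pwt W J a w x (\<lambda>j\<in>J. y j + complex_of_real s * u j) * ?D x) - 2 * ?D v)) (at s)" for y s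
  proof -
    let ?h = "\<lambda>x s. llr J a w x (\<lambda>j\<in>J. y j + complex_of_real s * u j)"
    have "((\<lambda>s. ?h x s) has_real_derivative (- 2 * ?D x)) (at s)" for x
      unfolding llr_def cip_shift_right by (auto intro!: derivative_eq_intros)
    from DERIV_softmax[OF fin(2,3) v, of ?h "\<lambda>x. - 2 * ?D x" s, OF this]
    show ?thesis unfolding pwt_def
      by (rule back_subst[where P="\<lambda>d. (_ has_real_derivative d) _"])
        (simp add: sum_negf sum_distrib_left algebra_simps)
  qed
qed (use fin in measurable)

lemma cip_sum_left: "cip J (\<lambda>j. \<Sum>x\<in>W. of_real (p x) * b x j) u = (\<Sum>x\<in>W. p x * cip J (b x) u)"
proof -
  have "cip J (\<lambda>j. \<Sum>x\<in>W. of_real (p x) * b x j) u = (\<Sum>j\<in>J. \<Sum>x\<in>W. p x * Re (b x j * cnj (u j)))"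
    unfolding cip_def sum_distrib_right mult.assoc Re_sum
    by (intro sum.cong refl) (simp add: algebra_simps)
  also have "\<dots> = (\<Sum>x\<in>W. p x * cip J (b x) u)"
    unfolding cip_def sum_distrib_left by (rule sum.swap)
  finally show ?thesis .
qed

lemma has_real_derivative_csq:
  assumes "\<And>j. j \<in> J \<Longrightarrow> ((\<lambda>t. b t j) has_vector_derivative b' j) (at t)"
  shows "((\<lambda>t. csq J (b t)) has_real_derivative 2 * cip J (b t) b') (at t)"
proof -
  have "((\<lambda>t. (cmod (b t j))\<^sup>2) has_real_derivative 2 * Re (b t j * cnj (b' j))) (at t)" if "j \<in> J" for j
  proof -
    have R: "((\<lambda>t. Re (b t j)) has_real_derivative Re (b' j)) (at t)" "((\<lambda>t. Im (b t j)) has_real_derivative Im (b' j)) (at t)"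
      using assms[OF that] by (auto simp: has_real_derivative_iff_has_vector_derivative
          intro: bounded_linear.has_vector_derivative[OF bounded_linear_Re] bounded_linear.has_vector_derivative[OF bounded_linear_Im])
    show ?thesis unfolding cmod_power2
      by (rule derivative_eq_intros R refl)+ (simp add: algebra_simps)
  qed
  then show ?thesis unfolding csq_def cip_def sum_distrib_left by (intro DERIV_sum) auto
qed

lemma has_real_derivative_cip:
  assumes "\<And>j. j \<in> J \<Longrightarrow> ((\<lambda>t. b t j) has_vector_derivative b' j) (at t)"
  shows "((\<lambda>t. cip J (b t) y) has_real_derivative cip J b' y) (at t)"
proof -
  have "((\<lambda>t. Re (b t j * cnj (y j))) has_real_derivative Re (b' j * cnj (y j))) (at t)" if "j \<in> J" for j
    unfolding has_real_derivative_iff_has_vector_derivative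
    by (intro bounded_linear.has_vector_derivative[OF bounded_linear_Re]
       bounded_linear.has_vector_derivative[OF bounded_linear_mult_left] assms that)
  then show ?thesis unfolding cip_def by (intro DERIV_sum) auto
qed

text \<open>The relation between information and mean square error: the derivative is twice the mean
  inner product of the posterior error of the signal with the posterior error of its velocity. The
  log-likelihood ratio contributes a deterministic term and a term linear in the noise; integration
  by parts in the latter cancels the former and leaves a quadratic expression in the posterior
  weights.\<close>

lemma has_real_derivative_iota:
  fixes a a' :: "real \<Rightarrow> 'w \<Rightarrow> 'j \<Rightarrow> complex"
  assumes fin: "finite J" "finite W" "W \<noteq> {}" and d: "0 < d"
    and der: "\<And>t w j. \<bar>t - t0\<bar> < d \<Longrightarrow> w \<in> W \<Longrightarrow> j \<in> J \<Longrightarrow> ((\<lambda>t. a t w j) has_vector_derivative a' t w j) (at t)"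
    and ba: "\<And>t w j. \<bar>t - t0\<bar> < d \<Longrightarrow> w \<in> W \<Longrightarrow> j \<in> J \<Longrightarrow> cmod (a t w j) \<le> B"
    and ba': "\<And>t w j. \<bar>t - t0\<bar> < d \<Longrightarrow> w \<in> W \<Longrightarrow> j \<in> J \<Longrightarrow> cmod (a' t w j) \<le> B"
  shows "((\<lambda>t. iota W J (a t)) has_real_derivative
     (\<Sum>w\<in>W. \<integral>y. 2 * cip J (\<lambda>j. \<Sum>v\<in>W. pwt W J (a t0) w v y * (a t0 w j - a t0 v j))
                      (\<lambda>j. \<Sum>v\<in>W. pwt W J (a t0) w v y * (a' t0 w j - a' t0 v j)) \<partial>gam J) / card W) (at t0)"
proof -
  interpret g: prob_space "gam J" by (rule prob_space_gam)
  define b where "b t w v j = a t w j - a t v j" for t w v j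
  define b' where "b' t w v j = a' t w j - a' t v j" for t w v j
  \<comment> \<open>For empty \<open>J\<close> the bounds say nothing about \<open>B\<close>, so its
    sign is available only when \<open>J\<close> has an element.\<close>
  have B0: "0 \<le> B" if Jne: "J \<noteq> {}"
  proof -
    obtain j where j: "j \<in> J" using Jne by blast
    obtain w where w: "w \<in> W" using fin by blast
    show ?thesis using ba[of t0 w j] d j w norm_ge_zero[of "a t0 w j"] by (smt (verit))
  qed
  have bd: "((\<lambda>t. b t w v j) has_vector_derivative b' t w v j) (at t)"
    if "\<bar>t - t0\<bar> < d" "w \<in> W" "v \<in> W" "j \<in> J" for t w v j
    unfolding b_def b'_def using der that by (intro derivative_intros) auto
  have bb: "cmod (b t w v j) \<le> 2 * B" "cmod (b' t w v j) \<le> 2 * B"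
    if "\<bar>t - t0\<bar> < d" "w \<in> W" "v \<in> W" "j \<in> J" for t w v j
  proof -
    show "cmod (b t w v j) \<le> 2 * B" using norm_triangle_ineq4[of "a t w j" "a t v j"] ba[of t w j] ba[of t v j] that
      by (simp add: b_def)
    show "cmod (b' t w v j) \<le> 2 * B" using norm_triangle_ineq4[of "a' t w j" "a' t v j"] ba'[of t w j] ba'[of t v j] that
      by (simp add: b'_def)
  qed
  define dl where "dl t w v y = - 2 * cip J (b t w v) (b' t w v) - 2 * cip J (b' t w v) y" for t w v y
  have llr: "llr J (a t) w v y = - csq J (b t w v) - 2 * cip J (b t w v) y" for t w v y
    by (simp add: llr_def b_def[abs_def])
  have dllr: "((\<lambda>t. llr J (a t) w v y) has_real_derivative dl t w v y) (at t)"
    if "\<bar>t - t0\<bar> < d" "w \<in> W" "v \<in> W" for t w v y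
  proof -
    have 1: "((\<lambda>t. csq J (b t w v)) has_real_derivative 2 * cip J (b t w v) (b' t w v)) (at t)"
      using bd that by (intro has_real_derivative_csq) auto
    have 2: "((\<lambda>t. cip J (b t w v) y) has_real_derivative cip J (b' t w v) y) (at t)"
      using bd that by (intro has_real_derivative_cip) auto
    show ?thesis unfolding llr dl_def by (rule derivative_eq_intros 1 2 refl)+ simp
  qed
  \<comment> \<open>A domination independent of \<open>t\<close>, although the direction
    \<open>b' t w v\<close> moves with \<open>t\<close>: the noise enters through its real and
    imaginary coordinates, written as inner products with 1 and \<i> at position \<open>j\<close>,
    whose integrability is known.\<close>
  define DB where "DB y = (\<Sum>j\<in>J. 8 * B * B + 4 * B * (\<bar>cip J (\<lambda>i. if i = j then 1 else 0) y\<bar> + \<bar>cip J (\<lambda>i. if i = j then \<i> else 0) y\<bar>))" for y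
  have DBi: "integrable (gam J) DB"
    unfolding DB_def by (intro Bochner_Integration.integrable_sum Bochner_Integration.integrable_add integrable_mult_right
         integrable_abs_cip fin) auto
  have dlb: "\<bar>dl t w v y\<bar> \<le> DB y" if "\<bar>t - t0\<bar> < d" "w \<in> W" "v \<in> W" for t w v y
  proof -
    have e: "cip J (\<lambda>i. if i = j then 1 else 0) y = Re (y j)" "cip J (\<lambda>i. if i = j then \<i> else 0) y = Im (y j)" if "j \<in> J" for j
      using that fin by (simp_all add: cip_def if_distrib[where f="\<lambda>x. x * _"] if_distrib[where f=Re] sum.delta' cong: if_cong)
    have "dl t w v y = (\<Sum>j\<in>J. - 2 * Re (b t w v j * cnj (b' t w v j)) - 2 * Re (b' t w v j * cnj (y j)))"
      by (simp add: dl_def cip_def sum_subtractf sum_distrib_left sum_negf)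
    also have "\<bar>\<dots>\<bar> \<le> (\<Sum>j\<in>J. \<bar>- 2 * Re (b t w v j * cnj (b' t w v j)) - 2 * Re (b' t w v j * cnj (y j))\<bar>)"
      by (rule sum_abs)
    also have "\<dots> \<le> DB y" unfolding DB_def
    proof (intro sum_mono)
      fix j assume j: "j \<in> J"
      have B: "0 \<le> B" using B0 j by auto
      have 1: "\<bar>Re (b t w v j * cnj (b' t w v j))\<bar> \<le> (2 * B) * (2 * B)"
        using abs_Re_le_cmod[of "b t w v j * cnj (b' t w v j)"] mult_mono[OF bb(1) bb(2), of t w v j t w v j] that j B
        by (simp add: norm_mult)
      have 2: "\<bar>Re (b' t w v j * cnj (y j))\<bar> \<le> 2 * B * cmod (y j)"
        using abs_Re_le_cmod[of "b' t w v j * cnj (y j)"] mult_right_mono[OF bb(2), of t w v j "cmod (y j)"] that j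
        by (simp add: norm_mult)
      have 3: "2 * B * cmod (y j) \<le> 2 * B * (\<bar>Re (y j)\<bar> + \<bar>Im (y j)\<bar>)"
        using cmod_le[of "y j"] B by (intro mult_left_mono) auto
      show "\<bar>- 2 * Re (b t w v j * cnj (b' t w v j)) - 2 * Re (b' t w v j * cnj (y j))\<bar>
        \<le> 8 * B * B + 4 * B * (\<bar>cip J (\<lambda>i. if i = j then 1 else 0) y\<bar> + \<bar>cip J (\<lambda>i. if i = j then \<i> else 0) y\<bar>)"
        unfolding e[OF j] using 1 2 3 by (simp add: algebra_simps abs_le_iff)
    qed
    finally show ?thesis .
  qed
  let ?p = "\<lambda>t w v y. pwt W J (a t) w v y"
  have dlse: "((\<lambda>t. ln ((\<Sum>v\<in>W. exp (llr J (a t) w v y)) / card W)) has_real_derivative (\<Sum>v\<in>W. ?p t w v y * dl t w v y)) (at t)"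
    if "\<bar>t - t0\<bar> < d" "w \<in> W" for t w y
  proof -
    have Z: "0 < (\<Sum>v\<in>W. exp (llr J (a t) w v y))" by (rule sum_exp_pos[OF fin(2,3)])
    have c: "real (card W) > 0" using fin by (simp add: card_gt_0_iff)
    have "((\<lambda>t. \<Sum>v\<in>W. exp (llr J (a t) w v y)) has_real_derivative (\<Sum>v\<in>W. exp (llr J (a t) w v y) * dl t w v y)) (at t)"
      using dllr that by (intro DERIV_sum DERIV_fun_exp[THEN DERIV_cong]) auto
    then have "((\<lambda>t. ln ((\<Sum>v\<in>W. exp (llr J (a t) w v y)) / card W)) has_real_derivative
        (1 / ((\<Sum>v\<in>W. exp (llr J (a t) w v y)) / card W)) * ((\<Sum>v\<in>W. exp (llr J (a t) w v y) * dl t w v y) / card W)) (at t)"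
      using Z c
      by (intro DERIV_chain2[OF DERIV_ln_divide] DERIV_cdivide) auto
    then show ?thesis
      by (rule back_subst[where P="\<lambda>d. (_ has_real_derivative d) _"])
        (use c Z in \<open>simp add: pwt_def sum_divide_distrib sum_distrib_left field_simps\<close>)
  qed
  have main: "((\<lambda>t. \<integral>y. ln ((\<Sum>v\<in>W. exp (llr J (a t) w v y)) / card W) \<partial>gam J) has_real_derivative
      (\<integral>y. (\<Sum>v\<in>W. ?p t0 w v y * dl t0 w v y) \<partial>gam J)) (at t0)" if w: "w \<in> W" for w
  proof (rule has_real_derivative_integral[OF d])
    show "((\<lambda>t. ln ((\<Sum>v\<in>W. exp (llr J (a t) w v y)) / card W)) has_real_derivative (\<Sum>v\<in>W. ?p t w v y * dl t w v y)) (at t)"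
      if "\<bar>t - t0\<bar> < d" for t y by (rule dlse[OF that w])
    show "integrable (gam J) (\<lambda>y. ln ((\<Sum>v\<in>W. exp (llr J (a t) w v y)) / card W))" for t
      by (rule integrable_lse[OF fin])
    show "(\<lambda>y. \<Sum>v\<in>W. ?p t0 w v y * dl t0 w v y) \<in> borel_measurable (gam J)"
      unfolding dl_def by measurable
    show "integrable (gam J) DB" by (rule DBi)
    show "\<bar>\<Sum>v\<in>W. ?p t w v y * dl t w v y\<bar> \<le> DB y" if "\<bar>t - t0\<bar> < d" for t y
      using dlb that w by (intro weighted_abs_le fin pwt_nonneg pwt_sum) auto
  qed
  have val: "(\<integral>y. (\<Sum>v\<in>W. ?p t0 w v y * dl t0 w v y) \<partial>gam J)
     = - (\<integral>y. 2 * cip J (\<lambda>j. \<Sum>v\<in>W. ?p t0 w v y * (a t0 w j - a t0 v j))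
                      (\<lambda>j. \<Sum>v\<in>W. ?p t0 w v y * (a' t0 w j - a' t0 v j)) \<partial>gam J)" if w: "w \<in> W" for w
  proof -
    let ?q = "\<lambda>v y. ?p t0 w v y"
    have ip: "integrable (gam J) (\<lambda>y. ?q v y * c)" if "v \<in> W" for v c
      using pwt_nonneg[OF fin(2,3), of J] pwt_le1[OF fin(2) that, of J]
      by (intro integrable_mult_left integrable_bounded_gam[where B=1]) auto
    have ic: "integrable (gam J) (\<lambda>y. ?q v y * cip J u y)" if "v \<in> W" for v u
    proof (rule Bochner_Integration.integrable_bound[OF integrable_abs_cip[OF fin(1), of u]])
      show "AE y in gam J. norm (?q v y * cip J u y) \<le> norm \<bar>cip J u y\<bar>"
        using pwt_nonneg[OF fin(2,3), of J] pwt_le1[OF fin(2) that, of J]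
        by (intro AE_I2) (simp add: abs_mult mult_left_le_one_le)
    qed (use fin in measurable)
    let ?S = "\<lambda>v y. (\<Sum>x\<in>W. ?q x y * cip J (b t0 w x) (b' t0 w v))"
    have iqs: "integrable (gam J) (\<lambda>y. ?q v y * (2 * ?S v y))" if v: "v \<in> W" for v
    proof (rule integrable_bounded_gam[where B="2 * (\<Sum>x\<in>W. \<bar>cip J (b t0 w x) (b' t0 w v)\<bar>)"])
      fix y
      have "\<bar>?S v y\<bar> \<le> (\<Sum>x\<in>W. \<bar>cip J (b t0 w x) (b' t0 w v)\<bar>)"
        using fin by (intro weighted_abs_le pwt_nonneg pwt_sum member_le_sum) auto
      then have "\<bar>?q v y\<bar> * \<bar>2 * ?S v y\<bar> \<le> 1 * (2 * (\<Sum>x\<in>W. \<bar>cip J (b t0 w x) (b' t0 w v)\<bar>))"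
        using pwt_nonneg[OF fin(2,3), of J "a t0" w v y] pwt_le1[OF fin(2) v, of J "a t0" w y] by (intro mult_mono) auto
      then show "norm (?q v y * (2 * ?S v y)) \<le> 2 * (\<Sum>x\<in>W. \<bar>cip J (b t0 w x) (b' t0 w v)\<bar>)"
        by (simp add: abs_mult)
    qed measurable
    \<comment> \<open>The \<open>?C\<close> produced by integration by parts cancels the
      deterministic part of \<open>dl\<close>; only the double posterior average inside
      \<open>?S\<close> survives.\<close>
    have one: "(\<integral>y. ?q v y * dl t0 w v y \<partial>gam J) = - (\<integral>y. ?q v y * (2 * ?S v y) \<partial>gam J)" if v: "v \<in> W" for v
    proof -
      let ?C = "cip J (b t0 w v) (b' t0 w v)"
      have "(\<integral>y. ?q v y * dl t0 w v y \<partial>gam J) = (\<integral>y. ?q v y * (- 2 * ?C) - 2 * (?q v y * cip J (b' t0 w v) y) \<partial>gam J)"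
        by (intro Bochner_Integration.integral_cong refl) (simp add: dl_def algebra_simps)
      also have "\<dots> = (\<integral>y. ?q v y * (- 2 * ?C) \<partial>gam J) - 2 * (\<integral>y. ?q v y * cip J (b' t0 w v) y \<partial>gam J)"
        using ip[OF v] ic[OF v] by (subst Bochner_Integration.integral_diff) auto
      also have "2 * (\<integral>y. ?q v y * cip J (b' t0 w v) y \<partial>gam J) = (\<integral>y. ?q v y * (2 * ?S v y - 2 * ?C) \<partial>gam J)"
        using stein_pwt[OF fin v, of "a t0" w "b' t0 w v"] by (simp add: b_def[abs_def])
      also have "\<dots> = (\<integral>y. ?q v y * (2 * ?S v y) + ?q v y * (- 2 * ?C) \<partial>gam J)"
        by (intro Bochner_Integration.integral_cong refl) (simp add: algebra_simps)
      also have "\<dots> = (\<integral>y. ?q v y * (2 * ?S v y) \<partial>gam J) + (\<integral>y. ?q v y * (- 2 * ?C) \<partial>gam J)"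
        using ip[OF v] iqs[OF v] by (intro Bochner_Integration.integral_add) auto
      finally show ?thesis by simp
    qed
    have "(\<integral>y. (\<Sum>v\<in>W. ?q v y * dl t0 w v y) \<partial>gam J) = (\<Sum>v\<in>W. \<integral>y. ?q v y * dl t0 w v y \<partial>gam J)"
    proof (rule Bochner_Integration.integral_sum)
      fix v assume v: "v \<in> W"
      have "integrable (gam J) (\<lambda>y. ?q v y * (- 2 * cip J (b t0 w v) (b' t0 w v)) - 2 * (?q v y * cip J (b' t0 w v) y))"
        using ip[OF v] ic[OF v] by (intro Bochner_Integration.integrable_diff) auto
      then show "integrable (gam J) (\<lambda>y. ?q v y * dl t0 w v y)"
        by (rule back_subst[where P="integrable (gam J)"]) (auto simp: dl_def algebra_simps)
    qed
    also have "\<dots> = - (\<Sum>v\<in>W. \<integral>y. ?q v y * (2 * ?S v y) \<partial>gam J)"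
      using one by (simp add: sum_negf)
    also have "(\<Sum>v\<in>W. \<integral>y. ?q v y * (2 * ?S v y) \<partial>gam J) = (\<integral>y. (\<Sum>v\<in>W. ?q v y * (2 * ?S v y)) \<partial>gam J)"
      using iqs by (intro Bochner_Integration.integral_sum[symmetric]) auto
    also have "\<dots> = (\<integral>y. 2 * cip J (\<lambda>j. \<Sum>v\<in>W. ?q v y * (a t0 w j - a t0 v j))
                      (\<lambda>j. \<Sum>v\<in>W. ?q v y * (a' t0 w j - a' t0 v j)) \<partial>gam J)"
    proof (intro Bochner_Integration.integral_cong refl)
      fix y
      have "cip J (\<lambda>j. \<Sum>v\<in>W. ?q v y * (a t0 w j - a t0 v j)) (\<lambda>j. \<Sum>v\<in>W. ?q v y * (a' t0 w j - a' t0 v j))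
        = (\<Sum>v\<in>W. ?q v y * ?S v y)"
        unfolding b_def[symmetric] b'_def[symmetric]
        by (subst cip_commute, subst cip_sum_left, subst cip_commute, subst cip_sum_left) simp
      then show "(\<Sum>v\<in>W. ?q v y * (2 * ?S v y)) = 2 * cip J (\<lambda>j. \<Sum>v\<in>W. ?q v y * (a t0 w j - a t0 v j))
                      (\<lambda>j. \<Sum>v\<in>W. ?q v y * (a' t0 w j - a' t0 v j))"
        by (simp add: sum_distrib_left mult.left_commute)
    qed
    finally show ?thesis .
  qed
  have "((\<lambda>t. iota W J (a t)) has_real_derivative
     - (\<Sum>w\<in>W. \<integral>y. (\<Sum>v\<in>W. ?p t0 w v y * dl t0 w v y) \<partial>gam J) / card W) (at t0)"
    unfolding iota_def by (intro DERIV_cdivide DERIV_minus DERIV_sum main)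
  then show ?thesis by (simp add: val sum_negf)
qed

section \<open>Estimators as functions of the received signal, and degraded observations\<close>

definition mix :: "'w set \<Rightarrow> 'j set \<Rightarrow> ('w \<Rightarrow> 'j \<Rightarrow> complex) \<Rightarrow> ('j \<Rightarrow> complex) \<Rightarrow> real" where
  "mix W J a y = (\<Sum>v\<in>W. lik J (a v) y) / card W"

text \<open>The posterior mean computed from the received point alone. In contrast to
  \<open>pwt\<close>, whose argument is the noise under a given true input, this is a function that
  a receiver can evaluate.\<close>

definition est :: "'w set \<Rightarrow> 'j set \<Rightarrow> ('w \<Rightarrow> 'j \<Rightarrow> complex) \<Rightarrow> ('w \<Rightarrow> complex) \<Rightarrow> ('j \<Rightarrow> complex) \<Rightarrow> complex" where
  "est W J a \<xi> y = (\<Sum>v\<in>W. complex_of_real (lik J (a v) y) * \<xi> v) / complex_of_real (\<Sum>v\<in>W. lik J (a v) y)"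

lemma measurable_mix[measurable]: "mix W J a \<in> borel_measurable (gam J)"
  unfolding mix_def by measurable

lemma measurable_est[measurable]: "est W J a \<xi> \<in> borel_measurable (gam J)"
  unfolding est_def by measurable

lemma mix_pos: "finite W \<Longrightarrow> W \<noteq> {} \<Longrightarrow> 0 < mix W J a y"
  unfolding mix_def by (intro divide_pos_pos sum_pos) (auto simp: card_gt_0_iff)

text \<open>The passage from the noise \<open>y\<close> to the received signal
  \<open>y + a w\<close>. It makes \<open>pwt\<close> the posterior probability given by Bayes' rule
  for a uniform prior.\<close>

lemma exp_llr: "exp (llr J a w v y) = lik J (a v) (\<lambda>j\<in>J. y j + a w j) / lik J (a w) (\<lambda>j\<in>J. y j + a w j)"
proof -
  have d: "cip J (\<lambda>j. a w j - a v j) y = cip J (a w) y - cip J (a v) y"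
    unfolding cip_def sum_subtractf[symmetric] by (intro sum.cong refl) (simp add: algebra_simps)
  have c: "csq J (\<lambda>j. a w j - a v j) = csq J (a w) - 2 * cip J (a v) (a w) + csq J (a v)"
    unfolding csq_def cip_def sum_distrib_left sum_subtractf[symmetric] sum.distrib[symmetric] cmod_power2
    by (intro sum.cong refl) (simp add: power2_eq_square algebra_simps)
  show ?thesis unfolding lik_def llr_def d c exp_diff[symmetric] cip_add_right cip_self by (simp add: algebra_simps)
qed

lemma pwt_posterior:
  "pwt W J a w v y = lik J (a v) (\<lambda>j\<in>J. y j + a w j) / (\<Sum>x\<in>W. lik J (a x) (\<lambda>j\<in>J. y j + a w j))"
  using less_imp_neq[OF lik_pos[of J "a w" "\<lambda>j\<in>J. y j + a w j"]]
  unfolding pwt_def exp_llr sum_divide_distrib[symmetric] by simp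

lemma pwt_err:
  assumes "finite W" "W \<noteq> {}"
  shows "(\<Sum>v\<in>W. complex_of_real (pwt W J a w v y) * (\<xi> w - \<xi> v)) = \<xi> w - est W J a \<xi> (\<lambda>j\<in>J. y j + a w j)"
proof -
  have "(\<Sum>v\<in>W. complex_of_real (pwt W J a w v y) * (\<xi> w - \<xi> v)) =
    complex_of_real (\<Sum>v\<in>W. pwt W J a w v y) * \<xi> w - (\<Sum>v\<in>W. complex_of_real (pwt W J a w v y) * \<xi> v)"
    by (simp add: right_diff_distrib sum_subtractf sum_distrib_right)
  then show ?thesis
    unfolding pwt_sum[OF assms] by (simp add: pwt_posterior est_def sum_divide_distrib)
qed

lemma mse_est:
  assumes "finite W" "W \<noteq> {}"
  shows "mse W J a \<xi> = (\<Sum>w\<in>W. \<integral>y. (cmod (\<xi> w - est W J a \<xi> (\<lambda>j\<in>J. y j + a w j)))\<^sup>2 \<partial>gam J) / card W"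
  unfolding mse_def pwt_err[OF assms] ..

text \<open>The estimate is a convex combination of the values of \<open>\<xi>\<close>, so the error
  is bounded uniformly in the received signal, and every integral of a squared error
  converges.\<close>

lemma cmod_est_err_le:
  assumes "finite W" "w \<in> W"
  shows "cmod (\<xi> w - est W J a \<xi> y) \<le> (\<Sum>v\<in>W. cmod (\<xi> w - \<xi> v))"
proof -
  let ?S = "\<Sum>v\<in>W. lik J (a v) y"
  have S: "?S > 0" using assms by (intro sum_pos) auto
  have "\<xi> w - est W J a \<xi> y = (\<Sum>v\<in>W. complex_of_real (lik J (a v) y) * (\<xi> w - \<xi> v)) / complex_of_real ?S"
    unfolding est_def right_diff_distrib sum_subtractf sum_distrib_right[symmetric] diff_divide_distrib of_real_sum[symmetric]
    using less_imp_neq[OF S] by (simp del: of_real_sum)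
  also have "cmod \<dots> \<le> (\<Sum>v\<in>W. cmod (complex_of_real (lik J (a v) y) * (\<xi> w - \<xi> v))) / ?S"
    unfolding norm_divide norm_of_real using S by (simp add: divide_right_mono norm_sum)
  also have "\<dots> = (\<Sum>v\<in>W. (lik J (a v) y / ?S) * cmod (\<xi> w - \<xi> v))"
    by (simp add: norm_mult sum_divide_distrib)
  also have "\<dots> \<le> (\<Sum>v\<in>W. 1 * cmod (\<xi> w - \<xi> v))"
    using S member_le_sum[of _ W "\<lambda>v. lik J (a v) y"] assms(1)
    by (intro sum_mono mult_right_mono) auto
  finally show ?thesis by simp
qed

lemma integrable_est_err:
  assumes "finite W" "w \<in> W" and [measurable]: "f \<in> measurable M (gam J)" and "prob_space M"
  shows "integrable M (\<lambda>y. (cmod (\<xi> w - est W J a \<xi> (f y)))\<^sup>2)"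
proof -
  interpret prob_space M by fact
  show ?thesis
    using power_mono[OF cmod_est_err_le[OF assms(1,2)], of \<xi> J a _ 2]
    by (intro integrable_const_bound[where B="(\<Sum>v\<in>W. cmod (\<xi> w - \<xi> v))\<^sup>2"] AE_I2) auto
qed

lemma weighted_mean_minimizes:
  fixes \<xi> :: "'w \<Rightarrow> complex" and l :: "'w \<Rightarrow> real"
  assumes "finite W" "(\<Sum>v\<in>W. l v) > 0" and e: "e = (\<Sum>v\<in>W. complex_of_real (l v) * \<xi> v) / complex_of_real (\<Sum>v\<in>W. l v)"
  shows "(\<Sum>w\<in>W. l w * (cmod (\<xi> w - e))\<^sup>2) \<le> (\<Sum>w\<in>W. l w * (cmod (\<xi> w - h))\<^sup>2)"
proof -
  have eq: "(cmod (\<xi> w - h))\<^sup>2 = (cmod (\<xi> w - e))\<^sup>2 + 2 * Re ((\<xi> w - e) * cnj (e - h)) + (cmod (e - h))\<^sup>2" for w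
    unfolding cmod_power2 by (simp add: power2_eq_square algebra_simps)
  have z: "(\<Sum>w\<in>W. complex_of_real (l w) * (\<xi> w - e)) = 0"
  proof -
    have "complex_of_real (\<Sum>v\<in>W. l v) * e = (\<Sum>v\<in>W. complex_of_real (l v) * \<xi> v)"
      unfolding e using assms(2) by (simp del: of_real_sum)
    then show ?thesis by (simp add: right_diff_distrib sum_subtractf sum_distrib_right)
  qed
  have "(\<Sum>w\<in>W. l w * Re ((\<xi> w - e) * cnj (e - h))) = Re ((\<Sum>w\<in>W. complex_of_real (l w) * (\<xi> w - e)) * cnj (e - h))"
    unfolding sum_distrib_right mult.assoc Re_sum by (intro sum.cong refl) (simp add: algebra_simps)
  then have z': "(\<Sum>w\<in>W. l w * Re ((\<xi> w - e) * cnj (e - h))) = 0" unfolding z by simp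
  have "(\<Sum>w\<in>W. l w * (cmod (\<xi> w - h))\<^sup>2) = (\<Sum>w\<in>W. l w * (cmod (\<xi> w - e))\<^sup>2)
      + 2 * (\<Sum>w\<in>W. l w * Re ((\<xi> w - e) * cnj (e - h))) + (\<Sum>w\<in>W. l w) * (cmod (e - h))\<^sup>2"
    unfolding eq by (simp add: sum.distrib distrib_left sum_distrib_left sum_distrib_right mult.left_commute)
  then show ?thesis using z' assms(2) by simp
qed

text \<open>The shift formula collects all inputs under one integral over the received signal, and
  there the posterior mean minimises the weighted squared error at every point. Integrability is a
  hypothesis since the competitor \<open>h\<close> may be unbounded; later it contains a linear
  function of the signal.\<close>

lemma mse_le:
  assumes fin: "finite J" "finite W" "W \<noteq> {}" and h[measurable]: "h \<in> borel_measurable (gam J)"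
    and ih: "\<And>w. w \<in> W \<Longrightarrow> integrable (gam J) (\<lambda>y. (cmod (\<xi> w - h (\<lambda>j\<in>J. y j + a w j)))\<^sup>2)"
  shows "mse W J a \<xi> \<le> (\<Sum>w\<in>W. \<integral>y. (cmod (\<xi> w - h (\<lambda>j\<in>J. y j + a w j)))\<^sup>2 \<partial>gam J) / card W"
proof -
  have sh: "(\<Sum>w\<in>W. \<integral>y. (cmod (\<xi> w - g (\<lambda>j\<in>J. y j + a w j)))\<^sup>2 \<partial>gam J) = (\<integral>y. (\<Sum>w\<in>W. lik J (a w) y * (cmod (\<xi> w - g y))\<^sup>2) \<partial>gam J)"
    and si: "integrable (gam J) (\<lambda>y. \<Sum>w\<in>W. lik J (a w) y * (cmod (\<xi> w - g y))\<^sup>2)"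
    if [measurable]: "g \<in> borel_measurable (gam J)"
      and ig: "\<And>w. w \<in> W \<Longrightarrow> integrable (gam J) (\<lambda>y. (cmod (\<xi> w - g (\<lambda>j\<in>J. y j + a w j)))\<^sup>2)" for g
  proof -
    have i: "integrable (gam J) (\<lambda>y. lik J (a w) y * (cmod (\<xi> w - g y))\<^sup>2)" if "w \<in> W" for w
      using ig[OF that] integrable_gam_shift[OF fin(1), of "\<lambda>y. (cmod (\<xi> w - g y))\<^sup>2" "a w"] by simp
    have "(\<integral>y. (cmod (\<xi> w - g (\<lambda>j\<in>J. y j + a w j)))\<^sup>2 \<partial>gam J) = (\<integral>y. lik J (a w) y * (cmod (\<xi> w - g y))\<^sup>2 \<partial>gam J)" for w
      using integral_gam_shift[OF fin(1), of "\<lambda>y. (cmod (\<xi> w - g y))\<^sup>2" "a w"] by simp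
    then show "(\<Sum>w\<in>W. \<integral>y. (cmod (\<xi> w - g (\<lambda>j\<in>J. y j + a w j)))\<^sup>2 \<partial>gam J) = (\<integral>y. (\<Sum>w\<in>W. lik J (a w) y * (cmod (\<xi> w - g y))\<^sup>2) \<partial>gam J)"
      using i by (simp add: Bochner_Integration.integral_sum)
    show "integrable (gam J) (\<lambda>y. \<Sum>w\<in>W. lik J (a w) y * (cmod (\<xi> w - g y))\<^sup>2)"
      using i by (intro Bochner_Integration.integrable_sum) auto
  qed
  have ie: "integrable (gam J) (\<lambda>y. (cmod (\<xi> w - est W J a \<xi> (\<lambda>j\<in>J. y j + a w j)))\<^sup>2)" if "w \<in> W" for w
    by (rule integrable_est_err[OF fin(2) that _ prob_space_gam]) measurable
  have "(\<integral>y. (\<Sum>w\<in>W. lik J (a w) y * (cmod (\<xi> w - est W J a \<xi> y))\<^sup>2) \<partial>gam J)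
     \<le> (\<integral>y. (\<Sum>w\<in>W. lik J (a w) y * (cmod (\<xi> w - h y))\<^sup>2) \<partial>gam J)"
  proof (rule integral_mono[OF si[OF measurable_est ie] si[OF h ih]])
    fix y
    have "(\<Sum>v\<in>W. lik J (a v) y) > 0" using fin by (intro sum_pos) auto
    then show "(\<Sum>w\<in>W. lik J (a w) y * (cmod (\<xi> w - est W J a \<xi> y))\<^sup>2) \<le> (\<Sum>w\<in>W. lik J (a w) y * (cmod (\<xi> w - h y))\<^sup>2)"
      by (rule weighted_mean_minimizes[OF fin(2)]) (simp add: est_def)
  qed auto
  then show ?thesis
    using sh[OF measurable_est ie] sh[OF h ih] unfolding mse_est[OF fin(2,3)] by (simp add: divide_right_mono restrict_def)
qed

text \<open>A shift of the noise along a null direction of \<open>T\<close> does not change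
  \<open>lin J K T y\<close>, so integration by parts with derivative 0 gives the orthogonality.
  This takes the place of an independence argument for the two parts of the noise.\<close>

lemma coisom_null_orthogonal:
  assumes fin: "finite J" "finite K" and [measurable]: "g \<in> borel_measurable (gam K)"
    and b: "\<And>z. \<bar>g z\<bar> \<le> B" and u: "\<And>k. k \<in> K \<Longrightarrow> (\<Sum>j\<in>J. T k j * u j) = 0"
  shows "(\<integral>y. g (lin J K T y) * cip J u y \<partial>gam J) = (0::real)"
proof -
  have "lin J K T (\<lambda>j\<in>J. y j + complex_of_real s * u j) = lin J K T y" for y s
  proof
    fix k
    have "(\<Sum>j\<in>J. T k j * (y j + complex_of_real s * u j)) = (\<Sum>j\<in>J. T k j * y j) + of_real s * (\<Sum>j\<in>J. T k j * u j)"
      by (simp add: distrib_left sum.distrib sum_distrib_left mult.left_commute)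
    then show "lin J K T (\<lambda>j\<in>J. y j + complex_of_real s * u j) k = lin J K T y k"
      using u[of k] by (simp add: lin_def)
  qed
  then have "2 * (\<integral>y. g (lin J K T y) * cip J u y \<partial>gam J) = (\<integral>y. 0 \<partial>gam J)"
    by (intro gaussian_stein[OF fin(1), where B=B and B'=0]) (auto simp: b)
  then show ?thesis by simp
qed

text \<open>A degraded observation \<open>lin J K T Y\<close> cannot beat a linear correction of its
  estimate by the remaining, independent part of the noise.\<close>

lemma mse_degraded:
  fixes T :: "'k \<Rightarrow> 'j \<Rightarrow> complex"
  assumes fin: "finite J" "finite K" "finite W" "W \<noteq> {}" and T: "coisom J K T"
    and a1: "\<And>w k. w \<in> W \<Longrightarrow> k \<in> K \<Longrightarrow> a1 w k = (\<Sum>j\<in>J. T k j * a w j)"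
    and p': "\<And>k. k \<in> K \<Longrightarrow> p' k = (\<Sum>j\<in>J. p j * cnj (T k j))"
  shows "mse W J a (\<lambda>w. \<xi> w + (\<Sum>j\<in>J. p j * a w j))
    \<le> mse W K a1 (\<lambda>w. \<xi> w + (\<Sum>k\<in>K. p' k * a1 w k)) + csq J p - csq K p'"
proof -
  interpret g: prob_space "gam J" by (rule prob_space_gam)
  define \<eta> where "\<eta> w = \<xi> w + (\<Sum>j\<in>J. p j * a w j)" for w
  define \<eta>1 where "\<eta>1 w = \<xi> w + (\<Sum>k\<in>K. p' k * a1 w k)" for w
  \<comment> \<open>The component of \<open>p\<close> orthogonal to the rows of \<open>T\<close>:
    the linear form with these coefficients is the part of the noise that \<open>lin J K T\<close>
    does not see.\<close>
  define r where "r j = p j - (\<Sum>k\<in>K. p' k * T k j)" for j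
  let ?L = "lin J K T"
  define h where "h y = est W K a1 \<eta>1 (?L y) + (\<Sum>j\<in>J. r j * y j)" for y
  have hm[measurable]: "h \<in> borel_measurable (gam J)" unfolding h_def by measurable
  have Tr: "(\<Sum>j\<in>J. T k j * cnj (r j)) = 0" if k: "k \<in> K" for k
  proof -
    have "(\<Sum>j\<in>J. T k j * cnj (r j)) = cnj (\<Sum>j\<in>J. p j * cnj (T k j)) - (\<Sum>j\<in>J. T k j * (\<Sum>l\<in>K. cnj (T l j) * cnj (p' l)))"
      by (simp add: r_def right_diff_distrib sum_subtractf mult.commute)
    also have "\<dots> = 0" unfolding coisom_lin_adjoint[OF fin(2) T k] p'[OF k] by simp
    finally show ?thesis .
  qed
  have csr: "csq J r = csq J p - csq K p'"
  proof -
    have c: "complex_of_real (csq X f) = (\<Sum>x\<in>X. f x * cnj (f x))" for X :: "'x set" and f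
      by (simp add: csq_def complex_norm_square del: of_real_power)
    have "(\<Sum>j\<in>J. r j * cnj (r j)) = (\<Sum>j\<in>J. p j * cnj (r j)) - (\<Sum>j\<in>J. (\<Sum>k\<in>K. p' k * T k j) * cnj (r j))"
      by (subst (1) r_def) (simp add: left_diff_distrib sum_subtractf)
    also have "(\<Sum>j\<in>J. (\<Sum>k\<in>K. p' k * T k j) * cnj (r j)) = (\<Sum>k\<in>K. p' k * (\<Sum>j\<in>J. T k j * cnj (r j)))"
      by (simp add: sum_distrib_left sum_distrib_right mult.assoc) (rule sum.swap)
    also have "\<dots> = 0" using Tr by simp
    also have "(\<Sum>j\<in>J. p j * cnj (r j)) = (\<Sum>j\<in>J. p j * cnj (p j)) - (\<Sum>j\<in>J. \<Sum>k\<in>K. p j * cnj (T k j) * cnj (p' k))"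
      by (simp add: r_def right_diff_distrib sum_subtractf sum_distrib_left mult_ac)
    also have "(\<Sum>j\<in>J. \<Sum>k\<in>K. p j * cnj (T k j) * cnj (p' k)) = (\<Sum>k\<in>K. (\<Sum>j\<in>J. p j * cnj (T k j)) * cnj (p' k))"
      unfolding sum_distrib_right by (rule sum.swap)
    also have "\<dots> = (\<Sum>k\<in>K. p' k * cnj (p' k))" using p' by simp
    finally have "complex_of_real (csq J r) = complex_of_real (csq J p - csq K p')"
      unfolding c of_real_diff by simp
    then show ?thesis using of_real_eq_iff by blast
  qed
  have Lsh: "?L (\<lambda>j\<in>J. y j + a w j) = (\<lambda>k\<in>K. ?L y k + a1 w k)" if "w \<in> W" for w y
    using a1[OF that] by (auto simp: lin_def distrib_left sum.distrib)
  have ra: "(\<Sum>j\<in>J. r j * a w j) = (\<Sum>j\<in>J. p j * a w j) - (\<Sum>k\<in>K. p' k * a1 w k)" if "w \<in> W" for w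
  proof -
    have "(\<Sum>j\<in>J. r j * a w j) = (\<Sum>j\<in>J. p j * a w j) - (\<Sum>j\<in>J. \<Sum>k\<in>K. p' k * (T k j * a w j))"
      by (simp add: r_def left_diff_distrib sum_subtractf sum_distrib_right mult.assoc)
    also have "(\<Sum>j\<in>J. \<Sum>k\<in>K. p' k * (T k j * a w j)) = (\<Sum>k\<in>K. p' k * a1 w k)"
      by (subst sum.swap) (simp add: sum_distrib_left[symmetric] a1[OF that])
    finally show ?thesis .
  qed
  define e where "e w z = \<eta>1 w - est W K a1 \<eta>1 (\<lambda>k\<in>K. z k + a1 w k)" for w z
  let ?e = e
  have err: "\<eta> w - h (\<lambda>j\<in>J. y j + a w j) = ?e w (?L y) - (\<Sum>j\<in>J. r j * y j)" if "w \<in> W" for w y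
    using ra[OF that] by (simp add: h_def e_def Lsh[OF that] \<eta>_def \<eta>1_def distrib_left sum.distrib)
  have Re_lin: "Re (\<Sum>j\<in>J. r j * y j) = cip J (\<lambda>j. cnj (r j)) y" for y
    by (simp add: cip_def)
  have Im_lin: "Im (\<Sum>j\<in>J. r j * y j) = cip J (\<lambda>j. \<i> * cnj (r j)) y" for y
    by (simp add: cip_def algebra_simps)
  have sq: "(cmod (e - z))\<^sup>2 = (cmod e)\<^sup>2 + (cmod z)\<^sup>2 - 2 * (Re e * Re z + Im e * Im z)" for e z
    unfolding cmod_power2 by (simp add: power2_eq_square algebra_simps)
  have emK[measurable]: "?e w \<in> borel_measurable (gam K)" for w
    unfolding e_def by measurable
  have em[measurable]: "(\<lambda>y. ?e w (?L y)) \<in> borel_measurable (gam J)" for w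
    by (rule measurable_compose[OF measurable_lin emK])
  have eb: "cmod (?e w z) \<le> (\<Sum>v\<in>W. cmod (\<eta>1 w - \<eta>1 v))" if "w \<in> W" for w z
    unfolding e_def by (rule cmod_est_err_le[OF fin(3) that])
  have i1: "integrable (gam J) (\<lambda>y. (cmod (?e w (?L y)))\<^sup>2)" if "w \<in> W" for w
    unfolding e_def by (rule integrable_est_err[OF fin(3) that _ prob_space_gam])
      (rule measurable_compose[OF measurable_lin measurable_shift])
  have i2: "integrable (gam J) (\<lambda>y. (cmod (\<Sum>j\<in>J. r j * y j))\<^sup>2)"
    by (rule cmod2_lin_form[OF fin(1)])
  have i3: "integrable (gam J) (\<lambda>y. Re (?e w (?L y)) * cip J u y)" "integrable (gam J) (\<lambda>y. Im (?e w (?L y)) * cip J u y)"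
    if w: "w \<in> W" for w u
  proof -
    let ?B = "\<Sum>v\<in>W. cmod (\<eta>1 w - \<eta>1 v)"
    have ib: "integrable (gam J) (\<lambda>y. ?B * \<bar>cip J u y\<bar>)" by (intro integrable_mult_right integrable_abs_cip fin)
    have B: "0 \<le> ?B" by (simp add: sum_nonneg)
    have R: "\<bar>Re (?e w z)\<bar> \<le> ?B" "\<bar>Im (?e w z)\<bar> \<le> ?B" for z
      using eb[OF w, of z] abs_Re_le_cmod[of "?e w z"] abs_Im_le_cmod[of "?e w z"] by linarith+
    show "integrable (gam J) (\<lambda>y. Re (?e w (?L y)) * cip J u y)"
      by (rule Bochner_Integration.integrable_bound[OF ib]) (use R(1) B in \<open>auto intro!: AE_I2 mult_right_mono simp: abs_mult\<close>)
    show "integrable (gam J) (\<lambda>y. Im (?e w (?L y)) * cip J u y)"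
      by (rule Bochner_Integration.integrable_bound[OF ib]) (use R(2) B in \<open>auto intro!: AE_I2 mult_right_mono simp: abs_mult\<close>)
  qed
  have z3: "(\<integral>y. Re (?e w (?L y)) * cip J u y \<partial>gam J) = 0" "(\<integral>y. Im (?e w (?L y)) * cip J u y \<partial>gam J) = 0"
    if w: "w \<in> W" and u: "\<And>k. k \<in> K \<Longrightarrow> (\<Sum>j\<in>J. T k j * u j) = 0" for w u
  proof -
    let ?B = "\<Sum>v\<in>W. cmod (\<eta>1 w - \<eta>1 v)"
    have R: "\<bar>Re (?e w z)\<bar> \<le> ?B" "\<bar>Im (?e w z)\<bar> \<le> ?B" for z
      using eb[OF w, of z] abs_Re_le_cmod[of "?e w z"] abs_Im_le_cmod[of "?e w z"] by linarith+
    show "(\<integral>y. Re (?e w (?L y)) * cip J u y \<partial>gam J) = 0"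
      by (rule coisom_null_orthogonal[OF fin(1,2) _ R(1) u]) measurable
    show "(\<integral>y. Im (?e w (?L y)) * cip J u y \<partial>gam J) = 0"
      by (rule coisom_null_orthogonal[OF fin(1,2) _ R(2) u]) measurable
  qed
  have u1: "\<And>k. k \<in> K \<Longrightarrow> (\<Sum>j\<in>J. T k j * cnj (r j)) = 0" by (rule Tr)
  have u2: "\<And>k. k \<in> K \<Longrightarrow> (\<Sum>j\<in>J. T k j * (\<i> * cnj (r j))) = 0"
    using Tr by (simp add: mult.left_commute sum_distrib_left[symmetric])
  have split: "(cmod (\<eta> w - h (\<lambda>j\<in>J. y j + a w j)))\<^sup>2 =
      (cmod (?e w (?L y)))\<^sup>2 + (cmod (\<Sum>j\<in>J. r j * y j))\<^sup>2
      - 2 * (Re (?e w (?L y)) * cip J (\<lambda>j. cnj (r j)) y + Im (?e w (?L y)) * cip J (\<lambda>j. \<i> * cnj (r j)) y)"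
    if "w \<in> W" for w y
    unfolding err[OF that] sq Re_lin[symmetric] Im_lin[symmetric] ..
  have int: "integrable (gam J) (\<lambda>y. (cmod (\<eta> w - h (\<lambda>j\<in>J. y j + a w j)))\<^sup>2)" if "w \<in> W" for w
    unfolding split[OF that] using i1[OF that] i2 i3[OF that]
    by (intro Bochner_Integration.integrable_diff Bochner_Integration.integrable_add integrable_mult_right)
  have val: "(\<integral>y. (cmod (\<eta> w - h (\<lambda>j\<in>J. y j + a w j)))\<^sup>2 \<partial>gam J) = (\<integral>z. (cmod (?e w z))\<^sup>2 \<partial>gam K) + csq J r" if w: "w \<in> W" for w
  proof -
    have "(\<integral>y. (cmod (\<eta> w - h (\<lambda>j\<in>J. y j + a w j)))\<^sup>2 \<partial>gam J) = (\<integral>y. (cmod (?e w (?L y)))\<^sup>2 \<partial>gam J) + csq J r"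
      unfolding split[OF w] using i1[OF w] i2 i3[OF w] z3[OF w u1] z3[OF w u2] cmod2_lin_form(2)[OF fin(1)] by simp
    also have "(\<integral>y. (cmod (?e w (?L y)))\<^sup>2 \<partial>gam J) = (\<integral>z. (cmod (?e w z))\<^sup>2 \<partial>distr (gam J) (gam K) ?L)"
      by (subst integral_distr) measurable
    finally show ?thesis unfolding distr_gam_lin[OF fin(1,2) T] .
  qed
  have "mse W J a \<eta> \<le> (\<Sum>w\<in>W. \<integral>y. (cmod (\<eta> w - h (\<lambda>j\<in>J. y j + a w j)))\<^sup>2 \<partial>gam J) / card W"
    by (rule mse_le[OF fin(1,3,4) hm int])
  also have "\<dots> = mse W K a1 \<eta>1 + csq J r"
    using fin(3,4) by (simp add: val mse_est e_def sum.distrib add_divide_distrib)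
  finally show ?thesis unfolding csr by (simp add: \<eta>_def[abs_def] \<eta>1_def[abs_def])
qed

text \<open>The signal \<open>b\<close> is the image of \<open>a\<close> under the adjoint of
  \<open>T\<close>, an isometric embedding. The noise outside its range enters no likelihood ratio,
  and the noise inside is again standard.\<close>

lemma iota_isometry:
  assumes fin: "finite J" "finite K" and T: "coisom K J T"
    and b: "\<And>w k. w \<in> W \<Longrightarrow> k \<in> K \<Longrightarrow> b w k = (\<Sum>j\<in>J. cnj (T j k) * a w j)"
  shows "iota W K b = iota W J a"
proof -
  have llr: "llr K b w v y = llr J a w v (lin K J T y)" if "w \<in> W" "v \<in> W" for w v y
  proof -
    let ?d = "\<lambda>j. a w j - a v j"
    let ?D = "\<lambda>k\<in>K. \<Sum>j\<in>J. cnj (T j k) * ?d j"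
    have bd: "b w k - b v k = ?D k" if "k \<in> K" for k
      using b \<open>w \<in> W\<close> \<open>v \<in> W\<close> that by (simp add: right_diff_distrib sum_subtractf)
    have 1: "cip K (\<lambda>k. b w k - b v k) y = cip J ?d (lin K J T y)" for y
      unfolding cip_adjoint[where J=K and K=J and T=T and a="?d" and y=y, symmetric] unfolding cip_def using bd by (intro sum.cong) auto
    have "csq K (\<lambda>k. b w k - b v k) = cip K (\<lambda>k. b w k - b v k) ?D"
      unfolding cip_self[symmetric] unfolding cip_def using bd by (intro sum.cong) auto
    also have "\<dots> = cip J ?d (lin K J T ?D)" by (rule 1)
    also have "\<dots> = csq J ?d"
      unfolding cip_self[symmetric] unfolding cip_def lin_def
      using coisom_lin_adjoint[OF fin(1) T, of _ ?d] by (intro sum.cong) auto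
    finally show ?thesis unfolding llr_def 1 by simp
  qed
  have "(\<integral>y. ln ((\<Sum>v\<in>W. exp (llr K b w v y)) / card W) \<partial>gam K) = (\<integral>y. ln ((\<Sum>v\<in>W. exp (llr J a w v y)) / card W) \<partial>gam J)"
    if "w \<in> W" for w
  proof -
    have "(\<integral>y. ln ((\<Sum>v\<in>W. exp (llr K b w v y)) / card W) \<partial>gam K) = (\<integral>y. ln ((\<Sum>v\<in>W. exp (llr J a w v (lin K J T y))) / card W) \<partial>gam K)"
      using llr[OF that] by simp
    also have "\<dots> = (\<integral>y. ln ((\<Sum>v\<in>W. exp (llr J a w v y)) / card W) \<partial>distr (gam K) (gam J) (lin K J T))"
      by (subst integral_distr) measurable
    finally show ?thesis unfolding distr_gam_lin[OF fin(2,1) T] .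
  qed
  then show ?thesis unfolding iota_def by simp
qed

text \<open>The summand of \<open>iota\<close> is the relative entropy of the output distribution
  for the input \<open>w\<close> with respect to the mean output \<open>mix\<close>. This is the
  form to which a bound for decoders applies, since decoders act on the received signal.\<close>

lemma iota_lik:
  assumes fin: "finite J" "finite W" "W \<noteq> {}" and w: "w \<in> W"
  shows "integrable (gam J) (\<lambda>y. lik J (a w) y * ln (lik J (a w) y / mix W J a y))"
    and "(\<integral>y. lik J (a w) y * ln (lik J (a w) y / mix W J a y) \<partial>gam J) =
       - (\<integral>y. ln ((\<Sum>v\<in>W. exp (llr J a w v y)) / card W) \<partial>gam J)"
proof -
  let ?g = "\<lambda>y. ln (lik J (a w) y / mix W J a y)"
  have eq: "ln ((\<Sum>v\<in>W. exp (llr J a w v y)) / card W) = - ?g (\<lambda>j\<in>J. y j + a w j)" for y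
  proof -
    let ?y = "\<lambda>j\<in>J. y j + a w j"
    have "(\<Sum>v\<in>W. exp (llr J a w v y)) / card W = mix W J a ?y / lik J (a w) ?y"
      unfolding exp_llr sum_divide_distrib[symmetric] mix_def by simp
    then show ?thesis using mix_pos[OF fin(2,3), of J a ?y] lik_pos[of J "a w" ?y] by (simp add: ln_div)
  qed
  have "integrable (gam J) (\<lambda>y. - ?g (\<lambda>j\<in>J. y j + a w j))"
    using integrable_lse[OF fin, of a w] unfolding eq .
  then have "integrable (gam J) (\<lambda>y. ?g (\<lambda>j\<in>J. y j + a w j))" by simp
  then show "integrable (gam J) (\<lambda>y. lik J (a w) y * ?g y)"
    using integrable_gam_shift[OF fin(1), of ?g "a w"] by simp
  show "(\<integral>y. lik J (a w) y * ?g y \<partial>gam J) = - (\<integral>y. ln ((\<Sum>v\<in>W. exp (llr J a w v y)) / card W) \<partial>gam J)"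
    unfolding eq using integral_gam_shift[OF fin(1), of ?g "a w"] by simp
qed

lemma iota_eq_lik:
  assumes fin: "finite J" "finite W" "W \<noteq> {}"
  shows "iota W J a = (\<Sum>w\<in>W. \<integral>y. lik J (a w) y * ln (lik J (a w) y / mix W J a y) \<partial>gam J) / card W"
  unfolding iota_def using iota_lik(2)[OF fin] by (simp add: sum_negf)

section \<open>Fano's inequality\<close>

lemma sum_Times: "(\<Sum>w\<in>M \<times> C. g w) = (\<Sum>m\<in>M. \<Sum>c\<in>C. g (m, c))"
  by (simp add: sum.cartesian_product split_beta')

text \<open>The decision defines a guess distribution \<open>q\<close>: half of the mass on the
  decoded message, the other half uniform. Comparing the posterior with \<open>q\<close> by ln x >=
  1 - 1/x costs at most ln 2 for a correct decision and ln 2 + ln (card M) for an error. The binary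
  entropy of the error is thereby replaced by the constant ln 2, which disappears after division by
  the blocklength.\<close>

lemma fano:
  fixes f :: "'m \<Rightarrow> 'y \<Rightarrow> real" and D :: "'y \<Rightarrow> 'm"
  assumes M: "finite M" "M \<noteq> {}"
    and D[measurable]: "D \<in> measurable N (count_space UNIV)"
    and fpos: "\<And>m y. m \<in> M \<Longrightarrow> 0 < f m y"
    and fi: "\<And>m. m \<in> M \<Longrightarrow> integrable N (f m)" and f1: "\<And>m. m \<in> M \<Longrightarrow> (\<integral>y. f m y \<partial>N) = 1"
    and F: "\<And>y. F y = (\<Sum>m\<in>M. f m y) / card M"
    and li: "\<And>m. m \<in> M \<Longrightarrow> integrable N (\<lambda>y. f m y * ln (f m y / F y))"
    and Pe: "(\<Sum>m\<in>M. \<integral>y. f m y * indicator {y \<in> space N. D y \<noteq> m} y \<partial>N) / card M \<le> \<epsilon>"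
  shows "(1 - \<epsilon>) * ln (card M) - ln 2 \<le> (\<Sum>m\<in>M. \<integral>y. f m y * ln (f m y / F y) \<partial>N) / card M"
proof -
  let ?c = "real (card M)"
  have c: "?c \<ge> 1" using M by (simp add: Suc_leI card_gt_0_iff)
  let ?I = "\<lambda>m y. indicator {y \<in> space N. D y \<noteq> m} y :: real"
  have Im: "{y \<in> space N. D y \<noteq> m} \<in> sets N" for m by measurable
  have pt: "(\<Sum>m\<in>M. f m y * (ln ?c - ln 2)) - (\<Sum>m\<in>M. f m y * ?I m y * ln ?c) \<le> (\<Sum>m\<in>M. f m y * ln (f m y / F y))"
    if y: "y \<in> space N" for y
  proof -
    define q where "q m = (if D y = m then 1/2 else 0) + 1 / (2 * ?c)" for m
    have q: "q m > 0" for m using c by (auto simp: q_def intro!: add_nonneg_pos)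
    have S: "(\<Sum>m\<in>M. f m y) > 0" using M fpos by (intro sum_pos) auto
    have Fp: "F y > 0" using S c unfolding F by (intro divide_pos_pos) auto
    have lnq: "ln (q m) \<ge> - ln 2 - ?I m y * ln ?c" if "m \<in> M" for m
    proof (cases "D y = m")
      case True
      have "ln (1/2) \<le> ln (q m)" using True c by (subst ln_le_cancel_iff) (auto simp: q_def intro!: add_pos_pos)
      then show ?thesis using True by (simp add: ln_div)
    next
      case False
      then show ?thesis using c y by (simp add: q_def ln_div ln_mult)
    qed
    have one: "f m y * (1 - ln 2 + ln ?c) - f m y * ?I m y * ln ?c - ?c * F y * q m \<le> f m y * ln (f m y / F y)" if m: "m \<in> M" for m
    proof -
      \<comment> \<open>The posterior probability of \<open>m\<close> divided by its guess
        probability.\<close>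
      let ?x = "f m y / (?c * F y * q m)"
      have xp: "?x > 0" using fpos[OF m, of y] Fp q[of m] c by (intro divide_pos_pos mult_pos_pos) auto
      have "ln (inverse ?x) \<le> inverse ?x - 1"
        by (rule ln_le_minus_one[OF positive_imp_inverse_positive[OF xp]])
      then have "1 - inverse ?x \<le> ln ?x" unfolding ln_inverse by linarith
      then have "f m y * (1 - inverse ?x) \<le> f m y * ln ?x" using fpos[OF m, of y] by (intro mult_left_mono) auto
      moreover have "f m y * inverse ?x = ?c * F y * q m" using fpos[OF m, of y] by (simp add: field_simps)
      moreover have "ln ?x = ln (f m y / F y) - ln ?c - ln (q m)"
        using fpos[OF m, of y] Fp q[of m] c by (simp add: ln_div ln_mult)
      moreover have "f m y * ln (q m) \<ge> f m y * (- ln 2 - ?I m y * ln ?c)"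
        using lnq[OF m] fpos[OF m, of y] by (intro mult_left_mono) auto
      moreover have "f m y * ln ?x = f m y * ln (f m y / F y) - f m y * ln ?c - f m y * ln (q m)"
        if "ln ?x = ln (f m y / F y) - ln ?c - ln (q m)"
        unfolding that by (simp add: algebra_simps)
      ultimately have *: "f m y - ?c * F y * q m \<le> f m y * ln (f m y / F y) - f m y * ln ?c - f m y * ln (q m)"
        "f m y * (- ln 2 - ?I m y * ln ?c) \<le> f m y * ln (q m)"
        by (simp_all add: right_diff_distrib)
      have "f m y * (1 - ln 2 + ln ?c) - f m y * ?I m y * ln ?c = f m y + f m y * ln ?c + f m y * (- ln 2 - ?I m y * ln ?c)"
        by (simp add: algebra_simps)
      then show ?thesis using * by linarith
    qed
    have "(\<Sum>m\<in>M. ?c * F y * q m) \<le> ?c * F y"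
    proof -
      have "(\<Sum>m\<in>M. q m) = (\<Sum>m\<in>M. if D y = m then 1/2 else 0) + 1/2"
        using c by (simp add: q_def sum.distrib)
      also have "\<dots> \<le> 1" using M by (simp add: sum.delta')
      finally have "(?c * F y) * (\<Sum>m\<in>M. q m) \<le> (?c * F y) * 1" using Fp by (intro mult_left_mono) auto
      then show ?thesis by (simp add: sum_distrib_left)
    qed
    also have "?c * F y = (\<Sum>m\<in>M. f m y)" unfolding F using c by simp
    finally have qs: "(\<Sum>m\<in>M. ?c * F y * q m) \<le> (\<Sum>m\<in>M. f m y)" .
    have "(\<Sum>m\<in>M. f m y * (1 - ln 2 + ln ?c) - f m y * ?I m y * ln ?c - ?c * F y * q m) \<le> (\<Sum>m\<in>M. f m y * ln (f m y / F y))"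
      by (intro sum_mono one)
    then show ?thesis using qs by (simp add: sum_subtractf sum.distrib algebra_simps)
  qed
  have i1: "integrable N (\<lambda>y. f m y * (ln ?c - ln 2))" if "m \<in> M" for m
    using fi[OF that] by simp
  have i2: "integrable N (\<lambda>y. f m y * ?I m y)" if "m \<in> M" for m
    using fi[OF that] Im by (rule integrable_mult_indicator[where A="{y \<in> space N. D y \<noteq> m}" and f="f m", simplified mult.commute real_scaleR_def, rotated])
  have "(\<integral>y. (\<Sum>m\<in>M. f m y * (ln ?c - ln 2)) - (\<Sum>m\<in>M. f m y * ?I m y * ln ?c) \<partial>N) \<le> (\<integral>y. (\<Sum>m\<in>M. f m y * ln (f m y / F y)) \<partial>N)"
    using i1 i2 li pt by (intro integral_mono Bochner_Integration.integrable_diff Bochner_Integration.integrable_sum integrable_mult_left) auto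
  also have "\<dots> = (\<Sum>m\<in>M. \<integral>y. f m y * ln (f m y / F y) \<partial>N)"
    using li by (intro Bochner_Integration.integral_sum) auto
  also have "(\<integral>y. (\<Sum>m\<in>M. f m y * (ln ?c - ln 2)) - (\<Sum>m\<in>M. f m y * ?I m y * ln ?c) \<partial>N)
     = (\<Sum>m\<in>M. \<integral>y. f m y * (ln ?c - ln 2) \<partial>N) - (\<Sum>m\<in>M. \<integral>y. f m y * ?I m y * ln ?c \<partial>N)"
    using i1 i2 by (subst Bochner_Integration.integral_diff)
      (auto intro!: Bochner_Integration.integrable_sum integrable_mult_left simp: Bochner_Integration.integral_sum)
  also have "(\<Sum>m\<in>M. \<integral>y. f m y * (ln ?c - ln 2) \<partial>N) = ?c * (ln ?c - ln 2)"
    using f1 by simp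
  also have "(\<Sum>m\<in>M. \<integral>y. f m y * ?I m y * ln ?c \<partial>N) = (\<Sum>m\<in>M. \<integral>y. f m y * ?I m y \<partial>N) * ln ?c"
    by (simp add: sum_distrib_right)
  finally have le: "?c * (ln ?c - ln 2) - (\<Sum>m\<in>M. \<integral>y. f m y * ?I m y \<partial>N) * ln ?c \<le> (\<Sum>m\<in>M. \<integral>y. f m y * ln (f m y / F y) \<partial>N)" .
  have "(\<Sum>m\<in>M. \<integral>y. f m y * ?I m y \<partial>N) * ln ?c \<le> (\<epsilon> * ?c) * ln ?c"
    using Pe c by (intro mult_right_mono) (auto simp: divide_le_eq)
  with le have "?c * (ln ?c - ln 2) - (\<epsilon> * ?c) * ln ?c \<le> (\<Sum>m\<in>M. \<integral>y. f m y * ln (f m y / F y) \<partial>N)" by linarith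
  then show ?thesis using c by (simp add: le_divide_eq algebra_simps)
qed

lemma lik_indicator:
  assumes "finite J" and D[measurable]: "D \<in> measurable (gam J) (count_space UNIV)"
  shows "(\<integral>y. lik J a y * indicator {y \<in> space (gam J). D y \<noteq> m} y \<partial>gam J)
     = measure (gam J) {y \<in> space (gam J). D (\<lambda>j\<in>J. y j + a j) \<noteq> m}"
proof -
  have m: "{y \<in> space (gam J). D y \<noteq> m} \<in> sets (gam J)" by measurable
  have D2[measurable]: "(\<lambda>y. D (\<lambda>j\<in>J. y j + a j)) \<in> measurable (gam J) (count_space UNIV)"
    by (rule measurable_compose[OF measurable_shift D])
  have m2: "{y \<in> space (gam J). D (\<lambda>j\<in>J. y j + a j) \<noteq> m} \<in> sets (gam J)" by measurable
  have "(\<integral>y. lik J a y * indicator {y \<in> space (gam J). D y \<noteq> m} y \<partial>gam J)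
     = (\<integral>y. indicator {y \<in> space (gam J). D y \<noteq> m} (\<lambda>j\<in>J. y j + a j) \<partial>gam J)"
    using integral_gam_shift[OF assms(1), of "indicator {y \<in> space (gam J). D y \<noteq> m} :: _ \<Rightarrow> real" a] m by simp
  also have "\<dots> = (\<integral>y. indicator {y \<in> space (gam J). D (\<lambda>j\<in>J. y j + a j) \<noteq> m} y \<partial>gam J)"
    by (intro Bochner_Integration.integral_cong refl) (auto simp: indicator_def space_gam)
  also have "\<dots> = measure (gam J) {y \<in> space (gam J). D (\<lambda>j\<in>J. y j + a j) \<noteq> m}"
    using m2 by simp
  finally show ?thesis .
qed

lemma fano_iota:
  fixes D :: "('j \<Rightarrow> complex) \<Rightarrow> 'w"
  assumes fin: "finite J" "finite W" "W \<noteq> {}" and D: "D \<in> measurable (gam J) (count_space UNIV)"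
    and Pe: "(\<Sum>w\<in>W. measure (gam J) {y \<in> space (gam J). D (\<lambda>j\<in>J. y j + a w j) \<noteq> w}) / card W \<le> \<epsilon>"
  shows "(1 - \<epsilon>) * ln (card W) - ln 2 \<le> iota W J a"
  unfolding iota_eq_lik[OF fin]
proof (rule fano[OF fin(2,3) D, where f="\<lambda>w. lik J (a w)"])
  show "(\<Sum>m\<in>W. \<integral>y. lik J (a m) y * indicator {y \<in> space (gam J). D y \<noteq> m} y \<partial>gam J) / card W \<le> \<epsilon>"
    unfolding lik_indicator[OF fin(1) D] by (rule Pe)
qed (use iota_lik(1)[OF fin] integrable_lik[OF fin(1)] in \<open>auto simp: mix_def\<close>)

text \<open>The density for the message \<open>m\<close> is itself a mixture over \<open>c\<close>.
  Splitting the logarithm at this mixture is the chain rule, already at each point: the information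
  on \<open>m\<close> is that on the pair minus that on \<open>c\<close> given
  \<open>m\<close>.\<close>

lemma fano_iota_diff:
  fixes D :: "('j \<Rightarrow> complex) \<Rightarrow> 'm"
  assumes fin: "finite J" "finite M" "M \<noteq> {}" "finite C" "C \<noteq> {}" and D: "D \<in> measurable (gam J) (count_space UNIV)"
    and Pe: "(\<Sum>(m, c)\<in>M \<times> C. measure (gam J) {y \<in> space (gam J). D (\<lambda>j\<in>J. y j + a (m, c) j) \<noteq> m}) / card (M \<times> C) \<le> \<epsilon>"
  shows "(1 - \<epsilon>) * ln (card M) - ln 2 \<le> iota (M \<times> C) J a - (\<Sum>m\<in>M. iota C J (\<lambda>c. a (m, c))) / card M"
proof -
  let ?k = "real (card C)"
  have k: "?k > 0" using fin by (simp add: card_gt_0_iff)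
  define f where "f m = mix C J (\<lambda>c. a (m, c))" for m
  have f: "f m y = (\<Sum>c\<in>C. lik J (a (m, c)) y) / ?k" for m y by (simp add: f_def mix_def)
  have fpos: "0 < f m y" for m y unfolding f_def by (rule mix_pos[OF fin(4,5)])
  have fi: "integrable (gam J) (f m)" for m
    unfolding f[abs_def] by (intro integrable_divide Bochner_Integration.integrable_sum integrable_lik fin)
  have f1: "(\<integral>y. f m y \<partial>gam J) = 1" for m
    unfolding f using integrable_lik[OF fin(1)] k by (simp add: Bochner_Integration.integral_sum)
  let ?F = "mix (M \<times> C) J a"
  have finP: "finite (M \<times> C)" "M \<times> C \<noteq> {}" using fin by auto
  have F: "?F y = (\<Sum>m\<in>M. f m y) / card M" for y
    by (simp add: mix_def f card_cartesian_product sum_Times sum_divide_distrib[symmetric])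
  have Fpos: "0 < ?F y" for y by (rule mix_pos[OF finP])
  have i1: "integrable (gam J) (\<lambda>y. lik J (a (m, c)) y * ln (lik J (a (m, c)) y / ?F y))" if "m \<in> M" "c \<in> C" for m c
    using iota_lik(1)[OF fin(1) finP, of "(m, c)" a] that by simp
  have i2: "integrable (gam J) (\<lambda>y. lik J (a (m, c)) y * ln (lik J (a (m, c)) y / f m y))" if "c \<in> C" for m c
    unfolding f_def using iota_lik(1)[OF fin(1,4,5) that, of "\<lambda>c. a (m, c)"] .
  have pt: "f m y * ln (f m y / ?F y) = (\<Sum>c\<in>C. lik J (a (m, c)) y * ln (lik J (a (m, c)) y / ?F y)
       - lik J (a (m, c)) y * ln (lik J (a (m, c)) y / f m y)) / ?k" for m y
  proof -
    have "lik J (a (m, c)) y * ln (lik J (a (m, c)) y / ?F y) - lik J (a (m, c)) y * ln (lik J (a (m, c)) y / f m y)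
       = lik J (a (m, c)) y * ln (f m y / ?F y)" for c
      using fpos[of m y] Fpos[of y] lik_pos[of J "a (m, c)" y] by (simp add: ln_div algebra_simps)
    then show ?thesis unfolding f[of m y] by (simp add: sum_distrib_right)
  qed
  have li: "integrable (gam J) (\<lambda>y. f m y * ln (f m y / ?F y))" if "m \<in> M" for m
    unfolding pt using i1[OF that] i2 by (intro integrable_divide Bochner_Integration.integrable_sum Bochner_Integration.integrable_diff) auto
  have val: "(\<integral>y. f m y * ln (f m y / ?F y) \<partial>gam J)
    = (\<Sum>c\<in>C. \<integral>y. lik J (a (m, c)) y * ln (lik J (a (m, c)) y / ?F y) \<partial>gam J) / ?k - iota C J (\<lambda>c. a (m, c))" if m: "m \<in> M" for m
    unfolding pt using i1[OF m] i2
    by (simp add: Bochner_Integration.integral_sum Bochner_Integration.integral_diff sum_subtractf diff_divide_distrib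
         iota_eq_lik[OF fin(1,4,5)] f_def)
  have "(1 - \<epsilon>) * ln (card M) - ln 2 \<le> (\<Sum>m\<in>M. \<integral>y. f m y * ln (f m y / ?F y) \<partial>gam J) / card M"
  proof (rule fano[OF fin(2,3) D fpos fi f1 F li])
    have "(\<integral>y. f m y * indicator {y \<in> space (gam J). D y \<noteq> m} y \<partial>gam J)
       = (\<Sum>c\<in>C. measure (gam J) {y \<in> space (gam J). D (\<lambda>j\<in>J. y j + a (m, c) j) \<noteq> m}) / ?k" for m
    proof -
      have m: "{y \<in> space (gam J). D y \<noteq> m} \<in> sets (gam J)" using D by measurable
      have i: "integrable (gam J) (\<lambda>y. lik J (a (m, c)) y * indicator {y \<in> space (gam J). D y \<noteq> m} y)" for c
        using integrable_mult_indicator[OF m integrable_lik(1)[OF fin(1)], of "a (m, c)"] by (simp add: mult.commute)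
      have "(\<integral>y. f m y * indicator {y \<in> space (gam J). D y \<noteq> m} y \<partial>gam J)
        = (\<integral>y. (\<Sum>c\<in>C. lik J (a (m, c)) y * indicator {y \<in> space (gam J). D y \<noteq> m} y) / ?k \<partial>gam J)"
        by (simp add: f sum_distrib_right)
      also have "\<dots> = (\<Sum>c\<in>C. \<integral>y. lik J (a (m, c)) y * indicator {y \<in> space (gam J). D y \<noteq> m} y \<partial>gam J) / ?k"
        using i by (simp add: Bochner_Integration.integral_sum)
      finally show ?thesis unfolding lik_indicator[OF fin(1) D] .
    qed
    then have "(\<Sum>m\<in>M. \<integral>y. f m y * indicator {y \<in> space (gam J). D y \<noteq> m} y \<partial>gam J) / card M
      = (\<Sum>(m, c)\<in>M \<times> C. measure (gam J) {y \<in> space (gam J). D (\<lambda>j\<in>J. y j + a (m, c) j) \<noteq> m}) / card (M \<times> C)"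
      by (simp add: card_cartesian_product sum.cartesian_product[symmetric] sum_divide_distrib[symmetric])
    then show "(\<Sum>m\<in>M. \<integral>y. f m y * indicator {y \<in> space (gam J). D y \<noteq> m} y \<partial>gam J) / card M \<le> \<epsilon>"
      using Pe by simp
  qed
  also have "\<dots> = (\<Sum>m\<in>M. (\<Sum>c\<in>C. \<integral>y. lik J (a (m, c)) y * ln (lik J (a (m, c)) y / ?F y) \<partial>gam J) / ?k) / card M
      - (\<Sum>m\<in>M. iota C J (\<lambda>c. a (m, c))) / card M"
    by (simp add: val sum_subtractf diff_divide_distrib)
  also have "(\<Sum>m\<in>M. (\<Sum>c\<in>C. \<integral>y. lik J (a (m, c)) y * ln (lik J (a (m, c)) y / ?F y) \<partial>gam J) / ?k) / card M = iota (M \<times> C) J a"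
    unfolding iota_eq_lik[OF fin(1) finP]
    by (simp add: card_cartesian_product sum_Times sum_divide_distrib[symmetric] mult.commute)
  finally show ?thesis .
qed

section \<open>Derivatives along a path of degraded channels\<close>

lemma integrable_pwt_err:
  assumes "finite W" "W \<noteq> {}"
  shows "integrable (gam J) (\<lambda>y. (cmod (\<Sum>v\<in>W. complex_of_real (pwt W J a w v y) * (\<xi> w - \<xi> v)))\<^sup>2)"
proof (rule integrable_bounded_gam[where B="(\<Sum>v\<in>W. cmod (\<xi> w - \<xi> v))\<^sup>2"])
  fix y
  have "cmod (\<Sum>v\<in>W. complex_of_real (pwt W J a w v y) * (\<xi> w - \<xi> v)) \<le> (\<Sum>v\<in>W. cmod (complex_of_real (pwt W J a w v y) * (\<xi> w - \<xi> v)))"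
    by (rule norm_sum)
  also have "\<dots> \<le> (\<Sum>v\<in>W. cmod (\<xi> w - \<xi> v))"
    using pwt_nonneg[OF assms, of J a w _ y] pwt_le1[OF assms(1), of _ J a w y]
    by (intro sum_mono) (simp add: norm_mult mult_left_le_one_le abs_of_nonneg)
  finally show "norm ((cmod (\<Sum>v\<in>W. complex_of_real (pwt W J a w v y) * (\<xi> w - \<xi> v)))\<^sup>2) \<le> (\<Sum>v\<in>W. cmod (\<xi> w - \<xi> v))\<^sup>2"
    by (simp add: power_mono)
qed measurable

lemma mse_scale: "mse W J a (\<lambda>w. c * \<xi> w) = (cmod c)\<^sup>2 * mse W J a \<xi>"
proof -
  have *: "(\<Sum>v\<in>W. complex_of_real (pwt W J a w v y) * (c * \<xi> w - c * \<xi> v)) = c * (\<Sum>v\<in>W. complex_of_real (pwt W J a w v y) * (\<xi> w - \<xi> v))" for w y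
    by (simp add: sum_distrib_left right_diff_distrib mult.left_commute)
  show ?thesis unfolding mse_def * norm_mult power_mult_distrib by (simp add: sum_distrib_left)
qed

lemma mse_weighted_sum:
  assumes W: "finite W" "W \<noteq> {}"
  shows "(\<Sum>j\<in>X. \<alpha> j * mse W J a (f j)) = (\<Sum>w\<in>W. \<integral>y. (\<Sum>j\<in>X. \<alpha> j *
      (cmod (\<Sum>v\<in>W. complex_of_real (pwt W J a w v y) * (f j w - f j v)))\<^sup>2) \<partial>gam J) / card W"
proof -
  let ?E = "\<lambda>w \<xi> y. (cmod (\<Sum>v\<in>W. complex_of_real (pwt W J a w v y) * (\<xi> w - \<xi> v)))\<^sup>2"
  have "(\<Sum>j\<in>X. \<alpha> j * mse W J a (f j)) = (\<Sum>j\<in>X. \<Sum>w\<in>W. \<alpha> j * (\<integral>y. ?E w (f j) y \<partial>gam J)) / card W"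
    unfolding mse_def by (simp add: sum_distrib_left sum_divide_distrib)
  also have "(\<Sum>j\<in>X. \<Sum>w\<in>W. \<alpha> j * (\<integral>y. ?E w (f j) y \<partial>gam J)) = (\<Sum>w\<in>W. \<Sum>j\<in>X. \<alpha> j * (\<integral>y. ?E w (f j) y \<partial>gam J))"
    by (rule sum.swap)
  also have "\<dots> = (\<Sum>w\<in>W. \<integral>y. (\<Sum>j\<in>X. \<alpha> j * ?E w (f j) y) \<partial>gam J)"
    using integrable_pwt_err[OF W, of J a] by (intro sum.cong refl) (simp add: Bochner_Integration.integral_sum)
  finally show ?thesis .
qed

text \<open>An inequality between quadratic forms of one common error survives averaging, with
  \<open>p\<close> instantiated by the posterior weights at each value of the noise. The three
  families will belong to the stronger receiver, the weaker receiver and the power constraint; all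
  errors refer to the same observation.\<close>

lemma mse_form_le:
  assumes W: "finite W" "W \<noteq> {}"
    and le: "\<And>w p. w \<in> W \<Longrightarrow> (\<Sum>j\<in>X. \<alpha> j * (cmod (\<Sum>v\<in>W. complex_of_real (p v) * (f j w - f j v)))\<^sup>2)
      \<le> (\<Sum>k\<in>Y. \<beta> k * (cmod (\<Sum>v\<in>W. complex_of_real (p v) * (g k w - g k v)))\<^sup>2)
        + (\<Sum>r\<in>Z. (cmod (\<Sum>v\<in>W. complex_of_real (p v) * (h r w - h r v)))\<^sup>2)"
  shows "(\<Sum>j\<in>X. \<alpha> j * mse W J a (f j)) \<le> (\<Sum>k\<in>Y. \<beta> k * mse W J a (g k)) + (\<Sum>r\<in>Z. mse W J a (h r))"
proof -
  note i = integrable_pwt_err[OF W, of J a]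
  have "(\<Sum>j\<in>X. \<alpha> j * mse W J a (f j)) \<le> (\<Sum>k\<in>Y. \<beta> k * mse W J a (g k)) + (\<Sum>r\<in>Z. 1 * mse W J a (h r))"
    unfolding mse_weighted_sum[OF W] add_divide_distrib[symmetric] sum.distrib[symmetric]
  proof (intro divide_right_mono sum_mono)
    fix w assume w: "w \<in> W"
    let ?E = "\<lambda>\<xi> y. (cmod (\<Sum>v\<in>W. complex_of_real (pwt W J a w v y) * (\<xi> w - \<xi> v)))\<^sup>2"
    have "(\<integral>y. (\<Sum>j\<in>X. \<alpha> j * ?E (f j) y) \<partial>gam J) \<le> (\<integral>y. (\<Sum>k\<in>Y. \<beta> k * ?E (g k) y) + (\<Sum>r\<in>Z. 1 * ?E (h r) y) \<partial>gam J)"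
      using le[OF w] by (intro integral_mono Bochner_Integration.integrable_add Bochner_Integration.integrable_sum integrable_mult_right i) auto
    also have "\<dots> = (\<integral>y. (\<Sum>k\<in>Y. \<beta> k * ?E (g k) y) \<partial>gam J) + (\<integral>y. (\<Sum>r\<in>Z. 1 * ?E (h r) y) \<partial>gam J)"
      by (intro Bochner_Integration.integral_add Bochner_Integration.integrable_sum integrable_mult_right i)
    finally show "(\<integral>y. (\<Sum>j\<in>X. \<alpha> j * ?E (f j) y) \<partial>gam J)
      \<le> (\<integral>y. (\<Sum>k\<in>Y. \<beta> k * ?E (g k) y) \<partial>gam J) + (\<integral>y. (\<Sum>r\<in>Z. 1 * ?E (h r) y) \<partial>gam J)" .
  qed simp
  then show ?thesis by simp
qed

lemma Re_scaled_cnj: "Re ((complex_of_real r * z) * cnj (complex_of_real r' * z)) = (r * r') * (cmod z)\<^sup>2"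
  unfolding cmod_power2 by (simp add: power2_eq_square algebra_simps)

text \<open>With one real amplitude per coordinate, signal and velocity are multiples of the same
  vector entry, so the inner product of their errors is diagonal and only mean square errors of
  unscaled coordinates remain.\<close>

lemma has_real_derivative_iota_scale:
  fixes c c' :: "'j \<Rightarrow> real \<Rightarrow> real" and B :: "'w \<Rightarrow> 'j \<Rightarrow> complex"
  assumes fin: "finite J" "finite W" "W \<noteq> {}"
    and c: "\<And>j t. j \<in> J \<Longrightarrow> (c j has_real_derivative c' j t) (at t)"
    and b: "\<And>j t. j \<in> J \<Longrightarrow> \<bar>c j t\<bar> \<le> R" "\<And>j t. j \<in> J \<Longrightarrow> \<bar>c' j t\<bar> \<le> R"
  shows "((\<lambda>t. iota W J (\<lambda>w j. c j t * B w j)) has_real_derivative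
      (\<Sum>j\<in>J. (2 * c j t * c' j t) * mse W J (\<lambda>w j. c j t * B w j) (\<lambda>w. B w j))) (at t)"
proof -
  let ?a = "\<lambda>t w j. complex_of_real (c j t) * B w j"
  let ?e = "\<lambda>w j y. \<Sum>v\<in>W. complex_of_real (pwt W J (?a t) w v y) * (B w j - B v j)"
  define BB where "BB = R * (\<Sum>w\<in>W. \<Sum>j\<in>J. cmod (B w j))"
  have Bb: "r * cmod (B w j) \<le> BB" if "w \<in> W" "j \<in> J" "r \<le> R" "0 \<le> r" for w j r
  proof -
    have "cmod (B w j) \<le> (\<Sum>j\<in>J. cmod (B w j))" using fin that by (intro member_le_sum) auto
    also have "\<dots> \<le> (\<Sum>w\<in>W. \<Sum>j\<in>J. cmod (B w j))" using fin that by (intro member_le_sum sum_nonneg) auto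
    finally show ?thesis unfolding BB_def using that by (intro mult_mono) auto
  qed
  have "((\<lambda>t. iota W J (?a t)) has_real_derivative
     (\<Sum>w\<in>W. \<integral>y. 2 * cip J (\<lambda>j. \<Sum>v\<in>W. pwt W J (?a t) w v y * (?a t w j - ?a t v j))
                      (\<lambda>j. \<Sum>v\<in>W. pwt W J (?a t) w v y * (complex_of_real (c' j t) * B w j - complex_of_real (c' j t) * B v j)) \<partial>gam J) / card W) (at t)"
  proof (rule has_real_derivative_iota[OF fin, where d=1 and a="?a" and a'="\<lambda>t w j. complex_of_real (c' j t) * B w j" and B=BB])
    show "((\<lambda>t. ?a t w j) has_vector_derivative complex_of_real (c' j t) * B w j) (at t)" if "j \<in> J" for t w j
      using c[OF that, of t] unfolding has_real_derivative_iff_has_vector_derivative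
      by (intro bounded_linear.has_vector_derivative[OF bounded_linear_mult_left] bounded_linear.has_vector_derivative[OF bounded_linear_of_real])
  qed (use Bb b in \<open>auto simp: norm_mult\<close>)
  moreover have "cip J (\<lambda>j. \<Sum>v\<in>W. pwt W J (?a t) w v y * (?a t w j - ?a t v j))
                      (\<lambda>j. \<Sum>v\<in>W. pwt W J (?a t) w v y * (complex_of_real (c' j t) * B w j - complex_of_real (c' j t) * B v j))
     = (\<Sum>j\<in>J. (c j t * c' j t) * (cmod (?e w j y))\<^sup>2)" for w y
  proof -
    have s: "(\<Sum>v\<in>W. complex_of_real (pwt W J (?a t) w v y) * (complex_of_real r * B w j - complex_of_real r * B v j)) = complex_of_real r * ?e w j y" for r j
      by (simp add: sum_distrib_left right_diff_distrib mult.left_commute)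
    show ?thesis unfolding s cip_def Re_scaled_cnj ..
  qed
  moreover have "(\<Sum>w\<in>W. \<integral>y. 2 * (\<Sum>j\<in>J. (c j t * c' j t) * (cmod (?e w j y))\<^sup>2) \<partial>gam J) / card W
     = (\<Sum>j\<in>J. (2 * c j t * c' j t) * mse W J (?a t) (\<lambda>w. B w j))"
  proof -
    have "(\<integral>y. 2 * (\<Sum>j\<in>J. (c j t * c' j t) * (cmod (?e w j y))\<^sup>2) \<partial>gam J) = (\<Sum>j\<in>J. (2 * c j t * c' j t) * (\<integral>y. (cmod (?e w j y))\<^sup>2 \<partial>gam J))" for w
      using integrable_pwt_err[OF fin(2,3), of J "?a t" w "\<lambda>w. B w _"]
      by (simp add: Bochner_Integration.integral_sum sum_distrib_left mult.assoc)
    then have "(\<Sum>w\<in>W. \<integral>y. 2 * (\<Sum>j\<in>J. (c j t * c' j t) * (cmod (?e w j y))\<^sup>2) \<partial>gam J)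
      = (\<Sum>j\<in>J. \<Sum>w\<in>W. (2 * c j t * c' j t) * (\<integral>y. (cmod (?e w j y))\<^sup>2 \<partial>gam J))"
      by (simp only:) (rule sum.swap)
    then show ?thesis unfolding mse_def by (simp add: sum_distrib_left sum_divide_distrib)
  qed
  ultimately show ?thesis by simp
qed

text \<open>Amplitude, relative to unit noise, of a signal of which the power fraction \<open>(sin \<theta>)\<^sup>2\<close> has been
  replaced by independent Gaussian interference of power \<open>(sin \<theta>)\<^sup>2 * d\<close>.\<close>

definition cc :: "real \<Rightarrow> real \<Rightarrow> real" where
  "cc d \<theta> = cos \<theta> / sqrt (1 + (sin \<theta>)\<^sup>2 * d)"

definition cc' :: "real \<Rightarrow> real \<Rightarrow> real" where
  "cc' d \<theta> = - sin \<theta> * (1 + d) / ((1 + (sin \<theta>)\<^sup>2 * d) * sqrt (1 + (sin \<theta>)\<^sup>2 * d))"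

lemma cc_arg: "0 \<le> d \<Longrightarrow> 1 \<le> 1 + (sin \<theta>)\<^sup>2 * (d::real)"
  by simp

lemma cc_sq: "0 \<le> d \<Longrightarrow> (cc d \<theta>)\<^sup>2 = (1 - (sin \<theta>)\<^sup>2) / (1 + (sin \<theta>)\<^sup>2 * d)"
  using cc_arg[of d \<theta>] by (simp add: cc_def power_divide cos_squared_eq)

lemma cc_deriv: assumes d: "0 \<le> d" shows "(cc d has_real_derivative cc' d \<theta>) (at \<theta>)"
proof -
  let ?u = "1 + (sin \<theta>)\<^sup>2 * d"
  have u: "?u > 0" using cc_arg[OF d, of \<theta>] by linarith
  have "((\<lambda>\<theta>. cos \<theta> / sqrt (1 + (sin \<theta>)\<^sup>2 * d)) has_real_derivative
     (- sin \<theta> * sqrt ?u - cos \<theta> * (inverse (sqrt ?u) / 2 * (2 * sin \<theta> * cos \<theta> * d))) / (sqrt ?u * sqrt ?u)) (at \<theta>)"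
    by (rule derivative_eq_intros refl DERIV_real_sqrt_generic | use u in simp)+
  moreover have "(- sin \<theta> * sqrt ?u - cos \<theta> * (inverse (sqrt ?u) / 2 * (2 * sin \<theta> * cos \<theta> * d))) / (sqrt ?u * sqrt ?u) = cc' d \<theta>"
  proof -
    have s: "sqrt ?u > 0" "sqrt ?u * sqrt ?u = ?u" using u by auto
    have "- sin \<theta> * sqrt ?u - cos \<theta> * (inverse (sqrt ?u) / 2 * (2 * sin \<theta> * cos \<theta> * d))
      = (- sin \<theta> * (sqrt ?u * sqrt ?u) - sin \<theta> * (cos \<theta>)\<^sup>2 * d) / sqrt ?u"
      using s(1) by (simp add: field_simps power2_eq_square)
    also have "\<dots> = - sin \<theta> * (?u + (cos \<theta>)\<^sup>2 * d) / sqrt ?u" unfolding s(2) by (simp add: algebra_simps)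
    also have "?u + (cos \<theta>)\<^sup>2 * d = 1 + d" by (simp add: cos_squared_eq algebra_simps)
    finally show ?thesis unfolding cc'_def s(2) by (simp add: mult.commute)
  qed
  ultimately show ?thesis unfolding cc_def[abs_def] by simp
qed

text \<open>With t = (sin \<theta>)^2 the square of \<open>cc\<close> is (1 - t) / (1 + t d), whose
  derivative in t is - (1 + d) / (1 + t d)^2; the remaining factor is the derivative of t.\<close>

lemma cc_cc': assumes d: "0 \<le> d"
  shows "2 * cc d \<theta> * cc' d \<theta> = - (2 * sin \<theta> * cos \<theta>) * ((1 + d) / (1 + (sin \<theta>)\<^sup>2 * d)\<^sup>2)"
proof -
  let ?u = "1 + (sin \<theta>)\<^sup>2 * d"
  have s: "sqrt ?u > 0" "sqrt ?u * sqrt ?u = ?u" using cc_arg[OF d, of \<theta>] by auto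
  have "cc d \<theta> * cc' d \<theta> = - (sin \<theta> * cos \<theta>) * (1 + d) / (?u * (sqrt ?u * sqrt ?u))"
    unfolding cc_def cc'_def by (simp only: times_divide_times_eq mult_minus_left mult_minus_right mult_ac)
  then show ?thesis unfolding s(2) by (simp add: power2_eq_square)
qed

lemma cc_bound: assumes d: "0 \<le> d" shows "\<bar>cc d \<theta>\<bar> \<le> 1 + d" "\<bar>cc' d \<theta>\<bar> \<le> 1 + d"
proof -
  let ?u = "1 + (sin \<theta>)\<^sup>2 * d"
  have s: "sqrt ?u \<ge> 1" "?u \<ge> 1" using cc_arg[OF d, of \<theta>] by auto
  have "\<bar>cc d \<theta>\<bar> \<le> 1 / 1" unfolding cc_def abs_divide using s by (intro frac_le) auto
  then show "\<bar>cc d \<theta>\<bar> \<le> 1 + d" using d by simp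
  have p: "1 * 1 \<le> ?u * sqrt ?u" using s by (intro mult_mono) auto
  have "\<bar>cc' d \<theta>\<bar> = \<bar>sin \<theta>\<bar> * (1 + d) / (?u * sqrt ?u)"
    unfolding cc'_def abs_divide abs_mult using s d by simp
  also have "\<dots> \<le> 1 * (1 + d) / 1" using s p d by (intro frac_le mult_right_mono) auto
  finally show "\<bar>cc' d \<theta>\<bar> \<le> 1 + d" by simp
qed

section \<open>The path from the code to a Gaussian input\<close>

lemma sum_pair_delta:
  fixes f :: "nat \<Rightarrow> 'a::comm_monoid_add" and i n m :: nat
  assumes "i < n"
  shows "(\<Sum>p\<in>{..<n} \<times> {..<m}. if fst p = i then f (snd p) else 0) = (\<Sum>j<m. f j)"
proof -
  have "(\<Sum>p\<in>{..<n} \<times> {..<m}. if fst p = i then f (snd p) else 0) = (\<Sum>i'<n. \<Sum>j<m. if i' = i then f j else 0)"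
    by (simp only: sum_Times fst_conv snd_conv)
  also have "\<dots> = (\<Sum>i'<n. if i' = i then (\<Sum>j<m. f j) else 0)"
    by (intro sum.cong refl) auto
  also have "\<dots> = (\<Sum>j<m. f j)" by (subst sum.delta) (use assms in auto)
  finally show ?thesis .
qed

text \<open>An abstract form of the optimality conditions. In the main application \<open>B\<close>
  and \<open>B1\<close> are the received signals in coordinates where the noise is white and the
  optimal Gaussian covariance Q arrives diagonally, with entries \<open>d\<close> and
  \<open>d1\<close>; \<open>T1\<close>, \<open>Td\<close> and \<open>TB\<close> say that the second
  receiver is degraded. \<open>mu\<close> is the image of the input under a root R of the remaining
  multiplier, and \<open>N\<close> is R Q A^H, where A produces \<open>B\<close>. \<open>Nsq\<close>
  is complementary slackness on the columns of Q A^H, and \<open>form\<close> is the stationarity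
  inequality at the vectors that occur on the path. Without matrices in the assumptions, the same
  argument also covers a single receiver.\<close>

locale degraded_path =
  fixes W :: "'w set" and n m m1 q :: nat and a b :: real
    and B B1 mu :: "'w \<Rightarrow> nat \<Rightarrow> nat \<Rightarrow> complex"
    and T N :: "nat \<Rightarrow> nat \<Rightarrow> complex" and d d1 :: "nat \<Rightarrow> real"
  assumes W: "finite W" "W \<noteq> {}"
    and ab: "0 \<le> a" "0 \<le> b"
    and d: "\<And>j. j < m \<Longrightarrow> 0 \<le> d j" and d1: "\<And>k. k < m1 \<Longrightarrow> 0 \<le> d1 k"
    and T1: "\<And>k l. k < m1 \<Longrightarrow> l < m1 \<Longrightarrow> (\<Sum>j<m. T k j * cnj (T l j)) = (if k = l then 1 else 0)"
    and Td: "\<And>k l. k < m1 \<Longrightarrow> l < m1 \<Longrightarrow> (\<Sum>j<m. of_real (d j) * (T k j * cnj (T l j))) = (if k = l then of_real (d1 k) else 0)"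
    and TB: "\<And>w i k. w \<in> W \<Longrightarrow> i < n \<Longrightarrow> k < m1 \<Longrightarrow> B1 w i k = (\<Sum>j<m. T k j * B w i j)"
    and Nsq: "\<And>j. j < m \<Longrightarrow> (\<Sum>r<q. (cmod (N r j))\<^sup>2) =
        b * ((d j)\<^sup>2 / (1 + d j)) - (\<Sum>k<m1. a / (1 + d1 k) * ((cmod (T k j))\<^sup>2 * (d j)\<^sup>2))"
    and form: "\<And>t w i p. 0 \<le> t \<Longrightarrow> t \<le> 1 \<Longrightarrow> w \<in> W \<Longrightarrow> i < n \<Longrightarrow>
       (\<Sum>j<m. b * (1 + d j) / (1 + t * d j)\<^sup>2 * (cmod (\<Sum>v\<in>W. complex_of_real (p v) * (B w i j - B v i j)))\<^sup>2)
       \<le> (\<Sum>k<m1. a / (1 + d1 k) * (cmod (\<Sum>v\<in>W. complex_of_real (p v) *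
             ((B1 w i k + (\<Sum>j<m. T k j * of_real (d j * ((1 - t) / (1 + t * d j))) * B w i j))
              - (B1 v i k + (\<Sum>j<m. T k j * of_real (d j * ((1 - t) / (1 + t * d j))) * B v i j)))))\<^sup>2)
        + (\<Sum>r<q. (cmod (\<Sum>v\<in>W. complex_of_real (p v) *
             ((mu w i r + (\<Sum>j<m. N r j * of_real ((1 - t) / (1 + t * d j)) * B w i j))
              - (mu v i r + (\<Sum>j<m. N r j * of_real ((1 - t) / (1 + t * d j)) * B v i j)))))\<^sup>2)"
begin

abbreviation "J \<equiv> {..<n} \<times> {..<m}"
abbreviation "K \<equiv> {..<n} \<times> {..<m1}"

text \<open>The code's signal on the path divided by the standard deviation of noise plus
  interference, so that the noise measure is \<open>gam J\<close> for every angle.\<close>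

definition sg :: "real \<Rightarrow> 'w \<Rightarrow> nat \<times> nat \<Rightarrow> complex" where
  "sg \<theta> w p = of_real (cc (d (snd p)) \<theta>) * B w (fst p) (snd p)"

definition sg1 :: "real \<Rightarrow> 'w \<Rightarrow> nat \<times> nat \<Rightarrow> complex" where
  "sg1 \<theta> w p = of_real (cc (d1 (snd p)) \<theta>) * B1 w (fst p) (snd p)"

lemma u_pos: "j < m \<Longrightarrow> 0 < 1 + (sin \<theta>)\<^sup>2 * d j" and u1_pos: "k < m1 \<Longrightarrow> 0 < 1 + (sin \<theta>)\<^sup>2 * d1 k"
  using cc_arg[OF d, of j \<theta>] cc_arg[OF d1, of k \<theta>] by linarith+

text \<open>The target is \<open>B1\<close> plus a linear function of the stronger receiver's
  signal. For the weaker receiver the matching linear function has the single coefficient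
  \<open>d1 k\<close> times an amplitude, so there the target is a multiple of \<open>B1\<close>.
  The last two terms are the noise energies of the two linear functions.\<close>

lemma mse_step_T:
  assumes i: "i < n" and k: "k < m1"
  shows "mse W J (sg \<theta>) (\<lambda>w. B1 w i k + (\<Sum>j<m. T k j * of_real (d j * ((1 - (sin \<theta>)\<^sup>2) / (1 + (sin \<theta>)\<^sup>2 * d j))) * B w i j))
    \<le> ((1 + d1 k) / (1 + (sin \<theta>)\<^sup>2 * d1 k))\<^sup>2 * mse W K (sg1 \<theta>) (\<lambda>w. B1 w i k)
      + (\<Sum>j<m. (cmod (T k j))\<^sup>2 * (d j)\<^sup>2 * ((1 - (sin \<theta>)\<^sup>2) / (1 + (sin \<theta>)\<^sup>2 * d j)))
      - (d1 k)\<^sup>2 * ((1 - (sin \<theta>)\<^sup>2) / (1 + (sin \<theta>)\<^sup>2 * d1 k))"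
proof -
  define u where "u j = sqrt (1 + (sin \<theta>)\<^sup>2 * d j)" for j
  define u1 where "u1 k = sqrt (1 + (sin \<theta>)\<^sup>2 * d1 k)" for k
  have up: "u j > 0" "u j * u j = 1 + (sin \<theta>)\<^sup>2 * d j" if "j < m" for j
    using u_pos[OF that, of \<theta>] by (auto simp: u_def)
  have un: "u j \<noteq> 0" if "j < m" for j using up(1)[OF that] by simp
  have u1p: "u1 k > 0" "u1 k * u1 k = 1 + (sin \<theta>)\<^sup>2 * d1 k" if "k < m1" for k
    using u1_pos[OF that, of \<theta>] by (auto simp: u1_def)
  \<comment> \<open>Each receiver is normalised by its own noise level, so \<open>T\<close> is
    rescaled by a ratio of standard deviations. The rows remain orthonormal because \<open>T\<close>
    carries both the white noise (\<open>T1\<close>) and the interference (\<open>Td\<close>) to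
    diagonal form.\<close>
  define TT where "TT p p' = (if fst p' = fst p then T (snd p) (snd p') * of_real (u (snd p') / u1 (snd p)) else 0)" for p p' :: "nat \<times> nat"
  define P where "P p = (if fst p = i then T k (snd p) * of_real (d (snd p) * cc (d (snd p)) \<theta>) else 0)" for p :: "nat \<times> nat"
  define P' where "P' p = (if p = (i, k) then complex_of_real (d1 k * cc (d1 k) \<theta>) else 0)" for p :: "nat \<times> nat"
  have Tu: "(\<Sum>j<m. T k j * cnj (T l j) * of_real (u j * u j)) = (if k = l then of_real (u1 k * u1 k) else 0)"
    if "k < m1" "l < m1" for k l
  proof -
    have "(\<Sum>j<m. T k j * cnj (T l j) * of_real (u j * u j)) =
       (\<Sum>j<m. T k j * cnj (T l j) + of_real ((sin \<theta>)\<^sup>2) * (of_real (d j) * (T k j * cnj (T l j))))"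
    proof (intro sum.cong refl)
      fix j assume "j \<in> {..<m}"
      then have "complex_of_real (u j * u j) = 1 + of_real ((sin \<theta>)\<^sup>2) * of_real (d j)"
        using arg_cong[OF up(2), of j complex_of_real] by simp
      then show "T k j * cnj (T l j) * of_real (u j * u j) = T k j * cnj (T l j) + of_real ((sin \<theta>)\<^sup>2) * (of_real (d j) * (T k j * cnj (T l j)))"
        by (simp add: algebra_simps)
    qed
    also have "\<dots> = (\<Sum>j<m. T k j * cnj (T l j)) + of_real ((sin \<theta>)\<^sup>2) * (\<Sum>j<m. of_real (d j) * (T k j * cnj (T l j)))"
      by (simp only: sum.distrib sum_distrib_left)
    finally have "(\<Sum>j<m. T k j * cnj (T l j) * of_real (u j * u j)) = \<dots>" .
    then show ?thesis
      using T1[OF that] Td[OF that] arg_cong[OF u1p(2)[OF that(1)], where f=complex_of_real] by auto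
  qed
  have co: "coisom J K TT"
    unfolding coisom_def
  proof (intro ballI)
    fix p1 p2 assume p: "p1 \<in> K" "p2 \<in> K"
    obtain i1 k1 i2 k2 where e: "p1 = (i1, k1)" "p2 = (i2, k2)" by (metis surj_pair)
    have lt: "i1 < n" "k1 < m1" "i2 < n" "k2 < m1" using p e by auto
    have "(\<Sum>p\<in>J. TT p1 p * cnj (TT p2 p)) = (\<Sum>p\<in>J. if fst p = i1 then
        (if i1 = i2 then T k1 (snd p) * cnj (T k2 (snd p)) * of_real (u (snd p) * u (snd p)) / of_real (u1 k1 * u1 k2) else 0) else 0)"
      by (intro sum.cong refl) (auto simp: TT_def e mult_ac)
    also have "\<dots> = (\<Sum>j<m. if i1 = i2 then T k1 j * cnj (T k2 j) * of_real (u j * u j) / of_real (u1 k1 * u1 k2) else 0)"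
      by (rule sum_pair_delta[OF lt(1)])
    also have "\<dots> = (if i1 = i2 then (\<Sum>j<m. T k1 j * cnj (T k2 j) * of_real (u j * u j)) / of_real (u1 k1 * u1 k2) else 0)"
      by (simp add: sum_divide_distrib)
    also have "\<dots> = (if p1 = p2 then 1 else 0)"
      unfolding Tu[OF lt(2,4)] e using u1p(1)[OF lt(2)] by auto
    finally show "(\<Sum>p\<in>J. TT p1 p * cnj (TT p2 p)) = (if p1 = p2 then 1 else 0)" .
  qed
  have a1: "sg1 \<theta> w p = (\<Sum>j\<in>J. TT p j * sg \<theta> w j)" if w: "w \<in> W" and p: "p \<in> K" for w p
  proof -
    obtain i1 k1 where e: "p = (i1, k1)" by (metis surj_pair)
    have lt: "i1 < n" "k1 < m1" using p e by auto
    have "(\<Sum>j\<in>J. TT p j * sg \<theta> w j) = (\<Sum>p'\<in>J. if fst p' = i1 then (of_real (cos \<theta> / u1 k1) * (T k1 (snd p') * B w i1 (snd p'))) else 0)"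
      using un by (intro sum.cong refl) (auto simp: TT_def sg_def e cc_def u_def[symmetric])
    also have "\<dots> = (\<Sum>j<m. of_real (cos \<theta> / u1 k1) * (T k1 j * B w i1 j))" by (rule sum_pair_delta[OF lt(1)])
    also have "\<dots> = sg1 \<theta> w p" using TB[OF w lt] by (simp add: sg1_def e cc_def u1_def sum_distrib_left[symmetric] sum_divide_distrib[symmetric])
    finally show ?thesis by simp
  qed
  have p': "P' p = (\<Sum>j\<in>J. P j * cnj (TT p j))" if p: "p \<in> K" for p
  proof -
    obtain i1 k1 where e: "p = (i1, k1)" by (metis surj_pair)
    have lt: "i1 < n" "k1 < m1" using p e by auto
    have "(\<Sum>j\<in>J. P j * cnj (TT p j)) = (\<Sum>p'\<in>J. if fst p' = i1 then (if i1 = i then of_real (cos \<theta> / u1 k1) * (of_real (d (snd p')) * (T k (snd p') * cnj (T k1 (snd p')))) else 0) else 0)"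
      using un by (intro sum.cong refl) (auto simp: TT_def P_def e cc_def u_def[symmetric])
    also have "\<dots> = (\<Sum>j<m. if i1 = i then of_real (cos \<theta> / u1 k1) * (of_real (d j) * (T k j * cnj (T k1 j))) else 0)" by (rule sum_pair_delta[OF lt(1)])
    also have "\<dots> = (if i1 = i then of_real (cos \<theta> / u1 k1) * (\<Sum>j<m. of_real (d j) * (T k j * cnj (T k1 j))) else 0)"
      by (simp add: sum_distrib_left)
    also have "\<dots> = P' p" unfolding Td[OF k lt(2)] by (auto simp: P'_def e cc_def u1_def)
    finally show ?thesis by simp
  qed
  have main: "mse W J (sg \<theta>) (\<lambda>w. B1 w i k + (\<Sum>j\<in>J. P j * sg \<theta> w j))
    \<le> mse W K (sg1 \<theta>) (\<lambda>w. B1 w i k + (\<Sum>k\<in>K. P' k * sg1 \<theta> w k)) + csq J P - csq K P'"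
    by (rule mse_degraded[OF _ _ W co a1 p']) auto
  have e1: "(\<Sum>j\<in>J. P j * sg \<theta> w j) = (\<Sum>j<m. T k j * of_real (d j * ((1 - (sin \<theta>)\<^sup>2) / (1 + (sin \<theta>)\<^sup>2 * d j))) * B w i j)" for w
  proof -
    have "(\<Sum>p\<in>J. P p * sg \<theta> w p) = (\<Sum>p\<in>J. if fst p = i then T k (snd p) * of_real (d (snd p) * ((cc (d (snd p)) \<theta>)\<^sup>2)) * B w i (snd p) else 0)"
      by (intro sum.cong refl) (auto simp: P_def sg_def power2_eq_square)
    also have "\<dots> = (\<Sum>j<m. T k j * of_real (d j * ((cc (d j) \<theta>)\<^sup>2)) * B w i j)" by (rule sum_pair_delta[OF i])
    also have "\<dots> = (\<Sum>j<m. T k j * of_real (d j * ((1 - (sin \<theta>)\<^sup>2) / (1 + (sin \<theta>)\<^sup>2 * d j))) * B w i j)"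
      by (intro sum.cong refl) (simp only: cc_sq d lessThan_iff)
    finally show ?thesis .
  qed
  have ik: "(i, k) \<in> K" using i k by simp
  have e2: "(\<Sum>p\<in>K. P' p * sg1 \<theta> w p) = of_real (d1 k * (cc (d1 k) \<theta>)\<^sup>2) * B1 w i k" for w
  proof -
    have "(\<Sum>p\<in>K. P' p * sg1 \<theta> w p) = (\<Sum>p\<in>K. if p = (i, k) then of_real (d1 k * (cc (d1 k) \<theta>)\<^sup>2) * B1 w i k else 0)"
      by (intro sum.cong refl) (auto simp: P'_def sg1_def power2_eq_square)
    also have "\<dots> = of_real (d1 k * (cc (d1 k) \<theta>)\<^sup>2) * B1 w i k" using ik by (simp add: sum.delta)
    finally show ?thesis .
  qed
  have f: "1 + d1 k * (cc (d1 k) \<theta>)\<^sup>2 = (1 + d1 k) / (1 + (sin \<theta>)\<^sup>2 * d1 k)"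
    using u1_pos[OF k, of \<theta>] unfolding cc_sq[OF d1[OF k]] by (simp add: field_simps)
  have e3: "mse W K (sg1 \<theta>) (\<lambda>w. B1 w i k + (\<Sum>k\<in>K. P' k * sg1 \<theta> w k)) = ((1 + d1 k) / (1 + (sin \<theta>)\<^sup>2 * d1 k))\<^sup>2 * mse W K (sg1 \<theta>) (\<lambda>w. B1 w i k)"
  proof -
    have "(\<lambda>w. B1 w i k + (\<Sum>k\<in>K. P' k * sg1 \<theta> w k)) = (\<lambda>w. complex_of_real ((1 + d1 k) / (1 + (sin \<theta>)\<^sup>2 * d1 k)) * B1 w i k)"
      unfolding e2 f[symmetric] by (simp add: algebra_simps)
    then show ?thesis by (simp only: mse_scale norm_of_real power2_abs)
  qed
  have e4: "csq J P = (\<Sum>j<m. (cmod (T k j))\<^sup>2 * (d j)\<^sup>2 * ((1 - (sin \<theta>)\<^sup>2) / (1 + (sin \<theta>)\<^sup>2 * d j)))"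
  proof -
    have "csq J P = (\<Sum>p\<in>J. if fst p = i then (cmod (T k (snd p)))\<^sup>2 * (d (snd p))\<^sup>2 * (cc (d (snd p)) \<theta>)\<^sup>2 else 0)"
      unfolding csq_def by (intro sum.cong refl) (auto simp: P_def norm_mult power_mult_distrib)
    also have "\<dots> = (\<Sum>j<m. (cmod (T k j))\<^sup>2 * (d j)\<^sup>2 * (cc (d j) \<theta>)\<^sup>2)" by (rule sum_pair_delta[OF i])
    also have "\<dots> = (\<Sum>j<m. (cmod (T k j))\<^sup>2 * (d j)\<^sup>2 * ((1 - (sin \<theta>)\<^sup>2) / (1 + (sin \<theta>)\<^sup>2 * d j)))"
      by (intro sum.cong refl) (simp only: cc_sq d lessThan_iff)
    finally show ?thesis .
  qed
  have e5: "csq K P' = (d1 k)\<^sup>2 * ((1 - (sin \<theta>)\<^sup>2) / (1 + (sin \<theta>)\<^sup>2 * d1 k))"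
  proof -
    have "csq K P' = (\<Sum>p\<in>K. if p = (i, k) then (d1 k)\<^sup>2 * (cc (d1 k) \<theta>)\<^sup>2 else 0)"
      unfolding csq_def by (intro sum.cong refl) (auto simp: P'_def norm_mult power_mult_distrib)
    also have "\<dots> = (d1 k)\<^sup>2 * (cc (d1 k) \<theta>)\<^sup>2" using ik by (simp add: sum.delta)
    finally show ?thesis unfolding cc_sq[OF d1[OF k]] .
  qed
  show ?thesis using main unfolding e1 e3 e4 e5 .
qed

text \<open>The comparison of degraded observations with the empty index set as the weaker receiver:
  its error is the plain variance, and the linear part of the target costs its whole noise
  energy.\<close>

lemma mse_step_M:
  assumes i: "i < n"
  shows "mse W J (sg \<theta>) (\<lambda>w. mu w i r + (\<Sum>j<m. N r j * of_real ((1 - (sin \<theta>)\<^sup>2) / (1 + (sin \<theta>)\<^sup>2 * d j)) * B w i j))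
    \<le> mse W ({}::nat set) (\<lambda>_ _. 0) (\<lambda>w. mu w i r) + (\<Sum>j<m. (cmod (N r j))\<^sup>2 * ((1 - (sin \<theta>)\<^sup>2) / (1 + (sin \<theta>)\<^sup>2 * d j)))"
proof -
  define P where "P p = (if fst p = i then N r (snd p) * of_real (cc (d (snd p)) \<theta>) else 0)" for p :: "nat \<times> nat"
  have main: "mse W J (sg \<theta>) (\<lambda>w. mu w i r + (\<Sum>j\<in>J. P j * sg \<theta> w j))
    \<le> mse W ({}::nat set) (\<lambda>_ _. 0) (\<lambda>w. mu w i r + (\<Sum>k\<in>({}::nat set). 0 * 0)) + csq J P - csq ({}::nat set) (\<lambda>_. 0)"
    by (rule mse_degraded[OF _ _ W, where T="\<lambda>_ _. 0"]) (auto simp: coisom_def)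
  have e1: "(\<Sum>j\<in>J. P j * sg \<theta> w j) = (\<Sum>j<m. N r j * of_real ((1 - (sin \<theta>)\<^sup>2) / (1 + (sin \<theta>)\<^sup>2 * d j)) * B w i j)" for w
  proof -
    have "(\<Sum>p\<in>J. P p * sg \<theta> w p) = (\<Sum>p\<in>J. if fst p = i then N r (snd p) * of_real ((cc (d (snd p)) \<theta>)\<^sup>2) * B w i (snd p) else 0)"
      by (intro sum.cong refl) (auto simp: P_def sg_def power2_eq_square)
    also have "\<dots> = (\<Sum>j<m. N r j * of_real ((cc (d j) \<theta>)\<^sup>2) * B w i j)" by (rule sum_pair_delta[OF i])
    also have "\<dots> = (\<Sum>j<m. N r j * of_real ((1 - (sin \<theta>)\<^sup>2) / (1 + (sin \<theta>)\<^sup>2 * d j)) * B w i j)"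
      by (intro sum.cong refl) (simp only: cc_sq d lessThan_iff)
    finally show ?thesis .
  qed
  have e4: "csq J P = (\<Sum>j<m. (cmod (N r j))\<^sup>2 * ((1 - (sin \<theta>)\<^sup>2) / (1 + (sin \<theta>)\<^sup>2 * d j)))"
  proof -
    have "csq J P = (\<Sum>p\<in>J. if fst p = i then (cmod (N r (snd p)))\<^sup>2 * (cc (d (snd p)) \<theta>)\<^sup>2 else 0)"
      unfolding csq_def by (intro sum.cong refl) (auto simp: P_def norm_mult power_mult_distrib)
    also have "\<dots> = (\<Sum>j<m. (cmod (N r j))\<^sup>2 * (cc (d j) \<theta>)\<^sup>2)" by (rule sum_pair_delta[OF i])
    also have "\<dots> = (\<Sum>j<m. (cmod (N r j))\<^sup>2 * ((1 - (sin \<theta>)\<^sup>2) / (1 + (sin \<theta>)\<^sup>2 * d j)))"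
      by (intro sum.cong refl) (simp only: cc_sq d lessThan_iff)
    finally show ?thesis .
  qed
  show ?thesis using main unfolding e1 e4 by (simp add: csq_def)
qed

text \<open>The derivative of the objective along the path, divided by \<open>2 * sin \<theta> * cos \<theta>\<close>,
  is nonnegative.\<close>

lemma path_inequality:
  assumes t: "t = (sin \<theta>)\<^sup>2"
  shows "(\<Sum>p\<in>J. b * (1 + d (snd p)) / (1 + t * d (snd p))\<^sup>2 * mse W J (sg \<theta>) (\<lambda>w. B w (fst p) (snd p)))
    \<le> (\<Sum>p\<in>K. a * (1 + d1 (snd p)) / (1 + t * d1 (snd p))\<^sup>2 * mse W K (sg1 \<theta>) (\<lambda>w. B1 w (fst p) (snd p)))
      + (\<Sum>i<n. \<Sum>r<q. mse W ({}::nat set) (\<lambda>_ _. 0) (\<lambda>w. mu w i r))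
      + n * (b * (\<Sum>j<m. d j / (1 + t * d j) - d j / (1 + d j)) - a * (\<Sum>k<m1. d1 k / (1 + t * d1 k) - d1 k / (1 + d1 k)))"
proof -
  have t01: "0 \<le> t" "t \<le> 1" unfolding t by (auto simp: abs_square_le_1)
  define s where "s j = (1 - t) / (1 + t * d j)" for j
  define s1 where "s1 k = (1 - t) / (1 + t * d1 k)" for k
  define X where "X w i k = B1 w i k + (\<Sum>j<m. T k j * of_real (d j * s j) * B w i j)" for w i k
  define Y where "Y w i r = mu w i r + (\<Sum>j<m. N r j * of_real (s j) * B w i j)" for w i r
  define V where "V i r = mse W ({}::nat set) (\<lambda>_ _. 0) (\<lambda>w. mu w i r)" for i r
  let ?M1 = "\<lambda>i k. mse W K (sg1 \<theta>) (\<lambda>w. B1 w i k)"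
  have s0: "0 \<le> s j" if "j < m" for j using t01 u_pos[OF that, of \<theta>] by (simp add: s_def t)
  \<comment> \<open>Stationarity averaged over the posterior of the stronger receiver. All three
    terms still refer to the observation \<open>sg \<theta>\<close>; the facts \<open>X\<close> and
    \<open>Y\<close> move the right-hand ones to the weaker receiver and to no observation.\<close>
  have A: "(\<Sum>j<m. b * (1 + d j) / (1 + t * d j)\<^sup>2 * mse W J (sg \<theta>) (\<lambda>w. B w i j))
    \<le> (\<Sum>k<m1. a / (1 + d1 k) * mse W J (sg \<theta>) (\<lambda>w. X w i k)) + (\<Sum>r<q. mse W J (sg \<theta>) (\<lambda>w. Y w i r))" if i: "i < n" for i
    using form[OF t01 _ i] by (intro mse_form_le[OF W]) (simp add: X_def Y_def s_def)
  have X: "a / (1 + d1 k) * mse W J (sg \<theta>) (\<lambda>w. X w i k)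
    \<le> a * (1 + d1 k) / (1 + t * d1 k)\<^sup>2 * ?M1 i k + a / (1 + d1 k) * (\<Sum>j<m. (cmod (T k j))\<^sup>2 * (d j)\<^sup>2 * s j)
       - a * ((d1 k)\<^sup>2 / (1 + d1 k) * s1 k)" if i: "i < n" and k: "k < m1" for i k
  proof -
    have "a / (1 + d1 k) * mse W J (sg \<theta>) (\<lambda>w. X w i k) \<le> a / (1 + d1 k) * (((1 + d1 k) / (1 + t * d1 k))\<^sup>2 * ?M1 i k
      + (\<Sum>j<m. (cmod (T k j))\<^sup>2 * (d j)\<^sup>2 * s j) - (d1 k)\<^sup>2 * s1 k)"
      using mse_step_T[OF i k, of \<theta>] ab d1[OF k] unfolding X_def s_def s1_def t by (intro mult_left_mono) auto
    also have "\<dots> = (a / (1 + d1 k) * ((1 + d1 k) / (1 + t * d1 k))\<^sup>2) * ?M1 i k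
       + a / (1 + d1 k) * (\<Sum>j<m. (cmod (T k j))\<^sup>2 * (d j)\<^sup>2 * s j) - a * ((d1 k)\<^sup>2 / (1 + d1 k) * s1 k)"
      by (simp add: algebra_simps)
    also have "a / (1 + d1 k) * ((1 + d1 k) / (1 + t * d1 k))\<^sup>2 = a * (1 + d1 k) / (1 + t * d1 k)\<^sup>2"
      using d1[OF k] by (simp add: power2_eq_square power_divide)
    finally show ?thesis .
  qed
  have Y: "mse W J (sg \<theta>) (\<lambda>w. Y w i r) \<le> V i r + (\<Sum>j<m. (cmod (N r j))\<^sup>2 * s j)" if i: "i < n" for i r
    using mse_step_M[OF i, of \<theta> r] unfolding Y_def s_def V_def t .
  \<comment> \<open>Slackness balances the noise energies: those from \<open>N\<close> and those
    from \<open>T\<close> add up to an expression in \<open>d\<close> alone.\<close>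
  have N: "(\<Sum>r<q. \<Sum>j<m. (cmod (N r j))\<^sup>2 * s j) + (\<Sum>k<m1. a / (1 + d1 k) * (\<Sum>j<m. (cmod (T k j))\<^sup>2 * (d j)\<^sup>2 * s j))
     = b * (\<Sum>j<m. (d j)\<^sup>2 / (1 + d j) * s j)"
  proof -
    have "(\<Sum>r<q. \<Sum>j<m. (cmod (N r j))\<^sup>2 * s j) = (\<Sum>j<m. (\<Sum>r<q. (cmod (N r j))\<^sup>2) * s j)"
      by (subst sum.swap) (simp add: sum_distrib_right)
    also have "\<dots> = (\<Sum>j<m. (b * ((d j)\<^sup>2 / (1 + d j)) - (\<Sum>k<m1. a / (1 + d1 k) * ((cmod (T k j))\<^sup>2 * (d j)\<^sup>2))) * s j)"
      using Nsq by simp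
    also have "\<dots> = b * (\<Sum>j<m. (d j)\<^sup>2 / (1 + d j) * s j) - (\<Sum>j<m. \<Sum>k<m1. a / (1 + d1 k) * ((cmod (T k j))\<^sup>2 * (d j)\<^sup>2 * s j))"
      by (simp add: left_diff_distrib sum_subtractf sum_distrib_left sum_distrib_right mult.assoc)
    also have "(\<Sum>j<m. \<Sum>k<m1. a / (1 + d1 k) * ((cmod (T k j))\<^sup>2 * (d j)\<^sup>2 * s j)) = (\<Sum>k<m1. a / (1 + d1 k) * (\<Sum>j<m. (cmod (T k j))\<^sup>2 * (d j)\<^sup>2 * s j))"
      by (subst sum.swap) (simp add: sum_distrib_left)
    finally show ?thesis by simp
  qed
  \<comment> \<open>With \<open>s j\<close> inserted, the energy is the derivative of ln (1 + t d)
    in t minus its value at the Gaussian end t = 1.\<close>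
  have ds: "(d j)\<^sup>2 / (1 + d j) * s j = d j / (1 + t * d j) - d j / (1 + d j)" if "j < m" for j
    using d[OF that] u_pos[OF that, of \<theta>] unfolding s_def t[symmetric] by (simp add: field_simps power2_eq_square)
  have ds1: "(d1 k)\<^sup>2 / (1 + d1 k) * s1 k = d1 k / (1 + t * d1 k) - d1 k / (1 + d1 k)" if "k < m1" for k
    using d1[OF that] u1_pos[OF that, of \<theta>] unfolding s1_def t[symmetric] by (simp add: field_simps power2_eq_square)
  define R where "R = b * (\<Sum>j<m. d j / (1 + t * d j) - d j / (1 + d j)) - a * (\<Sum>k<m1. d1 k / (1 + t * d1 k) - d1 k / (1 + d1 k))"
  have per: "(\<Sum>j<m. b * (1 + d j) / (1 + t * d j)\<^sup>2 * mse W J (sg \<theta>) (\<lambda>w. B w i j))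
    \<le> (\<Sum>k<m1. a * (1 + d1 k) / (1 + t * d1 k)\<^sup>2 * ?M1 i k) + (\<Sum>r<q. V i r) + R" if i: "i < n" for i
  proof -
    have "(\<Sum>j<m. b * (1 + d j) / (1 + t * d j)\<^sup>2 * mse W J (sg \<theta>) (\<lambda>w. B w i j))
      \<le> (\<Sum>k<m1. a * (1 + d1 k) / (1 + t * d1 k)\<^sup>2 * ?M1 i k + a / (1 + d1 k) * (\<Sum>j<m. (cmod (T k j))\<^sup>2 * (d j)\<^sup>2 * s j)
       - a * ((d1 k)\<^sup>2 / (1 + d1 k) * s1 k)) + (\<Sum>r<q. V i r + (\<Sum>j<m. (cmod (N r j))\<^sup>2 * s j))"
      using X[OF i] Y[OF i] by (intro order_trans[OF A[OF i]] add_mono sum_mono) auto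
    also have "\<dots> = (\<Sum>k<m1. a * (1 + d1 k) / (1 + t * d1 k)\<^sup>2 * ?M1 i k) + (\<Sum>r<q. V i r)
       + b * (\<Sum>j<m. (d j)\<^sup>2 / (1 + d j) * s j) - a * (\<Sum>k<m1. (d1 k)\<^sup>2 / (1 + d1 k) * s1 k)"
      using N by (simp add: sum.distrib sum_subtractf sum_distrib_left)
    also have "(\<Sum>j<m. (d j)\<^sup>2 / (1 + d j) * s j) = (\<Sum>j<m. d j / (1 + t * d j) - d j / (1 + d j))"
      using ds by (intro sum.cong refl) simp
    also have "(\<Sum>k<m1. (d1 k)\<^sup>2 / (1 + d1 k) * s1 k) = (\<Sum>k<m1. d1 k / (1 + t * d1 k) - d1 k / (1 + d1 k))"
      using ds1 by (intro sum.cong refl) simp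
    finally show ?thesis by (simp add: R_def)
  qed
  have "(\<Sum>i<n. \<Sum>j<m. b * (1 + d j) / (1 + t * d j)\<^sup>2 * mse W J (sg \<theta>) (\<lambda>w. B w i j))
    \<le> (\<Sum>i<n. (\<Sum>k<m1. a * (1 + d1 k) / (1 + t * d1 k)\<^sup>2 * ?M1 i k) + (\<Sum>r<q. V i r) + R)"
    using per by (intro sum_mono) auto
  then show ?thesis unfolding sum_Times R_def[symmetric] V_def[symmetric] by (simp add: sum.distrib)
qed

text \<open>The function \<open>\<Psi>\<close> does not decrease from the code at angle 0 to the
  Gaussian input at \<open>pi / 2\<close>, where the code's signals and with them both
  \<open>iota\<close> terms vanish.\<close>

theorem extremal_inequality:
  "b * iota W J (\<lambda>w p. B w (fst p) (snd p)) - a * iota W K (\<lambda>w p. B1 w (fst p) (snd p))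
    \<le> n * (b * (\<Sum>j<m. ln (1 + d j)) - a * (\<Sum>k<m1. ln (1 + d1 k)))
      + (\<Sum>i<n. \<Sum>r<q. mse W ({}::nat set) (\<lambda>_ _. 0) (\<lambda>w. mu w i r))
      - n * (b * (\<Sum>j<m. d j / (1 + d j)) - a * (\<Sum>k<m1. d1 k / (1 + d1 k)))"
proof -
  define V where "V = (\<Sum>i<n. \<Sum>r<q. mse W ({}::nat set) (\<lambda>_ _. 0) (\<lambda>w. mu w i r))"
  define tm where "tm = b * (\<Sum>j<m. d j / (1 + d j)) - a * (\<Sum>k<m1. d1 k / (1 + d1 k))"
  \<comment> \<open>The logarithms are the information carried by the Gaussian part of the input, so
    each bracket is the information on the whole input. \<open>V\<close> and \<open>n * tm\<close>
    are the charges for power at the two ends; they are interpolated linearly in the power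
    fraction.\<close>
  define \<Psi> where "\<Psi> \<theta> = b * (iota W J (sg \<theta>) + n * (\<Sum>j<m. ln (1 + (sin \<theta>)\<^sup>2 * d j)))
     - a * (iota W K (sg1 \<theta>) + n * (\<Sum>k<m1. ln (1 + (sin \<theta>)\<^sup>2 * d1 k))) - (cos \<theta>)\<^sup>2 * V - (sin \<theta>)\<^sup>2 * (n * tm)" for \<theta>
  have lnd: "((\<lambda>\<theta>. \<Sum>j<l. ln (1 + (sin \<theta>)\<^sup>2 * e j)) has_real_derivative (2 * sin \<theta> * cos \<theta>) * (\<Sum>j<l. e j / (1 + (sin \<theta>)\<^sup>2 * e j))) (at \<theta>)"
    if "\<And>j. j < l \<Longrightarrow> 0 \<le> e j" for l :: nat and e :: "nat \<Rightarrow> real" and \<theta>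
  proof -
    have "((\<lambda>\<theta>. ln (1 + (sin \<theta>)\<^sup>2 * e j)) has_real_derivative (2 * sin \<theta> * cos \<theta>) * (e j / (1 + (sin \<theta>)\<^sup>2 * e j))) (at \<theta>)" if "j < l" for j
    proof -
      have u: "1 + (sin \<theta>)\<^sup>2 * e j > 0" using cc_arg[OF \<open>\<And>j. j < l \<Longrightarrow> 0 \<le> e j\<close>[OF that], of \<theta>] by linarith
      show ?thesis by (rule derivative_eq_intros refl u)+ (simp add: field_simps)
    qed
    then show ?thesis unfolding sum_distrib_left by (intro DERIV_sum) auto
  qed
  have i0: "((\<lambda>\<theta>. iota W J (sg \<theta>)) has_real_derivative
     (\<Sum>p\<in>J. (2 * cc (d (snd p)) \<theta> * cc' (d (snd p)) \<theta>) * mse W J (sg \<theta>) (\<lambda>w. B w (fst p) (snd p)))) (at \<theta>)" for \<theta>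
    unfolding sg_def
  proof (rule has_real_derivative_iota_scale[OF _ W, where R="1 + (\<Sum>j<m. d j)"])
    fix p \<theta> assume p: "p \<in> J"
    then have "d (snd p) \<le> (\<Sum>j<m. d j)" using d by (intro member_le_sum) auto
    then show "\<bar>cc (d (snd p)) \<theta>\<bar> \<le> 1 + (\<Sum>j<m. d j)" "\<bar>cc' (d (snd p)) \<theta>\<bar> \<le> 1 + (\<Sum>j<m. d j)"
      using cc_bound[of "d (snd p)" \<theta>] d[of "snd p"] p by auto
    show "(cc (d (snd p)) has_real_derivative cc' (d (snd p)) \<theta>) (at \<theta>)"
      using p d by (intro cc_deriv) auto
  qed auto
  have i1: "((\<lambda>\<theta>. iota W K (sg1 \<theta>)) has_real_derivative
     (\<Sum>p\<in>K. (2 * cc (d1 (snd p)) \<theta> * cc' (d1 (snd p)) \<theta>) * mse W K (sg1 \<theta>) (\<lambda>w. B1 w (fst p) (snd p)))) (at \<theta>)" for \<theta>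
    unfolding sg1_def
  proof (rule has_real_derivative_iota_scale[OF _ W, where R="1 + (\<Sum>j<m1. d1 j)"])
    fix p \<theta> assume p: "p \<in> K"
    then have "d1 (snd p) \<le> (\<Sum>j<m1. d1 j)" using d1 by (intro member_le_sum) auto
    then show "\<bar>cc (d1 (snd p)) \<theta>\<bar> \<le> 1 + (\<Sum>j<m1. d1 j)" "\<bar>cc' (d1 (snd p)) \<theta>\<bar> \<le> 1 + (\<Sum>j<m1. d1 j)"
      using cc_bound[of "d1 (snd p)" \<theta>] d1[of "snd p"] p by auto
    show "(cc (d1 (snd p)) has_real_derivative cc' (d1 (snd p)) \<theta>) (at \<theta>)"
      using p d1 by (intro cc_deriv) auto
  qed auto
  define D where "D \<theta> = b * ((\<Sum>p\<in>J. (2 * cc (d (snd p)) \<theta> * cc' (d (snd p)) \<theta>) * mse W J (sg \<theta>) (\<lambda>w. B w (fst p) (snd p)))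
        + n * ((2 * sin \<theta> * cos \<theta>) * (\<Sum>j<m. d j / (1 + (sin \<theta>)\<^sup>2 * d j))))
     - a * ((\<Sum>p\<in>K. (2 * cc (d1 (snd p)) \<theta> * cc' (d1 (snd p)) \<theta>) * mse W K (sg1 \<theta>) (\<lambda>w. B1 w (fst p) (snd p)))
        + n * ((2 * sin \<theta> * cos \<theta>) * (\<Sum>k<m1. d1 k / (1 + (sin \<theta>)\<^sup>2 * d1 k))))
     - (- (2 * sin \<theta> * cos \<theta>)) * V - (2 * sin \<theta> * cos \<theta>) * (n * tm)" for \<theta>
  have der: "(\<Psi> has_real_derivative D \<theta>) (at \<theta>)" for \<theta>
  proof -
    have c2: "((\<lambda>\<theta>. (cos \<theta>)\<^sup>2) has_real_derivative - (2 * sin \<theta> * cos \<theta>)) (at \<theta>)"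
      and s2: "((\<lambda>\<theta>. (sin \<theta>)\<^sup>2) has_real_derivative 2 * sin \<theta> * cos \<theta>) (at \<theta>)"
      by (rule derivative_eq_intros refl | simp)+
    show ?thesis unfolding \<Psi>_def[abs_def] D_def
      by (intro DERIV_diff DERIV_add DERIV_cmult DERIV_cmult_right i0 i1 lnd d d1 c2 s2)
  qed
  have D0: "0 \<le> D \<theta>" if "0 \<le> \<theta>" "\<theta> \<le> pi / 2" for \<theta>
  proof -
    \<comment> \<open>The velocity of t = (sin \<theta>)^2, nonnegative on the quarter circle. It is
      a factor of every term of the derivative, which reduces the sign to
      \<open>path_inequality\<close>.\<close>
    let ?\<sigma> = "2 * sin \<theta> * cos \<theta>"
    have \<sigma>: "0 \<le> ?\<sigma>" using that by (intro mult_nonneg_nonneg sin_ge_zero cos_ge_zero) auto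
    define t where "t = (sin \<theta>)\<^sup>2"
    define S where "S = (\<Sum>p\<in>J. b * (1 + d (snd p)) / (1 + t * d (snd p))\<^sup>2 * mse W J (sg \<theta>) (\<lambda>w. B w (fst p) (snd p)))"
    define S1 where "S1 = (\<Sum>p\<in>K. a * (1 + d1 (snd p)) / (1 + t * d1 (snd p))\<^sup>2 * mse W K (sg1 \<theta>) (\<lambda>w. B1 w (fst p) (snd p)))"
    have eS: "b * (\<Sum>p\<in>J. (2 * cc (d (snd p)) \<theta> * cc' (d (snd p)) \<theta>) * mse W J (sg \<theta>) (\<lambda>w. B w (fst p) (snd p))) = - ?\<sigma> * S"
      unfolding S_def sum_distrib_left
    proof (intro sum.cong refl)
      fix p assume "p \<in> J"
      then have "0 \<le> d (snd p)" using d by auto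
      then show "b * ((2 * cc (d (snd p)) \<theta> * cc' (d (snd p)) \<theta>) * mse W J (sg \<theta>) (\<lambda>w. B w (fst p) (snd p)))
        = - ?\<sigma> * (b * (1 + d (snd p)) / (1 + t * d (snd p))\<^sup>2 * mse W J (sg \<theta>) (\<lambda>w. B w (fst p) (snd p)))"
        unfolding cc_cc'[OF \<open>0 \<le> d (snd p)\<close>] t_def by simp
    qed
    have eS1: "a * (\<Sum>p\<in>K. (2 * cc (d1 (snd p)) \<theta> * cc' (d1 (snd p)) \<theta>) * mse W K (sg1 \<theta>) (\<lambda>w. B1 w (fst p) (snd p))) = - ?\<sigma> * S1"
      unfolding S1_def sum_distrib_left
    proof (intro sum.cong refl)
      fix p assume "p \<in> K"
      then have "0 \<le> d1 (snd p)" using d1 by auto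
      then show "a * ((2 * cc (d1 (snd p)) \<theta> * cc' (d1 (snd p)) \<theta>) * mse W K (sg1 \<theta>) (\<lambda>w. B1 w (fst p) (snd p)))
        = - ?\<sigma> * (a * (1 + d1 (snd p)) / (1 + t * d1 (snd p))\<^sup>2 * mse W K (sg1 \<theta>) (\<lambda>w. B1 w (fst p) (snd p)))"
        unfolding cc_cc'[OF \<open>0 \<le> d1 (snd p)\<close>] t_def by simp
    qed
    define E where "E = (\<Sum>j<m. d j / (1 + t * d j))"
    define E1 where "E1 = (\<Sum>k<m1. d1 k / (1 + t * d1 k))"
    have "S \<le> S1 + V + n * (b * E - a * E1 - tm)"
      using path_inequality[OF t_def] unfolding S_def S1_def V_def E_def E1_def tm_def
      by (simp add: sum_subtractf algebra_simps)
    then have "0 \<le> ?\<sigma> * (S1 + V + n * (b * E - a * E1 - tm) - S)" by (intro mult_nonneg_nonneg[OF \<sigma>]) simp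
    also have "\<dots> = D \<theta>"
      unfolding D_def distrib_left[of b] distrib_left[of a] eS eS1 t_def[symmetric] E_def[symmetric] E1_def[symmetric]
      by (simp add: algebra_simps)
    finally show ?thesis .
  qed
  have "\<Psi> 0 \<le> \<Psi> (pi / 2)"
    by (rule DERIV_nonneg_imp_nondecreasing) (use der D0 in auto)
  moreover have "sg 0 = (\<lambda>w p. B w (fst p) (snd p))" "sg1 0 = (\<lambda>w p. B1 w (fst p) (snd p))"
    by (auto simp: sg_def sg1_def cc_def fun_eq_iff)
  moreover have "sg (pi / 2) = (\<lambda>w p. 0)" "sg1 (pi / 2) = (\<lambda>w p. 0)"
    by (auto simp: sg_def sg1_def cc_def fun_eq_iff)
  moreover have "iota W J (\<lambda>w p. 0) = 0" "iota W K (\<lambda>w p. 0) = 0"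
    using W by (simp_all add: iota_def llr_def csq_def cip_def)
  ultimately show ?thesis unfolding \<Psi>_def V_def[symmetric] tm_def[symmetric] by (simp add: algebra_simps)
qed

end

section \<open>Positive semidefinite matrices\<close>

lemma mat_mult_index:
  assumes "X \<in> carrier_mat a b" "Y \<in> carrier_mat b c" "i < a" "j < c"
  shows "(X * Y) $$ (i, j) = (\<Sum>l<b. X $$ (i, l) * Y $$ (l, j))"
  using assms by (simp add: scalar_prod_def atLeast0LessThan)

lemma mat_vec_index:
  assumes "X \<in> carrier_mat a b" "v \<in> carrier_vec b" "i < a"
  shows "(X *\<^sub>v v) $ i = (\<Sum>l<b. X $$ (i, l) * v $ l)"
  using assms by (simp add: scalar_prod_def atLeast0LessThan)

lemma adj_carrier[intro]: "A \<in> carrier_mat r c \<Longrightarrow> mat_adjoint A \<in> carrier_mat c r"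
  unfolding mat_adjoint_def by (auto simp: mat_of_rows_def)

lemma adj_dim[simp]: "dim_row (mat_adjoint A) = dim_col A" "dim_col (mat_adjoint A) = dim_row A"
  unfolding mat_adjoint_def by (auto simp: mat_of_rows_def)

lemma adj_index:
  assumes "A \<in> carrier_mat r c" "i < c" "j < r"
  shows "mat_adjoint A $$ (i, j) = cnj (A $$ (j, i))"
  using assms unfolding mat_adjoint_def by (auto simp: mat_of_rows_def vec_of_list_index conjugate_vec_def)

lemma adj_adj:
  fixes A :: "complex mat"
  assumes "A \<in> carrier_mat r c" shows "mat_adjoint (mat_adjoint A) = A"
  by (rule eq_matI) (use assms adj_index[OF assms] adj_index[OF adj_carrier[OF assms]] in auto)

lemma adj_mult:
  fixes A B :: "complex mat"
  assumes A: "A \<in> carrier_mat a b" and B: "B \<in> carrier_mat b c"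
  shows "mat_adjoint (A * B) = mat_adjoint B * mat_adjoint A"
proof (rule eq_matI)
  fix i j assume "i < dim_row (mat_adjoint B * mat_adjoint A)" "j < dim_col (mat_adjoint B * mat_adjoint A)"
  then have i: "i < c" and j: "j < a" using assms adj_carrier[OF A] adj_carrier[OF B] by auto
  have "mat_adjoint (A * B) $$ (i, j) = cnj (\<Sum>l<b. A $$ (j, l) * B $$ (l, i))"
    using adj_index[OF mult_carrier_mat[OF A B] i j] mat_mult_index[OF A B j i] by simp
  also have "\<dots> = (\<Sum>l<b. mat_adjoint B $$ (i, l) * mat_adjoint A $$ (l, j))"
    using adj_index[OF A _ j] adj_index[OF B i] by (simp add: mult.commute)
  also have "\<dots> = (mat_adjoint B * mat_adjoint A) $$ (i, j)"
    using mat_mult_index[OF adj_carrier[OF B] adj_carrier[OF A] i j] by simp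
  finally show "mat_adjoint (A * B) $$ (i, j) = (mat_adjoint B * mat_adjoint A) $$ (i, j)" .
qed (use assms adj_carrier[OF A] adj_carrier[OF B] adj_carrier[OF mult_carrier_mat[OF A B]] in auto)

lemma adj_one: "mat_adjoint (1\<^sub>m k :: complex mat) = 1\<^sub>m k"
  by (rule eq_matI) (use adj_index[OF one_carrier_mat] adj_carrier[OF one_carrier_mat, of k] in auto)

lemma cprod_sum: "v \<in> carrier_vec k \<Longrightarrow> w \<in> carrier_vec k \<Longrightarrow> v \<bullet>c w = (\<Sum>i<k. v $ i * cnj (w $ i))"
  for v w :: "complex Matrix.vec"
  by (simp add: scalar_prod_def atLeast0LessThan conjugate_vec_def)

text \<open>The quadratic form on functions of the index, so that test vectors can be written as
  lambda terms without dimension conditions.\<close>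

definition qform :: "nat \<Rightarrow> complex mat \<Rightarrow> (nat \<Rightarrow> complex) \<Rightarrow> complex" where
  "qform k A f = (\<Sum>i<k. \<Sum>j<k. A $$ (i, j) * f j * cnj (f i))"

lemma qform_cprod:
  assumes A: "A \<in> carrier_mat k k" and v: "v \<in> carrier_vec k"
  shows "(A *\<^sub>v v) \<bullet>c v = qform k A (\<lambda>i. v $ i)"
proof -
  have "(A *\<^sub>v v) \<bullet>c v = (\<Sum>i<k. (A *\<^sub>v v) $ i * cnj (v $ i))"
    using A v by (intro cprod_sum) auto
  then show ?thesis unfolding qform_def using mat_vec_index[OF A v] by (simp add: sum_distrib_right)
qed

lemma psd_qform: "psd k A \<longleftrightarrow> A \<in> carrier_mat k k \<and> (\<forall>f. Im (qform k A f) = 0 \<and> 0 \<le> Re (qform k A f))"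
proof safe
  assume p: "psd k A" then show A: "A \<in> carrier_mat k k" by (simp add: psd_def)
  fix f
  have e: "qform k A f = (A *\<^sub>v vec k f) \<bullet>c vec k f"
    unfolding qform_cprod[OF A vec_carrier] by (simp add: qform_def)
  show "Im (qform k A f) = 0" "0 \<le> Re (qform k A f)" unfolding e using p by (auto simp: psd_def)
next
  assume "A \<in> carrier_mat k k" "\<forall>f. Im (qform k A f) = 0 \<and> 0 \<le> Re (qform k A f)"
  then show "psd k A" unfolding psd_def using qform_cprod[of A k] by simp
qed

lemma psd_carrier: "psd k A \<Longrightarrow> A \<in> carrier_mat k k" by (simp add: psd_def)

lemma qform_two:
  assumes "i < k" "j < k" "i \<noteq> j"
  shows "qform k A (\<lambda>l. if l = i then x else if l = j then y else 0) =
    A $$ (i, i) * x * cnj x + A $$ (i, j) * y * cnj x + A $$ (j, i) * x * cnj y + A $$ (j, j) * y * cnj y"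
proof -
  let ?f = "\<lambda>l. if l = i then x else if l = j then y else 0"
  have s: "(\<Sum>l<k. g l * ?f l) = g i * x + g j * y" for g
  proof -
    have "(\<Sum>l<k. g l * ?f l) = (\<Sum>l<k. (if l = i then g l * x else 0) + (if l = j then g l * y else 0))"
      using assms by (intro sum.cong refl) auto
    also have "\<dots> = g i * x + g j * y" using assms by (simp add: sum.distrib)
    finally show ?thesis .
  qed
  have s': "(\<Sum>l<k. g l * cnj (?f l)) = g i * cnj x + g j * cnj y" for g
  proof -
    have "(\<Sum>l<k. g l * cnj (?f l)) = (\<Sum>l<k. (if l = i then g l * cnj x else 0) + (if l = j then g l * cnj y else 0))"
      using assms by (intro sum.cong refl) auto
    also have "\<dots> = g i * cnj x + g j * cnj y" using assms by (simp add: sum.distrib)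
    finally show ?thesis .
  qed
  have "qform k A ?f = (\<Sum>a<k. (\<Sum>l<k. A $$ (a, l) * ?f l) * cnj (?f a))"
    unfolding qform_def by (simp add: sum_distrib_right)
  also have "\<dots> = (\<Sum>a<k. (A $$ (a, i) * x + A $$ (a, j) * y) * cnj (?f a))" unfolding s ..
  also have "\<dots> = (A $$ (i, i) * x + A $$ (i, j) * y) * cnj x + (A $$ (j, i) * x + A $$ (j, j) * y) * cnj y" unfolding s' ..
  finally show ?thesis by (simp add: algebra_simps)
qed

lemma qform_one:
  assumes "i < k" shows "qform k A (\<lambda>l. if l = i then x else 0) = A $$ (i, i) * x * cnj x"
proof -
  have d: "(\<Sum>l<k. g l * (if l = i then y else 0)) = g i * y" for g and y :: complex
    using assms by (simp add: if_distrib[where f="\<lambda>z. _ * z"] sum.delta cong: if_cong)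
  have "qform k A (\<lambda>l. if l = i then x else 0) = (\<Sum>a<k. (\<Sum>l<k. A $$ (a, l) * (if l = i then x else 0)) * (if a = i then cnj x else 0))"
    unfolding qform_def by (intro sum.cong refl) (simp add: sum_distrib_right)
  then show ?thesis unfolding d .
qed

lemma psd_diag: assumes "psd k A" "i < k" shows "Im (A $$ (i, i)) = 0" "0 \<le> Re (A $$ (i, i))"
proof -
  have "Im (qform k A (\<lambda>l. if l = i then 1 else 0)) = 0" "0 \<le> Re (qform k A (\<lambda>l. if l = i then 1 else 0))"
    using assms(1) unfolding psd_qform by blast+
  then show "Im (A $$ (i, i)) = 0" "0 \<le> Re (A $$ (i, i))" unfolding qform_one[OF assms(2)] by simp_all
qed

text \<open>\<open>psd\<close> only demands that the form is real and nonnegative. Hermitian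
  symmetry follows by polarisation with the test vectors e_i + e_j and e_i + \<i> e_j.\<close>

lemma psd_entry:
  assumes p: "psd k A" and i: "i < k" and j: "j < k"
  shows "A $$ (j, i) = cnj (A $$ (i, j))"
proof (cases "i = j")
  case True
  then show ?thesis using psd_diag[OF p i] by (simp add: complex_eq_iff)
next
  case False
  have d: "Im (A $$ (i, i)) = 0" "Im (A $$ (j, j)) = 0" using psd_diag[OF p] i j by auto
  have q: "Im (qform k A f) = 0" for f using p unfolding psd_qform by blast
  have "Im (A $$ (i, i) + A $$ (i, j) + A $$ (j, i) + A $$ (j, j)) = 0"
    using q[of "\<lambda>l. if l = i then 1 else if l = j then 1 else 0"] unfolding qform_two[OF i j False] by simp
  moreover have "Im (A $$ (i, i) + A $$ (i, j) * \<i> + A $$ (j, i) * (- \<i>) + A $$ (j, j) * \<i> * (- \<i>)) = 0"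
    using q[of "\<lambda>l. if l = i then 1 else if l = j then \<i> else 0"] unfolding qform_two[OF i j False] by simp
  ultimately show ?thesis using d by (simp add: complex_eq_iff)
qed

lemma qform_congruence:
  assumes A: "A \<in> carrier_mat m t" and Q: "Q \<in> carrier_mat t t"
  shows "qform m (A * Q * mat_adjoint A) f = qform t Q (\<lambda>l. \<Sum>i<m. cnj (A $$ (i, l)) * f i)"
proof -
  have e: "(A * Q * mat_adjoint A) $$ (i, j) = (\<Sum>l<t. \<Sum>k<t. A $$ (i, k) * Q $$ (k, l) * cnj (A $$ (j, l)))" if "i < m" "j < m" for i j
    using mat_mult_index[OF mult_carrier_mat[OF A Q] adj_carrier[OF A] that] mat_mult_index[OF A Q that(1)] adj_index[OF A _ that(2)]
    by (simp add: sum_distrib_right)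
  have "qform m (A * Q * mat_adjoint A) f = (\<Sum>i<m. \<Sum>j<m. \<Sum>l<t. \<Sum>k<t. A $$ (i, k) * Q $$ (k, l) * cnj (A $$ (j, l)) * f j * cnj (f i))"
    unfolding qform_def using e by (intro sum.cong refl) (simp add: sum_distrib_right)
  also have "\<dots> = (\<Sum>i<m. \<Sum>l<t. \<Sum>j<m. \<Sum>k<t. A $$ (i, k) * Q $$ (k, l) * cnj (A $$ (j, l)) * f j * cnj (f i))"
    by (intro sum.cong refl sum.swap)
  also have "\<dots> = (\<Sum>i<m. \<Sum>l<t. \<Sum>k<t. \<Sum>j<m. A $$ (i, k) * Q $$ (k, l) * cnj (A $$ (j, l)) * f j * cnj (f i))"
    by (intro sum.cong refl sum.swap)
  also have "\<dots> = (\<Sum>i<m. \<Sum>k<t. \<Sum>l<t. \<Sum>j<m. A $$ (i, k) * Q $$ (k, l) * cnj (A $$ (j, l)) * f j * cnj (f i))"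
    by (intro sum.cong refl sum.swap)
  also have "\<dots> = (\<Sum>k<t. \<Sum>i<m. \<Sum>l<t. \<Sum>j<m. A $$ (i, k) * Q $$ (k, l) * cnj (A $$ (j, l)) * f j * cnj (f i))"
    by (rule sum.swap)
  also have "\<dots> = (\<Sum>k<t. \<Sum>l<t. \<Sum>i<m. \<Sum>j<m. A $$ (i, k) * Q $$ (k, l) * cnj (A $$ (j, l)) * f j * cnj (f i))"
    by (intro sum.cong refl sum.swap)
  also have "\<dots> = qform t Q (\<lambda>l. \<Sum>i<m. cnj (A $$ (i, l)) * f i)"
  proof -
    have "(\<Sum>i<m. \<Sum>j<m. A $$ (i, k) * Q $$ (k, l) * cnj (A $$ (j, l)) * f j * cnj (f i))
      = Q $$ (k, l) * (\<Sum>i<m. cnj (A $$ (i, l)) * f i) * cnj (\<Sum>i<m. cnj (A $$ (i, k)) * f i)" for k l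
    proof -
      have "(\<Sum>i<m. \<Sum>j<m. A $$ (i, k) * Q $$ (k, l) * cnj (A $$ (j, l)) * f j * cnj (f i))
        = (\<Sum>i<m. (Q $$ (k, l) * (\<Sum>j<m. cnj (A $$ (j, l)) * f j)) * (A $$ (i, k) * cnj (f i)))"
        by (intro sum.cong refl) (simp add: sum_distrib_left sum_distrib_right mult_ac)
      then show ?thesis by (simp add: sum_distrib_left[symmetric])
    qed
    then show ?thesis unfolding qform_def by simp
  qed
  finally show ?thesis .
qed

lemma psd_congruence:
  assumes "A \<in> carrier_mat m t" "psd t Q" shows "psd m (A * Q * mat_adjoint A)"
  using assms qform_congruence[OF assms(1) psd_carrier[OF assms(2)]] unfolding psd_qform
  by (auto intro!: mult_carrier_mat adj_carrier)

section \<open>The spectral theorem by Householder deflation\<close>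

definition cdiag :: "nat \<Rightarrow> (nat \<Rightarrow> complex) \<Rightarrow> complex mat" where
  "cdiag k d = mat k k (\<lambda>(i, j). if i = j then d i else 0)"

lemma cdiag_carrier[simp]: "cdiag k d \<in> carrier_mat k k"
  by (simp add: cdiag_def)

lemma cdiag_dim[simp]: "dim_row (cdiag k d) = k" "dim_col (cdiag k d) = k"
  by (simp_all add: cdiag_def)

lemma cdiag_index[simp]: "i < k \<Longrightarrow> j < k \<Longrightarrow> cdiag k d $$ (i, j) = (if i = j then d i else 0)"
  by (simp add: cdiag_def)

text \<open>The reflection 1 - g u u^H that carries the first basis vector to the normalised
  multiple \<open>x\<close> of \<open>v\<close>, with g = 2 / |u|^2. The phase \<open>ph\<close>
  makes the first entry of \<open>x\<close> nonpositive; then |u|^2 = 2 (1 + |x_0|) stays away from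
  0 even when \<open>v\<close> is parallel to the first basis vector.\<close>

lemma householder:
  fixes v :: "complex Matrix.vec"
  assumes v: "v \<in> carrier_vec k" "v \<noteq> 0\<^sub>v k" and k: "0 < k"
  obtains H c where "H \<in> carrier_mat k k" "mat_adjoint H = H" "H * H = 1\<^sub>m k" "c \<noteq> 0" "col H 0 = c \<cdot>\<^sub>v v"
proof -
  define N where "N = (\<Sum>i<k. (cmod (v $ i))\<^sup>2)"
  have N: "N > 0"
  proof -
    obtain i where "i < k" "v $ i \<noteq> 0" using v by (metis carrier_vecD eq_vecI index_zero_vec)
    then show ?thesis unfolding N_def by (intro sum_pos2[of _ i]) auto
  qed
  define ph where "ph = (if v $ 0 = 0 then 1 else - cnj (v $ 0) / complex_of_real (cmod (v $ 0)))"
  have ph1: "cmod ph = 1" by (simp add: ph_def norm_divide)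
  define c where "c = ph / complex_of_real (sqrt N)"
  have c0: "c \<noteq> 0" using ph1 N by (auto simp: c_def)
  define x where "x i = c * v $ i" for i
  have x0: "x 0 = - complex_of_real (cmod (x 0))"
  proof -
    have "ph * v $ 0 = - complex_of_real (cmod (v $ 0))"
    proof (cases "v $ 0 = 0")
      case False
      have "cnj (v $ 0) * v $ 0 = complex_of_real (cmod (v $ 0)) * complex_of_real (cmod (v $ 0))"
        using complex_norm_square[of "v $ 0"] by (simp add: power2_eq_square mult.commute)
      then show ?thesis using False by (simp add: ph_def)
    qed (simp add: ph_def)
    moreover have "cmod (x 0) = cmod (v $ 0) / sqrt N" using ph1 N by (simp add: x_def c_def norm_mult norm_divide)
    ultimately show ?thesis by (simp add: x_def c_def)
  qed
  have xn: "(\<Sum>i<k. x i * cnj (x i)) = 1"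
  proof -
    have "(\<Sum>i<k. x i * cnj (x i)) = (\<Sum>i<k. complex_of_real ((cmod (x i))\<^sup>2))"
      by (simp add: complex_norm_square del: of_real_power)
    also have "\<dots> = complex_of_real (\<Sum>i<k. (cmod (v $ i))\<^sup>2 / N)"
      unfolding of_real_sum using N ph1 by (intro sum.cong refl) (simp add: x_def c_def norm_mult norm_divide power_mult_distrib power_divide)
    also have "\<dots> = 1" using N by (simp add: sum_divide_distrib[symmetric] N_def[symmetric])
    finally show ?thesis .
  qed
  define u where "u i = x i - (if i = 0 then 1 else 0)" for i
  define g where "g = 1 / (1 + cmod (x 0))"
  have g: "g * (1 + cmod (x 0)) = 1" by (simp add: g_def add_nonneg_eq_0_iff)
  have un: "(\<Sum>i<k. u i * cnj (u i)) = complex_of_real (2 * (1 + cmod (x 0)))"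
  proof -
    have "(\<Sum>i<k. u i * cnj (u i)) = (\<Sum>i<k. x i * cnj (x i) + (if i = 0 then 1 - x 0 - cnj (x 0) else 0))"
      by (intro sum.cong refl) (auto simp: u_def algebra_simps)
    also have "\<dots> = 2 - x 0 - cnj (x 0)" using xn k by (simp add: sum.distrib)
    also have "\<dots> = complex_of_real (2 * (1 + cmod (x 0)))" by (subst (1 2) x0) simp
    finally show ?thesis .
  qed
  define H where "H = mat k k (\<lambda>(i, j). (if i = j then 1 else 0) - complex_of_real g * (u i * cnj (u j)))"
  have H: "H \<in> carrier_mat k k" by (simp add: H_def)
  have Hi: "H $$ (i, j) = (if i = j then 1 else 0) - complex_of_real g * (u i * cnj (u j))" if "i < k" "j < k" for i j
    using that by (simp add: H_def)
  have "mat_adjoint H = H"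
    by (rule eq_matI) (use H adj_index[OF H] Hi in auto)
  moreover have "H * H = 1\<^sub>m k"
  proof (rule eq_matI)
    fix i j assume "i < dim_row (1\<^sub>m k :: complex mat)" "j < dim_col (1\<^sub>m k :: complex mat)"
    then have ij: "i < k" "j < k" by auto
    have "(H * H) $$ (i, j) = (\<Sum>l<k. H $$ (i, l) * H $$ (l, j))" by (rule mat_mult_index[OF H H ij])
    also have "\<dots> = (\<Sum>l<k. (if i = l then (if l = j then 1 else 0) else 0) - (if i = l then complex_of_real g * (u i * cnj (u j)) else 0)
       - (if l = j then complex_of_real g * (u i * cnj (u j)) else 0) + (complex_of_real g * complex_of_real g * u i * cnj (u j)) * (u l * cnj (u l)))"
      using ij by (intro sum.cong refl) (auto simp: Hi algebra_simps)
    also have "\<dots> = (if i = j then 1 else 0) - 2 * (complex_of_real g * (u i * cnj (u j)))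
       + (complex_of_real g * complex_of_real g * u i * cnj (u j)) * complex_of_real (2 * (1 + cmod (x 0)))"
      using ij unfolding sum.distrib sum_subtractf sum_distrib_left[symmetric] un by (simp add: sum.delta)
    also have "(complex_of_real g * complex_of_real g * u i * cnj (u j)) * complex_of_real (2 * (1 + cmod (x 0)))
      = 2 * (complex_of_real g * (u i * cnj (u j))) * complex_of_real (g * (1 + cmod (x 0)))" by simp
    finally show "(H * H) $$ (i, j) = 1\<^sub>m k $$ (i, j)" unfolding g using ij by simp
  qed (use H in auto)
  moreover have "col H 0 = c \<cdot>\<^sub>v v"
  proof (rule eq_vecI)
    fix i assume "i < dim_vec (c \<cdot>\<^sub>v v)"
    then have i: "i < k" using v by auto
    have "cnj (u 0) = - complex_of_real (1 + cmod (x 0))" by (subst u_def, subst x0) simp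
    then have "complex_of_real g * (u i * cnj (u 0)) = complex_of_real g * (u i * (- complex_of_real (1 + cmod (x 0))))" by simp
    also have "\<dots> = - u i * complex_of_real (g * (1 + cmod (x 0)))" by (simp add: algebra_simps)
    finally have "complex_of_real g * (u i * cnj (u 0)) = - u i * complex_of_real (g * (1 + cmod (x 0)))" .
    then have "H $$ (i, 0) = (if i = 0 then 1 else 0) + u i" unfolding Hi[OF i k] g by simp
    then show "col H 0 $ i = (c \<cdot>\<^sub>v v) $ i" using H i k v by (simp add: u_def x_def)
  qed (use H v in auto)
  ultimately show ?thesis using that[OF H] c0 by blast
qed


definition bmat :: "nat \<Rightarrow> complex \<Rightarrow> complex mat \<Rightarrow> complex mat" where
  "bmat k c X = mat (Suc k) (Suc k) (\<lambda>(i, j). case i of 0 \<Rightarrow> (if j = 0 then c else 0)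
     | Suc i' \<Rightarrow> (case j of 0 \<Rightarrow> 0 | Suc j' \<Rightarrow> X $$ (i', j')))"

lemma bmat_carrier[simp]: "bmat k c X \<in> carrier_mat (Suc k) (Suc k)"
  by (simp add: bmat_def)

lemma bmat_index:
  "bmat k c X $$ (0, 0) = c"
  "j < k \<Longrightarrow> bmat k c X $$ (0, Suc j) = 0"
  "i < k \<Longrightarrow> bmat k c X $$ (Suc i, 0) = 0"
  "i < k \<Longrightarrow> j < k \<Longrightarrow> bmat k c X $$ (Suc i, Suc j) = X $$ (i, j)"
  by (simp_all add: bmat_def)

lemma bmat_eqI:
  assumes "A \<in> carrier_mat (Suc k) (Suc k)" "A $$ (0, 0) = c"
    "\<And>j. j < k \<Longrightarrow> A $$ (0, Suc j) = 0" "\<And>i. i < k \<Longrightarrow> A $$ (Suc i, 0) = 0"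
    "\<And>i j. i < k \<Longrightarrow> j < k \<Longrightarrow> A $$ (Suc i, Suc j) = X $$ (i, j)"
  shows "A = bmat k c X"
proof (rule eq_matI)
  fix i j assume "i < dim_row (bmat k c X)" "j < dim_col (bmat k c X)"
  then have "i < Suc k" "j < Suc k" by (auto simp: bmat_def)
  then show "A $$ (i, j) = bmat k c X $$ (i, j)"
    using assms by (cases i; cases j) (auto simp: bmat_index)
qed (use assms in \<open>auto simp: bmat_def\<close>)

lemma bmat_mult:
  assumes X: "X \<in> carrier_mat k k" and Y: "Y \<in> carrier_mat k k"
  shows "bmat k c X * bmat k c' Y = bmat k (c * c') (X * Y)"
proof (rule bmat_eqI)
  note i = mat_mult_index[OF bmat_carrier bmat_carrier]
  show "(bmat k c X * bmat k c' Y) $$ (0, 0) = c * c'"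
    by (subst i) (auto simp: sum.lessThan_Suc_shift bmat_index simp del: sum.lessThan_Suc intro!: sum.neutral)
  show "(bmat k c X * bmat k c' Y) $$ (0, Suc j) = 0" if "j < k" for j
    using that by (subst i) (auto simp: sum.lessThan_Suc_shift bmat_index simp del: sum.lessThan_Suc intro!: sum.neutral)
  show "(bmat k c X * bmat k c' Y) $$ (Suc j, 0) = 0" if "j < k" for j
    using that by (subst i) (auto simp: sum.lessThan_Suc_shift bmat_index simp del: sum.lessThan_Suc intro!: sum.neutral)
  show "(bmat k c X * bmat k c' Y) $$ (Suc a, Suc b) = (X * Y) $$ (a, b)" if "a < k" "b < k" for a b
    using that mat_mult_index[OF X Y that] by (subst i) (auto simp: sum.lessThan_Suc_shift bmat_index simp del: sum.lessThan_Suc)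
qed (rule mult_carrier_mat[OF bmat_carrier bmat_carrier])

lemma bmat_adj:
  assumes X: "X \<in> carrier_mat k k"
  shows "mat_adjoint (bmat k c X) = bmat k (cnj c) (mat_adjoint X)"
  by (rule bmat_eqI) (use X in \<open>auto simp: adj_index[OF bmat_carrier] adj_index[OF X] bmat_index\<close>)

lemma bmat_one: "bmat k 1 (1\<^sub>m k) = 1\<^sub>m (Suc k)"
  by (rule bmat_eqI[symmetric]) auto

lemma bmat_cdiag: "bmat k (d 0) (cdiag k (\<lambda>i. d (Suc i))) = cdiag (Suc k) d"
  by (rule bmat_eqI[symmetric]) auto

lemma qform_bmat: "qform k X f = qform (Suc k) (bmat k c X) (\<lambda>i. case i of 0 \<Rightarrow> 0 | Suc j \<Rightarrow> f j)"
  unfolding qform_def sum.lessThan_Suc_shift by (simp add: bmat_index del: sum.lessThan_Suc)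

text \<open>In a basis that starts with an eigenvector the first column is cleared below the
  eigenvalue, Hermitian symmetry clears the first row, and the remaining block is again positive
  semidefinite, as its form is that of the whole matrix on vectors with first entry 0.\<close>

theorem psd_spectral:
  assumes "psd k A"
  shows "\<exists>U d. U \<in> carrier_mat k k \<and> mat_adjoint U * U = 1\<^sub>m k \<and> U * mat_adjoint U = 1\<^sub>m k \<and>
     (\<forall>i<k. 0 \<le> d i) \<and> mat_adjoint U * A * U = cdiag k (\<lambda>i. complex_of_real (d i))"
  using assms
proof (induction k arbitrary: A)
  case 0
  then have "A \<in> carrier_mat 0 0" by (rule psd_carrier)
  then show ?case
    by (intro exI[of _ "1\<^sub>m 0"] exI[of _ "\<lambda>_. 0"]) (auto simp: adj_one cdiag_def intro!: eq_matI)
next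
  case (Suc k)
  let ?n = "Suc k"
  have A: "A \<in> carrier_mat ?n ?n" by (rule psd_carrier[OF Suc.prems])
  obtain e where "e \<in> spectrum A" using spectrum_non_empty[OF A] by auto
  then obtain v where v: "eigenvector A v e" by (auto simp: spectrum_def eigenvalue_def)
  then have vc: "v \<in> carrier_vec ?n" "v \<noteq> 0\<^sub>v ?n" "A *\<^sub>v v = e \<cdot>\<^sub>v v"
    using A by (auto simp: eigenvector_def)
  obtain H c where H: "H \<in> carrier_mat ?n ?n" "mat_adjoint H = H" "H * H = 1\<^sub>m ?n" "c \<noteq> 0" "col H 0 = c \<cdot>\<^sub>v v"
    by (rule householder[OF vc(1,2)]) auto
  define A' where "A' = H * A * H"
  have A'c: "A' \<in> carrier_mat ?n ?n" using A H by (simp add: A'_def)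
  have A'p: "psd ?n A'" using psd_congruence[OF H(1) Suc.prems] H(2) by (simp add: A'_def)
  have AH: "col (A * H) 0 = e \<cdot>\<^sub>v col H 0"
  proof -
    have "col (A * H) 0 = A *\<^sub>v col H 0" using A H by (intro col_mult2) auto
    also have "\<dots> = c \<cdot>\<^sub>v (e \<cdot>\<^sub>v v)" unfolding H(5) using A vc by (simp add: mult_mat_vec)
    also have "\<dots> = e \<cdot>\<^sub>v col H 0" unfolding H(5) by (simp add: smult_smult_assoc mult.commute)
    finally show ?thesis .
  qed
  have "A' = H * (A * H)" unfolding A'_def using A H by (simp add: assoc_mult_mat[of _ ?n ?n _ ?n _ ?n])
  then have "col A' 0 = H *\<^sub>v (e \<cdot>\<^sub>v col H 0)"
    using A H(1) col_mult2[of H ?n ?n "A * H" ?n 0] unfolding AH by simp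
  also have "\<dots> = e \<cdot>\<^sub>v (H *\<^sub>v col H 0)"
    by (rule mult_mat_vec[OF H(1)]) (use H(1) in \<open>simp add: carrier_vecI\<close>)
  also have "H *\<^sub>v col H 0 = col (H * H) 0" using H by (intro col_mult2[symmetric]) auto
  finally have col0: "col A' 0 = e \<cdot>\<^sub>v col (1\<^sub>m ?n) 0" unfolding H(3) .
  have A'i0: "A' $$ (i, 0) = (if i = 0 then e else 0)" if "i < ?n" for i
    using arg_cong[OF col0, of "\<lambda>x. x $ i"] A'c that by auto
  have A'0j: "A' $$ (0, Suc j) = 0" if "j < k" for j
    using psd_entry[OF A'p, of "Suc j" 0] A'i0[of "Suc j"] that by simp
  define X where "X = mat k k (\<lambda>(i, j). A' $$ (Suc i, Suc j))"
  have Xc: "X \<in> carrier_mat k k" by (simp add: X_def)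
  have A'b: "A' = bmat k e X"
    by (rule bmat_eqI) (use A'c A'i0 A'0j in \<open>auto simp: X_def\<close>)
  have "psd k X" using A'p Xc unfolding psd_qform A'b qform_bmat[of k X _ e] by blast
  from Suc.IH[OF this] obtain V d where V: "V \<in> carrier_mat k k" "mat_adjoint V * V = 1\<^sub>m k" "V * mat_adjoint V = 1\<^sub>m k"
     "\<forall>i<k. 0 \<le> d i" "mat_adjoint V * X * V = cdiag k (\<lambda>i. complex_of_real (d i))" by blast
  define VV where "VV = bmat k 1 V"
  have VVc: "VV \<in> carrier_mat ?n ?n" by (simp add: VV_def)
  have VVa: "mat_adjoint VV = bmat k 1 (mat_adjoint V)" unfolding VV_def by (simp add: bmat_adj[OF V(1)])
  have VV1: "mat_adjoint VV * VV = 1\<^sub>m ?n" "VV * mat_adjoint VV = 1\<^sub>m ?n"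
    unfolding VVa unfolding VV_def bmat_mult[OF V(1) adj_carrier[OF V(1)]] bmat_mult[OF adj_carrier[OF V(1)] V(1)]
    using V by (simp_all add: bmat_one)
  have e: "e = complex_of_real (Re e)" "0 \<le> Re e"
    using psd_diag[OF A'p, of 0] A'i0[of 0] by (auto simp: complex_eq_iff)
  have VVA: "mat_adjoint VV * A' * VV = cdiag ?n (\<lambda>i. complex_of_real (case i of 0 \<Rightarrow> Re e | Suc j \<Rightarrow> d j))"
  proof -
    have "mat_adjoint VV * A' * VV = bmat k e (mat_adjoint V * X * V)"
      unfolding VVa A'b unfolding VV_def using V(1) Xc by (simp add: bmat_mult[OF adj_carrier] bmat_mult[OF mult_carrier_mat[OF adj_carrier]])
    also have "\<dots> = cdiag ?n (\<lambda>i. complex_of_real (case i of 0 \<Rightarrow> Re e | Suc j \<Rightarrow> d j))"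
      unfolding V(5) bmat_cdiag[symmetric] using e(1) by simp
    finally show ?thesis .
  qed
  define U where "U = H * VV"
  have Uc: "U \<in> carrier_mat ?n ?n" using H VVc by (simp add: U_def)
  have Ua: "mat_adjoint (H * VV) = mat_adjoint VV * H" using adj_mult[OF H(1) VVc] H(2) by simp
  note as = assoc_mult_mat[of _ ?n ?n _ ?n _ ?n]
  have aV: "mat_adjoint VV \<in> carrier_mat ?n ?n" using VVc by auto
  have "mat_adjoint U * U = mat_adjoint VV * ((H * H) * VV)"
    unfolding U_def Ua using H(1) VVc aV by (simp add: as)
  then have 1: "mat_adjoint U * U = 1\<^sub>m ?n" unfolding H(3) using VVc VV1 by simp
  have "U * mat_adjoint U = H * ((VV * mat_adjoint VV) * H)"
    unfolding U_def Ua using assoc_mult_mat[OF H(1) VVc mult_carrier_mat[OF aV H(1)]] assoc_mult_mat[OF VVc aV H(1)] by simp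
  then have 2: "U * mat_adjoint U = 1\<^sub>m ?n" unfolding VV1 using H by simp
  have "mat_adjoint U * A * U = mat_adjoint VV * A' * VV"
    unfolding U_def Ua A'_def using H(1) VVc aV A by (simp add: as)
  then have 3: "mat_adjoint U * A * U = cdiag ?n (\<lambda>i. complex_of_real (case i of 0 \<Rightarrow> Re e | Suc j \<Rightarrow> d j))"
    unfolding VVA .
  show ?case
    using Uc 1 2 3 V(4) e(2)
    by (intro exI[of _ U] exI[of _ "\<lambda>i. case i of 0 \<Rightarrow> Re e | Suc j \<Rightarrow> d j"]) (auto split: nat.split)
qed

section \<open>Whitening, determinants and their derivatives\<close>

lemma det_cdiag: "det (cdiag k d) = (\<Prod>i<k. d i)"
proof -
  have "upper_triangular (cdiag k d)" unfolding upper_triangular_def by (auto simp: cdiag_def)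
  then have "det (cdiag k d) = prod_list (diag_mat (cdiag k d))"
    by (rule det_upper_triangular[OF _ cdiag_carrier])
  also have "\<dots> = (\<Prod>i = 0..<k. cdiag k d $$ (i, i))" by (simp add: prod_list_diag_prod cdiag_def)
  finally show ?thesis by (simp add: atLeast0LessThan)
qed

lemma cdiag_mult: "cdiag k d * cdiag k e = cdiag k (\<lambda>i. d i * e i)"
proof (rule eq_matI)
  fix i j assume "i < dim_row (cdiag k (\<lambda>i. d i * e i))" "j < dim_col (cdiag k (\<lambda>i. d i * e i))"
  then have ij: "i < k" "j < k" by (auto simp: cdiag_def)
  have "(cdiag k d * cdiag k e) $$ (i, j) = (\<Sum>l<k. if l = i then (if i = j then d i * e i else 0) else 0)"
    unfolding mat_mult_index[OF cdiag_carrier cdiag_carrier ij] using ij by (intro sum.cong refl) auto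
  then show "(cdiag k d * cdiag k e) $$ (i, j) = cdiag k (\<lambda>i. d i * e i) $$ (i, j)" using ij by simp
qed (auto simp: cdiag_def)

lemma cdiag_adj: "mat_adjoint (cdiag k d) = cdiag k (\<lambda>i. cnj (d i))"
  by (rule eq_matI) (auto simp: cdiag_def adj_index[OF cdiag_carrier[unfolded cdiag_def]])

lemma cdiag_one: "cdiag k (\<lambda>_. 1) = 1\<^sub>m k"
  by (rule eq_matI) (auto simp: cdiag_def)

lemma cdiag_cong: "(\<And>i. i < k \<Longrightarrow> d i = e i) \<Longrightarrow> cdiag k d = cdiag k e"
  by (rule eq_matI) (auto simp: cdiag_def)

lemma assoc_mult_mat4:
  assumes "U \<in> carrier_mat m1 m2" "X \<in> carrier_mat m2 m3" "Y \<in> carrier_mat m3 m4" "V \<in> carrier_mat m4 m5"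
  shows "(U * X) * (Y * V) = U * ((X * Y) * V)"
  using assoc_mult_mat[OF assms(1,2) mult_carrier_mat[OF assms(3,4)]] assoc_mult_mat[OF assms(2,3,4)] by simp

text \<open>A positive determinant excludes the eigenvalue 0, so the square roots of the eigenvalues
  can be inverted. That the determinant is real is recorded because \<open>lndet\<close> looks at
  real parts, and these multiply only when one factor is real.\<close>

lemma psd_factor:
  assumes S: "psd m S" and det: "0 < Re (det S)"
  shows "Im (det S) = 0"
    and "\<exists>B Bi. B \<in> carrier_mat m m \<and> Bi \<in> carrier_mat m m \<and> B * Bi = 1\<^sub>m m \<and> Bi * B = 1\<^sub>m m \<and> B * mat_adjoint B = S"
proof -
  obtain U s where U: "U \<in> carrier_mat m m" "mat_adjoint U * U = 1\<^sub>m m" "U * mat_adjoint U = 1\<^sub>m m"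
    "\<forall>i<m. 0 \<le> s i" "mat_adjoint U * S * U = cdiag m (\<lambda>i. complex_of_real (s i))"
    using psd_spectral[OF S] by blast
  have Sc: "S \<in> carrier_mat m m" by (rule psd_carrier[OF S])
  have Uc: "mat_adjoint U \<in> carrier_mat m m" using U by auto
  note as = assoc_mult_mat[of _ m m _ m _ m]
  have SU: "S = U * cdiag m (\<lambda>i. complex_of_real (s i)) * mat_adjoint U"
  proof -
    have "U * (mat_adjoint U * S * U) * mat_adjoint U = (U * mat_adjoint U) * S * (U * mat_adjoint U)"
      using U(1) Uc Sc by (simp add: as)
    then show ?thesis unfolding U(5) U(3) using Sc by simp
  qed
  have "det S = det U * det (cdiag m (\<lambda>i. complex_of_real (s i))) * det (mat_adjoint U)"
    by (subst SU) (simp only: det_mult[OF mult_carrier_mat[OF U(1) cdiag_carrier] Uc] det_mult[OF U(1) cdiag_carrier])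
  also have "\<dots> = det (U * mat_adjoint U) * (\<Prod>i<m. complex_of_real (s i))"
    by (simp add: det_mult[of _ m] U(1) Uc det_cdiag)
  finally have dS: "det S = complex_of_real (\<Prod>i<m. s i)" unfolding U(3) by simp
  then show "Im (det S) = 0" by (simp only: Im_complex_of_real)
  have "(\<Prod>i<m. s i) > 0" using det unfolding dS Re_complex_of_real .
  then have sp: "s i > 0" if "i < m" for i
    using U(4) that by (metis finite_lessThan lessThan_iff less_irrefl less_le prod_zero_iff)
  define B where "B = U * cdiag m (\<lambda>i. complex_of_real (sqrt (s i)))"
  define Bi where "Bi = cdiag m (\<lambda>i. complex_of_real (1 / sqrt (s i))) * mat_adjoint U"
  have Bc: "B \<in> carrier_mat m m" "Bi \<in> carrier_mat m m" using U(1) by (auto simp: B_def Bi_def intro!: mult_carrier_mat[of _ m m])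
  have c1: "cdiag m (\<lambda>i. complex_of_real (sqrt (s i))) * cdiag m (\<lambda>i. complex_of_real (1 / sqrt (s i))) = 1\<^sub>m m"
    "cdiag m (\<lambda>i. complex_of_real (1 / sqrt (s i))) * cdiag m (\<lambda>i. complex_of_real (sqrt (s i))) = 1\<^sub>m m"
    unfolding cdiag_mult cdiag_one[symmetric]
    by (rule cdiag_cong; use sp in \<open>force simp flip: of_real_mult\<close>)+
  have cs: "cdiag m (\<lambda>i. complex_of_real (sqrt (s i))) * cdiag m (\<lambda>i. complex_of_real (sqrt (s i))) = cdiag m (\<lambda>i. complex_of_real (s i))"
    unfolding cdiag_mult by (rule cdiag_cong) (use sp in \<open>auto simp flip: of_real_mult simp: less_imp_le\<close>)
  let ?D = "cdiag m (\<lambda>i. complex_of_real (sqrt (s i)))" and ?E = "cdiag m (\<lambda>i. complex_of_real (1 / sqrt (s i)))"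
  have "B * Bi = U * ((?D * ?E) * mat_adjoint U)"
    unfolding B_def Bi_def by (rule assoc_mult_mat4[OF U(1) cdiag_carrier cdiag_carrier Uc])
  then have 1: "B * Bi = 1\<^sub>m m" unfolding c1 left_mult_one_mat[OF Uc] U(3) .
  have "Bi * B = ?E * ((mat_adjoint U * U) * ?D)" unfolding B_def Bi_def using U(1) Uc by (simp add: as)
  then have 2: "Bi * B = 1\<^sub>m m" unfolding U(2) left_mult_one_mat[OF cdiag_carrier] c1 .
  have "mat_adjoint B = ?D * mat_adjoint U" unfolding B_def adj_mult[OF U(1) cdiag_carrier] cdiag_adj by simp
  then have "B * mat_adjoint B = B * (?D * mat_adjoint U)" by simp
  also have "\<dots> = U * ((?D * ?D) * mat_adjoint U)"
    unfolding B_def by (rule assoc_mult_mat4[OF U(1) cdiag_carrier cdiag_carrier Uc])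
  also have "\<dots> = U * (?D * ?D) * mat_adjoint U"
    by (rule assoc_mult_mat[OF U(1) mult_carrier_mat[OF cdiag_carrier cdiag_carrier] Uc, symmetric])
  finally have "B * mat_adjoint B = U * (?D * ?D) * mat_adjoint U" .
  then have 3: "B * mat_adjoint B = S" unfolding cs SU[symmetric] .
  show "\<exists>B Bi. B \<in> carrier_mat m m \<and> Bi \<in> carrier_mat m m \<and> B * Bi = 1\<^sub>m m \<and> Bi * B = 1\<^sub>m m \<and> B * mat_adjoint B = S"
    using Bc 1 2 3 by blast
qed

text \<open>\<open>Bi\<close> whitens noise of covariance \<open>S\<close> and at the same time diagonalises the covariance
  \<open>K * Q * mat_adjoint K\<close> of the received signal.\<close>

definition rdiag :: "nat \<Rightarrow> complex mat \<Rightarrow> complex mat \<Rightarrow> complex mat \<Rightarrow> complex mat \<Rightarrow> complex mat \<Rightarrow> (nat \<Rightarrow> real) \<Rightarrow> bool" where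
  "rdiag m S K Q B Bi d \<longleftrightarrow> B \<in> carrier_mat m m \<and> Bi \<in> carrier_mat m m \<and> B * Bi = 1\<^sub>m m \<and> Bi * B = 1\<^sub>m m \<and>
     B * mat_adjoint B = S \<and> (\<forall>j<m. 0 \<le> d j) \<and>
     (Bi * K) * Q * mat_adjoint (Bi * K) = cdiag m (\<lambda>j. complex_of_real (d j))"

text \<open>\<open>B0\<close> whitens the noise. The unitary \<open>U\<close> that diagonalises the
  whitened covariance can be absorbed, since \<open>B0 * U\<close> is again a factor of
  \<open>S\<close>.\<close>

lemma rdiag_exists:
  assumes S: "psd m S" "0 < Re (det S)" and K: "K \<in> carrier_mat m t" and Q: "psd t Q"
  obtains B Bi d where "rdiag m S K Q B Bi d"
proof -
  obtain B0 Bi0 where B0: "B0 \<in> carrier_mat m m" "Bi0 \<in> carrier_mat m m" "B0 * Bi0 = 1\<^sub>m m" "Bi0 * B0 = 1\<^sub>m m" "B0 * mat_adjoint B0 = S"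
    using psd_factor(2)[OF S] by blast
  have Qc: "Q \<in> carrier_mat t t" by (rule psd_carrier[OF Q])
  define A0 where "A0 = Bi0 * K"
  have A0: "A0 \<in> carrier_mat m t" using B0 K by (simp add: A0_def)
  obtain U d where U: "U \<in> carrier_mat m m" "mat_adjoint U * U = 1\<^sub>m m" "U * mat_adjoint U = 1\<^sub>m m"
    "\<forall>i<m. 0 \<le> d i" "mat_adjoint U * (A0 * Q * mat_adjoint A0) * U = cdiag m (\<lambda>i. complex_of_real (d i))"
    using psd_spectral[OF psd_congruence[OF A0 Q]] by blast
  have Uc: "mat_adjoint U \<in> carrier_mat m m" and A0c: "mat_adjoint A0 \<in> carrier_mat t m" and B0c: "mat_adjoint B0 \<in> carrier_mat m m"
    using U A0 B0 by auto
  note as = assoc_mult_mat[of _ m m _ m _ m]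
  let ?B = "B0 * U" and ?Bi = "mat_adjoint U * Bi0"
  have "?B * ?Bi = B0 * ((U * mat_adjoint U) * Bi0)" using U(1) Uc B0 by (simp add: as)
  then have 1: "?B * ?Bi = 1\<^sub>m m" unfolding U(3) using B0 by simp
  have "?Bi * ?B = mat_adjoint U * ((Bi0 * B0) * U)" using U(1) Uc B0(1,2) by (simp add: as)
  then have 2: "?Bi * ?B = 1\<^sub>m m" unfolding B0(4) using U by simp
  have "?B * mat_adjoint ?B = B0 * (U * (mat_adjoint U * mat_adjoint B0))"
    unfolding adj_mult[OF B0(1) U(1)] by (rule assoc_mult_mat[OF B0(1) U(1) mult_carrier_mat[OF Uc B0c]])
  also have "U * (mat_adjoint U * mat_adjoint B0) = mat_adjoint B0"
    unfolding assoc_mult_mat[OF U(1) Uc B0c, symmetric] U(3) by (rule left_mult_one_mat[OF B0c])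
  finally have 3: "?B * mat_adjoint ?B = S" unfolding B0(5) .
  have BK: "?Bi * K = mat_adjoint U * A0" unfolding A0_def by (rule assoc_mult_mat[OF Uc B0(2) K])
  have "(?Bi * K) * Q * mat_adjoint (?Bi * K) = mat_adjoint U * (A0 * Q * mat_adjoint A0) * U"
  proof -
    have a: "mat_adjoint (mat_adjoint U * A0) = mat_adjoint A0 * U"
      unfolding adj_mult[OF Uc A0] adj_adj[OF U(1)] ..
    have "mat_adjoint U * A0 * Q = mat_adjoint U * (A0 * Q)" by (rule assoc_mult_mat[OF Uc A0 Qc])
    then have "(mat_adjoint U * A0) * Q * (mat_adjoint A0 * U) = mat_adjoint U * (A0 * Q) * (mat_adjoint A0 * U)" by simp
    also have "\<dots> = (mat_adjoint U * (A0 * Q) * mat_adjoint A0) * U"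
      by (rule assoc_mult_mat[OF mult_carrier_mat[OF Uc mult_carrier_mat[OF A0 Qc]] A0c U(1), symmetric])
    also have "mat_adjoint U * (A0 * Q) * mat_adjoint A0 = mat_adjoint U * (A0 * Q * mat_adjoint A0)"
      by (rule assoc_mult_mat[OF Uc mult_carrier_mat[OF A0 Qc] A0c])
    finally show ?thesis unfolding BK a .
  qed
  then have "rdiag m S K Q ?B ?Bi d"
    unfolding rdiag_def using 1 2 3 U B0(1,2) Uc by (auto intro: mult_carrier_mat)
  then show ?thesis by (rule that)
qed

text \<open>With \<open>K = B * (Bi * K)\<close> the factor \<open>B\<close> comes out on both sides
  of the sum. \<open>R\<close> is unrelated to the \<open>Q\<close> that determined the coordinates,
  which permits differentiation at \<open>Q\<close> in coordinates that stay fixed.\<close>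

lemma rdiag_det:
  assumes r: "rdiag m S K Q B Bi d" and K: "K \<in> carrier_mat m t" and R: "R \<in> carrier_mat t t"
  shows "det (S + K * R * mat_adjoint K) = det S * det (1\<^sub>m m + (Bi * K) * R * mat_adjoint (Bi * K))"
proof -
  have B: "B \<in> carrier_mat m m" "Bi \<in> carrier_mat m m" "B * Bi = 1\<^sub>m m" "Bi * B = 1\<^sub>m m" "B * mat_adjoint B = S"
    using r by (auto simp: rdiag_def)
  have Bc: "mat_adjoint B \<in> carrier_mat m m" using B by auto
  define A where "A = Bi * K"
  have A: "A \<in> carrier_mat m t" using B K by (simp add: A_def)
  have Ac: "mat_adjoint A \<in> carrier_mat t m" using A by auto
  have KA: "K = B * A" unfolding A_def using assoc_mult_mat[OF B(1,2) K] B(3) K by simp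
  have AR: "A * R \<in> carrier_mat m t" "A * R * mat_adjoint A \<in> carrier_mat m m" using A R Ac by auto
  have "K * R * mat_adjoint K = B * (A * R * mat_adjoint A) * mat_adjoint B"
  proof -
    have "K * R * mat_adjoint K = (B * A * R) * (mat_adjoint A * mat_adjoint B)"
      unfolding KA adj_mult[OF B(1) A] ..
    also have "B * A * R = B * (A * R)" by (rule assoc_mult_mat[OF B(1) A R])
    also have "B * (A * R) * (mat_adjoint A * mat_adjoint B) = B * (A * R) * mat_adjoint A * mat_adjoint B"
      by (rule assoc_mult_mat[OF mult_carrier_mat[OF B(1) AR(1)] Ac Bc, symmetric])
    also have "B * (A * R) * mat_adjoint A = B * (A * R * mat_adjoint A)" by (rule assoc_mult_mat[OF B(1) AR(1) Ac])
    finally show ?thesis .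
  qed
  moreover have "S = B * 1\<^sub>m m * mat_adjoint B" using B by simp
  ultimately have "S + K * R * mat_adjoint K = B * (1\<^sub>m m + A * R * mat_adjoint A) * mat_adjoint B"
    unfolding mult_add_distrib_mat[OF B(1) one_carrier_mat AR(2)]
      add_mult_distrib_mat[OF mult_carrier_mat[OF B(1) one_carrier_mat] mult_carrier_mat[OF B(1) AR(2)] Bc] by simp
  then have "det (S + K * R * mat_adjoint K) = det B * det (1\<^sub>m m + A * R * mat_adjoint A) * det (mat_adjoint B)"
    using B(1) Bc AR(2) by (simp add: det_mult[of _ m])
  also have "\<dots> = det (B * mat_adjoint B) * det (1\<^sub>m m + A * R * mat_adjoint A)"
    using B(1) Bc by (simp add: det_mult[of _ m])
  finally show ?thesis unfolding B(5) A_def .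
qed

lemma one_plus_cdiag: "1\<^sub>m m + cdiag m (\<lambda>j. complex_of_real (d j)) = cdiag m (\<lambda>j. complex_of_real (1 + d j))"
  by (rule eq_matI) (auto simp: cdiag_def)

lemma rdiag_det_Q:
  assumes r: "rdiag m S K Q B Bi d" and K: "K \<in> carrier_mat m t" and Q: "Q \<in> carrier_mat t t"
  shows "det (S + K * Q * mat_adjoint K) = det S * complex_of_real (\<Prod>j<m. 1 + d j)"
proof -
  have "(Bi * K) * Q * mat_adjoint (Bi * K) = cdiag m (\<lambda>j. complex_of_real (d j))" using r by (simp add: rdiag_def)
  then show ?thesis unfolding rdiag_det[OF r K Q] by (simp only: one_plus_cdiag det_cdiag of_real_prod)
qed

text \<open>Natural logarithms suit the derivatives; rates in bits are recovered by one division by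
  ln 2 at the end.\<close>

definition lndet :: "complex mat \<Rightarrow> real" where "lndet A = ln (Re (det A))"

lemma rdiag_lndet:
  assumes r: "rdiag m S K Q B Bi d" and S: "0 < Re (det S)" and K: "K \<in> carrier_mat m t" and Q: "Q \<in> carrier_mat t t"
  shows "0 < Re (det (S + K * Q * mat_adjoint K))"
    and "lndet (S + K * Q * mat_adjoint K) - lndet S = (\<Sum>j<m. ln (1 + d j))"
proof -
  have d: "0 < 1 + d j" if "j < m" for j using r that by (auto simp: rdiag_def add_pos_nonneg)
  have p: "0 < (\<Prod>j<m. 1 + d j)" using d by (intro prod_pos) auto
  have e: "Re (det (S + K * Q * mat_adjoint K)) = Re (det S) * (\<Prod>j<m. 1 + d j)"
    unfolding rdiag_det_Q[OF r K Q] times_complex.sel Re_complex_of_real Im_complex_of_real by simp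
  show "0 < Re (det (S + K * Q * mat_adjoint K))" unfolding e using S p by simp
  show "lndet (S + K * Q * mat_adjoint K) - lndet S = (\<Sum>j<m. ln (1 + d j))"
  proof -
    have "ln (\<Prod>j<m. 1 + d j) = (\<Sum>j<m. ln (1 + d j))"       by (rule ln_prod) (use d less_imp_neq[OF d] in force)+
    then show ?thesis unfolding lndet_def e ln_mult_pos[OF S p] by simp
  qed
qed

text \<open>A permutation other than the identity moves at least two indices, so its product has two
  factors that vanish at 0 and contributes nothing to first order.\<close>

lemma det_cdiag_deriv:
  assumes X: "X \<in> carrier_mat m m"
  shows "((\<lambda>s. det (cdiag m e + s \<cdot>\<^sub>m X)) has_field_derivative (\<Sum>j<m. X $$ (j, j) * (\<Prod>i\<in>{..<m} - {j}. e i))) (at 0)"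
proof -
  let ?P = "{p. p permutes {0..<m}}"
  let ?f = "\<lambda>p i s. (if i = p i then e i else 0) + s * X $$ (i, p i)"
  have det: "det (cdiag m e + s \<cdot>\<^sub>m X) = (\<Sum>p\<in>?P. signof p * (\<Prod>i<m. ?f p i s))" for s
  proof -
    have "det (cdiag m e + s \<cdot>\<^sub>m X) = (\<Sum>p\<in>?P. signof p * (\<Prod>i = 0..<m. (cdiag m e + s \<cdot>\<^sub>m X) $$ (i, p i)))"
      by (rule det_def') (use X in simp)
    also have "\<dots> = (\<Sum>p\<in>?P. signof p * (\<Prod>i<m. ?f p i s))"
    proof (intro sum.cong refl arg_cong2[where f="(*)"])
      fix p assume "p \<in> ?P"
      then have p: "p i < m" if "i < m" for i using that permutes_in_image[of p "{0..<m}" i] by auto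
      show "(\<Prod>i = 0..<m. (cdiag m e + s \<cdot>\<^sub>m X) $$ (i, p i)) = (\<Prod>i<m. ?f p i s)"
        unfolding atLeast0LessThan using p X by (intro prod.cong refl) auto
    qed
    finally show ?thesis .
  qed
  let ?D = "\<lambda>p. \<Sum>j<m. X $$ (j, p j) * (\<Prod>i\<in>{..<m} - {j}. ?f p i 0)"
  have "((\<lambda>s. \<Sum>p\<in>?P. signof p * (\<Prod>i<m. ?f p i s)) has_field_derivative (\<Sum>p\<in>?P. signof p * ?D p)) (at 0)"
    by (intro DERIV_sum DERIV_cmult has_field_derivative_prod) (auto intro!: derivative_eq_intros)
  moreover have "(\<Sum>p\<in>?P. signof p * ?D p) = (\<Sum>j<m. X $$ (j, j) * (\<Prod>i\<in>{..<m} - {j}. e i))"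
  proof -
    have z: "?D p = 0" if p: "p permutes {0..<m}" "p \<noteq> id" for p
    proof (intro sum.neutral ballI)
      fix j assume j: "j \<in> {..<m}"
      obtain a where a: "p a \<noteq> a" using p(2) by (metis eq_id_iff)
      then have am: "a < m" using p(1) by (metis atLeastLessThan_iff permutes_not_in zero_le)
      \<comment> \<open>A moved index may coincide with the factor \<open>j\<close> being
        differentiated; then its image is a second moved index.\<close>
      have "\<exists>i. i < m \<and> i \<noteq> j \<and> p i \<noteq> i"
      proof (cases "a = j")
        case False then show ?thesis using a am by blast
      next
        case True
        have "p a < m" using permutes_in_image[OF p(1), of a] am by simp
        moreover have "p (p a) \<noteq> p a" using a permutes_inj[OF p(1)] by (metis injD)
        ultimately show ?thesis using a True by blast
      qed
      then obtain i where i: "i < m" "i \<noteq> j" "p i \<noteq> i" by blast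
      have "(\<Prod>i\<in>{..<m} - {j}. ?f p i 0) = 0"
        by (rule prod_zero) (use i in \<open>auto intro!: bexI[of _ i]\<close>)
      then show "X $$ (j, p j) * (\<Prod>i\<in>{..<m} - {j}. ?f p i 0) = 0" by simp
    qed
    have idP: "id \<in> ?P" by (simp add: permutes_id)
    have "(\<Sum>p\<in>?P. signof p * ?D p) = (\<Sum>p\<in>{id}. signof p * ?D p)"
      using idP z by (intro sum.mono_neutral_right) (auto simp: finite_permutations)
    also have "\<dots> = (\<Sum>j<m. X $$ (j, j) * (\<Prod>i\<in>{..<m} - {j}. e i))" by (simp add: signof_id)
    finally show ?thesis .
  qed
  ultimately show ?thesis unfolding det by simp
qed

text \<open>The derivative is the trace of the inverse at the base point times the direction. In the
  coordinates of \<open>rdiag\<close> the base point is diagonal, so only the diagonal of the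
  direction matters.\<close>

lemma lndet_deriv:
  assumes r: "rdiag m S K Q B Bi d" and S: "0 < Re (det S)" "Im (det S) = 0" and K: "K \<in> carrier_mat m t"
    and Q: "Q \<in> carrier_mat t t" and D: "D \<in> carrier_mat t t"
  shows "((\<lambda>s. lndet (S + K * (Q + complex_of_real s \<cdot>\<^sub>m D) * mat_adjoint K)) has_real_derivative
     (\<Sum>j<m. Re (((Bi * K) * D * mat_adjoint (Bi * K)) $$ (j, j)) / (1 + d j))) (at 0)"
proof -
  define A where "A = Bi * K"
  have Bi: "Bi \<in> carrier_mat m m" using r by (simp add: rdiag_def)
  have A: "A \<in> carrier_mat m t" using Bi K by (simp add: A_def)
  have Ac: "mat_adjoint A \<in> carrier_mat t m" using A by auto
  have AQ: "A * Q * mat_adjoint A = cdiag m (\<lambda>j. complex_of_real (d j))" using r by (simp add: rdiag_def A_def)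
  define X where "X = A * D * mat_adjoint A"
  have X: "X \<in> carrier_mat m m" using A D Ac by (simp add: X_def)
  let ?e = "\<lambda>j. complex_of_real (1 + d j)"
  have d: "0 < 1 + d j" if "j < m" for j using r that by (auto simp: rdiag_def add_pos_nonneg)
  let ?pr = "\<Prod>j<m. 1 + d j"
  have pr: "0 < ?pr" using d by (intro prod_pos) auto
  have det: "Re (det (S + K * (Q + complex_of_real s \<cdot>\<^sub>m D) * mat_adjoint K)) = Re (det S) * Re (det (cdiag m ?e + complex_of_real s \<cdot>\<^sub>m X))" for s
  proof -
    have "A * (Q + complex_of_real s \<cdot>\<^sub>m D) = A * Q + complex_of_real s \<cdot>\<^sub>m (A * D)"
      using A Q D by (simp add: mult_add_distrib_mat[of A m t] mult_smult_distrib[of A m t])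
    then have "A * (Q + complex_of_real s \<cdot>\<^sub>m D) * mat_adjoint A = A * Q * mat_adjoint A + complex_of_real s \<cdot>\<^sub>m X"
      using A Q D Ac unfolding X_def by (simp add: add_mult_distrib_mat[of _ m t] mult_smult_assoc_mat[of _ m t])
    then have "1\<^sub>m m + A * (Q + complex_of_real s \<cdot>\<^sub>m D) * mat_adjoint A = (1\<^sub>m m + cdiag m (\<lambda>j. complex_of_real (d j))) + complex_of_real s \<cdot>\<^sub>m X"
      unfolding AQ using X by (simp add: assoc_add_mat[of _ m m])
    then show ?thesis
      using rdiag_det[OF r K, of "Q + complex_of_real s \<cdot>\<^sub>m D"] Q D S(2) unfolding one_plus_cdiag A_def by simp
  qed
  have "((\<lambda>s. det (cdiag m ?e + s \<cdot>\<^sub>m X)) has_field_derivative (\<Sum>j<m. X $$ (j, j) * (\<Prod>i\<in>{..<m} - {j}. ?e i))) (at (of_real 0))"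
    using det_cdiag_deriv[OF X] by simp
  from has_vector_derivative_real_field[OF this, of UNIV]
  have "((\<lambda>s. det (cdiag m ?e + complex_of_real s \<cdot>\<^sub>m X)) has_vector_derivative (\<Sum>j<m. X $$ (j, j) * (\<Prod>i\<in>{..<m} - {j}. ?e i))) (at 0)" by simp
  from bounded_linear.has_vector_derivative[OF bounded_linear_Re this]
  have dR: "((\<lambda>s. Re (det (cdiag m ?e + complex_of_real s \<cdot>\<^sub>m X))) has_real_derivative Re (\<Sum>j<m. X $$ (j, j) * (\<Prod>i\<in>{..<m} - {j}. ?e i))) (at 0)"
    by (simp add: has_real_derivative_iff_has_vector_derivative)
  have val: "Re (\<Sum>j<m. X $$ (j, j) * (\<Prod>i\<in>{..<m} - {j}. ?e i)) = ?pr * (\<Sum>j<m. Re (X $$ (j, j)) / (1 + d j))"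
    unfolding Re_sum sum_distrib_left
  proof (intro sum.cong refl)
    fix j assume j: "j \<in> {..<m}"
    have "(\<Prod>i\<in>{..<m} - {j}. 1 + d i) = ?pr / (1 + d j)"
      using d[of j] j by (simp add: prod.remove[of _ j])
    then have "(\<Prod>i\<in>{..<m} - {j}. ?e i) = complex_of_real (?pr / (1 + d j))" by (metis of_real_prod)
    then show "Re (X $$ (j, j) * (\<Prod>i\<in>{..<m} - {j}. ?e i)) = ?pr * (Re (X $$ (j, j)) / (1 + d j))"
      by (simp only: Re_complex_of_real Im_complex_of_real times_complex.sel) simp
  qed
  have v0: "Re (det (cdiag m ?e + complex_of_real 0 \<cdot>\<^sub>m X)) = ?pr"
  proof -
    have "cdiag m ?e + complex_of_real 0 \<cdot>\<^sub>m X = cdiag m ?e" using X by (intro eq_matI) auto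
    then show ?thesis by (simp add: det_cdiag flip: of_real_prod of_real_add)
  qed
  have "((\<lambda>s. ln (Re (det S) * Re (det (cdiag m ?e + complex_of_real s \<cdot>\<^sub>m X)))) has_real_derivative
     (1 / (Re (det S) * ?pr)) * (Re (det S) * (?pr * (\<Sum>j<m. Re (X $$ (j, j)) / (1 + d j))))) (at 0)"
    by (rule DERIV_chain2[OF DERIV_ln_divide DERIV_cmult[OF dR[unfolded val]], unfolded v0]) (use S pr in simp)
  moreover have "(1 / (Re (det S) * ?pr)) * (Re (det S) * (?pr * (\<Sum>j<m. Re (X $$ (j, j)) / (1 + d j)))) = (\<Sum>j<m. Re (X $$ (j, j)) / (1 + d j))"
  proof -
    have "1 / (p * q) * (p * (q * x)) = x" if "0 < p" "0 < q" for p q x :: real using that by simp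
    then show ?thesis using S(1) pr by blast
  qed
  ultimately show ?thesis unfolding lndet_def det X_def A_def by simp
qed

section \<open>The optimal input covariances\<close>

definition feas :: "nat \<Rightarrow> real \<Rightarrow> complex mat \<Rightarrow> complex mat \<Rightarrow> bool" where
  "feas t P Qp Qc \<longleftrightarrow> psd t Qp \<and> psd t Qc \<and> Re (mtrace Qp) + Re (mtrace Qc) \<le> P"

definition obj :: "real \<Rightarrow> real \<Rightarrow> nat \<Rightarrow> complex mat \<Rightarrow> complex mat \<Rightarrow> complex mat \<Rightarrow> complex mat \<Rightarrow> complex mat \<Rightarrow> real" where
  "obj a b m1 G S K Qp Qc =
     a * (lndet (1\<^sub>m m1 + G * (Qp + Qc) * mat_adjoint G) - lndet (1\<^sub>m m1 + G * Qc * mat_adjoint G))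
     + b * (lndet (S + K * Qc * mat_adjoint K) - lndet S)"

lemma mtrace_sum: "A \<in> carrier_mat k k \<Longrightarrow> mtrace A = (\<Sum>i<k. A $$ (i, i))"
  by (auto simp: mtrace_def)

lemma psd_trace_nonneg: "psd k A \<Longrightarrow> 0 \<le> Re (mtrace A)"
  by (auto simp: mtrace_sum[OF psd_carrier] intro!: sum_nonneg psd_diag)

text \<open>A test vector with entries 1 and a phase \<open>c\<close> that turns the entry z into
  -|z| gives 2|z| at most the sum of the two diagonal entries. Through this bound the feasible
  covariances form a bounded set.\<close>

lemma psd_entry_le_trace:
  assumes p: "psd k A" and i: "i < k" and j: "j < k"
  shows "cmod (A $$ (i, j)) \<le> Re (mtrace A)"
proof -
  have tr: "Re (mtrace A) = (\<Sum>l<k. Re (A $$ (l, l)))" by (simp add: mtrace_sum[OF psd_carrier[OF p]])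
  have one: "Re (A $$ (l, l)) \<le> Re (mtrace A)" if "l < k" for l
    unfolding tr using that psd_diag(2)[OF p] by (intro member_le_sum) auto
  show ?thesis
  proof (cases "i = j")
    case True
    then show ?thesis using one[OF i] psd_diag[OF p i] by (simp add: cmod_eq_Re)
  next
    case False
    define z where "z = A $$ (i, j)"
    define c where "c = (if z = 0 then 1 else - cnj z / complex_of_real (cmod z))"
    have c1: "c * cnj c = 1"
      by (simp add: c_def complex_norm_square[symmetric] power2_eq_square[symmetric] mult.commute[of "cnj z" z] norm_divide)
    have "z * cnj z = complex_of_real (cmod z) * complex_of_real (cmod z)"
      using complex_norm_square[of z] by (simp add: power2_eq_square)
    then have zc: "z * c = - complex_of_real (cmod z)" by (auto simp: c_def)
    have "0 \<le> Re (qform k A (\<lambda>l. if l = i then 1 else if l = j then c else 0))"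
      using p unfolding psd_qform by blast
    also have "qform k A (\<lambda>l. if l = i then 1 else if l = j then c else 0) = A $$ (i, i) + z * c + cnj (z * c) + A $$ (j, j) * (c * cnj c)"
      unfolding qform_two[OF i j False] psd_entry[OF p i j] z_def by simp
    finally have "2 * cmod z \<le> Re (A $$ (i, i)) + Re (A $$ (j, j))" unfolding zc c1 by simp
    also have "\<dots> \<le> 2 * Re (mtrace A)" using one[OF i] one[OF j] by simp
    finally show ?thesis by (simp add: z_def)
  qed
qed

lemma congruence_index:
  assumes "K \<in> carrier_mat m t" "R \<in> carrier_mat t t" "i < m" "j < m"
  shows "(K * R * mat_adjoint K) $$ (i, j) = (\<Sum>l<t. \<Sum>k<t. K $$ (i, k) * R $$ (k, l) * cnj (K $$ (j, l)))"
  using mat_mult_index[OF mult_carrier_mat[OF assms(1,2)] adj_carrier[OF assms(1)] assms(3,4)]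
    mat_mult_index[OF assms(1,2,3)] adj_index[OF assms(1) _ assms(4)]
  by (simp add: sum_distrib_right)

lemma continuous_coord: "continuous_on UNIV (\<lambda>q :: 'i \<Rightarrow> complex. q x)"
  by (rule continuous_on_product_coordinates)

lemma continuous_det_congruence:
  fixes R :: "('i \<Rightarrow> complex) \<Rightarrow> complex mat"
  assumes S: "S \<in> carrier_mat m m" and K: "K \<in> carrier_mat m t" and R: "\<And>q. R q \<in> carrier_mat t t"
    and c: "\<And>k l. k < t \<Longrightarrow> l < t \<Longrightarrow> continuous_on UNIV (\<lambda>q. R q $$ (k, l))"
  shows "continuous_on UNIV (\<lambda>q. det (S + K * R q * mat_adjoint K))"
proof -
  have "det (S + K * R q * mat_adjoint K) = (\<Sum>p\<in>{p. p permutes {0..<m}}. signof p *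
     (\<Prod>i<m. S $$ (i, p i) + (\<Sum>l<t. \<Sum>k<t. K $$ (i, k) * R q $$ (k, l) * cnj (K $$ (p i, l)))))" for q
  proof -
    have KR: "K * R q * mat_adjoint K \<in> carrier_mat m m" using K R[of q] adj_carrier[OF K] by auto
    have "det (S + K * R q * mat_adjoint K) = (\<Sum>p\<in>{p. p permutes {0..<m}}. signof p * (\<Prod>i=0..<m. (S + K * R q * mat_adjoint K) $$ (i, p i)))"
      by (rule det_def') (use S KR in auto)
    also have "\<dots> = (\<Sum>p\<in>{p. p permutes {0..<m}}. signof p *
     (\<Prod>i<m. S $$ (i, p i) + (\<Sum>l<t. \<Sum>k<t. K $$ (i, k) * R q $$ (k, l) * cnj (K $$ (p i, l)))))"
    proof (intro sum.cong refl arg_cong2[where f="(*)"])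
      fix p assume "p \<in> {p. p permutes {0..<m}}"
      then have p: "p i < m" if "i < m" for i using that permutes_in_image[of p "{0..<m}" i] by auto
      show "(\<Prod>i=0..<m. (S + K * R q * mat_adjoint K) $$ (i, p i)) = (\<Prod>i<m. S $$ (i, p i) + (\<Sum>l<t. \<Sum>k<t. K $$ (i, k) * R q $$ (k, l) * cnj (K $$ (p i, l))))"
        unfolding atLeast0LessThan using p S KR K R by (intro prod.cong refl) (simp add: congruence_index[OF K R] del: index_mult_mat)
    qed
    finally show ?thesis .
  qed
  then show ?thesis
    by (simp only:) (intro continuous_on_sum continuous_on_mult continuous_on_prod continuous_on_add continuous_on_const c; simp)
qed

lemma psd_add: assumes "psd k A" "psd k B" shows "psd k (A + B)"
proof -
  have "qform k (A + B) f = qform k A f + qform k B f" for f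
    unfolding qform_def sum.distrib[symmetric]
    using psd_carrier[OF assms(1)] psd_carrier[OF assms(2)] by (intro sum.cong refl) (simp add: algebra_simps)
  then show ?thesis using assms unfolding psd_qform by auto
qed

lemma psd_smult: assumes "psd k A" "0 \<le> c" shows "psd k (complex_of_real c \<cdot>\<^sub>m A)"
proof -
  have "qform k (complex_of_real c \<cdot>\<^sub>m A) f = complex_of_real c * qform k A f" for f
    using psd_carrier[OF assms(1)] by (simp add: qform_def sum_distrib_left mult.assoc)
  then show ?thesis using assms unfolding psd_qform by auto
qed

lemma psd_zero: "psd k (0\<^sub>m k k)"
  unfolding psd_qform by (simp add: qform_def)

lemma psd_one: "psd k (1\<^sub>m k)"
proof -
  have "qform k (1\<^sub>m k) f = complex_of_real (\<Sum>i<k. (cmod (f i))\<^sup>2)" for f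
  proof -
    have "qform k (1\<^sub>m k) f = (\<Sum>i<k. \<Sum>j<k. if j = i then f i * cnj (f i) else 0)"
      unfolding qform_def by (intro sum.cong refl) auto
    also have "\<dots> = (\<Sum>i<k. complex_of_real ((cmod (f i))\<^sup>2))"
      by (intro sum.cong refl) (simp add: complex_norm_square del: of_real_power)
    finally show ?thesis by simp
  qed
  then show ?thesis unfolding psd_qform by (simp add: sum_nonneg del: of_real_sum)
qed

lemma psd_lndet_pos:
  assumes "psd m S" "0 < Re (det S)" "K \<in> carrier_mat m t" "psd t Q"
  shows "0 < Re (det (S + K * Q * mat_adjoint K))"
proof -
  obtain B Bi d where "rdiag m S K Q B Bi d" by (rule rdiag_exists[OF assms])
  then show ?thesis by (rule rdiag_lndet(1)[OF _ assms(2,3) psd_carrier[OF assms(4)]])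
qed

text \<open>A continuous function on a compact set attains its maximum. A pair of matrices is
  encoded as a function of (which matrix, row, column), so that the product topology on functions
  applies; \<open>Z\<close> is a product of balls of radius \<open>P\<close>, with {0} at all
  indices outside the two matrices.\<close>

lemma optimum_exists:
  assumes S: "psd m S" "0 < Re (det S)" and K: "K \<in> carrier_mat m t" and G: "G \<in> carrier_mat m1 t" and P: "0 \<le> P"
  obtains Qp Qc where "feas t P Qp Qc" "\<And>Qp' Qc'. feas t P Qp' Qc' \<Longrightarrow> obj a b m1 G S K Qp' Qc' \<le> obj a b m1 G S K Qp Qc"
proof -
  define Z :: "(nat \<times> nat \<times> nat \<Rightarrow> complex) set" where
    "Z = PiE UNIV (\<lambda>x. if x \<in> {..<2} \<times> {..<t} \<times> {..<t} then cball 0 P else {0})"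
  have Zc: "compact Z"
  proof -
    have "compactin (product_topology (\<lambda>x::nat \<times> nat \<times> nat. euclidean :: complex topology) UNIV) Z"
      unfolding Z_def by (auto simp: compactin_PiE)
    then show ?thesis by (simp add: euclidean_product_topology)
  qed
  define M where "M e q = mat t t (\<lambda>(i, j). q (e, i, j))" for e :: nat and q :: "nat \<times> nat \<times> nat \<Rightarrow> complex"
  have Mc: "M e q \<in> carrier_mat t t" for e q by (simp add: M_def)
  have Mi: "M e q $$ (i, j) = q (e, i, j)" if "i < t" "j < t" for e q i j using that by (simp add: M_def)
  have Mcont: "continuous_on UNIV (\<lambda>q. M e q $$ (i, j))" if "i < t" "j < t" for e i j
    unfolding Mi[OF that] by (rule continuous_coord)
  define F where "F = {q. feas t P (M 0 q) (M 1 q)}"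
  have qc: "continuous_on UNIV (\<lambda>q. qform t (M e q) f)" for e f
    unfolding qform_def using Mcont by (intro continuous_intros) auto
  have Fcl: "closed F"
  proof -
    have cp: "closed {q. psd t (M e q)}" for e
      unfolding psd_qform using Mc
      by (simp, intro closed_Collect_all closed_Collect_conj closed_Collect_eq closed_Collect_le continuous_intros qc)
    have ct: "closed {q. Re (mtrace (M 0 q)) + Re (mtrace (M 1 q)) \<le> P}"
      unfolding mtrace_sum[OF Mc] using Mcont by (intro closed_Collect_le continuous_intros) auto
    show ?thesis unfolding F_def feas_def by (intro closed_Collect_conj cp ct)
  qed
  have C: "compact (Z \<inter> F)" using Zc Fcl by (rule compact_Int_closed)
  have rep: "\<exists>q\<in>Z \<inter> F. M 0 q = Qp \<and> M 1 q = Qc" if f: "feas t P Qp Qc" for Qp Qc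
  proof -
    define q where "q x = (case x of (e, i, j) \<Rightarrow> if e < 2 \<and> i < t \<and> j < t then (if e = 0 then Qp else Qc) $$ (i, j) else 0)" for x :: "nat \<times> nat \<times> nat"
    have p: "psd t Qp" "psd t Qc" and tr: "Re (mtrace Qp) + Re (mtrace Qc) \<le> P" using f by (auto simp: feas_def)
    have e: "M 0 q = Qp" "M 1 q = Qc"
      using psd_carrier[OF p(1)] psd_carrier[OF p(2)] by (auto simp: M_def q_def intro!: eq_matI)
    have "cmod (Qp $$ (i, j)) \<le> P" "cmod (Qc $$ (i, j)) \<le> P" if "i < t" "j < t" for i j
      using psd_entry_le_trace[OF p(1) that] psd_entry_le_trace[OF p(2) that] tr psd_trace_nonneg[OF p(1)] psd_trace_nonneg[OF p(2)] by linarith+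
    then have "q \<in> Z" unfolding Z_def q_def by (auto simp: PiE_def Pi_def split: if_splits)
    moreover have "q \<in> F" unfolding F_def using e f by simp
    ultimately show ?thesis using e by blast
  qed
  have "feas t P (0\<^sub>m t t) (0\<^sub>m t t)" using P psd_zero by (simp add: feas_def mtrace_def)
  then have ne: "Z \<inter> F \<noteq> {}" using rep by blast
  have one: "psd m1 (1\<^sub>m m1)" "0 < Re (det (1\<^sub>m m1 :: complex mat))" using psd_one by auto
  have cont: "continuous_on (Z \<inter> F) (\<lambda>q. obj a b m1 G S K (M 0 q) (M 1 q))"
  proof -
    have pos: "psd t (M 0 q)" "psd t (M 1 q)" "psd t (M 0 q + M 1 q)" if "q \<in> Z \<inter> F" for q
      using that psd_add by (auto simp: F_def feas_def)
    have ln: "continuous_on (Z \<inter> F) (\<lambda>q. lndet (S' + K' * R q * mat_adjoint K'))"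
      if "psd m' S'" "0 < Re (det S')" "K' \<in> carrier_mat m' t" "\<And>q. R q \<in> carrier_mat t t"
        "\<And>k l. k < t \<Longrightarrow> l < t \<Longrightarrow> continuous_on UNIV (\<lambda>q. R q $$ (k, l))" "\<And>q. q \<in> Z \<inter> F \<Longrightarrow> psd t (R q)" for m' S' K' R
    proof -
      have "continuous_on UNIV (\<lambda>q. Re (det (S' + K' * R q * mat_adjoint K')))"
        using continuous_det_congruence[OF psd_carrier[OF that(1)] that(3,4,5)] by (intro continuous_intros)
      then have c: "continuous_on (Z \<inter> F) (\<lambda>q. Re (det (S' + K' * R q * mat_adjoint K')))"
        by (rule continuous_on_subset) simp
      show ?thesis unfolding lndet_def
        using psd_lndet_pos[OF that(1,2,3) that(6)] by (intro continuous_on_ln c) force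
    qed
    have cs: "continuous_on UNIV (\<lambda>q. (M 0 q + M 1 q) $$ (k, l))" if "k < t" "l < t" for k l
    proof -
      have "(M 0 q + M 1 q) $$ (k, l) = M 0 q $$ (k, l) + M 1 q $$ (k, l)" for q using Mc[of 1 q] that by auto
      then show ?thesis using Mcont that by (auto intro!: continuous_intros)
    qed
    show ?thesis unfolding obj_def using pos Mc Mcont
      by (intro continuous_intros ln[OF one G] ln[OF S K] cs) auto
  qed
  obtain q where q: "q \<in> Z \<inter> F" "\<And>r. r \<in> Z \<inter> F \<Longrightarrow> obj a b m1 G S K (M 0 r) (M 1 r) \<le> obj a b m1 G S K (M 0 q) (M 1 q)"
    using continuous_attains_sup[OF C ne cont] by blast
  show ?thesis
  proof (rule that[of "M 0 q" "M 1 q"])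
    show "feas t P (M 0 q) (M 1 q)" using q(1) by (simp add: F_def)
    fix Qp' Qc' assume "feas t P Qp' Qc'"
    then show "obj a b m1 G S K Qp' Qc' \<le> obj a b m1 G S K (M 0 q) (M 1 q)" using rep q(2) by metis
  qed
qed

section \<open>First-order optimality conditions\<close>

definition vsq :: "nat \<Rightarrow> complex Matrix.vec \<Rightarrow> real" where
  "vsq t v = (\<Sum>i<t. (cmod (v $ i))\<^sup>2)"

text \<open>For \<open>A = Bi * K\<close> with \<open>rdiag m S K Q B Bi d\<close> this is v^H K^H
  (S + K Q K^H)^(-1) K v, the derivative of the log-determinant at \<open>Q\<close> in the direction
  of the rank-one covariance \<open>outer t v\<close>.\<close>

definition hform :: "nat \<Rightarrow> complex mat \<Rightarrow> (nat \<Rightarrow> real) \<Rightarrow> complex Matrix.vec \<Rightarrow> real" where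
  "hform m A d v = (\<Sum>j<m. (cmod ((A *\<^sub>v v) $ j))\<^sup>2 / (1 + d j))"

definition outer :: "nat \<Rightarrow> complex Matrix.vec \<Rightarrow> complex mat" where
  "outer t v = mat t t (\<lambda>(i, j). v $ i * cnj (v $ j))"

lemma outer_carrier[simp]: "outer t v \<in> carrier_mat t t" by (simp add: outer_def)

lemma qform_outer: "qform t (outer t v) f = complex_of_real ((cmod (\<Sum>i<t. v $ i * cnj (f i)))\<^sup>2)"
proof -
  have "qform t (outer t v) f = (\<Sum>i<t. \<Sum>j<t. (v $ i * cnj (f i)) * cnj (v $ j * cnj (f j)))"
    unfolding qform_def outer_def by (intro sum.cong refl) (simp add: mult_ac)
  also have "\<dots> = (\<Sum>i<t. v $ i * cnj (f i)) * cnj (\<Sum>j<t. v $ j * cnj (f j))"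
    by (simp add: sum_product)
  finally show ?thesis by (simp add: complex_norm_square del: of_real_power)
qed

lemma psd_outer: "psd t (outer t v)"
  unfolding psd_qform qform_outer by (simp del: of_real_power)

lemma mtrace_outer: "mtrace (outer t v) = complex_of_real (vsq t v)"
  unfolding mtrace_sum[OF outer_carrier] vsq_def of_real_sum
  by (intro sum.cong refl) (simp add: outer_def complex_norm_square del: of_real_power)

lemma congruence_outer_index:
  assumes A: "A \<in> carrier_mat m t" and v: "v \<in> carrier_vec t" and j: "j < m"
  shows "(A * outer t v * mat_adjoint A) $$ (j, j) = complex_of_real ((cmod ((A *\<^sub>v v) $ j))\<^sup>2)"
proof -
  have "(A * outer t v * mat_adjoint A) $$ (j, j) = (\<Sum>l<t. \<Sum>k<t. (A $$ (j, k) * v $ k) * cnj (A $$ (j, l) * v $ l))"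
    unfolding congruence_index[OF A outer_carrier j j] by (intro sum.cong refl) (simp add: outer_def mult_ac)
  also have "\<dots> = (\<Sum>k<t. A $$ (j, k) * v $ k) * cnj (\<Sum>l<t. A $$ (j, l) * v $ l)"
    by (subst sum.swap) (simp add: sum_product)
  finally show ?thesis unfolding mat_vec_index[OF A v j] by (simp add: complex_norm_square del: of_real_power)
qed

lemma lndet_direction:
  assumes r: "rdiag m S K Q B Bi d" and S: "psd m S" "0 < Re (det S)" and K: "K \<in> carrier_mat m t"
    and Q: "Q \<in> carrier_mat t t" and v: "v \<in> carrier_vec t"
  shows "((\<lambda>s. lndet (S + K * (Q + complex_of_real s \<cdot>\<^sub>m (complex_of_real x \<cdot>\<^sub>m outer t v + complex_of_real y \<cdot>\<^sub>m Q)) * mat_adjoint K))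
     has_real_derivative x * hform m (Bi * K) d v + y * (\<Sum>j<m. d j / (1 + d j))) (at 0)"
proof -
  let ?D = "complex_of_real x \<cdot>\<^sub>m outer t v + complex_of_real y \<cdot>\<^sub>m Q"
  let ?A = "Bi * K"
  have A: "?A \<in> carrier_mat m t" using r K by (auto simp: rdiag_def)
  have Ac: "mat_adjoint ?A \<in> carrier_mat t m" using A by auto
  have D: "?D \<in> carrier_mat t t" using Q by simp
  have "Re ((?A * ?D * mat_adjoint ?A) $$ (j, j)) = x * (cmod ((?A *\<^sub>v v) $ j))\<^sup>2 + y * d j" if j: "j < m" for j
  proof -
    have "(?A * ?D * mat_adjoint ?A) $$ (j, j) = complex_of_real x * (?A * outer t v * mat_adjoint ?A) $$ (j, j) + complex_of_real y * (?A * Q * mat_adjoint ?A) $$ (j, j)"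
      unfolding congruence_index[OF A D j j] congruence_index[OF A outer_carrier j j] congruence_index[OF A Q j j] sum_distrib_left sum.distrib[symmetric]
      using Q by (intro sum.cong refl) (simp add: algebra_simps outer_def)
    also have "?A * Q * mat_adjoint ?A = cdiag m (\<lambda>j. complex_of_real (d j))" using r by (simp add: rdiag_def)
    finally show ?thesis unfolding congruence_outer_index[OF A v j] using j by (simp del: of_real_power)
  qed
  then have "(\<Sum>j<m. Re ((?A * ?D * mat_adjoint ?A) $$ (j, j)) / (1 + d j)) = x * hform m ?A d v + y * (\<Sum>j<m. d j / (1 + d j))"
    by (simp add: hform_def add_divide_distrib sum.distrib sum_distrib_left)
  then show ?thesis using lndet_deriv[OF r S(2) psd_factor(1)[OF S] K Q D] by simp
qed

lemma deriv_nonpos_at_max: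
  assumes "(f has_real_derivative l) (at 0)" "0 < \<epsilon>" "\<And>s. 0 < s \<Longrightarrow> s < \<epsilon> \<Longrightarrow> f s \<le> f 0"
  shows "l \<le> 0"
proof (rule ccontr)
  assume "\<not> l \<le> 0"
  then obtain e where e: "0 < e" "\<And>h. 0 < h \<Longrightarrow> h < e \<Longrightarrow> f 0 < f (0 + h)"
    using DERIV_pos_inc_right[OF assms(1)] by auto
  define h where "h = min e \<epsilon> / 2"
  have "0 < h" "h < e" "h < \<epsilon>" using e assms(2) by (auto simp: h_def)
  then show False using e(2)[of h] assms(3)[of h] by simp
qed

lemma mtrace_lin:
  assumes "X \<in> carrier_mat t t" "Y \<in> carrier_mat t t"
  shows "mtrace (X + c \<cdot>\<^sub>m Y) = mtrace X + c * mtrace Y"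
  using assms by (simp add: mtrace_sum[of _ t] sum.distrib sum_distrib_left)

text \<open>A Cauchy-Schwarz inequality for the form of \<open>Q\<close>, obtained by testing at f +
  c y with c proportional to the mixed term. It shows that rank-one terms from the range of
  \<open>Q\<close> may be subtracted for a small step, so variations in these directions are
  two-sided.\<close>

lemma psd_minus_outer:
  assumes p: "psd t Q" and y: "y \<in> carrier_vec t" and s: "0 \<le> s" "s * Re (qform t Q (\<lambda>i. y $ i)) \<le> 1"
  shows "psd t (Q + complex_of_real (- s) \<cdot>\<^sub>m outer t (Q *\<^sub>v y))"
proof -
  have Q: "Q \<in> carrier_mat t t" by (rule psd_carrier[OF p])
  let ?v = "Q *\<^sub>v y"
  have v: "?v \<in> carrier_vec t" using Q y by auto
  define k where "k = Re (qform t Q (\<lambda>i. y $ i))"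
  have k: "qform t Q (\<lambda>i. y $ i) = complex_of_real k" using p unfolding psd_qform k_def by (auto simp: complex_eq_iff)
  have lin: "qform t (Q + complex_of_real (- s) \<cdot>\<^sub>m outer t ?v) f = qform t Q f - complex_of_real (s * (cmod (\<Sum>i<t. ?v $ i * cnj (f i)))\<^sup>2)" for f
  proof -
    have "qform t (Q + complex_of_real (- s) \<cdot>\<^sub>m outer t ?v) f = qform t Q f - complex_of_real s * qform t (outer t ?v) f"
      unfolding qform_def sum_distrib_left sum_subtractf[symmetric]
      using Q by (intro sum.cong refl) (simp add: outer_def algebra_simps)
    then show ?thesis unfolding qform_outer by simp
  qed
  have key: "s * (cmod (\<Sum>i<t. ?v $ i * cnj (f i)))\<^sup>2 \<le> Re (qform t Q f)" for f
  proof -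
    define b where "b = (\<Sum>i<t. ?v $ i * cnj (f i))"
    have b1: "b = (\<Sum>i<t. \<Sum>j<t. Q $$ (i, j) * y $ j * cnj (f i))"
      unfolding b_def using mat_vec_index[OF Q y] by (simp add: sum_distrib_right)
    have b2: "cnj b = (\<Sum>i<t. \<Sum>j<t. Q $$ (i, j) * f j * cnj (y $ i))"
    proof -
      have "cnj b = (\<Sum>i<t. \<Sum>j<t. Q $$ (j, i) * cnj (y $ j) * f i)"
        unfolding b1 cnj_sum
      proof (intro sum.cong refl)
        fix i j assume "i \<in> {..<t}" "j \<in> {..<t}"
        then have "cnj (Q $$ (i, j)) = Q $$ (j, i)" using psd_entry[OF p, of i j] by simp
        then show "cnj (Q $$ (i, j) * y $ j * cnj (f i)) = Q $$ (j, i) * cnj (y $ j) * f i" by simp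
      qed
      also have "\<dots> = (\<Sum>i<t. \<Sum>j<t. Q $$ (i, j) * f j * cnj (y $ i))"
        by (subst sum.swap) (simp add: mult_ac)
      finally show ?thesis .
    qed
    define c where "c = - complex_of_real s * cnj b"
    have "qform t Q (\<lambda>i. f i + c * y $ i) = (\<Sum>i<t. \<Sum>j<t. Q $$ (i, j) * f j * cnj (f i) + c * (Q $$ (i, j) * y $ j * cnj (f i))
      + cnj c * (Q $$ (i, j) * f j * cnj (y $ i)) + c * cnj c * (Q $$ (i, j) * y $ j * cnj (y $ i)))"
      unfolding qform_def by (intro sum.cong refl) (simp add: algebra_simps)
    also have "\<dots> = qform t Q f + c * b + cnj c * cnj b + c * cnj c * qform t Q (\<lambda>i. y $ i)"
      unfolding b2 unfolding b1 qform_def by (simp only: sum.distrib sum_distrib_left)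
    also have "\<dots> = qform t Q f + complex_of_real (- 2 * s * (cmod b)\<^sup>2 + s * s * (cmod b)\<^sup>2 * k)"
    proof -
      have bb: "b * cnj b = complex_of_real ((cmod b)\<^sup>2)" by (rule complex_norm_square[symmetric])
      have "c * b = - complex_of_real s * (b * cnj b)" "cnj c * cnj b = - complex_of_real s * (b * cnj b)"
        "c * cnj c = complex_of_real s * complex_of_real s * (b * cnj b)" by (simp_all add: c_def mult_ac)
      then show ?thesis unfolding k bb by (simp add: algebra_simps del: of_real_power)
    qed
    finally have "0 \<le> Re (qform t Q f) + (- 2 * s * (cmod b)\<^sup>2 + s * s * (cmod b)\<^sup>2 * k)"
      using p unfolding psd_qform by (metis Re_complex_of_real plus_complex.simps(1))
    moreover have "s * s * (cmod b)\<^sup>2 * k \<le> s * (cmod b)\<^sup>2"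
      using mult_left_mono[OF s(2)[folded k_def], of "s * (cmod b)\<^sup>2"] s(1) by (simp add: mult_ac)
    ultimately show ?thesis unfolding b_def[symmetric] by simp
  qed
  have "Q + complex_of_real (- s) \<cdot>\<^sub>m outer t ?v \<in> carrier_mat t t" using Q by simp
  then show ?thesis unfolding psd_qform lin using key p unfolding psd_qform by simp
qed

lemma obj_direction:
  assumes S: "psd m S" "0 < Re (det S)" and K: "K \<in> carrier_mat m t" and G: "G \<in> carrier_mat m1 t"
    and Q: "Qp \<in> carrier_mat t t" "Qc \<in> carrier_mat t t" and v: "v \<in> carrier_vec t"
    and r0: "rdiag m1 (1\<^sub>m m1) G (Qp + Qc) B0 Bi0 d0" and r1: "rdiag m1 (1\<^sub>m m1) G Qc B1 Bi1 d1" and r: "rdiag m S K Qc B Bi d"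
  shows "((\<lambda>s. obj a b m1 G S K (Qp + complex_of_real s \<cdot>\<^sub>m (complex_of_real xp \<cdot>\<^sub>m outer t v + complex_of_real y \<cdot>\<^sub>m Qp))
                          (Qc + complex_of_real s \<cdot>\<^sub>m (complex_of_real xc \<cdot>\<^sub>m outer t v + complex_of_real y \<cdot>\<^sub>m Qc)))
     has_real_derivative
       a * (((xp + xc) * hform m1 (Bi0 * G) d0 v + y * (\<Sum>j<m1. d0 j / (1 + d0 j))) - (xc * hform m1 (Bi1 * G) d1 v + y * (\<Sum>j<m1. d1 j / (1 + d1 j))))
       + b * (xc * hform m (Bi * K) d v + y * (\<Sum>j<m. d j / (1 + d j)))) (at 0)"
proof -
  have one: "psd m1 (1\<^sub>m m1)" "0 < Re (det (1\<^sub>m m1 :: complex mat))" using psd_one by auto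
  have sum: "(Qp + complex_of_real s \<cdot>\<^sub>m (complex_of_real xp \<cdot>\<^sub>m outer t v + complex_of_real y \<cdot>\<^sub>m Qp)) + (Qc + complex_of_real s \<cdot>\<^sub>m (complex_of_real xc \<cdot>\<^sub>m outer t v + complex_of_real y \<cdot>\<^sub>m Qc))
    = (Qp + Qc) + complex_of_real s \<cdot>\<^sub>m (complex_of_real (xp + xc) \<cdot>\<^sub>m outer t v + complex_of_real y \<cdot>\<^sub>m (Qp + Qc))" for s
    by (rule eq_matI) (use Q in \<open>auto simp: algebra_simps outer_def\<close>)
  have Qs: "Qp + Qc \<in> carrier_mat t t" using Q by simp
  have "((\<lambda>s. a * (lndet (1\<^sub>m m1 + G * ((Qp + Qc) + complex_of_real s \<cdot>\<^sub>m (complex_of_real (xp + xc) \<cdot>\<^sub>m outer t v + complex_of_real y \<cdot>\<^sub>m (Qp + Qc))) * mat_adjoint G)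
       - lndet (1\<^sub>m m1 + G * (Qc + complex_of_real s \<cdot>\<^sub>m (complex_of_real xc \<cdot>\<^sub>m outer t v + complex_of_real y \<cdot>\<^sub>m Qc)) * mat_adjoint G))
     + b * (lndet (S + K * (Qc + complex_of_real s \<cdot>\<^sub>m (complex_of_real xc \<cdot>\<^sub>m outer t v + complex_of_real y \<cdot>\<^sub>m Qc)) * mat_adjoint K) - lndet S))
     has_real_derivative
       a * (((xp + xc) * hform m1 (Bi0 * G) d0 v + y * (\<Sum>j<m1. d0 j / (1 + d0 j))) - (xc * hform m1 (Bi1 * G) d1 v + y * (\<Sum>j<m1. d1 j / (1 + d1 j))))
       + b * ((xc * hform m (Bi * K) d v + y * (\<Sum>j<m. d j / (1 + d j))) - 0)) (at 0)"
    by (intro DERIV_add DERIV_cmult DERIV_diff DERIV_const lndet_direction[OF r0 one G Qs v] lndet_direction[OF r1 one G Q(2) v] lndet_direction[OF r S K Q(2) v])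
  then show ?thesis unfolding obj_def sum by simp
qed

lemma vsq_nonneg: "0 \<le> vsq t v" by (simp add: vsq_def sum_nonneg)

lemma hform_nonneg: "(\<And>j. j < m \<Longrightarrow> 0 \<le> d j) \<Longrightarrow> 0 \<le> hform m A d v"
  unfolding hform_def by (intro sum_nonneg divide_nonneg_nonneg) auto

text \<open>For zero power the multiplier is not determined by rescaling and has to be chosen large;
  this bound provides it.\<close>

lemma hform_bound:
  assumes A: "A \<in> carrier_mat m t" and d: "\<And>j. j < m \<Longrightarrow> 0 \<le> d j" and v: "v \<in> carrier_vec t"
  shows "hform m A d v \<le> (\<Sum>j<m. \<Sum>k<t. (cmod (A $$ (j, k)))\<^sup>2) * vsq t v"
  unfolding hform_def sum_distrib_right
proof (intro sum_mono)
  fix j assume "j \<in> {..<m}"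
  then have j: "j < m" by simp
  have "cmod ((A *\<^sub>v v) $ j) \<le> (\<Sum>k<t. cmod (A $$ (j, k)) * cmod (v $ k))"
    unfolding mat_vec_index[OF A v j] norm_mult[symmetric] by (rule norm_sum)
  then have "(cmod ((A *\<^sub>v v) $ j))\<^sup>2 \<le> (\<Sum>k<t. cmod (A $$ (j, k)) * cmod (v $ k))\<^sup>2"
    by (intro power_mono) auto
  also have "\<dots> \<le> (\<Sum>k<t. (cmod (A $$ (j, k)))\<^sup>2) * (\<Sum>k<t. (cmod (v $ k))\<^sup>2)"
    by (rule Cauchy_Schwarz_ineq_sum)
  finally have "(cmod ((A *\<^sub>v v) $ j))\<^sup>2 \<le> (\<Sum>k<t. (cmod (A $$ (j, k)))\<^sup>2) * vsq t v" by (simp add: vsq_def)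
  moreover have "(cmod ((A *\<^sub>v v) $ j))\<^sup>2 / (1 + d j) \<le> (cmod ((A *\<^sub>v v) $ j))\<^sup>2 / 1"
    using d[OF j] by (intro divide_left_mono) auto
  ultimately show "(cmod ((A *\<^sub>v v) $ j))\<^sup>2 / (1 + d j) \<le> (\<Sum>k<t. (cmod (A $$ (j, k)))\<^sup>2 * vsq t v)"
    by (simp add: sum_distrib_right)
qed

text \<open>The multiplier is explicit. A variation adds s v v^H to one covariance and restores the
  trace by shrinking both by the factor 1 - s |v|^2 / P. Its derivative at the optimum is
  nonpositive, and the shrinking contributes |v|^2 times \<open>\<Lambda> / P\<close>, which is
  \<open>lam\<close>. Variations of \<open>Qp\<close> and of \<open>Qc\<close> give the two
  inequalities; subtracting v v^H from \<open>Qc\<close>, for v in its range, gives the reverse of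
  the second one.\<close>

theorem kkt:
  assumes S: "psd m S" "0 < Re (det S)" and K: "K \<in> carrier_mat m t" and G: "G \<in> carrier_mat m1 t"
    and P: "0 \<le> P" and ab: "0 \<le> a" "0 \<le> b"
  obtains Qp Qc B0 Bi0 d0 B1 Bi1 d1 B Bi d lam where
    "feas t P Qp Qc"
    "rdiag m1 (1\<^sub>m m1) G (Qp + Qc) B0 Bi0 d0" "rdiag m1 (1\<^sub>m m1) G Qc B1 Bi1 d1" "rdiag m S K Qc B Bi d"
    "0 \<le> lam"
    "lam * P = a * (\<Sum>j<m1. d0 j / (1 + d0 j)) - a * (\<Sum>j<m1. d1 j / (1 + d1 j)) + b * (\<Sum>j<m. d j / (1 + d j))"
    "\<And>v. v \<in> carrier_vec t \<Longrightarrow> a * hform m1 (Bi0 * G) d0 v \<le> lam * vsq t v"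
    "\<And>v. v \<in> carrier_vec t \<Longrightarrow> a * hform m1 (Bi0 * G) d0 v - a * hform m1 (Bi1 * G) d1 v + b * hform m (Bi * K) d v \<le> lam * vsq t v"
    "\<And>y. y \<in> carrier_vec t \<Longrightarrow> a * hform m1 (Bi0 * G) d0 (Qc *\<^sub>v y) - a * hform m1 (Bi1 * G) d1 (Qc *\<^sub>v y) + b * hform m (Bi * K) d (Qc *\<^sub>v y) = lam * vsq t (Qc *\<^sub>v y)"
proof -
  obtain Qp Qc where f: "feas t P Qp Qc" and opt: "\<And>Qp' Qc'. feas t P Qp' Qc' \<Longrightarrow> obj a b m1 G S K Qp' Qc' \<le> obj a b m1 G S K Qp Qc"
    using optimum_exists[OF S K G P] by metis
  have p: "psd t Qp" "psd t Qc" and tr: "Re (mtrace Qp) + Re (mtrace Qc) \<le> P" using f by (auto simp: feas_def)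
  have Q: "Qp \<in> carrier_mat t t" "Qc \<in> carrier_mat t t" using p psd_carrier by auto
  have one: "psd m1 (1\<^sub>m m1)" "0 < Re (det (1\<^sub>m m1 :: complex mat))" using psd_one by auto
  obtain B0 Bi0 d0 where r0: "rdiag m1 (1\<^sub>m m1) G (Qp + Qc) B0 Bi0 d0" by (rule rdiag_exists[OF one G psd_add[OF p]])
  obtain B1 Bi1 d1 where r1: "rdiag m1 (1\<^sub>m m1) G Qc B1 Bi1 d1" by (rule rdiag_exists[OF one G p(2)])
  obtain B Bi d where r: "rdiag m S K Qc B Bi d" by (rule rdiag_exists[OF S K p(2)])
  define h0 h1 h where "h0 = hform m1 (Bi0 * G) d0" and "h1 = hform m1 (Bi1 * G) d1" and "h = hform m (Bi * K) d"
  define \<tau>0 \<tau>1 \<tau> where "\<tau>0 = (\<Sum>j<m1. d0 j / (1 + d0 j))" and "\<tau>1 = (\<Sum>j<m1. d1 j / (1 + d1 j))" and "\<tau> = (\<Sum>j<m. d j / (1 + d j))"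
  define \<Lambda> where "\<Lambda> = a * \<tau>0 - a * \<tau>1 + b * \<tau>"
  have dn: "\<And>j. j < m1 \<Longrightarrow> 0 \<le> d0 j" "\<And>j. j < m1 \<Longrightarrow> 0 \<le> d1 j" "\<And>j. j < m \<Longrightarrow> 0 \<le> d j"
    using r0 r1 r by (auto simp: rdiag_def)
  have Ac: "Bi0 * G \<in> carrier_mat m1 t" "Bi1 * G \<in> carrier_mat m1 t" "Bi * K \<in> carrier_mat m t"
    using r0 r1 r G K by (auto simp: rdiag_def)
  let ?Dp = "\<lambda>x y v s. Qp + complex_of_real s \<cdot>\<^sub>m (complex_of_real x \<cdot>\<^sub>m outer t v + complex_of_real y \<cdot>\<^sub>m Qp)"
  let ?Dc = "\<lambda>x y v s. Qc + complex_of_real s \<cdot>\<^sub>m (complex_of_real x \<cdot>\<^sub>m outer t v + complex_of_real y \<cdot>\<^sub>m Qc)"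
  have dir: "a * (xp + xc) * h0 v - a * xc * h1 v + b * xc * h v + y * \<Lambda> \<le> 0"
    if v: "v \<in> carrier_vec t" and e: "0 < \<epsilon>" and fe: "\<And>s. 0 < s \<Longrightarrow> s < \<epsilon> \<Longrightarrow> feas t P (?Dp xp y v s) (?Dc xc y v s)" for xp xc y v \<epsilon>
  proof -
    have z: "?Dp xp y v 0 = Qp" "?Dc xc y v 0 = Qc" using Q by (auto intro!: eq_matI simp: outer_def)
    have "a * (((xp + xc) * h0 v + y * \<tau>0) - (xc * h1 v + y * \<tau>1)) + b * (xc * h v + y * \<tau>) \<le> 0"
      unfolding h0_def h1_def h_def \<tau>0_def \<tau>1_def \<tau>_def
      by (rule deriv_nonpos_at_max[OF obj_direction[OF S K G Q v r0 r1 r] e]) (use opt[OF fe] z in simp)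
    then show ?thesis unfolding \<Lambda>_def by (simp add: algebra_simps)
  qed
  have comb: "Q' + complex_of_real s \<cdot>\<^sub>m (complex_of_real x \<cdot>\<^sub>m outer t v + complex_of_real y \<cdot>\<^sub>m Q')
     = complex_of_real (1 + s * y) \<cdot>\<^sub>m Q' + complex_of_real (s * x) \<cdot>\<^sub>m outer t v" if "Q' \<in> carrier_mat t t" for Q' s x y v
    using that by (auto intro!: eq_matI simp: outer_def algebra_simps)
  have trc: "Re (mtrace (Q' + complex_of_real s \<cdot>\<^sub>m (complex_of_real x \<cdot>\<^sub>m outer t v + complex_of_real y \<cdot>\<^sub>m Q')))
     = (1 + s * y) * Re (mtrace Q') + s * x * vsq t v" if "Q' \<in> carrier_mat t t" for Q' s x y v
    unfolding comb[OF that] using that mtrace_lin[of "complex_of_real (1 + s * y) \<cdot>\<^sub>m Q'" t "outer t v" "complex_of_real (s * x)"]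
      mtrace_lin[of "0\<^sub>m t t" t Q' "complex_of_real (1 + s * y)"]
    by (simp add: mtrace_outer mtrace_sum[of "0\<^sub>m t t" t] algebra_simps)
  have psdc: "psd t (Q' + complex_of_real s \<cdot>\<^sub>m (complex_of_real x \<cdot>\<^sub>m outer t v + complex_of_real y \<cdot>\<^sub>m Q'))"
    if "psd t Q'" "0 \<le> x" "0 \<le> s" "0 \<le> 1 + s * y" for Q' s x y v
    unfolding comb[OF psd_carrier[OF that(1)]] using that by (intro psd_add psd_smult psd_outer mult_nonneg_nonneg) auto
  \<comment> \<open>Shrinking both covariances is always feasible, so it cannot increase the
    objective to first order.\<close>
  have \<Lambda>0: "0 \<le> \<Lambda>"
  proof -
    have "a * (0 + 0) * h0 (0\<^sub>v t) - a * 0 * h1 (0\<^sub>v t) + b * 0 * h (0\<^sub>v t) + (- 1) * \<Lambda> \<le> 0"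
    proof (rule dir[where \<epsilon>=1])
      fix s :: real assume s: "0 < s" "s < 1"
      have "(1 - s) * (Re (mtrace Qp) + Re (mtrace Qc)) \<le> P"
        using mult_right_mono[OF less_imp_le[OF s(1)], of "Re (mtrace Qp) + Re (mtrace Qc)"] tr psd_trace_nonneg[OF p(1)] psd_trace_nonneg[OF p(2)]
        by (simp add: algebra_simps)
      then show "feas t P (?Dp 0 (- 1) (0\<^sub>v t) s) (?Dc 0 (- 1) (0\<^sub>v t) s)"
        unfolding feas_def trc[OF Q(1)] trc[OF Q(2)] using s by (intro conjI psdc p) (auto simp: algebra_simps)
    qed auto
    then show ?thesis by simp
  qed
  show ?thesis
  \<comment> \<open>At zero power there is nothing to rescale: both covariances vanish, the two
    equations hold trivially, and any large enough \<open>lam\<close> satisfies the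
    inequalities.\<close>
  proof (cases "P = 0")
    case True
    have z: "Re (mtrace Qp) = 0" "Re (mtrace Qc) = 0" using tr True psd_trace_nonneg[OF p(1)] psd_trace_nonneg[OF p(2)] by linarith+
    have Q0: "Qp = 0\<^sub>m t t" "Qc = 0\<^sub>m t t"
      using Q psd_entry_le_trace[OF p(1)] psd_entry_le_trace[OF p(2)] z by (auto intro!: eq_matI)
    have dz: "e j = 0" if rr: "rdiag k S' K' Q' C Ci e" and K': "K' \<in> carrier_mat k t" and Q': "Q' = 0\<^sub>m t t" and j: "j < k" for k S' K' Q' C Ci e j
    proof -
      have A: "Ci * K' \<in> carrier_mat k t" using rr K' by (auto simp: rdiag_def)
      have "(Ci * K' * Q' * mat_adjoint (Ci * K')) $$ (j, j) = 0"
        unfolding Q' congruence_index[OF A zero_carrier_mat j j] by simp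
      moreover have "(Ci * K' * Q' * mat_adjoint (Ci * K')) $$ (j, j) = complex_of_real (e j)"
        using rr j by (simp add: rdiag_def)
      ultimately show ?thesis by simp
    qed
    have "Qp + Qc = 0\<^sub>m t t" unfolding Q0 by simp
    then have "\<tau>0 = 0" "\<tau>1 = 0" "\<tau> = 0"
      using dz[OF r0 G] dz[OF r1 G Q0(2)] dz[OF r K Q0(2)] by (auto simp: \<tau>0_def \<tau>1_def \<tau>_def intro!: sum.neutral)
    then have L0: "\<Lambda> = 0" by (simp add: \<Lambda>_def)
    define lam where "lam = a * (\<Sum>j<m1. \<Sum>k<t. (cmod ((Bi0 * G) $$ (j, k)))\<^sup>2) + b * (\<Sum>j<m. \<Sum>k<t. (cmod ((Bi * K) $$ (j, k)))\<^sup>2)"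
    have b0: "a * h0 v \<le> (a * (\<Sum>j<m1. \<Sum>k<t. (cmod ((Bi0 * G) $$ (j, k)))\<^sup>2)) * vsq t v"
      "b * h v \<le> (b * (\<Sum>j<m. \<Sum>k<t. (cmod ((Bi * K) $$ (j, k)))\<^sup>2)) * vsq t v" if v: "v \<in> carrier_vec t" for v
      using mult_left_mono[OF hform_bound[OF Ac(1) dn(1) v] ab(1)] mult_left_mono[OF hform_bound[OF Ac(3) dn(3) v] ab(2)]
      unfolding h0_def h_def by (simp_all add: mult.assoc)
    have nn: "0 \<le> (a * (\<Sum>j<m1. \<Sum>k<t. (cmod ((Bi0 * G) $$ (j, k)))\<^sup>2))" "0 \<le> (b * (\<Sum>j<m. \<Sum>k<t. (cmod ((Bi * K) $$ (j, k)))\<^sup>2))"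
      using ab by (auto intro!: mult_nonneg_nonneg sum_nonneg)
    have nn': "0 \<le> (b * (\<Sum>j<m. \<Sum>k<t. (cmod ((Bi * K) $$ (j, k)))\<^sup>2)) * vsq t v" for v
      by (rule mult_nonneg_nonneg[OF nn(2) vsq_nonneg])
    show ?thesis
    proof (rule that[OF f r0 r1 r])
      show "0 \<le> lam" using nn by (simp add: lam_def)
      show "lam * P = a * (\<Sum>j<m1. d0 j / (1 + d0 j)) - a * (\<Sum>j<m1. d1 j / (1 + d1 j)) + b * (\<Sum>j<m. d j / (1 + d j))"
        using L0 True unfolding \<Lambda>_def \<tau>0_def \<tau>1_def \<tau>_def by simp
      show "a * hform m1 (Bi0 * G) d0 v \<le> lam * vsq t v" if v: "v \<in> carrier_vec t" for v
        using b0(1)[OF v] nn'[of v] unfolding lam_def h0_def[symmetric] distrib_right by linarith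
      show "a * hform m1 (Bi0 * G) d0 v - a * hform m1 (Bi1 * G) d1 v + b * hform m (Bi * K) d v \<le> lam * vsq t v" if v: "v \<in> carrier_vec t" for v
        using b0[OF v] mult_nonneg_nonneg[OF ab(1) hform_nonneg[of m1 d1 "Bi1 * G" v, OF dn(2)]]
        unfolding lam_def h0_def[symmetric] h_def[symmetric] distrib_right by linarith
      show "a * hform m1 (Bi0 * G) d0 (Qc *\<^sub>v y) - a * hform m1 (Bi1 * G) d1 (Qc *\<^sub>v y) + b * hform m (Bi * K) d (Qc *\<^sub>v y) = lam * vsq t (Qc *\<^sub>v y)"
        if y: "y \<in> carrier_vec t" for y
      proof -
        have v0: "Qc *\<^sub>v y = 0\<^sub>v t" unfolding Q0 using y by (intro eq_vecI) auto
        have hz: "hform k A e (0\<^sub>v t) = 0" if A: "A \<in> carrier_mat k t" for k A e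
          unfolding hform_def using mat_vec_index[OF A zero_carrier_vec] by (intro sum.neutral) auto
        show ?thesis unfolding v0 hz[OF Ac(1)] hz[OF Ac(2)] hz[OF Ac(3)] by (simp add: vsq_def)
      qed
    qed
  next
    case False
    then have Pp: "0 < P" using P by simp
    define lam where "lam = \<Lambda> / P"
    \<comment> \<open>The \<open>+ 1\<close> keeps the step length defined for v = 0. Below it the
      shrinking factor is nonnegative and the total trace stays within \<open>P\<close>.\<close>
    have sv: "0 \<le> 1 + s * (- (vsq t v / P))" "(1 + s * (- (vsq t v / P))) * (Re (mtrace Qp) + Re (mtrace Qc)) + s * vsq t v \<le> P"
      if "0 < s" "s < P / (vsq t v + 1)" for s v
    proof -
      have n: "0 < vsq t v + 1" using vsq_nonneg[of t v] by linarith
      have "s * vsq t v \<le> s * (vsq t v + 1)" using that by simp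
      also have "\<dots> \<le> P" using that n by (simp add: pos_less_divide_eq less_imp_le)
      finally have "s * (vsq t v / P) \<le> 1" using Pp by (simp add: divide_le_eq)
      then show c: "0 \<le> 1 + s * (- (vsq t v / P))" by simp
      have "(1 + s * (- (vsq t v / P))) * (Re (mtrace Qp) + Re (mtrace Qc)) \<le> (1 + s * (- (vsq t v / P))) * P"
        using tr c by (rule mult_left_mono)
      also have "\<dots> = P - s * vsq t v" using Pp by (simp add: algebra_simps)
      finally show "(1 + s * (- (vsq t v / P))) * (Re (mtrace Qp) + Re (mtrace Qc)) + s * vsq t v \<le> P" by simp
    qed
    have ep: "0 < P / (vsq t v + 1)" for v using Pp vsq_nonneg[of t v] by (simp add: add_nonneg_pos)
    have g1: "a * h0 v \<le> lam * vsq t v" if v: "v \<in> carrier_vec t" for v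
    proof -
      have "a * (1 + 0) * h0 v - a * 0 * h1 v + b * 0 * h v + (- (vsq t v / P)) * \<Lambda> \<le> 0"
      proof (rule dir[OF v ep])
        fix s assume s: "0 < s" "s < P / (vsq t v + 1)"
        show "feas t P (?Dp 1 (- (vsq t v / P)) v s) (?Dc 0 (- (vsq t v / P)) v s)"
          unfolding feas_def trc[OF Q(1)] trc[OF Q(2)] using s sv[OF s] by (intro conjI psdc p) (auto simp: algebra_simps add_divide_distrib)
      qed
      then show ?thesis by (simp add: lam_def mult.commute)
    qed
    have g2: "a * h0 v - a * h1 v + b * h v \<le> lam * vsq t v" if v: "v \<in> carrier_vec t" for v
    proof -
      have "a * (0 + 1) * h0 v - a * 1 * h1 v + b * 1 * h v + (- (vsq t v / P)) * \<Lambda> \<le> 0"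
      proof (rule dir[OF v ep])
        fix s assume s: "0 < s" "s < P / (vsq t v + 1)"
        show "feas t P (?Dp 0 (- (vsq t v / P)) v s) (?Dc 1 (- (vsq t v / P)) v s)"
          unfolding feas_def trc[OF Q(1)] trc[OF Q(2)] using s sv[OF s] by (intro conjI psdc p) (auto simp: algebra_simps add_divide_distrib)
      qed
      then show ?thesis by (simp add: lam_def mult.commute)
    qed
    \<comment> \<open>The rank-one term is now subtracted and both covariances are enlarged to use
      up the trace it frees. Positivity holds because \<open>v\<close> is in the range of
      \<open>Qc\<close>, for steps controlled by the form value \<open>k\<close>.\<close>
    have g3: "a * h0 v - a * h1 v + b * h v \<ge> lam * vsq t v" if y: "y \<in> carrier_vec t" and vd: "v = Qc *\<^sub>v y" for v y
    proof -
      have v: "v \<in> carrier_vec t" using Q y vd by auto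
      define k where "k = Re (qform t Qc (\<lambda>i. y $ i))"
      have k: "0 \<le> k" using p(2) unfolding psd_qform k_def by blast
      have "a * (0 + - 1) * h0 v - a * (- 1) * h1 v + b * (- 1) * h v + (vsq t v / P) * \<Lambda> \<le> 0"
      proof (rule dir[OF v, of "1 / (k + 1)"])
        show "0 < 1 / (k + 1)" using k by simp
        fix s assume s: "0 < s" "s < 1 / (k + 1)"
        have sk: "s * k \<le> 1"
        proof -
          have "s * (k + 1) < 1" using s k by (simp add: pos_less_divide_eq add_nonneg_pos)
          then show ?thesis using s by (simp add: algebra_simps)
        qed
        have nn: "0 \<le> s * (vsq t v / P)" using s vsq_nonneg[of t v] Pp by simp
        have split: "?Dc (- 1) (vsq t v / P) v s = (Qc + complex_of_real (- s) \<cdot>\<^sub>m outer t v) + complex_of_real (s * (vsq t v / P)) \<cdot>\<^sub>m Qc"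
          using Q by (auto intro!: eq_matI simp: outer_def algebra_simps)
        have pc: "psd t (?Dc (- 1) (vsq t v / P) v s)"
          unfolding split unfolding vd using s sk nn[unfolded vd] by (intro psd_add psd_smult psd_minus_outer p y) (auto simp: k_def)
        have "s * (vsq t v / P) * (Re (mtrace Qp) + Re (mtrace Qc)) \<le> s * (vsq t v / P) * P"
          using tr nn by (rule mult_left_mono)
        also have "\<dots> = s * vsq t v" using Pp by simp
        finally show "feas t P (?Dp 0 (vsq t v / P) v s) (?Dc (- 1) (vsq t v / P) v s)"
          unfolding feas_def trc[OF Q(1)] trc[OF Q(2)] using s tr nn
          by (intro conjI[OF psdc conjI[OF pc]] p) (auto simp: algebra_simps add_divide_distrib)
      qed
      then show ?thesis by (simp add: lam_def mult.commute)
    qed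
    show ?thesis
    proof (rule that[OF f r0 r1 r])
      show "0 \<le> lam" using \<Lambda>0 Pp by (simp add: lam_def)
      show "lam * P = a * (\<Sum>j<m1. d0 j / (1 + d0 j)) - a * (\<Sum>j<m1. d1 j / (1 + d1 j)) + b * (\<Sum>j<m. d j / (1 + d j))"
        using Pp unfolding lam_def \<Lambda>_def \<tau>0_def \<tau>1_def \<tau>_def by simp
    qed (use g1 g2 g3 Q in \<open>auto simp: h0_def h1_def h_def intro!: antisym\<close>)
  qed
qed

section \<open>The single-letter bound\<close>

definition sigv :: "complex mat \<Rightarrow> ('w \<Rightarrow> nat \<Rightarrow> complex Matrix.vec) \<Rightarrow> 'w \<Rightarrow> nat \<times> nat \<Rightarrow> complex" where
  "sigv A x w p = (A *\<^sub>v x w (fst p)) $ snd p"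

definition var :: "'w set \<Rightarrow> ('w \<Rightarrow> complex) \<Rightarrow> real" where
  "var W \<xi> = (\<Sum>w\<in>W. (cmod (\<xi> w - (\<Sum>v\<in>W. \<xi> v) / of_nat (card W)))\<^sup>2) / card W"

text \<open>With no coordinates all likelihood ratios are 1, so the posterior is uniform and the
  best estimate is the mean.\<close>

lemma mse_empty:
  assumes "finite W" "W \<noteq> {}"
  shows "mse W {} a \<xi> = var W \<xi>"
proof -
  interpret g: prob_space "gam {}" by (rule prob_space_gam)
  have c: "of_nat (card W) \<noteq> (0::complex)" using assms by simp
  have "(\<Sum>v\<in>W. complex_of_real (pwt W {} a w v y) * (\<xi> w - \<xi> v)) = \<xi> w - (\<Sum>v\<in>W. \<xi> v) / of_nat (card W)" for w y
  proof -
    have "(\<Sum>v\<in>W. complex_of_real (pwt W {} a w v y) * (\<xi> w - \<xi> v)) = (\<Sum>v\<in>W. \<xi> w - \<xi> v) / of_nat (card W)"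
      by (simp add: pwt_def llr_def csq_def cip_def sum_divide_distrib)
    also have "\<dots> = \<xi> w - (\<Sum>v\<in>W. \<xi> v) / of_nat (card W)"
      using c by (simp add: sum_subtractf diff_divide_distrib)
    finally show ?thesis .
  qed
  then show ?thesis unfolding mse_def var_def by (simp add: g.prob_space)
qed

text \<open>Within each group the group mean minimises the mean square deviation; replacing it by
  the overall mean can only increase the sum.\<close>

lemma var_within_le:
  assumes "finite M" "M \<noteq> {}" "finite C" "C \<noteq> {}"
  shows "(\<Sum>m\<in>M. var C (\<lambda>c. \<xi> (m, c))) / card M \<le> var (M \<times> C) \<xi>"
proof -
  let ?\<mu> = "(\<Sum>v\<in>M \<times> C. \<xi> v) / of_nat (card (M \<times> C))"
  have "(\<Sum>m\<in>M. var C (\<lambda>c. \<xi> (m, c))) / card M \<le> (\<Sum>m\<in>M. (\<Sum>c\<in>C. (cmod (\<xi> (m, c) - ?\<mu>))\<^sup>2) / card C) / card M"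
  proof (intro divide_right_mono sum_mono)
    fix m
    have "(\<Sum>c\<in>C. 1 * (cmod (\<xi> (m, c) - (\<Sum>v\<in>C. \<xi> (m, v)) / of_nat (card C)))\<^sup>2) \<le> (\<Sum>c\<in>C. 1 * (cmod (\<xi> (m, c) - ?\<mu>))\<^sup>2)"
      by (rule weighted_mean_minimizes[OF assms(3)]) (use assms in \<open>auto simp: card_gt_0_iff\<close>)
    then show "var C (\<lambda>c. \<xi> (m, c)) \<le> (\<Sum>c\<in>C. (cmod (\<xi> (m, c) - ?\<mu>))\<^sup>2) / card C"
      unfolding var_def by (simp add: divide_right_mono)
  qed simp
  also have "\<dots> = var (M \<times> C) \<xi>"
    unfolding var_def by (simp add: sum_Times card_cartesian_product sum_divide_distrib[symmetric] mult.commute)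
  finally show ?thesis .
qed

lemma var_nonneg: "0 \<le> var W \<xi>"
  by (simp add: var_def sum_nonneg)

lemma qform_one_mat: "qform k (1\<^sub>m k) f = complex_of_real (\<Sum>i<k. (cmod (f i))\<^sup>2)"
proof -
  have "qform k (1\<^sub>m k) f = (\<Sum>i<k. \<Sum>j<k. if j = i then f i * cnj (f i) else 0)"
    unfolding qform_def by (intro sum.cong refl) auto
  also have "\<dots> = (\<Sum>i<k. complex_of_real ((cmod (f i))\<^sup>2))"
    by (intro sum.cong refl) (simp add: complex_norm_square del: of_real_power)
  finally show ?thesis by simp
qed

lemma psd_root:
  assumes p: "psd t X"
  obtains R where "R \<in> carrier_mat t t" "\<And>v. v \<in> carrier_vec t \<Longrightarrow> (\<Sum>r<t. (cmod ((R *\<^sub>v v) $ r))\<^sup>2) = Re (qform t X (\<lambda>i. v $ i))"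
proof -
  have X: "X \<in> carrier_mat t t" by (rule psd_carrier[OF p])
  obtain U e where U: "U \<in> carrier_mat t t" "mat_adjoint U * U = 1\<^sub>m t" "U * mat_adjoint U = 1\<^sub>m t"
    "\<forall>i<t. 0 \<le> e i" "mat_adjoint U * X * U = cdiag t (\<lambda>i. complex_of_real (e i))"
    using psd_spectral[OF p] by blast
  have Uc: "mat_adjoint U \<in> carrier_mat t t" using U by auto
  let ?D = "cdiag t (\<lambda>i. complex_of_real (sqrt (e i)))"
  define L where "L = U * ?D"
  have L: "L \<in> carrier_mat t t" unfolding L_def by (rule mult_carrier_mat[OF U(1) cdiag_carrier])
  have La: "mat_adjoint L = ?D * mat_adjoint U" unfolding L_def adj_mult[OF U(1) cdiag_carrier] cdiag_adj by simp
  have DD: "?D * ?D = cdiag t (\<lambda>i. complex_of_real (e i))"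
    unfolding cdiag_mult by (rule cdiag_cong) (use U(4) in \<open>auto simp flip: of_real_mult\<close>)
  have UX: "U * (mat_adjoint U * X * U * mat_adjoint U) = X"
  proof -
    have 1: "mat_adjoint U * X * U * mat_adjoint U = mat_adjoint U * X"
      using assoc_mult_mat[OF mult_carrier_mat[OF Uc X] U(1) Uc] U(3) right_mult_one_mat[OF mult_carrier_mat[OF Uc X]] by simp
    show ?thesis unfolding 1 assoc_mult_mat[OF U(1) Uc X, symmetric] U(3) by (rule left_mult_one_mat[OF X])
  qed
  have "L * mat_adjoint L = U * ((?D * ?D) * mat_adjoint U)"
    unfolding La unfolding L_def by (rule assoc_mult_mat4[OF U(1) cdiag_carrier cdiag_carrier Uc])
  then have LL: "L * mat_adjoint L = X" unfolding DD U(5)[symmetric] UX .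
  have "X = L * 1\<^sub>m t * mat_adjoint L" unfolding right_mult_one_mat[OF L] LL ..
  then have q: "qform t X f = complex_of_real (\<Sum>l<t. (cmod (\<Sum>i<t. cnj (L $$ (i, l)) * f i))\<^sup>2)" for f
    using qform_congruence[OF L one_carrier_mat, of f] unfolding qform_one_mat by simp
  show ?thesis
  proof (rule that[OF adj_carrier[OF L]])
    fix v :: "complex Matrix.vec" assume v: "v \<in> carrier_vec t"
    show "(\<Sum>r<t. (cmod ((mat_adjoint L *\<^sub>v v) $ r))\<^sup>2) = Re (qform t X (\<lambda>i. v $ i))"
      unfolding q Re_complex_of_real using mat_vec_index[OF adj_carrier[OF L] v] adj_index[OF L] by simp
  qed
qed

text \<open>Stationarity in the primary covariance says that \<open>lam\<close> times the identity
  minus the form of the primary receiver is positive semidefinite. A root \<open>R\<close> expresses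
  this remainder of the price of power as a squared norm, so that it can be treated like a received
  signal.\<close>

lemma power_form_root:
  assumes A: "A \<in> carrier_mat m t" and le: "\<And>v. v \<in> carrier_vec t \<Longrightarrow> a * hform m A d v \<le> lam * vsq t v"
  obtains R where "R \<in> carrier_mat t t" "\<And>v. v \<in> carrier_vec t \<Longrightarrow> (\<Sum>r<t. (cmod ((R *\<^sub>v v) $ r))\<^sup>2) = lam * vsq t v - a * hform m A d v"
proof -
  define k where "k l = complex_of_real (a / (1 + d l))" for l
  define X where "X = mat t t (\<lambda>(i, j). complex_of_real lam * (if i = j then 1 else 0) - (\<Sum>l<m. k l * (cnj (A $$ (l, i)) * A $$ (l, j))))"
  have q: "qform t X (\<lambda>i. v $ i) = complex_of_real (lam * vsq t v - a * hform m A d v)" if v: "v \<in> carrier_vec t" for v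
  proof -
    have "qform t X (\<lambda>i. v $ i) = (\<Sum>i<t. \<Sum>j<t. complex_of_real lam * (1\<^sub>m t $$ (i, j) * v $ j * cnj (v $ i))
        - (\<Sum>l<m. k l * ((A $$ (l, j) * v $ j) * cnj (A $$ (l, i) * v $ i))))"
      unfolding qform_def
      by (intro sum.cong refl) (auto simp: X_def left_diff_distrib right_diff_distrib sum_distrib_right sum_distrib_left mult_ac)
    also have "\<dots> = complex_of_real lam * qform t (1\<^sub>m t) (\<lambda>i. v $ i)
        - (\<Sum>i<t. \<Sum>j<t. \<Sum>l<m. k l * ((A $$ (l, j) * v $ j) * cnj (A $$ (l, i) * v $ i)))"
      unfolding qform_def by (simp only: sum_subtractf sum_distrib_left)
    also have "(\<Sum>i<t. \<Sum>j<t. \<Sum>l<m. k l * ((A $$ (l, j) * v $ j) * cnj (A $$ (l, i) * v $ i)))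
        = (\<Sum>l<m. \<Sum>i<t. \<Sum>j<t. k l * ((A $$ (l, j) * v $ j) * cnj (A $$ (l, i) * v $ i)))"
    proof -
      have "(\<Sum>i<t. \<Sum>j<t. \<Sum>l<m. f i j l) = (\<Sum>l<m. \<Sum>i<t. \<Sum>j<t. f i j l)" for f :: "nat \<Rightarrow> nat \<Rightarrow> nat \<Rightarrow> complex"
        by (subst sum.swap[of _ "{..<m}" "{..<t}"], subst sum.swap[of _ "{..<m}" "{..<t}"]) (rule refl)
      then show ?thesis .
    qed
    also have "\<dots> = (\<Sum>l<m. k l * ((\<Sum>j<t. A $$ (l, j) * v $ j) * cnj (\<Sum>j<t. A $$ (l, j) * v $ j)))"
    proof (intro sum.cong refl)
      fix l
      have "(\<Sum>j<t. g j) * cnj (\<Sum>j<t. g j) = (\<Sum>i<t. \<Sum>j<t. g j * cnj (g i))" for g :: "nat \<Rightarrow> complex"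
        unfolding cnj_sum sum_product by (rule sum.swap)
      then show "(\<Sum>i<t. \<Sum>j<t. k l * ((A $$ (l, j) * v $ j) * cnj (A $$ (l, i) * v $ i)))
        = k l * ((\<Sum>j<t. A $$ (l, j) * v $ j) * cnj (\<Sum>j<t. A $$ (l, j) * v $ j))"
        by (simp only: sum_distrib_left)
    qed
    also have "\<dots> = (\<Sum>l<m. complex_of_real (a * ((cmod ((A *\<^sub>v v) $ l))\<^sup>2 / (1 + d l))))"
    proof (intro sum.cong refl)
      fix l assume "l \<in> {..<m}"
      then have e: "(A *\<^sub>v v) $ l = (\<Sum>j<t. A $$ (l, j) * v $ j)" using mat_vec_index[OF A v] by simp
      show "k l * ((\<Sum>j<t. A $$ (l, j) * v $ j) * cnj (\<Sum>j<t. A $$ (l, j) * v $ j)) = complex_of_real (a * ((cmod ((A *\<^sub>v v) $ l))\<^sup>2 / (1 + d l)))"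
        unfolding e complex_norm_square[symmetric] k_def of_real_mult[symmetric] by simp
    qed
    finally show ?thesis unfolding qform_one_mat by (simp add: vsq_def hform_def sum_distrib_left)
  qed
  have "psd t X"
    unfolding psd_def using q[THEN arg_cong, of _ Re] q le qform_cprod[of X t]
    by (auto simp: X_def)
  then obtain R where "R \<in> carrier_mat t t" "\<And>v. v \<in> carrier_vec t \<Longrightarrow> (\<Sum>r<t. (cmod ((R *\<^sub>v v) $ r))\<^sup>2) = Re (qform t X (\<lambda>i. v $ i))"
    by (rule psd_root) auto
  then show ?thesis using that q by simp
qed

lemma mat_vec_comb:
  fixes A :: "complex mat" and p :: "'w \<Rightarrow> complex"
  assumes A: "A \<in> carrier_mat m t" and x: "\<And>v. v \<in> W \<Longrightarrow> x v \<in> carrier_vec t" and w: "w \<in> W" and j: "j < m"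
  shows "(A *\<^sub>v Matrix.vec t (\<lambda>k. \<Sum>v\<in>W. p v * (x w $ k - x v $ k))) $ j = (\<Sum>v\<in>W. p v * ((A *\<^sub>v x w) $ j - (A *\<^sub>v x v) $ j))"
proof -
  have "(A *\<^sub>v Matrix.vec t (\<lambda>k. \<Sum>v\<in>W. p v * (x w $ k - x v $ k))) $ j = (\<Sum>l<t. A $$ (j, l) * (\<Sum>v\<in>W. p v * (x w $ l - x v $ l)))"
    unfolding mat_vec_index[OF A vec_carrier j] by simp
  also have "\<dots> = (\<Sum>v\<in>W. \<Sum>l<t. p v * (A $$ (j, l) * x w $ l - A $$ (j, l) * x v $ l))"
    unfolding sum_distrib_left by (subst sum.swap) (intro sum.cong refl, simp add: algebra_simps)
  also have "\<dots> = (\<Sum>v\<in>W. p v * ((A *\<^sub>v x w) $ j - (A *\<^sub>v x v) $ j))"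
    using mat_vec_index[OF A x j] w by (intro sum.cong refl) (simp add: sum_subtractf[symmetric] sum_distrib_left)
  finally show ?thesis .
qed

lemma sum_affine_comb:
  fixes p f :: "'w \<Rightarrow> complex"
  shows "(\<Sum>v\<in>W. p v * ((f w + (\<Sum>j<m. c j * g w j)) - (f v + (\<Sum>j<m. c j * g v j))))
    = (\<Sum>v\<in>W. p v * (f w - f v)) + (\<Sum>j<m. c j * (\<Sum>v\<in>W. p v * (g w j - g v j)))"
proof -
  have "(\<Sum>j<m. c j * (\<Sum>v\<in>W. p v * (g w j - g v j))) = (\<Sum>v\<in>W. p v * (\<Sum>j<m. c j * (g w j - g v j)))"
    unfolding sum_distrib_left by (subst sum.swap) (simp add: mult.left_commute)
  moreover have "(\<Sum>j<m. c j * (g w j - g v j)) = (\<Sum>j<m. c j * g w j) - (\<Sum>j<m. c j * g v j)" for v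
    by (simp add: right_diff_distrib sum_subtractf)
  ultimately have "(\<Sum>j<m. c j * (\<Sum>v\<in>W. p v * (g w j - g v j))) = (\<Sum>v\<in>W. p v * ((\<Sum>j<m. c j * g w j) - (\<Sum>j<m. c j * g v j)))"
    by simp
  then show ?thesis
    unfolding sum.distrib[symmetric] by (simp only: sum.distrib[symmetric]) (intro sum.cong refl, simp add: algebra_simps)
qed

text \<open>The path with a single receiver, of weight 1. The right side is the sum of the tangents
  of ln (1 + p) at p = \<open>d j\<close>, evaluated at the code's variances. The tangent point is
  free, and it will be the received covariance of the optimal Gaussian input instead of that of the
  code.\<close>

lemma iota_gaussian_bound:
  fixes x :: "'w \<Rightarrow> nat \<Rightarrow> complex Matrix.vec"
  assumes W: "finite W" "W \<noteq> {}" and d: "\<And>j. j < m \<Longrightarrow> 0 \<le> d j"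
  shows "iota W ({..<n} \<times> {..<m}) (sigv A x) \<le> n * (\<Sum>j<m. ln (1 + d j))
     + (\<Sum>i<n. \<Sum>r<m. var W (\<lambda>w. (A *\<^sub>v x w i) $ r) / (1 + d r)) - n * (\<Sum>j<m. d j / (1 + d j))"
proof -
  define B where "B w i j = (A *\<^sub>v x w i) $ j" for w i j
  define c where "c r = complex_of_real (1 / sqrt (1 + d r))" for r
  \<comment> \<open>The root of the multiplier is here the diagonal map with entries
    \<open>c r\<close>, and \<open>N\<close> is its product with the diagonal received covariance.
    With this choice \<open>form\<close> holds with equality.\<close>
  define N where "N r j = (if j = r then c r * of_real (d r) else 0)" for r j
  have sd: "0 < sqrt (1 + d j)" "sqrt (1 + d j) * sqrt (1 + d j) = 1 + d j" if "j < m" for j using d[OF that] by auto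
  have cs: "(cmod (c r))\<^sup>2 = 1 / (1 + d r)" if "r < m" for r
    using sd[OF that] by (simp add: c_def norm_divide power_divide power2_eq_square)
  interpret degraded_path W n m 0 m 0 1 B "\<lambda>_ _ _. 0" "\<lambda>w i r. c r * B w i r" "\<lambda>_ _. 0" N d "\<lambda>_. 0"
  proof
    show "(\<Sum>r<m. (cmod (N r j))\<^sup>2) = 1 * ((d j)\<^sup>2 / (1 + d j)) - (\<Sum>k<0. 0 / (1 + 0) * ((cmod 0)\<^sup>2 * (d j)\<^sup>2))" if j: "j < m" for j
    proof -
      have "(\<Sum>r<m. (cmod (N r j))\<^sup>2) = (\<Sum>r<m. if r = j then (d j)\<^sup>2 / (1 + d j) else 0)"
        by (intro sum.cong refl) (auto simp: N_def norm_mult power_mult_distrib cs)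
      then show ?thesis using j by simp
    qed
    fix t :: real and w i and p :: "'w \<Rightarrow> real" assume t: "0 \<le> t" "t \<le> 1"
    let ?e = "\<lambda>j. \<Sum>v\<in>W. complex_of_real (p v) * (B w i j - B v i j)"
    have eq: "1 * (1 + d r) / (1 + t * d r)\<^sup>2 * (cmod (?e r))\<^sup>2 = (cmod (\<Sum>v\<in>W. complex_of_real (p v) *
             ((c r * B w i r + (\<Sum>j<m. N r j * of_real ((1 - t) / (1 + t * d j)) * B w i j))
              - (c r * B v i r + (\<Sum>j<m. N r j * of_real ((1 - t) / (1 + t * d j)) * B v i j)))))\<^sup>2" if r: "r < m" for r
    proof -
      define s where "s = (1 - t) / (1 + t * d r)"
      have u: "1 + t * d r > 0" using t d[OF r] by (simp add: add_pos_nonneg)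
      have nn: "(\<Sum>j<m. N r j * of_real ((1 - t) / (1 + t * d j)) * B w i j) = c r * of_real (d r * s) * B w i r" for w
      proof -
        have "(\<Sum>j<m. N r j * of_real ((1 - t) / (1 + t * d j)) * B w i j) = (\<Sum>j<m. if j = r then c r * of_real (d r * s) * B w i r else 0)"
          by (intro sum.cong refl) (auto simp: N_def s_def)
        then show ?thesis using r by simp
      qed
      have k: "1 + d r * s = (1 + d r) / (1 + t * d r)" using u by (simp add: s_def field_simps)
      have "(\<Sum>v\<in>W. complex_of_real (p v) * ((c r * B w i r + c r * of_real (d r * s) * B w i r) - (c r * B v i r + c r * of_real (d r * s) * B v i r)))
         = (c r * of_real (1 + d r * s)) * ?e r"
        unfolding sum_distrib_left by (intro sum.cong refl) (simp add: algebra_simps)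
      then have "(cmod (\<Sum>v\<in>W. complex_of_real (p v) * ((c r * B w i r + c r * of_real (d r * s) * B w i r) - (c r * B v i r + c r * of_real (d r * s) * B v i r))))\<^sup>2
         = 1 / (1 + d r) * ((1 + d r) / (1 + t * d r))\<^sup>2 * (cmod (?e r))\<^sup>2"
        unfolding k by (simp only: norm_mult power_mult_distrib cs[OF r] norm_of_real power2_abs)
      moreover have "1 / (1 + d r) * ((1 + d r) / (1 + t * d r))\<^sup>2 = 1 * (1 + d r) / (1 + t * d r)\<^sup>2"
        using d[OF r] by (simp add: power2_eq_square)
      ultimately show ?thesis unfolding nn by (simp only:)
    qed
    show "(\<Sum>j<m. 1 * (1 + d j) / (1 + t * d j)\<^sup>2 * (cmod (?e j))\<^sup>2)
       \<le> (\<Sum>k<0. 0 / (1 + 0) * (cmod (\<Sum>v\<in>W. complex_of_real (p v) *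
             ((0 + (\<Sum>j<m. 0 * of_real (d j * ((1 - t) / (1 + t * d j))) * B w i j))
              - (0 + (\<Sum>j<m. 0 * of_real (d j * ((1 - t) / (1 + t * d j))) * B v i j)))))\<^sup>2)
        + (\<Sum>r<m. (cmod (\<Sum>v\<in>W. complex_of_real (p v) *
             ((c r * B w i r + (\<Sum>j<m. N r j * of_real ((1 - t) / (1 + t * d j)) * B w i j))
              - (c r * B v i r + (\<Sum>j<m. N r j * of_real ((1 - t) / (1 + t * d j)) * B v i j)))))\<^sup>2)"
      using eq by simp
  qed (use W d in auto)
  have "iota W ({..<n} \<times> {..<m}) (\<lambda>w p. B w (fst p) (snd p)) \<le> n * (\<Sum>j<m. ln (1 + d j))
     + (\<Sum>i<n. \<Sum>r<m. mse W ({}::nat set) (\<lambda>_ _. 0) (\<lambda>w. c r * B w i r)) - n * (\<Sum>j<m. d j / (1 + d j))"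
    using extremal_inequality by simp
  moreover have "mse W ({}::nat set) (\<lambda>_ _. 0) (\<lambda>w. c r * B w i r) = var W (\<lambda>w. (A *\<^sub>v x w i) $ r) / (1 + d r)" if "r < m" for i r
    using that by (simp add: mse_scale mse_empty[OF W] cs B_def)
  moreover have "sigv A x = (\<lambda>w p. B w (fst p) (snd p))" by (simp add: sigv_def[abs_def] B_def)
  ultimately show ?thesis by simp
qed

lemma mat_vec_add_congruence:
  assumes X: "X \<in> carrier_mat k t" and Q: "Q \<in> carrier_mat t t" and A: "A \<in> carrier_mat m t"
    and e: "e \<in> carrier_vec t" and u: "u \<in> carrier_vec m" and r: "r < k"
  shows "(X *\<^sub>v (e + Q *\<^sub>v (mat_adjoint A *\<^sub>v u))) $ r = (X *\<^sub>v e) $ r + (\<Sum>j<m. (X * Q * mat_adjoint A) $$ (r, j) * u $ j)"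
proof -
  have Ac: "mat_adjoint A \<in> carrier_mat t m" using A by auto
  have w: "Q *\<^sub>v (mat_adjoint A *\<^sub>v u) \<in> carrier_vec t" using Q Ac u by auto
  have "X *\<^sub>v (Q *\<^sub>v (mat_adjoint A *\<^sub>v u)) = (X * Q * mat_adjoint A) *\<^sub>v u"
    using assoc_mult_mat_vec[OF mult_carrier_mat[OF X Q] Ac u] assoc_mult_mat_vec[OF X Q mult_mat_vec_carrier[OF Ac u]] by simp
  then have "X *\<^sub>v (e + Q *\<^sub>v (mat_adjoint A *\<^sub>v u)) = X *\<^sub>v e + (X * Q * mat_adjoint A) *\<^sub>v u"
    using mult_add_distrib_mat_vec[OF X e w] by simp
  then show ?thesis
    using mat_vec_index[OF mult_carrier_mat[OF mult_carrier_mat[OF X Q] Ac] u r] X Ac r by simp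
qed

text \<open>The conditions of the path arise by testing the two optimality hypotheses:
  \<open>slack\<close> at the columns of Q A^H gives the column norms of \<open>N\<close>, and
  \<open>form\<close> at an error vector corrected for the Gaussian part gives the inequality along
  the whole path.\<close>

lemma iota_degraded_bound:
  fixes x :: "'w \<Rightarrow> nat \<Rightarrow> complex Matrix.vec"
  assumes W: "finite W" "W \<noteq> {}" and x: "\<And>w i. w \<in> W \<Longrightarrow> i < n \<Longrightarrow> x w i \<in> carrier_vec t" and ab: "0 \<le> a" "0 \<le> b"
    and A: "A \<in> carrier_mat m t" and A1: "A1 \<in> carrier_mat m1 t" and T: "T \<in> carrier_mat m1 m" and R: "R \<in> carrier_mat t t"
    and Q: "Q \<in> carrier_mat t t"
    and TT: "T * mat_adjoint T = 1\<^sub>m m1" and TA: "T * A = A1"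
    and AQ: "A * Q * mat_adjoint A = cdiag m (\<lambda>j. complex_of_real (d j))" and A1Q: "A1 * Q * mat_adjoint A1 = cdiag m1 (\<lambda>j. complex_of_real (d1 j))"
    and d: "\<And>j. j < m \<Longrightarrow> 0 \<le> d j" and d1: "\<And>k. k < m1 \<Longrightarrow> 0 \<le> d1 k"
    and form: "\<And>v. v \<in> carrier_vec t \<Longrightarrow> b * hform m A d v \<le> a * hform m1 A1 d1 v + (\<Sum>r<t. (cmod ((R *\<^sub>v v) $ r))\<^sup>2)"
    and slack: "\<And>y. y \<in> carrier_vec t \<Longrightarrow> b * hform m A d (Q *\<^sub>v y) = a * hform m1 A1 d1 (Q *\<^sub>v y) + (\<Sum>r<t. (cmod ((R *\<^sub>v (Q *\<^sub>v y)) $ r))\<^sup>2)"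
  shows "b * iota W ({..<n} \<times> {..<m}) (sigv A x) - a * iota W ({..<n} \<times> {..<m1}) (sigv A1 x)
    \<le> n * (b * (\<Sum>j<m. ln (1 + d j)) - a * (\<Sum>k<m1. ln (1 + d1 k)))
      + (\<Sum>i<n. \<Sum>r<t. var W (\<lambda>w. (R *\<^sub>v x w i) $ r))
      - n * (b * (\<Sum>j<m. d j / (1 + d j)) - a * (\<Sum>k<m1. d1 k / (1 + d1 k)))"
proof -
  have Ac: "mat_adjoint A \<in> carrier_mat t m" and Tc: "mat_adjoint T \<in> carrier_mat m m1" using A T by auto
  define N where "N = R * Q * mat_adjoint A"
  have TD: "A1 * Q * mat_adjoint A = T * cdiag m (\<lambda>j. complex_of_real (d j))"
  proof -
    have "A1 * Q * mat_adjoint A = T * (A * Q) * mat_adjoint A" unfolding TA[symmetric] assoc_mult_mat[OF T A Q] ..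
    also have "\<dots> = T * (A * Q * mat_adjoint A)" by (rule assoc_mult_mat[OF T mult_carrier_mat[OF A Q] Ac])
    finally show ?thesis unfolding AQ .
  qed
  have TDi: "(A1 * Q * mat_adjoint A) $$ (k, j) = T $$ (k, j) * of_real (d j)" if "k < m1" "j < m" for k j
  proof -
    have "(T * cdiag m (\<lambda>j. complex_of_real (d j))) $$ (k, j) = (\<Sum>l<m. if l = j then T $$ (k, j) * of_real (d j) else 0)"
      unfolding mat_mult_index[OF T cdiag_carrier that] using that by (intro sum.cong refl) auto
    then show ?thesis unfolding TD using that by simp
  qed
  have AQi: "(A * Q * mat_adjoint A) $$ (l, j) = (if l = j then of_real (d j) else 0)" if "l < m" "j < m" for l j
    unfolding AQ using that by simp
  have gap: "1 + d j * ((1 - t) / (1 + t * d j)) = (1 + d j) / (1 + t * d j)" if "0 \<le> t" "j < m" for t j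
  proof -
    have "1 + t * d j > 0" using that d by (simp add: add_pos_nonneg)
    then show ?thesis by (simp add: field_simps)
  qed
  interpret degraded_path W n m m1 t a b "\<lambda>w i j. (A *\<^sub>v x w i) $ j" "\<lambda>w i k. (A1 *\<^sub>v x w i) $ k" "\<lambda>w i r. (R *\<^sub>v x w i) $ r"
     "\<lambda>k j. T $$ (k, j)" "\<lambda>r j. N $$ (r, j)" d d1
  proof
    show "(\<Sum>j<m. T $$ (k, j) * cnj (T $$ (l, j))) = (if k = l then 1 else 0)" if "k < m1" "l < m1" for k l
    proof -
      have "(T * mat_adjoint T) $$ (k, l) = (\<Sum>j<m. T $$ (k, j) * cnj (T $$ (l, j)))"
        unfolding mat_mult_index[OF T Tc that] using adj_index[OF T _ that(2)] by simp
      then show ?thesis unfolding TT using that by simp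
    qed
    show "(\<Sum>j<m. complex_of_real (d j) * (T $$ (k, j) * cnj (T $$ (l, j)))) = (if k = l then complex_of_real (d1 k) else 0)" if "k < m1" "l < m1" for k l
    proof -
      have A1QAc: "A1 * Q * mat_adjoint A \<in> carrier_mat m1 m" using A1 Q Ac by auto
      have "A1 * Q * mat_adjoint A1 = A1 * Q * (mat_adjoint A * mat_adjoint T)" unfolding adj_mult[OF T A, symmetric] TA ..
      also have "\<dots> = (A1 * Q * mat_adjoint A) * mat_adjoint T"
        by (rule assoc_mult_mat[OF mult_carrier_mat[OF A1 Q] Ac Tc, symmetric])
      finally have "(A1 * Q * mat_adjoint A1) $$ (k, l) = (\<Sum>j<m. (A1 * Q * mat_adjoint A) $$ (k, j) * mat_adjoint T $$ (j, l))"
        using mat_mult_index[OF A1QAc Tc that] by simp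
      also have "\<dots> = (\<Sum>j<m. complex_of_real (d j) * (T $$ (k, j) * cnj (T $$ (l, j))))"
        by (intro sum.cong refl) (use TDi that adj_index[OF T _ that(2)] in \<open>simp del: index_mult_mat add: mult_ac\<close>)
      finally show ?thesis unfolding A1Q using that by simp
    qed
    show "(A1 *\<^sub>v x w i) $ k = (\<Sum>j<m. T $$ (k, j) * (A *\<^sub>v x w i) $ j)" if "w \<in> W" "i < n" "k < m1" for w i k
    proof -
      have "A1 *\<^sub>v x w i = T *\<^sub>v (A *\<^sub>v x w i)" unfolding TA[symmetric] by (rule assoc_mult_mat_vec[OF T A x[OF that(1,2)]])
      then show ?thesis using mat_vec_index[OF T mult_mat_vec_carrier[OF A x[OF that(1,2)]] that(3)] by simp
    qed
    show "(\<Sum>r<t. (cmod (N $$ (r, j)))\<^sup>2) = b * ((d j)\<^sup>2 / (1 + d j)) - (\<Sum>k<m1. a / (1 + d1 k) * ((cmod (T $$ (k, j)))\<^sup>2 * (d j)\<^sup>2))" if j: "j < m" for j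
    proof -
      let ?u = "Matrix.vec m (\<lambda>l. if l = j then 1 else 0) :: complex Matrix.vec"
      let ?y = "mat_adjoint A *\<^sub>v ?u"
      have y: "?y \<in> carrier_vec t" using Ac by auto
      have Qy: "Q *\<^sub>v ?y \<in> carrier_vec t" using Q y by auto
      have ev: "(X *\<^sub>v (Q *\<^sub>v ?y)) $ r = (X * Q * mat_adjoint A) $$ (r, j)" if X: "X \<in> carrier_mat k t" and r: "r < k" for X k r
      proof -
        have "(X *\<^sub>v (0\<^sub>v t + Q *\<^sub>v ?y)) $ r = (X *\<^sub>v 0\<^sub>v t) $ r + (\<Sum>l<m. (X * Q * mat_adjoint A) $$ (r, l) * ?u $ l)"
          by (rule mat_vec_add_congruence[OF X Q A zero_carrier_vec vec_carrier r])
        moreover have "(\<Sum>l<m. (X * Q * mat_adjoint A) $$ (r, l) * ?u $ l) = (\<Sum>l<m. if l = j then (X * Q * mat_adjoint A) $$ (r, j) else 0)"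
          by (intro sum.cong refl) auto
        moreover have "(X *\<^sub>v 0\<^sub>v t) $ r = 0" unfolding mat_vec_index[OF X zero_carrier_vec r] by (intro sum.neutral) auto
        ultimately show ?thesis using j left_zero_vec[OF Qy] by simp
      qed
      have h: "hform m A d (Q *\<^sub>v ?y) = (d j)\<^sup>2 / (1 + d j)"
      proof -
        have "hform m A d (Q *\<^sub>v ?y) = (\<Sum>l<m. if l = j then (d j)\<^sup>2 / (1 + d j) else 0)"
          unfolding hform_def by (intro sum.cong refl) (use ev[OF A] AQi j in \<open>auto simp del: index_mult_mat\<close>)
        then show ?thesis using j by simp
      qed
      have h1: "hform m1 A1 d1 (Q *\<^sub>v ?y) = (\<Sum>k<m1. (cmod (T $$ (k, j)))\<^sup>2 * (d j)\<^sup>2 / (1 + d1 k))"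
        unfolding hform_def by (intro sum.cong refl) (use ev[OF A1] TDi j in \<open>simp add: norm_mult power_mult_distrib del: index_mult_mat\<close>)
      have "(\<Sum>r<t. (cmod (N $$ (r, j)))\<^sup>2) = (\<Sum>r<t. (cmod ((R *\<^sub>v (Q *\<^sub>v ?y)) $ r))\<^sup>2)"
        unfolding N_def using ev[OF R] by simp
      also have "\<dots> = b * ((d j)\<^sup>2 / (1 + d j)) - a * (\<Sum>k<m1. (cmod (T $$ (k, j)))\<^sup>2 * (d j)\<^sup>2 / (1 + d1 k))"
        using slack[OF y] unfolding h h1 by simp
      finally show ?thesis by (simp add: sum_distrib_left)
    qed
    fix s :: real and w i and p :: "'w \<Rightarrow> real" assume s: "0 \<le> s" "s \<le> 1" and w: "w \<in> W" and i: "i < n"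
    define g where "g j = (1 - s) / (1 + s * d j)" for j
    define e where "e = Matrix.vec t (\<lambda>k. \<Sum>v\<in>W. complex_of_real (p v) * (x w i $ k - x v i $ k))"
    have ec: "e \<in> carrier_vec t" by (simp add: e_def)
    define u where "u = Matrix.vec m (\<lambda>j. complex_of_real (g j) * (A *\<^sub>v e) $ j)"
    have uc: "u \<in> carrier_vec m" by (simp add: u_def)
    \<comment> \<open>For \<open>s\<close> = (sin \<theta>)^2, sin \<theta> times this vector is the
      code's contribution to the error in estimating sin \<theta> X - cos \<theta> X_G, the negative
      velocity of the path: an error \<open>e\<close> in X induces an opposite error in the Gaussian
      part through the received signal. At the stronger receiver the correction only rescales the
      coordinates of \<open>A *\<^sub>v e\<close>.\<close>
    define v where "v = e + Q *\<^sub>v (mat_adjoint A *\<^sub>v u)"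
    have vc: "v \<in> carrier_vec t" unfolding v_def using ec Q Ac uc by auto
    have comb: "(X *\<^sub>v e) $ r = (\<Sum>v\<in>W. complex_of_real (p v) * ((X *\<^sub>v x w i) $ r - (X *\<^sub>v x v i) $ r))" if "X \<in> carrier_mat k t" "r < k" for X k r
      unfolding e_def by (rule mat_vec_comb[OF that(1) _ w that(2)]) (use x i in auto)
    have Xv: "(X *\<^sub>v v) $ r = (X *\<^sub>v e) $ r + (\<Sum>j<m. (X * Q * mat_adjoint A) $$ (r, j) * of_real (g j) * (A *\<^sub>v e) $ j)" if "X \<in> carrier_mat k t" "r < k" for X k r
      unfolding v_def mat_vec_add_congruence[OF that(1) Q A ec uc that(2)] by (simp add: u_def mult.assoc)
    have 1: "(A *\<^sub>v v) $ j = of_real ((1 + d j) / (1 + s * d j)) * (A *\<^sub>v e) $ j" if j: "j < m" for j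
    proof -
      have "(\<Sum>l<m. (A * Q * mat_adjoint A) $$ (j, l) * of_real (g l) * (A *\<^sub>v e) $ l) = (\<Sum>l<m. if l = j then of_real (d j * g j) * (A *\<^sub>v e) $ j else 0)"
        by (intro sum.cong refl) (use AQi[OF j] in \<open>auto simp del: index_mult_mat\<close>)
      then have "(A *\<^sub>v v) $ j = of_real (1 + d j * g j) * (A *\<^sub>v e) $ j" unfolding Xv[OF A j] using j by (simp add: algebra_simps)
      then show ?thesis unfolding g_def gap[OF s(1) j] .
    qed
    have L: "b * hform m A d v = (\<Sum>j<m. b * (1 + d j) / (1 + s * d j)\<^sup>2 * (cmod (\<Sum>v\<in>W. complex_of_real (p v) * ((A *\<^sub>v x w i) $ j - (A *\<^sub>v x v i) $ j)))\<^sup>2)"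
      unfolding hform_def sum_distrib_left
    proof (intro sum.cong refl)
      fix j assume "j \<in> {..<m}" then have j: "j < m" by simp
      have "b * ((cmod ((A *\<^sub>v v) $ j))\<^sup>2 / (1 + d j)) = b * (((1 + d j) / (1 + s * d j))\<^sup>2 / (1 + d j)) * (cmod ((A *\<^sub>v e) $ j))\<^sup>2"
        unfolding 1[OF j] norm_mult power_mult_distrib norm_of_real power2_abs by simp
      also have "((1 + d j) / (1 + s * d j))\<^sup>2 / (1 + d j) = (1 + d j) / (1 + s * d j)\<^sup>2"
        using d[OF j] by (simp add: power2_eq_square)
      finally show "b * ((cmod ((A *\<^sub>v v) $ j))\<^sup>2 / (1 + d j)) = b * (1 + d j) / (1 + s * d j)\<^sup>2 * (cmod (\<Sum>v\<in>W. complex_of_real (p v) * ((A *\<^sub>v x w i) $ j - (A *\<^sub>v x v i) $ j)))\<^sup>2"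
        unfolding comb[OF A j] by simp
    qed
    have M1: "(A1 *\<^sub>v v) $ k = (\<Sum>v\<in>W. complex_of_real (p v) *
             (((A1 *\<^sub>v x w i) $ k + (\<Sum>j<m. T $$ (k, j) * of_real (d j * g j) * (A *\<^sub>v x w i) $ j))
              - ((A1 *\<^sub>v x v i) $ k + (\<Sum>j<m. T $$ (k, j) * of_real (d j * g j) * (A *\<^sub>v x v i) $ j))))" if k: "k < m1" for k
    proof -
      have "(\<Sum>j<m. (A1 * Q * mat_adjoint A) $$ (k, j) * of_real (g j) * (A *\<^sub>v e) $ j)
         = (\<Sum>j<m. T $$ (k, j) * of_real (d j * g j) * (\<Sum>v\<in>W. complex_of_real (p v) * ((A *\<^sub>v x w i) $ j - (A *\<^sub>v x v i) $ j)))"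
        by (intro sum.cong refl) (use TDi[OF k] comb[OF A] in \<open>simp del: index_mult_mat add: mult.assoc\<close>)
      then show ?thesis unfolding Xv[OF A1 k] comb[OF A1 k]
        using sum_affine_comb[where W=W and w=w and m=m and p="\<lambda>v. complex_of_real (p v)" and f="\<lambda>v. (A1 *\<^sub>v x v i) $ k"
           and c="\<lambda>j. T $$ (k, j) * of_real (d j * g j)" and g="\<lambda>v j. (A *\<^sub>v x v i) $ j"] by simp
    qed
    have M2: "(R *\<^sub>v v) $ r = (\<Sum>v\<in>W. complex_of_real (p v) *
             (((R *\<^sub>v x w i) $ r + (\<Sum>j<m. N $$ (r, j) * of_real (g j) * (A *\<^sub>v x w i) $ j))
              - ((R *\<^sub>v x v i) $ r + (\<Sum>j<m. N $$ (r, j) * of_real (g j) * (A *\<^sub>v x v i) $ j))))" if r: "r < t" for r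
    proof -
      have "(\<Sum>j<m. (R * Q * mat_adjoint A) $$ (r, j) * of_real (g j) * (A *\<^sub>v e) $ j)
         = (\<Sum>j<m. N $$ (r, j) * of_real (g j) * (\<Sum>v\<in>W. complex_of_real (p v) * ((A *\<^sub>v x w i) $ j - (A *\<^sub>v x v i) $ j)))"
        unfolding N_def by (intro sum.cong refl) (use comb[OF A] in \<open>simp del: index_mult_mat\<close>)
      then show ?thesis unfolding Xv[OF R r] comb[OF R r]
        using sum_affine_comb[where W=W and w=w and m=m and p="\<lambda>v. complex_of_real (p v)" and f="\<lambda>v. (R *\<^sub>v x v i) $ r"
           and c="\<lambda>j. N $$ (r, j) * of_real (g j)" and g="\<lambda>v j. (A *\<^sub>v x v i) $ j"] by simp
    qed
    have "b * hform m A d v \<le> (\<Sum>k<m1. a / (1 + d1 k) * (cmod ((A1 *\<^sub>v v) $ k))\<^sup>2) + (\<Sum>r<t. (cmod ((R *\<^sub>v v) $ r))\<^sup>2)"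
      using form[OF vc] by (simp add: hform_def sum_distrib_left)
    then show "(\<Sum>j<m. b * (1 + d j) / (1 + s * d j)\<^sup>2 * (cmod (\<Sum>v\<in>W. complex_of_real (p v) * ((A *\<^sub>v x w i) $ j - (A *\<^sub>v x v i) $ j)))\<^sup>2)
       \<le> (\<Sum>k<m1. a / (1 + d1 k) * (cmod (\<Sum>v\<in>W. complex_of_real (p v) *
             (((A1 *\<^sub>v x w i) $ k + (\<Sum>j<m. T $$ (k, j) * of_real (d j * ((1 - s) / (1 + s * d j))) * (A *\<^sub>v x w i) $ j))
              - ((A1 *\<^sub>v x v i) $ k + (\<Sum>j<m. T $$ (k, j) * of_real (d j * ((1 - s) / (1 + s * d j))) * (A *\<^sub>v x v i) $ j)))))\<^sup>2)
        + (\<Sum>r<t. (cmod (\<Sum>v\<in>W. complex_of_real (p v) *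
             (((R *\<^sub>v x w i) $ r + (\<Sum>j<m. N $$ (r, j) * of_real ((1 - s) / (1 + s * d j)) * (A *\<^sub>v x w i) $ j))
              - ((R *\<^sub>v x v i) $ r + (\<Sum>j<m. N $$ (r, j) * of_real ((1 - s) / (1 + s * d j)) * (A *\<^sub>v x v i) $ j)))))\<^sup>2)"
      unfolding L[symmetric] g_def[symmetric] using M1 M2 by simp
  qed (use W ab d d1 in auto)
  show ?thesis using extremal_inequality unfolding mse_empty[OF W] sigv_def[abs_def] .
qed

text \<open>One copy of \<open>U\<close> for each time slot: the channel is memoryless, and all
  changes of coordinates act on the antennas only.\<close>

definition blk :: "complex mat \<Rightarrow> nat \<times> nat \<Rightarrow> nat \<times> nat \<Rightarrow> complex" where
  "blk U p p' = (if fst p' = fst p then U $$ (snd p, snd p') else 0)"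

lemma coisom_blk:
  assumes U: "U \<in> carrier_mat m1 m" and UU: "U * mat_adjoint U = 1\<^sub>m m1"
  shows "coisom ({..<n} \<times> {..<m}) ({..<n} \<times> {..<m1}) (blk U)"
  unfolding coisom_def
proof (intro ballI)
  fix p1 p2 assume p: "p1 \<in> {..<n} \<times> {..<m1}" "p2 \<in> {..<n} \<times> {..<m1}"
  obtain i1 k1 i2 k2 where e: "p1 = (i1, k1)" "p2 = (i2, k2)" by (metis surj_pair)
  have lt: "i1 < n" "k1 < m1" "i2 < n" "k2 < m1" using p e by auto
  have "(\<Sum>p\<in>{..<n} \<times> {..<m}. blk U p1 p * cnj (blk U p2 p)) = (\<Sum>p\<in>{..<n} \<times> {..<m}. if fst p = i1 then
      (if i1 = i2 then U $$ (k1, snd p) * cnj (U $$ (k2, snd p)) else 0) else 0)"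
    by (intro sum.cong refl) (auto simp: blk_def e)
  also have "\<dots> = (\<Sum>j<m. if i1 = i2 then U $$ (k1, j) * cnj (U $$ (k2, j)) else 0)" by (rule sum_pair_delta[OF lt(1)])
  also have "\<dots> = (if i1 = i2 then (U * mat_adjoint U) $$ (k1, k2) else 0)"
    unfolding mat_mult_index[OF U adj_carrier[OF U] lt(2,4)] using adj_index[OF U _ lt(4)] by simp
  also have "\<dots> = (if p1 = p2 then 1 else 0)" unfolding UU using lt by (auto simp: e)
  finally show "(\<Sum>p\<in>{..<n} \<times> {..<m}. blk U p1 p * cnj (blk U p2 p)) = (if p1 = p2 then 1 else 0)" .
qed

lemma blk_sum:
  assumes "i < n" shows "(\<Sum>p\<in>{..<n} \<times> {..<m}. blk U (i, k) p * y p) = (\<Sum>j<m. U $$ (k, j) * y (i, j))"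
proof -
  have "(\<Sum>p\<in>{..<n} \<times> {..<m}. blk U (i, k) p * y p) = (\<Sum>p\<in>{..<n} \<times> {..<m}. if fst p = i then U $$ (k, snd p) * y (i, snd p) else 0)"
    by (intro sum.cong refl) (auto simp: blk_def)
  also have "\<dots> = (\<Sum>j<m. U $$ (k, j) * y (i, j))" by (rule sum_pair_delta[OF assms])
  finally show ?thesis .
qed

lemma rdiag_one_unitary:
  assumes "rdiag m (1\<^sub>m m) G Q B Bi d"
  shows "Bi = mat_adjoint B" "mat_adjoint Bi = B"
proof -
  have B: "B \<in> carrier_mat m m" "Bi \<in> carrier_mat m m" "B * Bi = 1\<^sub>m m" "Bi * B = 1\<^sub>m m" "B * mat_adjoint B = 1\<^sub>m m"
    using assms by (auto simp: rdiag_def)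
  have Bc: "mat_adjoint B \<in> carrier_mat m m" using B by auto
  have "Bi = Bi * (B * mat_adjoint B)" unfolding B(5) using B by simp
  also have "\<dots> = (Bi * B) * mat_adjoint B" by (rule assoc_mult_mat[OF B(2,1) Bc, symmetric])
  finally show e: "Bi = mat_adjoint B" unfolding B(4) left_mult_one_mat[OF Bc] .
  show "mat_adjoint Bi = B" unfolding e by (rule adj_adj[OF B(1)])
qed

text \<open>The noise of the primary receiver is white from the start, so diagonalising coordinates
  are unitary there. Two different ones, for \<open>Qp + Qc\<close> and for \<open>Qc\<close>, can
  therefore be used in the same estimate.\<close>

lemma iota_unitary:
  assumes r: "rdiag m (1\<^sub>m m) G Q B Bi d" and G: "G \<in> carrier_mat m t" and x: "\<And>w i. w \<in> W \<Longrightarrow> i < n \<Longrightarrow> x w i \<in> carrier_vec t"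
  shows "iota W ({..<n} \<times> {..<m}) (sigv (Bi * G) x) = iota W ({..<n} \<times> {..<m}) (sigv G x)"
proof (rule iota_isometry[where T="blk B"])
  have B: "B \<in> carrier_mat m m" "Bi \<in> carrier_mat m m" "B * mat_adjoint B = 1\<^sub>m m" using r by (auto simp: rdiag_def)
  show "coisom ({..<n} \<times> {..<m}) ({..<n} \<times> {..<m}) (blk B)" by (rule coisom_blk[OF B(1,3)])
  fix w p assume w: "w \<in> W" and p: "p \<in> {..<n} \<times> {..<m}"
  obtain i k where e: "p = (i, k)" by (metis surj_pair)
  have lt: "i < n" "k < m" using p e by auto
  have "sigv (Bi * G) x w p = (Bi *\<^sub>v (G *\<^sub>v x w i)) $ k"
    unfolding sigv_def e using assoc_mult_mat_vec[OF B(2) G x[OF w lt(1)]] by simp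
  also have "\<dots> = (\<Sum>j<m. Bi $$ (k, j) * (G *\<^sub>v x w i) $ j)"
    by (rule mat_vec_index[OF B(2) mult_mat_vec_carrier[OF G x[OF w lt(1)]] lt(2)])
  also have "\<dots> = (\<Sum>j<m. cnj (B $$ (j, k)) * sigv G x w (i, j))"
    unfolding sigv_def rdiag_one_unitary(1)[OF r] using adj_index[OF B(1) lt(2)] by simp
  also have "\<dots> = (\<Sum>q\<in>{..<n} \<times> {..<m}. if fst q = i then cnj (B $$ (snd q, k)) * sigv G x w (i, snd q) else 0)"
    by (rule sum_pair_delta[OF lt(1), symmetric])
  also have "\<dots> = (\<Sum>q\<in>{..<n} \<times> {..<m}. cnj (blk B q p) * sigv G x w q)"
    by (intro sum.cong refl) (auto simp: blk_def e)
  finally show "sigv (Bi * G) x w p = (\<Sum>q\<in>{..<n} \<times> {..<m}. cnj (blk B q p) * sigv G x w q)" .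
qed auto

lemma var_mat_vec:
  fixes x :: "'w \<Rightarrow> complex Matrix.vec"
  assumes W: "finite W" "W \<noteq> {}" and A: "A \<in> carrier_mat m t" and x: "\<And>w. w \<in> W \<Longrightarrow> x w \<in> carrier_vec t" and r: "r < m"
  shows "var W (\<lambda>w. (A *\<^sub>v x w) $ r) =
    (\<Sum>w\<in>W. (cmod ((A *\<^sub>v Matrix.vec t (\<lambda>k. x w $ k - (\<Sum>v\<in>W. x v $ k) / of_nat (card W))) $ r))\<^sup>2) / card W"
proof -
  let ?p = "\<lambda>v::'w. 1 / of_nat (card W) :: complex"
  have c: "of_nat (card W) \<noteq> (0::complex)" using W by simp
  have m: "(\<Sum>v\<in>W. ?p v * (f w - f v)) = f w - (\<Sum>v\<in>W. f v) / of_nat (card W)" for f :: "'w \<Rightarrow> complex" and w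
    using c by (simp add: sum_divide_distrib[symmetric] sum_subtractf diff_divide_distrib)
  have mx: "(\<Sum>v\<in>W. ?p v * (x w $ k - x v $ k)) = x w $ k - (\<Sum>v\<in>W. x v $ k) / of_nat (card W)" for w k
    by (rule m[where f="\<lambda>v. x v $ k"])
  have "(A *\<^sub>v x w) $ r - (\<Sum>v\<in>W. (A *\<^sub>v x v) $ r) / of_nat (card W)
     = (A *\<^sub>v Matrix.vec t (\<lambda>k. x w $ k - (\<Sum>v\<in>W. x v $ k) / of_nat (card W))) $ r" if w: "w \<in> W" for w
    by (rule mat_vec_comb[where W=W and x=x and p="?p", OF A x w r, unfolded m[where f="\<lambda>v. (A *\<^sub>v x v) $ r"], symmetric, unfolded mx])
  then show ?thesis unfolding var_def by simp
qed

text \<open>The information on the pair of messages is bounded by the tangent bound at the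
  covariance \<open>Qp + Qc\<close>, and the difference of the informations given the primary
  message by the path that ends at \<open>Qc\<close>. The variance terms of both recombine, through
  \<open>R\<close>, to \<open>lam\<close> times the power of the code, and the identity for
  \<open>lam * P\<close> cancels all first-order terms. The covariances and \<open>Bi\<close> are
  chosen before the code and its length.\<close>

theorem broadcast_bound:
  assumes S: "psd m S" "0 < Re (det S)" and K: "K \<in> carrier_mat m t" and G: "G \<in> carrier_mat m1 t"
    and P: "0 \<le> P" and ab: "0 \<le> a" "0 \<le> b"
    and Pr: "Pr \<in> carrier_mat m1 m" and GP: "G = Pr * K" and PS: "Pr * S * mat_adjoint Pr = 1\<^sub>m m1"
  obtains Qp Qc B Bi where "feas t P Qp Qc" "B \<in> carrier_mat m m" "Bi \<in> carrier_mat m m" "B * Bi = 1\<^sub>m m" "B * mat_adjoint B = S"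
    "\<And>(M::nat set) (C::nat set) n x. finite M \<Longrightarrow> M \<noteq> {} \<Longrightarrow> finite C \<Longrightarrow> C \<noteq> {} \<Longrightarrow>
       (\<And>w i. w \<in> M \<times> C \<Longrightarrow> i < n \<Longrightarrow> x w i \<in> carrier_vec t) \<Longrightarrow>
       (\<Sum>i<n. \<Sum>k<t. var (M \<times> C) (\<lambda>w. x w i $ k)) \<le> real n * P \<Longrightarrow>
       a * iota (M \<times> C) ({..<n} \<times> {..<m1}) (sigv G x)
       + (\<Sum>\<mu>\<in>M. b * iota C ({..<n} \<times> {..<m}) (sigv (Bi * K) (\<lambda>c. x (\<mu>, c))) - a * iota C ({..<n} \<times> {..<m1}) (sigv G (\<lambda>c. x (\<mu>, c)))) / card M
       \<le> real n * obj a b m1 G S K Qp Qc"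
proof -
  obtain Qp Qc B0 Bi0 d0 B1 Bi1 d1 B Bi d lam where
    f: "feas t P Qp Qc" and
    r0: "rdiag m1 (1\<^sub>m m1) G (Qp + Qc) B0 Bi0 d0" and r1: "rdiag m1 (1\<^sub>m m1) G Qc B1 Bi1 d1" and r: "rdiag m S K Qc B Bi d" and
    lam: "0 \<le> lam" and
    lamP: "lam * P = a * (\<Sum>j<m1. d0 j / (1 + d0 j)) - a * (\<Sum>j<m1. d1 j / (1 + d1 j)) + b * (\<Sum>j<m. d j / (1 + d j))" and
    k1: "\<And>v. v \<in> carrier_vec t \<Longrightarrow> a * hform m1 (Bi0 * G) d0 v \<le> lam * vsq t v" and
    k2: "\<And>v. v \<in> carrier_vec t \<Longrightarrow> a * hform m1 (Bi0 * G) d0 v - a * hform m1 (Bi1 * G) d1 v + b * hform m (Bi * K) d v \<le> lam * vsq t v" and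
    k3: "\<And>y. y \<in> carrier_vec t \<Longrightarrow> a * hform m1 (Bi0 * G) d0 (Qc *\<^sub>v y) - a * hform m1 (Bi1 * G) d1 (Qc *\<^sub>v y) + b * hform m (Bi * K) d (Qc *\<^sub>v y) = lam * vsq t (Qc *\<^sub>v y)"
    by (rule kkt[OF S K G P ab]) blast
  have p: "psd t Qp" "psd t Qc" using f by (auto simp: feas_def)
  have Q: "Qp \<in> carrier_mat t t" "Qc \<in> carrier_mat t t" "Qp + Qc \<in> carrier_mat t t" using p psd_carrier by auto
  have B: "B \<in> carrier_mat m m" "Bi \<in> carrier_mat m m" "B * Bi = 1\<^sub>m m" "B * mat_adjoint B = S"
    and AQ: "(Bi * K) * Qc * mat_adjoint (Bi * K) = cdiag m (\<lambda>j. complex_of_real (d j))" and d: "\<And>j. j < m \<Longrightarrow> 0 \<le> d j"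
    using r by (auto simp: rdiag_def)
  have B1: "B1 \<in> carrier_mat m1 m1" "Bi1 \<in> carrier_mat m1 m1" "Bi1 * B1 = 1\<^sub>m m1"
    and A1Q: "(Bi1 * G) * Qc * mat_adjoint (Bi1 * G) = cdiag m1 (\<lambda>j. complex_of_real (d1 j))" and d1: "\<And>j. j < m1 \<Longrightarrow> 0 \<le> d1 j"
    using r1 by (auto simp: rdiag_def)
  have B0: "Bi0 \<in> carrier_mat m1 m1" and d0: "\<And>j. j < m1 \<Longrightarrow> 0 \<le> d0 j" using r0 by (auto simp: rdiag_def)
  have A0: "Bi0 * G \<in> carrier_mat m1 t" and A1: "Bi1 * G \<in> carrier_mat m1 t" and A: "Bi * K \<in> carrier_mat m t"
    using B0 B1 B G K by auto
  obtain R where R: "R \<in> carrier_mat t t" and Rq: "\<And>v. v \<in> carrier_vec t \<Longrightarrow> (\<Sum>r<t. (cmod ((R *\<^sub>v v) $ r))\<^sup>2) = lam * vsq t v - a * hform m1 (Bi0 * G) d0 v"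
    by (rule power_form_root[OF A0 k1]) auto
  \<comment> \<open>The transition from whitened coordinates of the joint receiver to diagonalising
    coordinates of the primary one. Its rows are orthonormal because \<open>B\<close> produces noise
    of covariance \<open>S\<close> and \<open>Pr\<close> maps such noise to white noise.\<close>
  define T where "T = Bi1 * Pr * B"
  have BP: "Bi1 * Pr \<in> carrier_mat m1 m" using B1 Pr by auto
  have T: "T \<in> carrier_mat m1 m" unfolding T_def by (rule mult_carrier_mat[OF BP B(1)])
  have TA: "T * (Bi * K) = Bi1 * G"
  proof -
    have "T * (Bi * K) = (Bi1 * Pr) * ((B * Bi) * K)" unfolding T_def by (rule assoc_mult_mat4[OF BP B(1,2) K])
    also have "\<dots> = (Bi1 * Pr) * K" unfolding B(3) left_mult_one_mat[OF K] ..
    also have "\<dots> = Bi1 * G" unfolding GP by (rule assoc_mult_mat[OF B1(2) Pr K])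
    finally show ?thesis .
  qed
  have TT: "T * mat_adjoint T = 1\<^sub>m m1"
  proof -
    have Pc: "mat_adjoint Pr \<in> carrier_mat m m1" and Bc: "mat_adjoint B \<in> carrier_mat m m" and BPc: "mat_adjoint (Bi1 * Pr) \<in> carrier_mat m m1"
      and Sc: "S \<in> carrier_mat m m"
      using Pr B BP psd_carrier[OF S(1)] by auto
    have "T * mat_adjoint T = (Bi1 * Pr * B) * (mat_adjoint B * mat_adjoint (Bi1 * Pr))"
      unfolding T_def adj_mult[OF BP B(1)] ..
    also have "\<dots> = (Bi1 * Pr) * (S * mat_adjoint (Bi1 * Pr))"
      unfolding assoc_mult_mat4[OF BP B(1) Bc BPc] B(4) ..
    also have "\<dots> = (Bi1 * Pr) * (S * (mat_adjoint Pr * B1))"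
      unfolding adj_mult[OF B1(2) Pr] rdiag_one_unitary(2)[OF r1] ..
    also have "\<dots> = (Bi1 * Pr) * ((S * mat_adjoint Pr) * B1)" unfolding assoc_mult_mat[OF Sc Pc B1(1)] ..
    also have "\<dots> = Bi1 * (Pr * ((S * mat_adjoint Pr) * B1))"
      by (rule assoc_mult_mat[OF B1(2) Pr mult_carrier_mat[OF mult_carrier_mat[OF Sc Pc] B1(1)]])
    also have "Pr * ((S * mat_adjoint Pr) * B1) = (Pr * (S * mat_adjoint Pr)) * B1"
      by (rule assoc_mult_mat[OF Pr mult_carrier_mat[OF Sc Pc] B1(1), symmetric])
    also have "Pr * (S * mat_adjoint Pr) = 1\<^sub>m m1" unfolding assoc_mult_mat[OF Pr Sc Pc, symmetric] PS ..
    finally show ?thesis unfolding left_mult_one_mat[OF B1(1)] B1(3) .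
  qed
  have form: "b * hform m (Bi * K) d v \<le> a * hform m1 (Bi1 * G) d1 v + (\<Sum>r<t. (cmod ((R *\<^sub>v v) $ r))\<^sup>2)" if v: "v \<in> carrier_vec t" for v
    unfolding Rq[OF v] using k2[OF v] by simp
  have slack: "b * hform m (Bi * K) d (Qc *\<^sub>v y) = a * hform m1 (Bi1 * G) d1 (Qc *\<^sub>v y) + (\<Sum>r<t. (cmod ((R *\<^sub>v (Qc *\<^sub>v y)) $ r))\<^sup>2)" if y: "y \<in> carrier_vec t" for y
    unfolding Rq[OF mult_mat_vec_carrier[OF Q(2) y]] using k3[OF y] by simp
  have objv: "obj a b m1 G S K Qp Qc = a * ((\<Sum>j<m1. ln (1 + d0 j)) - (\<Sum>j<m1. ln (1 + d1 j))) + b * (\<Sum>j<m. ln (1 + d j))"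
  proof -
    have l1: "lndet (1\<^sub>m m1) = 0" by (simp add: lndet_def)
    have one: "0 < Re (det (1\<^sub>m m1 :: complex mat))" by simp
    show ?thesis unfolding obj_def
      using rdiag_lndet(2)[OF r0 one G Q(3)] rdiag_lndet(2)[OF r1 one G Q(2)] rdiag_lndet(2)[OF r S(2) K Q(2)] l1 by simp
  qed
  show ?thesis
  proof (rule that[OF f B])
    fix M C :: "nat set" and n :: nat and x
    assume fin: "finite M" "M \<noteq> {}" "finite C" "C \<noteq> {}" and x: "\<And>w i. w \<in> M \<times> C \<Longrightarrow> i < n \<Longrightarrow> x w i \<in> carrier_vec t"
      and pw: "(\<Sum>i<n. \<Sum>k<t. var (M \<times> C) (\<lambda>w. x w i $ k)) \<le> real n * P"
    have W: "finite (M \<times> C)" "M \<times> C \<noteq> {}" using fin by auto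
    let ?W = "M \<times> C" and ?J = "{..<n} \<times> {..<m}" and ?J1 = "{..<n} \<times> {..<m1}"
    define L0 L1 L t0 t1 tt where "L0 = (\<Sum>j<m1. ln (1 + d0 j))" and "L1 = (\<Sum>j<m1. ln (1 + d1 j))" and "L = (\<Sum>j<m. ln (1 + d j))"
      and "t0 = (\<Sum>j<m1. d0 j / (1 + d0 j))" and "t1 = (\<Sum>j<m1. d1 j / (1 + d1 j))" and "tt = (\<Sum>j<m. d j / (1 + d j))"
    define V0 where "V0 = (\<Sum>i<n. \<Sum>r<m1. var ?W (\<lambda>w. ((Bi0 * G) *\<^sub>v x w i) $ r) / (1 + d0 r))"
    define VR where "VR = (\<Sum>i<n. \<Sum>r<t. var ?W (\<lambda>w. (R *\<^sub>v x w i) $ r))"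
    define VC where "VC \<mu> = (\<Sum>i<n. \<Sum>r<t. var C (\<lambda>c. (R *\<^sub>v x (\<mu>, c) i) $ r))" for \<mu>
    have u0: "iota ?W ?J1 (sigv (Bi0 * G) x) = iota ?W ?J1 (sigv G x)" by (rule iota_unitary[OF r0 G x])
    have s1: "a * iota ?W ?J1 (sigv G x) \<le> a * (n * L0 + V0 - n * t0)"
      unfolding u0[symmetric] L0_def V0_def t0_def by (intro mult_left_mono[OF _ ab(1)] iota_gaussian_bound[OF W d0])
    have s2: "b * iota C ?J (sigv (Bi * K) (\<lambda>c. x (\<mu>, c))) - a * iota C ?J1 (sigv G (\<lambda>c. x (\<mu>, c))) \<le> n * (b * L - a * L1) + VC \<mu> - n * (b * tt - a * t1)" if \<mu>: "\<mu> \<in> M" for \<mu>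
    proof -
      have xc: "\<And>c i. c \<in> C \<Longrightarrow> i < n \<Longrightarrow> x (\<mu>, c) i \<in> carrier_vec t" using x \<mu> by auto
      have u: "iota C ?J1 (sigv (Bi1 * G) (\<lambda>c. x (\<mu>, c))) = iota C ?J1 (sigv G (\<lambda>c. x (\<mu>, c)))"
        by (rule iota_unitary[OF r1 G xc])
      show ?thesis unfolding u[symmetric] L_def L1_def VC_def tt_def t1_def
        by (rule iota_degraded_bound[OF fin(3,4) xc ab A A1 T R Q(2) TT TA AQ A1Q d d1 form slack])
    qed
    have cM: "real (card M) > 0" using fin by (simp add: card_gt_0_iff)
    have s3: "(\<Sum>\<mu>\<in>M. b * iota C ?J (sigv (Bi * K) (\<lambda>c. x (\<mu>, c))) - a * iota C ?J1 (sigv G (\<lambda>c. x (\<mu>, c)))) / card M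
      \<le> n * (b * L - a * L1) - n * (b * tt - a * t1) + (\<Sum>\<mu>\<in>M. VC \<mu>) / card M"
    proof -
      have "(\<Sum>\<mu>\<in>M. b * iota C ?J (sigv (Bi * K) (\<lambda>c. x (\<mu>, c))) - a * iota C ?J1 (sigv G (\<lambda>c. x (\<mu>, c)))) / card M
        \<le> (\<Sum>\<mu>\<in>M. (n * (b * L - a * L1) - n * (b * tt - a * t1)) + VC \<mu>) / card M"
        using s2 by (intro divide_right_mono sum_mono) (auto simp: algebra_simps)
      also have "\<dots> = n * (b * L - a * L1) - n * (b * tt - a * t1) + (\<Sum>\<mu>\<in>M. VC \<mu>) / card M"
        using cM unfolding sum.distrib add_divide_distrib by simp
      finally show ?thesis .
    qed
    \<comment> \<open>The conditional bounds charge the variance within one primary message; on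
      average this is at most the total variance, which is what the power constraint
      controls.\<close>
    have s4: "(\<Sum>\<mu>\<in>M. VC \<mu>) / card M \<le> VR"
    proof -
      have "(\<Sum>\<mu>\<in>M. VC \<mu>) / card M = (\<Sum>i<n. \<Sum>r<t. (\<Sum>\<mu>\<in>M. var C (\<lambda>c. (R *\<^sub>v x (\<mu>, c) i) $ r)) / card M)"
      proof -
        have "(\<Sum>\<mu>\<in>M. VC \<mu>) = (\<Sum>i<n. \<Sum>\<mu>\<in>M. \<Sum>r<t. var C (\<lambda>c. (R *\<^sub>v x (\<mu>, c) i) $ r))"
          unfolding VC_def by (rule sum.swap)
        also have "\<dots> = (\<Sum>i<n. \<Sum>r<t. \<Sum>\<mu>\<in>M. var C (\<lambda>c. (R *\<^sub>v x (\<mu>, c) i) $ r))"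
          by (intro sum.cong refl sum.swap)
        finally show ?thesis by (simp add: sum_divide_distrib)
      qed
      also have "\<dots> \<le> VR" unfolding VR_def
        using var_within_le[OF fin, of "\<lambda>w. (R *\<^sub>v x w _) $ _"] by (intro sum_mono) auto
      finally show ?thesis .
    qed
    \<comment> \<open>By construction \<open>R\<close> charges \<open>lam * vsq t z\<close> minus
      the form that the primary tangent bound charges, so the two add up to the plain power.\<close>
    have s5: "a * V0 + VR = lam * (\<Sum>i<n. \<Sum>k<t. var ?W (\<lambda>w. x w i $ k))"
    proof -
      have "a * (\<Sum>r<m1. var ?W (\<lambda>w. ((Bi0 * G) *\<^sub>v x w i) $ r) / (1 + d0 r)) + (\<Sum>r<t. var ?W (\<lambda>w. (R *\<^sub>v x w i) $ r))
        = lam * (\<Sum>k<t. var ?W (\<lambda>w. x w i $ k))" if i: "i < n" for i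
      proof -
        define z where "z w = Matrix.vec t (\<lambda>k. x w i $ k - (\<Sum>v\<in>?W. x v i $ k) / of_nat (card ?W))" for w
        have zc: "z w \<in> carrier_vec t" for w by (simp add: z_def)
        have xi: "\<And>w. w \<in> ?W \<Longrightarrow> x w i \<in> carrier_vec t" using x i by auto
        have v: "var ?W (\<lambda>w. (X *\<^sub>v x w i) $ r) = (\<Sum>w\<in>?W. (cmod ((X *\<^sub>v z w) $ r))\<^sup>2) / card ?W" if "X \<in> carrier_mat k t" "r < k" for X k r
          unfolding z_def by (rule var_mat_vec[OF W that(1) xi that(2)])
        have e1: "(\<Sum>r<m1. var ?W (\<lambda>w. ((Bi0 * G) *\<^sub>v x w i) $ r) / (1 + d0 r)) = (\<Sum>w\<in>?W. hform m1 (Bi0 * G) d0 (z w)) / card ?W"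
        proof -
          have "(\<Sum>r<m1. var ?W (\<lambda>w. ((Bi0 * G) *\<^sub>v x w i) $ r) / (1 + d0 r)) = (\<Sum>r<m1. \<Sum>w\<in>?W. (cmod (((Bi0 * G) *\<^sub>v z w) $ r))\<^sup>2 / (1 + d0 r)) / card ?W"
            using v[OF A0] by (simp add: sum_divide_distrib mult.commute)
          also have "(\<Sum>r<m1. \<Sum>w\<in>?W. (cmod (((Bi0 * G) *\<^sub>v z w) $ r))\<^sup>2 / (1 + d0 r)) = (\<Sum>w\<in>?W. hform m1 (Bi0 * G) d0 (z w))"
            unfolding hform_def by (rule sum.swap)
          finally show ?thesis .
        qed
        have e2: "(\<Sum>r<t. var ?W (\<lambda>w. (R *\<^sub>v x w i) $ r)) = (\<Sum>w\<in>?W. lam * vsq t (z w) - a * hform m1 (Bi0 * G) d0 (z w)) / card ?W"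
        proof -
          have "(\<Sum>r<t. var ?W (\<lambda>w. (R *\<^sub>v x w i) $ r)) = (\<Sum>r<t. \<Sum>w\<in>?W. (cmod ((R *\<^sub>v z w) $ r))\<^sup>2) / card ?W"
            using v[OF R] by (simp add: sum_divide_distrib)
          also have "(\<Sum>r<t. \<Sum>w\<in>?W. (cmod ((R *\<^sub>v z w) $ r))\<^sup>2) = (\<Sum>w\<in>?W. \<Sum>r<t. (cmod ((R *\<^sub>v z w) $ r))\<^sup>2)" by (rule sum.swap)
          finally show ?thesis unfolding Rq[OF zc] .
        qed
        have e3: "(\<Sum>k<t. var ?W (\<lambda>w. x w i $ k)) = (\<Sum>w\<in>?W. vsq t (z w)) / card ?W"
        proof -
          have "(\<Sum>k<t. var ?W (\<lambda>w. x w i $ k)) = (\<Sum>k<t. \<Sum>w\<in>?W. (cmod (z w $ k))\<^sup>2) / card ?W"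
            unfolding var_def by (simp add: z_def sum_divide_distrib[symmetric])
          also have "(\<Sum>k<t. \<Sum>w\<in>?W. (cmod (z w $ k))\<^sup>2) = (\<Sum>w\<in>?W. vsq t (z w))" unfolding vsq_def by (rule sum.swap)
          finally show ?thesis .
        qed
        show ?thesis unfolding e1 e2 e3 by (simp add: sum_subtractf sum_distrib_left[symmetric] diff_divide_distrib)
      qed
      then show ?thesis unfolding V0_def VR_def sum_distrib_left sum.distrib[symmetric] by (intro sum.cong refl) (simp add: sum_distrib_left)
    qed
    have s6: "a * V0 + VR \<le> n * (lam * P)"
      unfolding s5 using mult_left_mono[OF pw lam] by (simp add: mult.left_commute)
    have "a * iota ?W ?J1 (sigv G x)
       + (\<Sum>\<mu>\<in>M. b * iota C ?J (sigv (Bi * K) (\<lambda>c. x (\<mu>, c))) - a * iota C ?J1 (sigv G (\<lambda>c. x (\<mu>, c)))) / card M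
      \<le> a * (n * L0 + V0 - n * t0) + (n * (b * L - a * L1) - n * (b * tt - a * t1) + VR)"
      using s1 s3 s4 by linarith
    also have "\<dots> = n * (a * (L0 - L1) + b * L) + (a * V0 + VR) - n * (a * t0 - a * t1 + b * tt)"
      by (simp add: algebra_simps)
    also have "\<dots> \<le> n * (a * (L0 - L1) + b * L)"
      using s6 unfolding lamP t0_def[symmetric] t1_def[symmetric] tt_def[symmetric] by simp
    finally show "a * iota ?W ?J1 (sigv G x)
       + (\<Sum>\<mu>\<in>M. b * iota C ?J (sigv (Bi * K) (\<lambda>c. x (\<mu>, c))) - a * iota C ?J1 (sigv G (\<lambda>c. x (\<mu>, c)))) / card M
       \<le> real n * obj a b m1 G S K Qp Qc"
      unfolding objv L0_def L1_def L_def .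
  qed
qed

section \<open>From codes to rates\<close>

lemma Re_mtrace_cov_mat: "Re (mtrace (cov_mat k W X)) = (\<Sum>a<k. var W (\<lambda>w. X w $ a))"
proof -
  have "mtrace (cov_mat k W X) = (\<Sum>a<k. complex_of_real (var W (\<lambda>w. X w $ a)))"
    unfolding mtrace_def by (intro sum.cong) (auto simp: cov_mat_def Let_def var_def complex_norm_square simp del: of_real_power complex_cnj_diff)
  then show ?thesis by simp
qed

lemma var_Times_fst:
  assumes "finite M" "finite C" "C \<noteq> {}"
  shows "var (M \<times> C) (\<lambda>w. f (fst w)) = var M f"
proof -
  have c: "real (card C) \<noteq> 0" "complex_of_nat (card C) \<noteq> 0" using assms by auto
  have m: "(\<Sum>w\<in>M \<times> C. f (fst w)) / of_nat (card (M \<times> C)) = (\<Sum>v\<in>M. f v) / of_nat (card M)"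
    using c unfolding sum_Times by (simp add: card_cartesian_product sum_distrib_left[symmetric])
  show ?thesis unfolding var_def m unfolding sum_Times
    using c by (simp add: card_cartesian_product sum_distrib_left[symmetric])
qed

lemma var_scale: "var W (\<lambda>w. c * \<xi> w) = (cmod c)\<^sup>2 * var W \<xi>"
proof -
  have "c * \<xi> w - (\<Sum>v\<in>W. c * \<xi> v) / of_nat (card W) = c * (\<xi> w - (\<Sum>v\<in>W. \<xi> v) / of_nat (card W))" for w
    by (simp add: sum_distrib_left[symmetric] right_diff_distrib)
  then show ?thesis by (simp add: var_def norm_mult power_mult_distrib sum_distrib_left[symmetric])
qed

lemma err_prob_gam:
  "err_prob n k D s m = measure (gam ({..<n} \<times> {..<k}))
     {y \<in> space (gam ({..<n} \<times> {..<k})). D (\<lambda>p\<in>{..<n} \<times> {..<k}. y p + s (fst p) $ snd p) \<noteq> m}"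
proof -
  have "restrict (\<lambda>(i, j). s i $ j + z (i, j)) ({..<n} \<times> {..<k}) = (\<lambda>p\<in>{..<n} \<times> {..<k}. z p + s (fst p) $ snd p)" for z
    by (auto simp: fun_eq_iff)
  then show ?thesis unfolding err_prob_def noise_def by simp
qed

lemma lin_blk_sigv:
  assumes U: "U \<in> carrier_mat k m" and A: "A \<in> carrier_mat m t" and x: "x w i \<in> carrier_vec t" and ij: "i < n" "j < k"
  shows "lin ({..<n} \<times> {..<m}) ({..<n} \<times> {..<k}) (blk U) (\<lambda>p\<in>{..<n} \<times> {..<m}. y p + sigv A x w p) (i, j)
    = lin ({..<n} \<times> {..<m}) ({..<n} \<times> {..<k}) (blk U) y (i, j) + ((U * A) *\<^sub>v x w i) $ j"
proof -
  have "lin ({..<n} \<times> {..<m}) ({..<n} \<times> {..<k}) (blk U) (\<lambda>p\<in>{..<n} \<times> {..<m}. y p + sigv A x w p) (i, j)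
      = (\<Sum>l<m. U $$ (j, l) * (y (i, l) + sigv A x w (i, l)))"
    using ij by (simp add: lin_def blk_sum)
  also have "\<dots> = (\<Sum>l<m. U $$ (j, l) * y (i, l)) + (\<Sum>l<m. U $$ (j, l) * (A *\<^sub>v x w i) $ l)"
    by (simp add: sigv_def distrib_left sum.distrib)
  also have "(\<Sum>l<m. U $$ (j, l) * (A *\<^sub>v x w i) $ l) = ((U * A) *\<^sub>v x w i) $ j"
    using mat_vec_index[OF U mult_mat_vec_carrier[OF A x] ij(2)] assoc_mult_mat_vec[OF U A x] by simp
  finally show ?thesis using ij by (simp add: lin_def blk_sum)
qed

text \<open>A receiver with signal \<open>A x\<close> can run the decoder of a weaker one:
  \<open>U\<close> reproduces the weaker noise distribution, and the offset \<open>h\<close> is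
  added back before decoding. As \<open>h\<close> does not depend on the message \<open>c\<close>,
  it may contain any interference that is fixed while \<open>c\<close> varies.\<close>

lemma fano_degraded:
  fixes x :: "nat \<Rightarrow> nat \<Rightarrow> complex Matrix.vec"
  assumes C: "finite C" "C \<noteq> {}" and D: "D \<in> measurable (PiM ({..<n} \<times> {..<k}) (\<lambda>_. borel)) (count_space UNIV)"
    and U: "U \<in> carrier_mat k m" "U * mat_adjoint U = 1\<^sub>m k" and A: "A \<in> carrier_mat m t"
    and x: "\<And>c i. c \<in> C \<Longrightarrow> i < n \<Longrightarrow> x c i \<in> carrier_vec t"
    and s: "\<And>c i j. c \<in> C \<Longrightarrow> i < n \<Longrightarrow> j < k \<Longrightarrow> s c i $ j = h i j + ((U * A) *\<^sub>v x c i) $ j"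
    and Pe: "(\<Sum>c\<in>C. err_prob n k D (s c) c) / card C \<le> \<epsilon>"
  shows "(1 - \<epsilon>) * ln (card C) - ln 2 \<le> iota C ({..<n} \<times> {..<m}) (sigv A x)"
proof -
  let ?J = "{..<n} \<times> {..<m}" and ?K = "{..<n} \<times> {..<k}"
  let ?L = "lin ?J ?K (blk U)"
  define D' where "D' y = D (\<lambda>p\<in>?K. ?L y p + h (fst p) (snd p))" for y
  have Dm: "D \<in> measurable (gam ?K) (count_space UNIV)"
    using D by (simp add: measurable_cong_sets[OF sets_gam refl])
  have D'm: "D' \<in> measurable (gam ?J) (count_space UNIV)"
    unfolding D'_def
    by (rule measurable_compose[OF measurable_lin[of ?J ?K "blk U"] measurable_compose[OF measurable_shift Dm]])
  have e: "err_prob n k D (s c) c = measure (gam ?J) {y \<in> space (gam ?J). D' (\<lambda>p\<in>?J. y p + sigv A x c p) \<noteq> c}" if c: "c \<in> C" for c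
  proof -
    have sm: "(\<lambda>y. D (\<lambda>p\<in>?K. y p + s c (fst p) $ snd p)) \<in> measurable (gam ?K) (count_space UNIV)"
      by (rule measurable_compose[OF measurable_shift Dm])
    have set: "{y \<in> space (gam ?K). D (\<lambda>p\<in>?K. y p + s c (fst p) $ snd p) \<noteq> c} \<in> sets (gam ?K)"
      using sm by measurable
    have "err_prob n k D (s c) c = measure (distr (gam ?J) (gam ?K) ?L) {y \<in> space (gam ?K). D (\<lambda>p\<in>?K. y p + s c (fst p) $ snd p) \<noteq> c}"
      unfolding err_prob_gam using distr_gam_lin[OF _ _ coisom_blk[OF U]] by simp
    also have "\<dots> = measure (gam ?J) {y \<in> space (gam ?J). D (\<lambda>p\<in>?K. ?L y p + s c (fst p) $ snd p) \<noteq> c}"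
      unfolding measure_distr[OF measurable_lin set]
      using measurable_space[OF measurable_lin[of ?J ?K "blk U"]] by (intro arg_cong[where f="measure (gam ?J)"]) auto
    also have "\<dots> = measure (gam ?J) {y \<in> space (gam ?J). D' (\<lambda>p\<in>?J. y p + sigv A x c p) \<noteq> c}"
    proof -
      have "(\<lambda>p\<in>?K. ?L y p + s c (fst p) $ snd p) = (\<lambda>p\<in>?K. ?L (\<lambda>p\<in>?J. y p + sigv A x c p) p + h (fst p) (snd p))" for y
      proof (intro restrict_ext)
        fix p assume p: "p \<in> ?K"
        then obtain i j where ij: "p = (i, j)" "i < n" "j < k" by auto
        show "?L y p + s c (fst p) $ snd p = ?L (\<lambda>p\<in>?J. y p + sigv A x c p) p + h (fst p) (snd p)"
          unfolding ij(1) lin_blk_sigv[where x=x and w=c, OF U(1) A x[OF c ij(2)] ij(2,3)] using s[OF c ij(2,3)] by simp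
      qed
      then show ?thesis unfolding D'_def by simp
    qed
    finally show ?thesis .
  qed
  show ?thesis
    by (rule fano_iota[OF _ C D'm]) (use Pe e in auto)
qed

text \<open>Selects antennas of the joint receiver: the identity as \<open>f\<close> gives the
  primary receiver, the shift by \<open>npr\<close> the cognitive one.\<close>

definition sel :: "nat \<Rightarrow> nat \<Rightarrow> (nat \<Rightarrow> nat) \<Rightarrow> complex mat" where
  "sel r m f = mat r m (\<lambda>(i, j). if j = f i then 1 else 0)"

lemma sel_carrier: "sel r m f \<in> carrier_mat r m" by (simp add: sel_def)

lemma sel_mult:
  assumes f: "\<And>i. i < r \<Longrightarrow> f i < m" and K: "K \<in> carrier_mat m t"
  shows "sel r m f * K = mat r t (\<lambda>(i, j). K $$ (f i, j))"
proof (rule eq_matI)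
  fix i j assume "i < dim_row (mat r t (\<lambda>(i, j). K $$ (f i, j)))" "j < dim_col (mat r t (\<lambda>(i, j). K $$ (f i, j)))"
  then have ij: "i < r" "j < t" by auto
  have "(sel r m f * K) $$ (i, j) = (\<Sum>l<m. if l = f i then K $$ (f i, j) else 0)"
    unfolding mat_mult_index[OF sel_carrier K ij] using ij by (intro sum.cong refl) (auto simp: sel_def)
  then show "(sel r m f * K) $$ (i, j) = mat r t (\<lambda>(i, j). K $$ (f i, j)) $$ (i, j)" using f ij by simp
qed (use K in \<open>auto simp: sel_def\<close>)

lemma sel_congruence:
  assumes f: "\<And>i. i < r \<Longrightarrow> f i < m" and S: "S \<in> carrier_mat m m" and one: "\<And>i j. i < r \<Longrightarrow> j < r \<Longrightarrow> S $$ (f i, f j) = (if i = j then 1 else 0)"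
  shows "sel r m f * S * mat_adjoint (sel r m f) = 1\<^sub>m r"
proof (rule eq_matI)
  have a: "mat_adjoint (sel r m f) \<in> carrier_mat m r" by (rule adj_carrier[OF sel_carrier])
  have e: "sel r m f * S = mat r m (\<lambda>(i, j). S $$ (f i, j))" by (rule sel_mult[OF f S])
  show "dim_row (sel r m f * S * mat_adjoint (sel r m f)) = dim_row (1\<^sub>m r)" by (simp add: sel_def)
  show "dim_col (sel r m f * S * mat_adjoint (sel r m f)) = dim_col (1\<^sub>m r)" using a by (simp only: index_mult_mat index_one_mat carrier_matD)
  fix i j assume "i < dim_row (1\<^sub>m r)" "j < dim_col (1\<^sub>m r)"
  then have ij: "i < r" "j < r" by auto
  have "(sel r m f * S * mat_adjoint (sel r m f)) $$ (i, j) = (\<Sum>l<m. (sel r m f * S) $$ (i, l) * mat_adjoint (sel r m f) $$ (l, j))"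
    by (rule mat_mult_index[OF mult_carrier_mat[OF sel_carrier S] a ij])
  also have "\<dots> = (\<Sum>l<m. if l = f j then S $$ (f i, f j) else 0)"
    unfolding e using ij adj_index[OF sel_carrier[of r m f] _ ij(2)] by (intro sum.cong refl) (auto simp: sel_def)
  also have "\<dots> = S $$ (f i, f j)" using f ij by simp
  finally show "(sel r m f * S * mat_adjoint (sel r m f)) $$ (i, j) = 1\<^sub>m r $$ (i, j)" using one[OF ij] ij by simp
qed

lemma sel_mult_mat_vec:
  assumes f: "\<And>i. i < r \<Longrightarrow> f i < m" and K: "K \<in> carrier_mat m t" and v: "v \<in> carrier_vec t" and i: "i < r"
  shows "((sel r m f * K) *\<^sub>v v) $ i = (K *\<^sub>v v) $ f i"
proof -
  have e: "sel r m f * K = mat r t (\<lambda>(i, j). K $$ (f i, j))" by (rule sel_mult[OF f K])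
  have "((sel r m f * K) *\<^sub>v v) $ i = (\<Sum>l<t. K $$ (f i, l) * v $ l)"
    unfolding e mat_vec_index[OF mat_carrier v i] using i by simp
  then show ?thesis unfolding mat_vec_index[OF K v f[OF i]] .
qed

text \<open>A separating functional may favour small values of a coordinate. Since \<open>X\<close>
  is downward closed, that coordinate can be set to 0 without leaving \<open>X\<close>, so clipping
  the weights to nonnegative ones loses nothing and the comparison for \<open>a, b \<ge> 0\<close>
  is enough.\<close>

lemma down_closed_closure_convex_hull:
  fixes X :: "(real \<times> real) set"
  assumes down: "\<And>p q p' q'. (p, q) \<in> X \<Longrightarrow> 0 \<le> p' \<Longrightarrow> p' \<le> p \<Longrightarrow> 0 \<le> q' \<Longrightarrow> q' \<le> q \<Longrightarrow> (p', q') \<in> X"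
    and nonneg: "\<And>p q. (p, q) \<in> X \<Longrightarrow> 0 \<le> p \<and> 0 \<le> q" and R: "0 \<le> R" "0 \<le> T"
    and sup: "\<And>a b. 0 \<le> a \<Longrightarrow> 0 \<le> b \<Longrightarrow> \<exists>p q. (p, q) \<in> X \<and> a * R + b * T \<le> a * p + b * q"
  shows "(R, T) \<in> closure (convex hull X)"
proof (rule ccontr)
  assume n: "(R, T) \<notin> closure (convex hull X)"
  have "convex (closure (convex hull X))" by (intro convex_closure convex_convex_hull)
  from separating_hyperplane_closed_point[OF this closed_closure n] obtain u c
    where u: "u \<bullet> (R, T) < c" "\<And>x. x \<in> closure (convex hull X) \<Longrightarrow> u \<bullet> x > c" by blast
  obtain u1 u2 where uu: "u = (u1, u2)" by (cases u)
  have X: "u1 * p + u2 * q > c" if "(p, q) \<in> X" for p q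
    using u(2)[of "(p, q)"] closure_subset[of "convex hull X"] hull_inc[OF that, of convex] by (auto simp: uu)
  define a b where "a = max (- u1) 0" and "b = max (- u2) 0"
  obtain p q where pq: "(p, q) \<in> X" "a * R + b * T \<le> a * p + b * q" using sup[of a b] by (auto simp: a_def b_def)
  have "(if u1 < 0 then p else 0, if u2 < 0 then q else 0) \<in> X" using down[OF pq(1)] nonneg[OF pq(1)] by simp
  from X[OF this] have "a * p + b * q < - c" by (auto simp: a_def b_def max_def split: if_splits)
  moreover have "- u1 * R - u2 * T \<le> a * R + b * T"
    using R mult_right_mono[of "- u1" a R] mult_right_mono[of "- u2" b T] by (simp add: a_def b_def)
  ultimately show False using pq(2) u(1) by (simp add: uu)
qed

lemma nmsg_pos: "0 < nmsg n R"
proof -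
  have "0 < \<lceil>2 powr (real n * R)\<rceil>" by (simp add: zero_less_ceiling)
  then show ?thesis by (simp add: nmsg_def)
qed

lemma ln_nmsg_ge: "real n * R * ln 2 \<le> ln (real (nmsg n R))"
proof -
  have "2 powr (real n * R) \<le> real (nmsg n R)" unfolding nmsg_def by linarith
  then have "ln (2 powr (real n * R)) \<le> ln (real (nmsg n R))" by (subst ln_le_cancel_iff) (use nmsg_pos[of n R] in auto)
  then show ?thesis by (simp add: ln_powr)
qed

lemma G_alpha_carrier:
  assumes "Hpp \<in> carrier_mat npr npt" "Hcp \<in> carrier_mat npr nct"
  shows "G_alpha npt nct Hpp Hcp \<alpha> \<in> carrier_mat npr (npt + nct)"
  using four_block_carrier_mat[OF assms(1) zero_carrier_mat[of 0 nct]] unfolding G_alpha_def by simp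

lemma K_bar_carrier:
  assumes "Hpp \<in> carrier_mat npr npt" "Hcc \<in> carrier_mat ncr nct"
  shows "K_bar npt ncr Hpp Hcp Hcc \<alpha> \<in> carrier_mat (npr + ncr) (npt + nct)"
  using assms unfolding K_bar_def by simp

lemma G_alpha_sel:
  assumes H: "Hpp \<in> carrier_mat npr npt" "Hcp \<in> carrier_mat npr nct" "Hcc \<in> carrier_mat ncr nct"
  shows "G_alpha npt nct Hpp Hcp \<alpha> = sel npr (npr + ncr) (\<lambda>i. i) * K_bar npt ncr Hpp Hcp Hcc \<alpha>"
proof -
  have e: "sel npr (npr + ncr) (\<lambda>i. i) * K_bar npt ncr Hpp Hcp Hcc \<alpha>
      = mat npr (npt + nct) (\<lambda>(i, j). K_bar npt ncr Hpp Hcp Hcc \<alpha> $$ (i, j))"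
    by (rule sel_mult[OF _ K_bar_carrier[OF H(1,3)]]) simp
  show ?thesis unfolding e by (rule eq_matI) (use H in \<open>auto simp: G_alpha_def K_bar_def\<close>)
qed

text \<open>The factor sqrt \<alpha> on the cognitive input cancels 1 / sqrt \<alpha> in the matrix.
  The lower component is the cognitive signal with the primary interference already subtracted,
  which is legitimate once the primary message is fixed.\<close>

lemma K_bar_mult_append:
  assumes H: "Hpp \<in> carrier_mat npr npt" "Hcp \<in> carrier_mat npr nct" "Hcc \<in> carrier_mat ncr nct" and \<alpha>: "0 < \<alpha>"
    and u: "u \<in> carrier_vec npt" and v: "v \<in> carrier_vec nct"
  shows "K_bar npt ncr Hpp Hcp Hcc \<alpha> *\<^sub>v (u @\<^sub>v complex_of_real (sqrt \<alpha>) \<cdot>\<^sub>v v)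
     = (Hpp *\<^sub>v u + Hcp *\<^sub>v v) @\<^sub>v (Hcc *\<^sub>v v)"
proof -
  have sc: "(complex_of_real (1 / sqrt \<alpha>) \<cdot>\<^sub>m H) *\<^sub>v (complex_of_real (sqrt \<alpha>) \<cdot>\<^sub>v v) = H *\<^sub>v v"
    if H: "H \<in> carrier_mat k nct" for H k
  proof (rule eq_vecI)
    fix i assume "i < dim_vec (H *\<^sub>v v)"
    then have i: "i < k" using H by simp
    have e: "complex_of_real (1 / sqrt \<alpha>) * complex_of_real (sqrt \<alpha>) = 1"
      using \<alpha> by (simp only: of_real_mult[symmetric]) simp
    have "((complex_of_real (1 / sqrt \<alpha>) \<cdot>\<^sub>m H) *\<^sub>v (complex_of_real (sqrt \<alpha>) \<cdot>\<^sub>v v)) $ i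
       = (\<Sum>l<nct. (complex_of_real (1 / sqrt \<alpha>) * complex_of_real (sqrt \<alpha>)) * (H $$ (i, l) * v $ l))"
      unfolding mat_vec_index[OF smult_carrier_mat[OF H] smult_carrier_vec[THEN iffD2, OF v] i]
      using H v i by (intro sum.cong refl) (simp add: mult_ac del: of_real_divide)
    then show "((complex_of_real (1 / sqrt \<alpha>) \<cdot>\<^sub>m H) *\<^sub>v (complex_of_real (sqrt \<alpha>) \<cdot>\<^sub>v v)) $ i = (H *\<^sub>v v) $ i"
      unfolding e mat_vec_index[OF H v i] by simp
  qed (use H in auto)
  have z: "0\<^sub>m ncr npt *\<^sub>v u = 0\<^sub>v ncr" using u by (intro eq_vecI) auto
  have "Hcc *\<^sub>v v \<in> carrier_vec ncr" using H v by auto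
  then show ?thesis unfolding K_bar_def
    using four_block_mat_mult_vec[OF H(1) smult_carrier_mat[OF H(2)] zero_carrier_mat smult_carrier_mat[OF H(3)] u smult_carrier_vec[THEN iffD2, OF v]]
    by (simp only: sc[OF H(2)] sc[OF H(3)] z left_zero_vec)
qed

text \<open>The code's powers are variances, so the mere existence of a code of positive length
  makes both power bounds nonnegative; the optimisation over covariances then has a feasible
  point.\<close>

lemma code_power_nonneg:
  assumes "mcc_code_exists npt nct npr ncr Hpp Hcp Hpc Hcc Pp Pc n Rp Rc \<epsilon>" and n: "0 < n"
  shows "0 \<le> Pp" "0 \<le> Pc"
proof -
  obtain Ep Ec where e: "(\<Sum>i<n. Re (mtrace (cov_mat npt {1..nmsg n Rp} (\<lambda>mp. Ep mp i)))) \<le> real n * Pp"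
     "(\<Sum>i<n. Re (mtrace (cov_mat nct ({1..nmsg n Rp} \<times> {1..nmsg n Rc}) (\<lambda>(mp, mc). Ec mp mc i)))) \<le> real n * Pc"
    using assms(1) unfolding mcc_code_exists_def Let_def by blast
  have "0 \<le> real n * Pp" using e(1) unfolding Re_mtrace_cov_mat by (rule order_trans[rotated]) (intro sum_nonneg var_nonneg)
  moreover have "0 \<le> real n * Pc" using e(2) unfolding Re_mtrace_cov_mat by (rule order_trans[rotated]) (intro sum_nonneg var_nonneg)
  ultimately show "0 \<le> Pp" "0 \<le> Pc" using n by (auto simp: zero_le_mult_iff)
qed

text \<open>Both Fano bounds are expressed through one joint input \<open>x\<close>. The primary
  bound has the form of a chain rule, the cognitive one is conditional on the primary message and
  averaged over it. \<open>B\<close> and \<open>Bi\<close> are an arbitrary factorisation of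
  \<open>S\<close>, so the one singled out by the optimisation can be inserted.\<close>

lemma code_rates_le:
  defines "J \<equiv> \<lambda>n k. {..<n} \<times> {..<k} :: (nat \<times> nat) set"
  assumes H: "Hpp \<in> carrier_mat npr npt" "Hcp \<in> carrier_mat npr nct" "Hpc \<in> carrier_mat ncr npt" "Hcc \<in> carrier_mat ncr nct"
    and \<alpha>: "0 < \<alpha>" and S: "admissible_Sigma npr ncr S"
    and B: "B \<in> carrier_mat (npr + ncr) (npr + ncr)" "Bi \<in> carrier_mat (npr + ncr) (npr + ncr)"
      "B * Bi = 1\<^sub>m (npr + ncr)" "B * mat_adjoint B = S"
    and code: "mcc_code_exists npt nct npr ncr Hpp Hcp Hpc Hcc Pp Pc n Rp Rc \<epsilon>"
  obtains M C :: "nat set" and x :: "nat \<times> nat \<Rightarrow> nat \<Rightarrow> complex Matrix.vec" where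
    "finite M" "M \<noteq> {}" "finite C" "C \<noteq> {}"
    "\<And>w i. w \<in> M \<times> C \<Longrightarrow> i < n \<Longrightarrow> x w i \<in> carrier_vec (npt + nct)"
    "(\<Sum>i<n. \<Sum>k<npt + nct. var (M \<times> C) (\<lambda>w. x w i $ k)) \<le> real n * (Pp + \<alpha> * Pc)"
    "(1 - \<epsilon>) * ln (nmsg n Rp) - ln 2 \<le> iota (M \<times> C) (J n npr) (sigv (G_alpha npt nct Hpp Hcp \<alpha>) x)
      - (\<Sum>\<mu>\<in>M. iota C (J n npr) (sigv (G_alpha npt nct Hpp Hcp \<alpha>) (\<lambda>c. x (\<mu>, c)))) / card M"
    "(1 - \<epsilon>) * ln (nmsg n Rc) - ln 2
      \<le> (\<Sum>\<mu>\<in>M. iota C (J n (npr + ncr)) (sigv (Bi * K_bar npt ncr Hpp Hcp Hcc \<alpha>) (\<lambda>c. x (\<mu>, c)))) / card M"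
proof -
  let ?m = "npr + ncr" and ?t = "npt + nct" and ?G = "G_alpha npt nct Hpp Hcp \<alpha>" and ?K = "K_bar npt ncr Hpp Hcp Hcc \<alpha>"
  define M C where "M = {1..nmsg n Rp}" and "C = {1..nmsg n Rc}"
  have fin: "finite M" "M \<noteq> {}" "finite C" "C \<noteq> {}" and card: "card M = nmsg n Rp" "card C = nmsg n Rc"
    using nmsg_pos[of n Rp] nmsg_pos[of n Rc] by (auto simp: M_def C_def)
  obtain Ep Ec Dp Dc where
    Ep: "\<forall>mp\<in>M. \<forall>i<n. Ep mp i \<in> carrier_vec npt" and
    Ec: "\<forall>(mp, mc)\<in>M \<times> C. \<forall>i<n. Ec mp mc i \<in> carrier_vec nct" and
    Pp: "(\<Sum>i<n. Re (mtrace (cov_mat npt M (\<lambda>mp. Ep mp i)))) \<le> real n * Pp" and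
    Pc: "(\<Sum>i<n. Re (mtrace (cov_mat nct (M \<times> C) (\<lambda>(mp, mc). Ec mp mc i)))) \<le> real n * Pc" and
    Dp: "Dp \<in> measurable (PiM ({..<n} \<times> {..<npr}) (\<lambda>_. borel)) (count_space UNIV)" and
    Dc: "Dc \<in> measurable (PiM ({..<n} \<times> {..<ncr}) (\<lambda>_. borel)) (count_space UNIV)" and
    ep: "(\<Sum>(mp, mc)\<in>M \<times> C. err_prob n npr Dp (\<lambda>i. Hpp *\<^sub>v Ep mp i + Hcp *\<^sub>v Ec mp mc i) mp) / real (card (M \<times> C)) \<le> \<epsilon>" and
    ec: "(\<Sum>(mp, mc)\<in>M \<times> C. err_prob n ncr Dc (\<lambda>i. Hpc *\<^sub>v Ep mp i + Hcc *\<^sub>v Ec mp mc i) mc) / real (card (M \<times> C)) \<le> \<epsilon>"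
    using code unfolding mcc_code_exists_def Let_def M_def C_def by blast
  have Ec': "Ec mp mc i \<in> carrier_vec nct" if "mp \<in> M" "mc \<in> C" "i < n" for mp mc i using Ec that by auto
  define x where "x w i = Ep (fst w) i @\<^sub>v complex_of_real (sqrt \<alpha>) \<cdot>\<^sub>v Ec (fst w) (snd w) i" for w i
  have x: "x w i \<in> carrier_vec ?t" if "w \<in> M \<times> C" "i < n" for w i
    using that Ep Ec'[of "fst w" "snd w" i] unfolding x_def by auto
  have G: "?G \<in> carrier_mat npr ?t" by (rule G_alpha_carrier[OF H(1,2)])
  have K: "?K \<in> carrier_mat ?m ?t" by (rule K_bar_carrier[OF H(1,4)])
  have Kx: "?K *\<^sub>v x (mp, mc) i = (Hpp *\<^sub>v Ep mp i + Hcp *\<^sub>v Ec mp mc i) @\<^sub>v (Hcc *\<^sub>v Ec mp mc i)" if "mp \<in> M" "mc \<in> C" "i < n" for mp mc i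
    unfolding x_def fst_conv snd_conv using Ep that Ec'[OF that] by (intro K_bar_mult_append[OF H(1,2,4) \<alpha>]) auto
  have Gx: "(?G *\<^sub>v x (mp, mc) i) $ j = (Hpp *\<^sub>v Ep mp i + Hcp *\<^sub>v Ec mp mc i) $ j" if "mp \<in> M" "mc \<in> C" "i < n" "j < npr" for mp mc i j
  proof -
    have "(?G *\<^sub>v x (mp, mc) i) $ j = (?K *\<^sub>v x (mp, mc) i) $ j"
      unfolding G_alpha_sel[OF H(1,2,4)] using that x by (intro sel_mult_mat_vec[OF _ K]) auto
    then show ?thesis unfolding Kx[OF that(1-3)] using that H by simp
  qed
  let ?P = "sel ncr ?m (\<lambda>i. npr + i)"
  have P: "?P \<in> carrier_mat ncr ?m" by (rule sel_carrier)
  have Sc: "S \<in> carrier_mat ?m ?m" using S psd_carrier by (auto simp: admissible_Sigma_def)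
  have PSP: "?P * S * mat_adjoint ?P = 1\<^sub>m ncr"
  proof (rule sel_congruence[OF _ Sc])
    fix i j assume "i < ncr" "j < ncr"
    then show "S $$ (npr + i, npr + j) = (if i = j then 1 else 0)" using S by (auto simp: admissible_Sigma_def)
  qed simp
  \<comment> \<open>\<open>B\<close> colours white noise to covariance \<open>S\<close>, and
    \<open>?P\<close> picks the block of the cognitive receiver, where \<open>S\<close> is the
    identity; the result is exactly that receiver's noise.\<close>
  define U where "U = ?P * B"
  have U: "U \<in> carrier_mat ncr ?m" unfolding U_def by (rule mult_carrier_mat[OF P B(1)])
  have UU: "U * mat_adjoint U = 1\<^sub>m ncr"
  proof -
    have a: "mat_adjoint B \<in> carrier_mat ?m ?m" "mat_adjoint ?P \<in> carrier_mat ?m ncr" using B P by auto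
    have "U * mat_adjoint U = (?P * B) * (mat_adjoint B * mat_adjoint ?P)" unfolding U_def adj_mult[OF P B(1)] ..
    also have "\<dots> = ?P * (S * mat_adjoint ?P)" unfolding assoc_mult_mat4[OF P B(1) a] B(4) ..
    also have "\<dots> = 1\<^sub>m ncr" unfolding PSP[symmetric] by (rule assoc_mult_mat[OF P Sc a(2), symmetric])
    finally show ?thesis .
  qed
  have A: "Bi * ?K \<in> carrier_mat ?m ?t" by (rule mult_carrier_mat[OF B(2) K])
  have UA: "U * (Bi * ?K) = ?P * ?K"
    unfolding U_def assoc_mult_mat4[OF P B(1,2) K] B(3) left_mult_one_mat[OF K] ..
  have Ux: "((U * (Bi * ?K)) *\<^sub>v x (mp, mc) i) $ j = (Hcc *\<^sub>v Ec mp mc i) $ j" if "mp \<in> M" "mc \<in> C" "i < n" "j < ncr" for mp mc i j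
  proof -
    have "((?P * ?K) *\<^sub>v x (mp, mc) i) $ j = (?K *\<^sub>v x (mp, mc) i) $ (npr + j)"
      using that x by (intro sel_mult_mat_vec[OF _ K]) auto
    then show ?thesis unfolding UA Kx[OF that(1-3)] using that H by simp
  qed
  show ?thesis
  proof (rule that[OF fin x])
    show "(\<Sum>i<n. \<Sum>k<?t. var (M \<times> C) (\<lambda>w. x w i $ k)) \<le> real n * (Pp + \<alpha> * Pc)"
    proof -
      have "(\<Sum>k<?t. var (M \<times> C) (\<lambda>w. x w i $ k)) = Re (mtrace (cov_mat npt M (\<lambda>mp. Ep mp i)))
           + \<alpha> * Re (mtrace (cov_mat nct (M \<times> C) (\<lambda>(mp, mc). Ec mp mc i)))" if i: "i < n" for i
      proof -
        have cong: "var (M \<times> C) f = var (M \<times> C) g" if "\<And>w. w \<in> M \<times> C \<Longrightarrow> f w = g w" for f g :: "nat \<times> nat \<Rightarrow> complex"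
          using that by (simp add: var_def cong: sum.cong_simp)
        have 1: "var (M \<times> C) (\<lambda>w. x w i $ k) = var M (\<lambda>mp. Ep mp i $ k)" if k: "k < npt" for k
        proof -
          have "var (M \<times> C) (\<lambda>w. x w i $ k) = var (M \<times> C) (\<lambda>w. (\<lambda>mp. Ep mp i $ k) (fst w))"
          proof (rule cong)
            fix w assume w: "w \<in> M \<times> C"
            have d: "dim_vec (Ep (fst w) i) = npt" using Ep w i by auto
            show "x w i $ k = Ep (fst w) i $ k" unfolding x_def using d k by simp
          qed
          also have "\<dots> = var M (\<lambda>mp. Ep mp i $ k)" by (rule var_Times_fst[OF fin(1,3,4)])
          finally show ?thesis .
        qed
        have 2: "var (M \<times> C) (\<lambda>w. x w i $ (npt + k)) = \<alpha> * var (M \<times> C) (\<lambda>w. (case w of (mp, mc) \<Rightarrow> Ec mp mc i) $ k)" if k: "k < nct" for k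
        proof -
          have "var (M \<times> C) (\<lambda>w. x w i $ (npt + k)) = var (M \<times> C) (\<lambda>w. complex_of_real (sqrt \<alpha>) * (case w of (mp, mc) \<Rightarrow> Ec mp mc i) $ k)"
          proof (rule cong)
            fix w assume w: "w \<in> M \<times> C"
            have d: "dim_vec (Ep (fst w) i) = npt" "dim_vec (Ec (fst w) (snd w) i) = nct" using Ep Ec'[of "fst w" "snd w" i] w i by auto
            show "x w i $ (npt + k) = complex_of_real (sqrt \<alpha>) * (case w of (mp, mc) \<Rightarrow> Ec mp mc i) $ k"
              unfolding x_def using d k by (simp add: split_beta)
          qed
          then show ?thesis unfolding var_scale using \<alpha> by simp
        qed
        have "(\<Sum>k<?t. var (M \<times> C) (\<lambda>w. x w i $ k)) = (\<Sum>k<npt. var (M \<times> C) (\<lambda>w. x w i $ k)) + (\<Sum>k<nct. var (M \<times> C) (\<lambda>w. x w i $ (npt + k)))"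
          by (induction nct) (auto simp: add.assoc)
        then show ?thesis unfolding Re_mtrace_cov_mat using 1 2 by (simp add: sum_distrib_left)
      qed
      then have "(\<Sum>i<n. \<Sum>k<?t. var (M \<times> C) (\<lambda>w. x w i $ k)) = (\<Sum>i<n. Re (mtrace (cov_mat npt M (\<lambda>mp. Ep mp i))))
           + \<alpha> * (\<Sum>i<n. Re (mtrace (cov_mat nct (M \<times> C) (\<lambda>(mp, mc). Ec mp mc i))))"
        by (simp add: sum.distrib sum_distrib_left)
      also have "\<dots> \<le> real n * Pp + \<alpha> * (real n * Pc)" using Pp Pc \<alpha> by (intro add_mono mult_left_mono) auto
      finally show ?thesis by (simp add: algebra_simps)
    qed
    show "(1 - \<epsilon>) * ln (nmsg n Rp) - ln 2 \<le> iota (M \<times> C) (J n npr) (sigv ?G x) - (\<Sum>\<mu>\<in>M. iota C (J n npr) (sigv ?G (\<lambda>c. x (\<mu>, c)))) / card M"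
    proof -
      have Dm: "Dp \<in> measurable (gam (J n npr)) (count_space UNIV)"
        using Dp unfolding J_def by (simp add: measurable_cong_sets[OF sets_gam refl])
      have fJ: "finite (J n npr)" by (simp add: J_def)
      have e: "measure (gam (J n npr)) {y \<in> space (gam (J n npr)). Dp (\<lambda>j\<in>J n npr. y j + sigv ?G x (mp, mc) j) \<noteq> mp}
         = err_prob n npr Dp (\<lambda>i. Hpp *\<^sub>v Ep mp i + Hcp *\<^sub>v Ec mp mc i) mp" if "mp \<in> M" "mc \<in> C" for mp mc
      proof -
        have "(\<lambda>j\<in>J n npr. y j + sigv ?G x (mp, mc) j) = (\<lambda>p\<in>J n npr. y p + (Hpp *\<^sub>v Ep mp (fst p) + Hcp *\<^sub>v Ec mp mc (fst p)) $ snd p)" for y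
          by (intro restrict_ext) (use Gx[OF that] in \<open>auto simp: J_def sigv_def\<close>)
        then show ?thesis unfolding err_prob_gam J_def by simp
      qed
      have "(1 - \<epsilon>) * ln (card M) - ln 2 \<le> iota (M \<times> C) (J n npr) (sigv ?G x) - (\<Sum>\<mu>\<in>M. iota C (J n npr) (\<lambda>c. sigv ?G x (\<mu>, c))) / card M"
      proof (rule fano_iota_diff[OF fJ fin Dm])
        have "(\<Sum>(mp, mc)\<in>M \<times> C. measure (gam (J n npr)) {y \<in> space (gam (J n npr)). Dp (\<lambda>j\<in>J n npr. y j + sigv ?G x (mp, mc) j) \<noteq> mp})
          = (\<Sum>(mp, mc)\<in>M \<times> C. err_prob n npr Dp (\<lambda>i. Hpp *\<^sub>v Ep mp i + Hcp *\<^sub>v Ec mp mc i) mp)"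
          using e by (intro sum.cong refl) auto
        then show "(\<Sum>(mp, mc)\<in>M \<times> C. measure (gam (J n npr)) {y \<in> space (gam (J n npr)). Dp (\<lambda>j\<in>J n npr. y j + sigv ?G x (mp, mc) j) \<noteq> mp}) / card (M \<times> C) \<le> \<epsilon>"
          using ep by simp
      qed
      moreover have "(\<lambda>c. sigv ?G x (\<mu>, c)) = sigv ?G (\<lambda>c. x (\<mu>, c))" for \<mu> by (simp add: sigv_def[abs_def])
      ultimately show ?thesis by (simp add: card)
    qed
    show "(1 - \<epsilon>) * ln (nmsg n Rc) - ln 2 \<le> (\<Sum>\<mu>\<in>M. iota C (J n ?m) (sigv (Bi * ?K) (\<lambda>c. x (\<mu>, c)))) / card M"
    proof -
      \<comment> \<open>The error probability of the cognitive receiver for a given primary message.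
        Fano's bound is affine in it, so averaging over the primary messages brings back the overall
        error probability.\<close>
      define \<delta> where "\<delta> \<mu> = (\<Sum>mc\<in>C. err_prob n ncr Dc (\<lambda>i. Hpc *\<^sub>v Ep \<mu> i + Hcc *\<^sub>v Ec \<mu> mc i) mc) / card C" for \<mu>
      have cM: "real (card M) > 0" and cC: "real (card C) \<ge> 1" using fin by (auto simp: card_gt_0_iff Suc_le_eq)
      have one: "(1 - \<delta> \<mu>) * ln (card C) - ln 2 \<le> iota C (J n ?m) (sigv (Bi * ?K) (\<lambda>c. x (\<mu>, c)))" if \<mu>: "\<mu> \<in> M" for \<mu>
        unfolding J_def
      proof (rule fano_degraded[OF fin(3,4) Dc U UU A, where h="\<lambda>i j. (Hpc *\<^sub>v Ep \<mu> i) $ j"])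
        show "(\<Sum>c\<in>C. err_prob n ncr Dc (\<lambda>i. Hpc *\<^sub>v Ep \<mu> i + Hcc *\<^sub>v Ec \<mu> c i) c) / card C \<le> \<delta> \<mu>" by (simp add: \<delta>_def)
        show "x (\<mu>, c) i \<in> carrier_vec ?t" if "c \<in> C" "i < n" for c i using x \<mu> that by simp
        fix c i j assume cij: "c \<in> C" "i < n" "j < ncr"
        show "(Hpc *\<^sub>v Ep \<mu> i + Hcc *\<^sub>v Ec \<mu> c i) $ j = (Hpc *\<^sub>v Ep \<mu> i) $ j + ((U * (Bi * ?K)) *\<^sub>v x (\<mu>, c) i) $ j"
          unfolding Ux[OF \<mu> cij] using H cij by simp
      qed
      have av: "(\<Sum>\<mu>\<in>M. \<delta> \<mu>) / card M \<le> \<epsilon>"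
      proof -
        have "(\<Sum>\<mu>\<in>M. \<delta> \<mu>) / card M = (\<Sum>(mp, mc)\<in>M \<times> C. err_prob n ncr Dc (\<lambda>i. Hpc *\<^sub>v Ep mp i + Hcc *\<^sub>v Ec mp mc i) mc) / real (card (M \<times> C))"
          unfolding \<delta>_def by (simp add: card_cartesian_product sum.cartesian_product[symmetric] sum_divide_distrib[symmetric] mult.commute)
        then show ?thesis using ec by simp
      qed
      have "(1 - \<epsilon>) * ln (card C) \<le> (1 - (\<Sum>\<mu>\<in>M. \<delta> \<mu>) / card M) * ln (card C)"
        using av cC by (intro mult_right_mono) auto
      also have "(1 - (\<Sum>\<mu>\<in>M. \<delta> \<mu>) / card M) * ln (card C) = (\<Sum>\<mu>\<in>M. (1 - \<delta> \<mu>) * ln (card C)) / card M"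
        using cM by (simp add: sum_distrib_right[symmetric] sum_subtractf field_simps)
      also have "\<dots> = (\<Sum>\<mu>\<in>M. (1 - \<delta> \<mu>) * ln (card C) - ln 2) / card M + ln 2"
        using cM by (simp add: sum_subtractf diff_divide_distrib)
      also have "\<dots> \<le> (\<Sum>\<mu>\<in>M. iota C (J n ?m) (sigv (Bi * ?K) (\<lambda>c. x (\<mu>, c)))) / card M + ln 2"
        using one by (intro add_right_mono divide_right_mono sum_mono) auto
      finally show ?thesis unfolding card by simp
    qed
  qed
qed

text \<open>All eigenvalues of the whitened signal covariance are nonnegative, so their logarithmic
  contributions are too. The rates of the optimal covariances are nonnegative for this reason, as
  membership in the region demands.\<close>

lemma lndet_nondecreasing:
  assumes "psd m S" "0 < Re (det S)" "K \<in> carrier_mat m t" "psd t Q"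
  shows "lndet S \<le> lndet (S + K * Q * mat_adjoint K)"
proof -
  obtain B Bi d where r: "rdiag m S K Q B Bi d" by (rule rdiag_exists[OF assms])
  then have "0 \<le> (\<Sum>j<m. ln (1 + d j))" by (intro sum_nonneg ln_ge_zero) (auto simp: rdiag_def)
  then show ?thesis using rdiag_lndet(2)[OF r assms(2,3) psd_carrier[OF assms(4)]] by simp
qed

lemma logdet_lndet: "logdet A = lndet A / ln 2"
  by (simp add: logdet_def lndet_def log_def)

theorem theorem2:
  fixes npt nct npr ncr :: nat
    and Hpp Hcp Hpc Hcc :: "complex mat"
    and Pp Pc :: real
  assumes "Hpp \<in> carrier_mat npr npt" and "Hcp \<in> carrier_mat npr nct"
    and "Hpc \<in> carrier_mat ncr npt" and "Hcc \<in> carrier_mat ncr nct"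
  shows "(\<forall>\<alpha>>0. \<forall>S. admissible_Sigma npr ncr S \<longrightarrow>
            C_MCC npt nct npr ncr Hpp Hcp Hpc Hcc Pp Pc \<subseteq> R_out npt nct npr ncr Hpp Hcp Hcc Pp Pc \<alpha> S)
       \<and> C_MCC npt nct npr ncr Hpp Hcp Hpc Hcc Pp Pc \<subseteq>
           (\<Inter>S \<in> {S. admissible_Sigma npr ncr S}. \<Inter>\<alpha> \<in> {\<alpha>. \<alpha> > 0}.
              R_out npt nct npr ncr Hpp Hcp Hcc Pp Pc \<alpha> S)"
proof -
  have "(Rp, Rc) \<in> R_out npt nct npr ncr Hpp Hcp Hcc Pp Pc \<alpha> S"
    if \<alpha>: "0 < \<alpha>" and adm: "admissible_Sigma npr ncr S" and R: "(Rp, Rc) \<in> C_MCC npt nct npr ncr Hpp Hcp Hpc Hcc Pp Pc" for \<alpha> S Rp Rc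
  proof -
    define G K t m P where "G = G_alpha npt nct Hpp Hcp \<alpha>" and "K = K_bar npt ncr Hpp Hcp Hcc \<alpha>" and "t = npt + nct"
      and "m = npr + ncr" and "P = Pp + \<alpha> * Pc"
    have G: "G \<in> carrier_mat npr t" unfolding G_def t_def by (rule G_alpha_carrier[OF assms(1,2)])
    have K: "K \<in> carrier_mat m t" unfolding K_def t_def m_def by (rule K_bar_carrier[OF assms(1,4)])
    have S: "psd m S" "0 < Re (det S)" using adm by (auto simp: admissible_Sigma_def m_def)
    have Rpos: "0 \<le> Rp" "0 \<le> Rc" and code: "\<And>\<epsilon>. 0 < \<epsilon> \<Longrightarrow> \<exists>N. \<forall>n\<ge>N. mcc_code_exists npt nct npr ncr Hpp Hcp Hpc Hcc Pp Pc n Rp Rc \<epsilon>"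
      using R by (auto simp: C_MCC_def)
    have P: "0 \<le> P"
    proof -
      obtain N where "\<forall>n\<ge>N. mcc_code_exists npt nct npr ncr Hpp Hcp Hpc Hcc Pp Pc n Rp Rc 1" using code[of 1] by auto
      \<comment> \<open>A positive blocklength is required here, hence \<open>Suc N\<close>.\<close>
      then have "mcc_code_exists npt nct npr ncr Hpp Hcp Hpc Hcc Pp Pc (Suc N) Rp Rc 1" by simp
      from code_power_nonneg[OF this] show ?thesis using \<alpha> by (simp add: P_def)
    qed
    have ln2: "0 < ln (2::real)" by simp
    let ?X = "{(Rp, Rc). 0 \<le> Rp \<and> 0 \<le> Rc \<and>
         (\<exists>Qp Qc. psd t Qp \<and> psd t Qc \<and>
            Re (mtrace Qp) + Re (mtrace Qc) \<le> P \<and>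
            Rp \<le> logdet (1\<^sub>m npr + G * Qp * mat_adjoint G + G * Qc * mat_adjoint G)
                 - logdet (1\<^sub>m npr + G * Qc * mat_adjoint G) \<and>
            Rc \<le> logdet (S + K * Qc * mat_adjoint K) - logdet S)}"
    \<comment> \<open>The point (p, q) depends on the weights only, not on the accuracy of the
      codes; therefore all losses can be sent to 0 against this one point.\<close>
    have "\<exists>p q. (p, q) \<in> ?X \<and> a * Rp + b * Rc \<le> a * p + b * q" if ab: "0 \<le> a" "0 \<le> b" for a b
    proof -
      have PS: "sel npr m (\<lambda>i. i) * S * mat_adjoint (sel npr m (\<lambda>i. i)) = 1\<^sub>m npr"
      proof (rule sel_congruence[OF _ psd_carrier[OF S(1)]])
        fix i j assume "i < npr" "j < npr"
        then show "S $$ (i, j) = (if i = j then 1 else 0)" using adm by (auto simp: admissible_Sigma_def)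
      qed (simp add: m_def)
      have GK: "G = sel npr m (\<lambda>i. i) * K" unfolding G_def K_def m_def by (rule G_alpha_sel[OF assms(1,2,4)])
      obtain Qp Qc B Bi where Q: "feas t P Qp Qc" and B: "B \<in> carrier_mat m m" "Bi \<in> carrier_mat m m" "B * Bi = 1\<^sub>m m" "B * mat_adjoint B = S"
        and bd: "\<And>(M::nat set) (C::nat set) n x. finite M \<Longrightarrow> M \<noteq> {} \<Longrightarrow> finite C \<Longrightarrow> C \<noteq> {} \<Longrightarrow>
           (\<And>w i. w \<in> M \<times> C \<Longrightarrow> i < n \<Longrightarrow> x w i \<in> carrier_vec t) \<Longrightarrow>
           (\<Sum>i<n. \<Sum>k<t. var (M \<times> C) (\<lambda>w. x w i $ k)) \<le> real n * P \<Longrightarrow>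
           a * iota (M \<times> C) ({..<n} \<times> {..<npr}) (sigv G x)
           + (\<Sum>\<mu>\<in>M. b * iota C ({..<n} \<times> {..<m}) (sigv (Bi * K) (\<lambda>c. x (\<mu>, c))) - a * iota C ({..<n} \<times> {..<npr}) (sigv G (\<lambda>c. x (\<mu>, c)))) / card M
           \<le> real n * obj a b npr G S K Qp Qc"
        by (rule broadcast_bound[OF S K G P ab sel_carrier GK PS]) (use that in blast)
      have psd: "psd t Qp" "psd t Qc" "Re (mtrace Qp) + Re (mtrace Qc) \<le> P" using Q by (auto simp: feas_def)
      note Qc = psd_carrier[OF psd(1)] psd_carrier[OF psd(2)]
      define S1 where "S1 = 1\<^sub>m npr + G * Qc * mat_adjoint G"
      have one: "psd npr (1\<^sub>m npr)" "0 < Re (det (1\<^sub>m npr :: complex mat))" by (auto simp: psd_one)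
      have S1: "psd npr S1" "0 < Re (det S1)" unfolding S1_def
        by (rule psd_add[OF psd_one psd_congruence[OF G psd(2)]], rule psd_lndet_pos[OF one G psd(2)])
      have aG: "mat_adjoint G \<in> carrier_mat t npr" using G by auto
      have c: "G * Qp * mat_adjoint G \<in> carrier_mat npr npr" "G * Qc * mat_adjoint G \<in> carrier_mat npr npr" using G Qc aG by auto
      have sum: "1\<^sub>m npr + G * Qp * mat_adjoint G + G * Qc * mat_adjoint G = S1 + G * Qp * mat_adjoint G"
        unfolding S1_def using c by (intro eq_matI) (auto simp del: index_mult_mat(1))
      have sum': "1\<^sub>m npr + G * (Qp + Qc) * mat_adjoint G = S1 + G * Qp * mat_adjoint G"
      proof -
        have "G * (Qp + Qc) * mat_adjoint G = G * Qp * mat_adjoint G + G * Qc * mat_adjoint G"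
          unfolding mult_add_distrib_mat[OF G Qc] by (rule add_mult_distrib_mat[OF mult_carrier_mat[OF G Qc(1)] mult_carrier_mat[OF G Qc(2)] aG])
        then show ?thesis unfolding sum[symmetric] using c by (simp add: assoc_add_mat[OF one_carrier_mat c])
      qed
      define p q where "p = logdet (S1 + G * Qp * mat_adjoint G) - logdet S1" and "q = logdet (S + K * Qc * mat_adjoint K) - logdet S"
      have pq: "p * ln 2 = lndet (S1 + G * Qp * mat_adjoint G) - lndet S1" "q * ln 2 = lndet (S + K * Qc * mat_adjoint K) - lndet S"
        by (simp_all add: p_def q_def logdet_lndet diff_divide_distrib[symmetric])
      have "0 \<le> p * ln 2" "0 \<le> q * ln 2" unfolding pq using lndet_nondecreasing[OF S1 G psd(1)] lndet_nondecreasing[OF S K psd(2)] by simp_all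
      then have "0 \<le> p" "0 \<le> q" using ln2 by (auto simp: zero_le_mult_iff)
      then have X: "(p, q) \<in> ?X"
        unfolding mem_Collect_eq prod.case sum S1_def[symmetric]
        using psd unfolding sum p_def q_def by (intro conjI exI[of _ Qp] exI[of _ Qc]) (auto simp: sum S1_def[symmetric])
      have ob: "obj a b npr G S K Qp Qc = (a * p + b * q) * ln 2"
        unfolding obj_def sum' S1_def[symmetric] pq[symmetric] by (simp add: algebra_simps)
      have "a * Rp + b * Rc \<le> a * p + b * q"
      \<comment> \<open>Two losses have to vanish: the factor 1 - \<epsilon> and the constants ln 2
        from Fano's inequality. Each is allotted e / 2, the first through the choice of \<epsilon>,
        the second through the blocklength.\<close>
      proof (rule field_le_epsilon)
        fix e :: real assume e: "0 < e"
        define V where "V = a * Rp + b * Rc"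
        have V: "0 \<le> V" using ab Rpos by (simp add: V_def)
        \<comment> \<open>The bound 1/2 keeps 1 - \<epsilon> positive, so that it may multiply
          inequalities; \<open>V + 1\<close> avoids a zero denominator and gives
          \<open>\<epsilon> * V \<le> e / 2\<close>.\<close>
        define \<epsilon> where "\<epsilon> = min (1/2) (e / (2 * (V + 1)))"
        have \<epsilon>: "0 < \<epsilon>" "\<epsilon> < 1" using e V by (auto simp: \<epsilon>_def)
        have "\<epsilon> * V \<le> e / (2 * (V + 1)) * (V + 1)" using e V by (intro mult_mono) (auto simp: \<epsilon>_def)
        also have "\<dots> = e / 2" using V by (simp add: field_simps)
        finally have eV: "\<epsilon> * V \<le> e / 2" .
        obtain N where N: "\<And>n. n \<ge> N \<Longrightarrow> mcc_code_exists npt nct npr ncr Hpp Hcp Hpc Hcc Pp Pc n Rp Rc \<epsilon>" using code[OF \<epsilon>(1)] by blast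
        obtain N' :: nat where N': "2 * (a + b) / e \<le> real N'" using real_arch_simple by blast
        define n where "n = Suc (max N N')"
        have n: "0 < real n" "N \<le> n" "2 * (a + b) / e \<le> real n" using N' by (auto simp: n_def)
        obtain M C :: "nat set" and x where MC: "finite M" "M \<noteq> {}" "finite C" "C \<noteq> {}"
          "\<And>w i. w \<in> M \<times> C \<Longrightarrow> i < n \<Longrightarrow> x w i \<in> carrier_vec t"
          "(\<Sum>i<n. \<Sum>k<t. var (M \<times> C) (\<lambda>w. x w i $ k)) \<le> real n * P"
          and f1: "(1 - \<epsilon>) * ln (nmsg n Rp) - ln 2 \<le> iota (M \<times> C) ({..<n} \<times> {..<npr}) (sigv G x)
            - (\<Sum>\<mu>\<in>M. iota C ({..<n} \<times> {..<npr}) (sigv G (\<lambda>c. x (\<mu>, c)))) / card M"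
          and f2: "(1 - \<epsilon>) * ln (nmsg n Rc) - ln 2
            \<le> (\<Sum>\<mu>\<in>M. iota C ({..<n} \<times> {..<m}) (sigv (Bi * K) (\<lambda>c. x (\<mu>, c)))) / card M"
          using code_rates_le[OF assms \<alpha> adm B[unfolded m_def] N[OF n(2)]]
          unfolding G_def K_def t_def m_def P_def by blast
        have g: "(1 - \<epsilon>) * (n * R * ln 2) - ln 2 \<le> (1 - \<epsilon>) * ln (nmsg n R) - ln 2" for R :: real
          using ln_nmsg_ge[of n R] \<epsilon> by (intro diff_right_mono mult_left_mono) auto
        have "a * ((1 - \<epsilon>) * (n * Rp * ln 2) - ln 2) + b * ((1 - \<epsilon>) * (n * Rc * ln 2) - ln 2)
          \<le> a * (iota (M \<times> C) ({..<n} \<times> {..<npr}) (sigv G x) - (\<Sum>\<mu>\<in>M. iota C ({..<n} \<times> {..<npr}) (sigv G (\<lambda>c. x (\<mu>, c)))) / card M)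
           + b * ((\<Sum>\<mu>\<in>M. iota C ({..<n} \<times> {..<m}) (sigv (Bi * K) (\<lambda>c. x (\<mu>, c)))) / card M)"
          using order_trans[OF g f1] order_trans[OF g f2] ab by (intro add_mono mult_left_mono) auto
        also have "\<dots> = a * iota (M \<times> C) ({..<n} \<times> {..<npr}) (sigv G x)
           + (\<Sum>\<mu>\<in>M. b * iota C ({..<n} \<times> {..<m}) (sigv (Bi * K) (\<lambda>c. x (\<mu>, c))) - a * iota C ({..<n} \<times> {..<npr}) (sigv G (\<lambda>c. x (\<mu>, c)))) / card M"
          unfolding sum_subtractf sum_distrib_left[symmetric] by (simp add: diff_divide_distrib right_diff_distrib)
        also have "\<dots> \<le> real n * ((a * p + b * q) * ln 2)" unfolding ob[symmetric] by (rule bd[OF MC])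
        finally have "(n * ((1 - \<epsilon>) * V) - (a + b)) * ln 2 \<le> (n * (a * p + b * q)) * ln 2"
          by (simp add: V_def algebra_simps)
        then have "n * ((1 - \<epsilon>) * V) - (a + b) \<le> n * (a * p + b * q)" using ln2 by simp
        moreover have "a + b \<le> n * (e / 2)" using n(3) e by (simp add: field_simps)
        ultimately have "n * ((1 - \<epsilon>) * V) \<le> n * (a * p + b * q + e / 2)" by (simp add: distrib_left)
        then have "(1 - \<epsilon>) * V \<le> a * p + b * q + e / 2" using n(1) by (simp add: mult_le_cancel_left)
        then have "V \<le> a * p + b * q + e" using eV by (simp add: algebra_simps)
        then show "a * Rp + b * Rc \<le> a * p + b * q + e" unfolding V_def .
      qed
      then show ?thesis using X by blast
    qed
    then have "(Rp, Rc) \<in> closure (convex hull ?X)"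
      by (intro down_closed_closure_convex_hull[OF _ _ Rpos]) (auto intro: order_trans)
    then show ?thesis unfolding R_out_def Let_def G_def K_def t_def P_def .
  qed
  then have "\<forall>\<alpha>>0. \<forall>S. admissible_Sigma npr ncr S \<longrightarrow>
      C_MCC npt nct npr ncr Hpp Hcp Hpc Hcc Pp Pc \<subseteq> R_out npt nct npr ncr Hpp Hcp Hcc Pp Pc \<alpha> S"
    by (intro allI impI subrelI)
  then show ?thesis by blast
qed

end
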